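(* Let $G = \langle N, E, l\rangle$ be a finite labeled directed acyclic graph whose nodes are numbered in reverse topological order (every child has a smaller number than each of its parents). Then the bisimilarity equivalence classes of $G$ (i.e., the bisimulation partition of $N$) can be computed in $O(\mathrm{Sort}(|N| + |E|))$ IOs in the external-memory model.
   Context: A graph is a triple $G=\langle N,E,l\rangle$ with $N$ a finite set of nodes, $E\subseteq N\times N$ a directed edge relation, and $l$ a function assigning a label $l(n)$ to each node. If $(m,n)\in E$, $n$ is a child of $m$ and $m$ a parent of $n$; $\mathrm{children}(m)$ denotes the set of children of $m$. Two nodes $n_1,n_2$ are bisimilar, $n_1\approx n_2$, iff (1) $l(n_1)=l(n_2)$; (2) for every $n_1'\in\mathrm{children}(n_1)$ there is $n_2'\in\mathrm{children}(n_2)$ with $n_1'\approx n_2'$; and (3) for every $n_2'\in\mathrm{children}(n_2)$ there is $n_1'\in\mathrm{children}(n_1)$ with $n_1'\approx n_2'$ (bisimilarity is the largest such relation). The bisimulation partition is the partition of $N$ into the equivalence classes of $\approx$. The input is given in external memory as a file of node records (identifier, label) sorted by identifier, and a file of edge records (parent, child). External-memory model: a fast internal memory of $M$ units of data and an unbounded external memory; data is transferred between them in blocks of $B$ units, each transfer being one IO; complexity is measured by the number of IOs. $\mathrm{Sort}(n)=\Theta\big(\frac{n}{B}\log_{M/B}\frac{n}{B}\big)$ is the number of IOs needed to sort $n$ units of data. *)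

theory Defs
  imports Complex_Main
begin

section \<open>Labeled graphs and bisimilarity\<close>

record ('n, 'l) lgraph =
  nodes :: "'n set"
  edges :: "('n \<times> 'n) set"
  label :: "'n \<Rightarrow> 'l"

definition wf_lgraph :: "('n, 'l) lgraph \<Rightarrow> bool" where
  "wf_lgraph G \<longleftrightarrow> finite (nodes G) \<and> edges G \<subseteq> nodes G \<times> nodes G"

definition children :: "('n, 'l) lgraph \<Rightarrow> 'n \<Rightarrow> 'n set" where
  "children G m = {n. (m, n) \<in> edges G}"

coinductive bisimilar :: "('n, 'l) lgraph \<Rightarrow> 'n \<Rightarrow> 'n \<Rightarrow> bool" for G where
  "\<lbrakk>m \<in> nodes G; n \<in> nodes G; label G m = label G n;
    \<forall>m'\<in>children G m. \<exists>n'\<in>children G n. bisimilar G m' n';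
    \<forall>n'\<in>children G n. \<exists>m'\<in>children G m. bisimilar G m' n'\<rbrakk>
   \<Longrightarrow> bisimilar G m n"

definition bisim_partition :: "('n, 'l) lgraph \<Rightarrow> 'n set set" where
  "bisim_partition G = nodes G // {(m, n). bisimilar G m n}"

definition reverse_topological :: "('n::linorder, 'l) lgraph \<Rightarrow> bool" where
  "reverse_topological G \<longleftrightarrow> (\<forall>(m, n)\<in>edges G. n < m)"

lemma bisimilar_refl:
  assumes "wf_lgraph G" "n \<in> nodes G"
  shows "bisimilar G n n"
proof -
  have "\<exists>v. x = v \<and> y = v \<and> v \<in> nodes G \<Longrightarrow> bisimilar G x y" for x y
  proof (coinduction arbitrary: x y rule: bisimilar.coinduct)
    case bisimilar
    then show ?case
      using assms(1) by (fastforce simp: wf_lgraph_def children_def)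
  qed
  then show ?thesis using assms(2) by blast
qed

lemma bisimilar_sym: "bisimilar G m n \<Longrightarrow> bisimilar G n m"
proof (coinduction arbitrary: m n rule: bisimilar.coinduct)
  case bisimilar
  then show ?case
  proof cases
    case 1
    then show ?thesis by (simp, blast)
  qed
qed

lemma bisimilar_trans:
  "bisimilar G m n \<Longrightarrow> bisimilar G n p \<Longrightarrow> bisimilar G m p"
proof (coinduction arbitrary: m n p rule: bisimilar.coinduct)
  case bisimilar
  from bisimilar(1) show ?case
  proof cases
    case 1
    note mn = this
    from bisimilar(2) show ?thesis
    proof cases
      case 1
      then show ?thesis using mn by (auto; meson)
    qed
  qed
qed

lemma equiv_bisimilar:
  "wf_lgraph G \<Longrightarrow> equiv (nodes G) {(m, n). bisimilar G m n}"
  by (intro equivI refl_onI symI transI)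
     (auto intro: bisimilar_refl bisimilar_sym bisimilar_trans elim: bisimilar.cases)

section \<open>The external-memory machine\<close>

text \<open>
  The internal memory is a list of \<open>M\<close> units. The external memory is an unbounded array of
  units, divided into blocks: block \<open>a\<close> consists of the units \<open>a * B, \<dots>, a * B + B - 1\<close>.
  Each unit holds a natural number below \<open>W\<close>.

  A program is the function performed by internal computation between two IOs, which is free
  of charge. It sees the internal memory and nothing else (there is no further control state),
  and yields the new internal memory together with the next action. The first argument of
  \<open>Read\<close> and \<open>Write\<close> is a block address, the second a position in internal memory; the argument
  of \<open>Halt\<close> is the block address at which the output file starts.
\<close>

datatype action = Read nat nat | Write nat nat | Halt nat

type_synonym program = "nat list \<Rightarrow> nat list \<times> action"

definition read_block :: "nat \<Rightarrow> nat \<Rightarrow> nat \<Rightarrow> (nat \<Rightarrow> nat) \<Rightarrow> nat list \<Rightarrow> nat list" where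
  "read_block B a p D mem = take p mem @ map D [a * B..<a * B + B] @ drop (p + B) mem"

definition write_block ::
  "nat \<Rightarrow> nat \<Rightarrow> nat \<Rightarrow> nat list \<Rightarrow> (nat \<Rightarrow> nat) \<Rightarrow> nat \<Rightarrow> nat" where
  "write_block B a p mem D =
     (\<lambda>x. if a * B \<le> x \<and> x < a * B + B then mem ! (p + (x - a * B)) else D x)"

definition valid_memory :: "nat \<Rightarrow> nat \<Rightarrow> nat list \<Rightarrow> bool" where
  "valid_memory M W mem \<longleftrightarrow> length mem = M \<and> (\<forall>v\<in>set mem. v < W)"

text \<open>
  \<open>runs M B W P mem D t a D'\<close>: started with internal memory \<open>mem\<close> and external memory \<open>D\<close>, the
  program halts after exactly \<open>t\<close> IOs with external memory \<open>D'\<close> and output address \<open>a\<close>. Block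
  addresses must fit into a unit; otherwise addresses could carry the contents of the whole
  internal memory.
\<close>

inductive runs ::
  "nat \<Rightarrow> nat \<Rightarrow> nat \<Rightarrow> program \<Rightarrow> nat list \<Rightarrow> (nat \<Rightarrow> nat) \<Rightarrow> nat \<Rightarrow> nat \<Rightarrow> (nat \<Rightarrow> nat) \<Rightarrow> bool"
  for M B W P where
  run_halt: "\<lbrakk>P mem = (mem', Halt a); valid_memory M W mem'; a < W\<rbrakk>
    \<Longrightarrow> runs M B W P mem D 0 a D"
| run_read: "\<lbrakk>P mem = (mem', Read b p); valid_memory M W mem'; b < W; p + B \<le> M;
     runs M B W P (read_block B b p D mem') D t a D'\<rbrakk>
    \<Longrightarrow> runs M B W P mem D (Suc t) a D'"
| run_write: "\<lbrakk>P mem = (mem', Write b p); valid_memory M W mem'; b < W; p + B \<le> M;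
     runs M B W P mem' (write_block B b p mem' D) t a D'\<rbrakk>
    \<Longrightarrow> runs M B W P mem D (Suc t) a D'"

section \<open>Input, output and cost bound\<close>

text \<open>Files of records with two fields are stored field by field, starting at a block boundary.\<close>

definition pair_file :: "(nat \<times> nat) list \<Rightarrow> nat list" where
  "pair_file rs = concat (map (\<lambda>(x, y). [x, y]) rs)"

definition node_file :: "(nat, nat) lgraph \<Rightarrow> nat list" where
  "node_file G = pair_file (map (\<lambda>n. (n, label G n)) (sorted_list_of_set (nodes G)))"

definition file_at :: "nat \<Rightarrow> (nat \<Rightarrow> nat) \<Rightarrow> nat \<Rightarrow> nat list \<Rightarrow> bool" where
  "file_at B D a ws \<longleftrightarrow> (\<forall>i<length ws. D (a * B + i) = ws ! i)"

text \<open>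
  The node file starts at block \<open>0\<close>, and the edge file, a listing \<open>es\<close> of the edges in any order,
  starts at the first block not used by the node file. The program is told only the numbers of
  records of the two files.
\<close>

definition edge_start :: "nat \<Rightarrow> (nat, nat) lgraph \<Rightarrow> nat" where
  "edge_start B G = (length (node_file G) + B - 1) div B"

definition init_disk :: "nat \<Rightarrow> (nat, nat) lgraph \<Rightarrow> (nat \<times> nat) list \<Rightarrow> nat \<Rightarrow> nat" where
  "init_disk B G es x =
     (let s = edge_start B G * B in
      if x < length (node_file G) then node_file G ! x
      else if s \<le> x \<and> x < s + length (pair_file es) then pair_file es ! (x - s)
      else 0)"

definition init_memory :: "nat \<Rightarrow> (nat, nat) lgraph \<Rightarrow> nat list" where
  "init_memory M G = [card (nodes G), card (edges G)] @ replicate (M - 2) 0"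

text \<open>
  A unit of data is a machine word of logarithmic length: it holds values polynomial in the
  input size and in the largest identifier or label occurring in the input. With unbounded
  numbers, a single unit could encode a whole file.
\<close>

definition word_limit :: "nat \<Rightarrow> (nat, nat) lgraph \<Rightarrow> nat" where
  "word_limit k G =
     (2 + card (nodes G) + card (edges G) + Max (insert 0 (nodes G \<union> label G ` nodes G))) ^ k"

text \<open>
  A partition is output as a file of records (node identifier, class identifier), one for each
  node, in any order.
\<close>

definition represents_partition :: "('n \<times> 'c) list \<Rightarrow> 'n set set \<Rightarrow> bool" where
  "represents_partition rs Q \<longleftrightarrow>
     distinct (map fst rs) \<and> (\<lambda>c. {n. (n, c) \<in> set rs}) ` snd ` set rs = Q"

text \<open>
  The usual reading of \<open>(n / B) * log (M / B) (n / B)\<close>, with the number of blocks rounded up and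
  the logarithm replaced by \<open>1\<close> where it is smaller: for \<open>n < M\<close> the bare formula drops below
  the cost of reading the data, and it is not even positive for \<open>n \<le> B\<close>. For \<open>n \<ge> M\<close> the two
  agree up to a factor of 2.
\<close>

definition sort_ios :: "nat \<Rightarrow> nat \<Rightarrow> nat \<Rightarrow> real" where
  "sort_ios M B n =
     real_of_int \<lceil>real n / real B\<rceil> * max 1 (log (real M / real B) (real n / real B))"

lemma sort_ios_bounds:
  assumes "1 \<le> B" "2 * B \<le> M" "M \<le> n"
  defines "s \<equiv> real n / real B * log (real M / real B) (real n / real B)"
  shows "s \<le> sort_ios M B n" "sort_ios M B n \<le> 2 * s"
proof -
  have q: "2 \<le> real M / real B" using assms(1,2) by (simp add: field_simps flip: of_nat_mult)
  have r: "real M / real B \<le> real n / real B" using assms(3) by (simp add: divide_right_mono)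
  have l: "1 \<le> log (real M / real B) (real n / real B)" using q r by (subst le_log_iff) auto
  have c: "real n / real B \<le> real_of_int \<lceil>real n / real B\<rceil>"
    "real_of_int \<lceil>real n / real B\<rceil> \<le> 2 * (real n / real B)"
    using q r by linarith+
  show "s \<le> sort_ios M B n"
    using mult_right_mono[OF c(1), of "log (real M / real B) (real n / real B)"] l
    by (simp add: s_def sort_ios_def max_def)
  show "sort_ios M B n \<le> 2 * s"
    using mult_right_mono[OF c(2), of "log (real M / real B) (real n / real B)"] l
    by (simp add: s_def sort_ios_def max_def mult.assoc)
qed

end

theory Submission
  imports Defs "HOL-Library.Nat_Bijection" "HOL-Library.List_Lexorder" "HOL-Library.Multiset"
begin

text \<open>
  Let the rank of a node be the length of a longest path from it, and its string the label followed
  by the sorted list of the classes of its children, a class being named by its least node. Nodes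
  of equal rank are bisimilar iff their strings agree. Ranks and classes are computed by
  time-forward processing with a single priority queue: the extraction of an item creates a bounded
  number of larger items, which depend only on the item and on a state of bounded size. Strings of
  unbounded length are compared by walking down, level by level, the trie of all strings of one rank,
  so that the number of items stays linear in \<open>|N| + |E|\<close>.

  The queue keeps \<open>O(U)\<close> items in memory, where \<open>U = f * B\<close> and \<open>f = M div B\<close>, and sorted runs of at
  most \<open>f ^ i * U\<close> items on level \<open>i\<close> of the disk. When a level holds \<open>f\<close> runs, they are merged to one
  run of the next level. When the items in memory may no longer be the least ones, the \<open>U\<close> least
  items on the disk are fetched with \<open>O(f * L)\<close> IOs, where \<open>L\<close> is the number of levels. Hence every
  item costs \<open>O(L / B)\<close> IOs, and \<open>L\<close> is bounded by the logarithm in the sorting bound.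

  A program of the machine has no state apart from its memory. So the queue is written in a command
  language, and a command is simulated by storing its continuation and its store in the memory,
  several numbers packed into a word of polynomially bounded size.
\<close>

section \<open>Commands\<close>

text \<open>Bisimilar nodes have equal rank, so strings need comparing only within a rank, and the
  classes in them belong to nodes of smaller rank, hence are known in time. The strings together
  have length linear in the graph: one item per position is affordable, whereas an item holding a
  whole string would not fit into a word.

  The automaton and the queue are verified separately. The set \<open>X\<close> of all items is
  defined from the graph; as created items are larger than their creator and no item is created
  twice, the extracted items always form an initial segment of \<open>X\<close>, and the state
  before an item is a function of its predecessor in \<open>X\<close>. The queue only has to deliver
  the least item.

  A fetch is cheap because a run is read on only while its last loaded item is below the largest
  buffered one: all but at most two blocks per run are paid by fewer than \<open>U = f * B\<close>
  small items. Merging is a repeated fetch. Flushes increment a counter in base \<open>f\<close>, so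
  level \<open>i\<close> is merged only once in \<open>f ^ (i + 1)\<close> flushes.\<close>

datatype 's com =
    Basic "'s \<Rightarrow> 's"
  | Rd "'s \<Rightarrow> nat" "nat list \<Rightarrow> 's \<Rightarrow> 's"
  | Wr "'s \<Rightarrow> nat" "'s \<Rightarrow> nat list"
  | Seq "'s com" "'s com" (infixr \<open>;;\<close> 60)
  | Cond "'s \<Rightarrow> bool" "'s com" "'s com"
  | While "'s \<Rightarrow> bool" "'s com"

definition block :: "nat \<Rightarrow> (nat \<Rightarrow> nat) \<Rightarrow> nat \<Rightarrow> nat list" where
  "block B D a = map D [a * B..<a * B + B]"

definition put :: "nat \<Rightarrow> nat \<Rightarrow> nat list \<Rightarrow> (nat \<Rightarrow> nat) \<Rightarrow> nat \<Rightarrow> nat" where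
  "put B a ws D = (\<lambda>x. if a * B \<le> x \<and> x < a * B + B then ws ! (x - a * B) else D x)"

text \<open>The store has to be \<open>ok\<close>, that is, to fit into memory, only at an IO:
  between IOs computation is free and intermediate stores never materialise. \<open>A\<close> bounds
  the block addresses and \<open>V\<close> the written words.\<close>

inductive exec :: "nat \<Rightarrow> ('s \<Rightarrow> bool) \<Rightarrow> nat \<Rightarrow> nat \<Rightarrow>
    's com \<Rightarrow> 's \<Rightarrow> (nat \<Rightarrow> nat) \<Rightarrow> nat \<Rightarrow> 's \<Rightarrow> (nat \<Rightarrow> nat) \<Rightarrow> bool"
  for B ok A V where
  exec_Basic: "exec B ok A V (Basic f) s D 0 (f s) D"
| exec_Rd: "ok s \<Longrightarrow> a s < A \<Longrightarrow> exec B ok A V (Rd a g) s D 1 (g (block B D (a s)) s) D"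
| exec_Wr: "ok s \<Longrightarrow> a s < A \<Longrightarrow> length (w s) = B \<Longrightarrow> (\<forall>x\<in>set (w s). x < V) \<Longrightarrow>
    exec B ok A V (Wr a w) s D 1 s (put B (a s) (w s) D)"
| exec_Seq: "exec B ok A V c s D t s' D' \<Longrightarrow> exec B ok A V d s' D' u s'' D'' \<Longrightarrow>
    exec B ok A V (c ;; d) s D (t + u) s'' D''"
| exec_CondT: "b s \<Longrightarrow> exec B ok A V c s D t s' D' \<Longrightarrow> exec B ok A V (Cond b c d) s D t s' D'"
| exec_CondF: "\<not> b s \<Longrightarrow> exec B ok A V d s D t s' D' \<Longrightarrow> exec B ok A V (Cond b c d) s D t s' D'"
| exec_WhileF: "\<not> b s \<Longrightarrow> exec B ok A V (While b c) s D 0 s D"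
| exec_WhileT: "b s \<Longrightarrow> exec B ok A V c s D t s' D' \<Longrightarrow> exec B ok A V (While b c) s' D' u s'' D'' \<Longrightarrow>
    exec B ok A V (While b c) s D (t + u) s'' D''"

text \<open>A continuation is the list of commands that remain to be executed.\<close>

fun silent :: "'s com list \<times> 's \<Rightarrow> ('s com list \<times> 's) option" where
  "silent (Basic f # K, s) = Some (K, f s)"
| "silent ((c ;; d) # K, s) = Some (c # d # K, s)"
| "silent (Cond b c d # K, s) = Some ((if b s then c else d) # K, s)"
| "silent (While b c # K, s) = Some (if b s then c # While b c # K else K, s)"
| "silent x = None"

text \<open>A relation, because a loop without IO may diverge silently; where it is defined,
  \<open>the_norm\<close> recovers the value that the program computes.\<close>

inductive norm :: "'s com list \<times> 's \<Rightarrow> 's com list \<times> 's \<Rightarrow> bool" where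
  norm_stop: "silent c = None \<Longrightarrow> norm c c"
| norm_step: "silent c = Some c' \<Longrightarrow> norm c' c'' \<Longrightarrow> norm c c''"

lemma norm_det: "norm c c1 \<Longrightarrow> norm c c2 \<Longrightarrow> c1 = c2"
proof (induction rule: norm.induct)
  case (norm_stop c)
  from norm_stop(2,1) show ?case by (cases rule: norm.cases) auto
next
  case (norm_step c c' c'')
  from norm_step(4,1,3) show ?case by (cases rule: norm.cases) auto
qed

lemma the_norm: "norm c c' \<Longrightarrow> (THE x. norm c x) = c'"
  using norm_det by blast

text \<open>The execution as the machine sees it: configurations exist only at IOs, and everything
  silent in between is skipped by \<open>norm\<close>.\<close>

inductive chain :: "nat \<Rightarrow> ('s \<Rightarrow> bool) \<Rightarrow> nat \<Rightarrow> nat \<Rightarrow>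
    's com list \<times> 's \<Rightarrow> (nat \<Rightarrow> nat) \<Rightarrow> nat \<Rightarrow> (nat \<Rightarrow> nat) \<Rightarrow> bool"
  for B ok A V where
  chain_end: "norm c ([], s) \<Longrightarrow> chain B ok A V c D 0 D"
| chain_Rd: "norm c (Rd a g # K, s) \<Longrightarrow> ok s \<Longrightarrow> a s < A \<Longrightarrow>
    chain B ok A V (K, g (block B D (a s)) s) D t D' \<Longrightarrow> chain B ok A V c D (Suc t) D'"
| chain_Wr: "norm c (Wr a w # K, s) \<Longrightarrow> ok s \<Longrightarrow> a s < A \<Longrightarrow>
    length (w s) = B \<Longrightarrow> (\<forall>x\<in>set (w s). x < V) \<Longrightarrow>
    chain B ok A V (K, s) (put B (a s) (w s) D) t D' \<Longrightarrow> chain B ok A V c D (Suc t) D'"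

lemma chain_silent:
  assumes "chain B ok A V c' D t D'" "silent c = Some c'"
  shows "chain B ok A V c D t D'"
  using assms
  by (induction rule: chain.induct) (auto intro: chain.intros norm_step)

text \<open>Generalised to a rest \<open>K\<close> with a chain of its own, so that the induction
  hypotheses for sequences and loops compose from the back.\<close>

lemma exec_chain:
  "exec B ok A V c s D t s' D' \<Longrightarrow> chain B ok A V (K, s') D' u D'' \<Longrightarrow>
    chain B ok A V (c # K, s) D (t + u) D''"
proof (induction arbitrary: K u D'' rule: exec.induct)
  case (exec_Basic f s D)
  then show ?case using chain_silent[of B ok A V "(K, f s)" D u D'' "(Basic f # K, s)"] by simp
next
  case (exec_Rd s a g D)
  have "norm (Rd a g # K, s) (Rd a g # K, s)" by (simp add: norm_stop)
  from chain_Rd[where ok=ok and A=A, OF this exec_Rd(1,2,3)] show ?case by simp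
next
  case (exec_Wr s a w D)
  have "norm (Wr a w # K, s) (Wr a w # K, s)" by (simp add: norm_stop)
  from chain_Wr[where ok=ok and A=A, OF this exec_Wr(1-5)] show ?case by simp
next
  case (exec_Seq c s D t s' D' d u s'' D'' K v)
  from exec_Seq.IH(1)[OF exec_Seq.IH(2)[OF exec_Seq.prems]]
  show ?case by (auto elim!: chain_silent simp: add.assoc)
next
  case (exec_CondT b s c D t s' D' d)
  from exec_CondT.IH[OF exec_CondT.prems] exec_CondT.hyps
  show ?case by (auto elim!: chain_silent)
next
  case (exec_CondF b s d D t s' D' c)
  from exec_CondF.IH[OF exec_CondF.prems] exec_CondF.hyps
  show ?case by (auto elim!: chain_silent)
next
  case (exec_WhileF b s c D)
  from exec_WhileF.prems exec_WhileF.hyps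
  show ?case by (auto elim!: chain_silent)
next
  case (exec_WhileT b s c D t s' D' u s'' D'' K v)
  from exec_WhileT.IH(1)[OF exec_WhileT.IH(2)[OF exec_WhileT.prems]] exec_WhileT.hyps
  show ?case by (auto elim!: chain_silent simp: add.assoc)
qed

text \<open>The continuations that can arise while \<open>c\<close> runs in front of
  \<open>K\<close>, apart from \<open>K\<close> itself. Their number is bounded by the size of the
  command, so the control state is a number bounded by a constant.\<close>

primrec conts :: "'s com \<Rightarrow> 's com list \<Rightarrow> 's com list set" where
  "conts (Basic f) K = {Basic f # K}"
| "conts (Rd a g) K = {Rd a g # K}"
| "conts (Wr a w) K = {Wr a w # K}"
| "conts (c ;; d) K = insert ((c ;; d) # K) (conts c (d # K) \<union> conts d K)"
| "conts (Cond b c d) K = insert (Cond b c d # K) (conts c K \<union> conts d K)"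
| "conts (While b c) K = insert (While b c # K) (conts c (While b c # K))"

primrec csize :: "'s com \<Rightarrow> nat" where
  "csize (Basic f) = 1"
| "csize (Rd a g) = 1"
| "csize (Wr a w) = 1"
| "csize (c ;; d) = Suc (csize c + csize d)"
| "csize (Cond b c d) = Suc (csize c + csize d)"
| "csize (While b c) = Suc (csize c)"

lemma conts_self: "c # K \<in> conts c K"
  by (cases c) auto

lemma conts_finite_card: "finite (conts c K) \<and> card (conts c K) \<le> csize c"
proof (induction c arbitrary: K)
  case (Seq c1 c2)
  have "card (conts c1 (c2 # K) \<union> conts c2 K) \<le> csize c1 + csize c2"
    by (rule order_trans[OF card_Un_le]) (use Seq in \<open>auto intro: add_mono\<close>)
  then show ?case using Seq by (auto simp: card_insert_if)
next
  case (Cond b c1 c2)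
  have "card (conts c1 K \<union> conts c2 K) \<le> csize c1 + csize c2"
    by (rule order_trans[OF card_Un_le]) (use Cond in \<open>auto intro: add_mono\<close>)
  then show ?case using Cond by (auto simp: card_insert_if)
next
  case (While b c)
  then show ?case by (auto simp: card_insert_if le_SucI)
qed auto

lemma conts_silent:
  "k \<in> conts c K \<Longrightarrow> silent (k, s) = Some (k', s') \<Longrightarrow> k' \<in> insert K (conts c K)"
proof (induction c arbitrary: K)
  case (Seq c d)
  from Seq.prems(1) consider "k = (c ;; d) # K" | "k \<in> conts c (d # K)" | "k \<in> conts d K" by auto
  then show ?case
    using Seq.IH(1)[of "d # K"] Seq.IH(2)[of K] Seq.prems(2) conts_self[of c "d # K"] conts_self[of d K]
    by cases auto
next
  case (Cond b c d)
  then show ?case using conts_self[of c K] conts_self[of d K] by (auto split: if_splits)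
next
  case (While b c)
  then show ?case
    using conts_self[of c "While b c # K"] by (auto split: if_splits)
qed auto

lemma conts_io:
  "io # k \<in> conts c K \<Longrightarrow> silent (io # k, s) = None \<Longrightarrow> k \<in> insert K (conts c K)"
proof (induction c arbitrary: K)
  case (Seq c d)
  then show ?case using conts_self[of d K] by fastforce
qed fastforce+

definition all_conts :: "'s com \<Rightarrow> 's com list set" where
  "all_conts c = insert [] (conts c [])"

lemma all_conts_norm:
  "norm x y \<Longrightarrow> fst x \<in> all_conts c \<Longrightarrow> fst y \<in> all_conts c"
proof (induction rule: norm.induct)
  case (norm_step c1 c2 c3)
  have "fst c2 \<in> all_conts c"
  proof (cases "fst c1 = []")
    case True
    then show ?thesis using norm_step by (cases c1) auto
  next
    case False
    then show ?thesis
      using norm_step conts_silent[of "fst c1" c "[]" "snd c1" "fst c2" "snd c2"]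
      by (auto simp: all_conts_def)
  qed
  then show ?case using norm_step by blast
qed

lemma all_conts_io:
  "io # k \<in> all_conts c \<Longrightarrow> silent (io # k, s) = None \<Longrightarrow> k \<in> all_conts c"
  using conts_io[of io k c "[]" s] by (auto simp: all_conts_def)

lemma ex_cont_index: "\<exists>f. inj_on f (all_conts c) \<and> (\<forall>k\<in>all_conts c. f k \<le> csize c)"
proof -
  have fin: "finite (all_conts c)" "card (all_conts c) \<le> Suc (csize c)"
    using conts_finite_card[of c "[]"] by (auto simp: all_conts_def card_insert_if)
  obtain f where f: "bij_betw f (all_conts c) {0..<card (all_conts c)}"
    using ex_bij_betw_finite_nat[OF fin(1)] by blast
  have "inj_on f (all_conts c)" "\<forall>k\<in>all_conts c. f k \<le> csize c"
    using f fin(2) by (auto simp: bij_betw_def dest!: equalityD1)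
  then show ?thesis by blast
qed

definition cont_index :: "'s com \<Rightarrow> 's com list \<Rightarrow> nat" where
  "cont_index c = (SOME f. inj_on f (all_conts c) \<and> (\<forall>k\<in>all_conts c. f k \<le> csize c))"

lemma cont_index: "inj_on (cont_index c) (all_conts c)" "\<And>k. k \<in> all_conts c \<Longrightarrow> cont_index c k \<le> csize c"
  using someI_ex[OF ex_cont_index[of c]] unfolding cont_index_def by blast+

section \<open>Packing lists into words\<close>

lemma triangle_eq: "2 * triangle n = n * (n + 1)"
  by (induction n) auto

text \<open>The pair code is quadratic, below \<open>2 * (Y * Y)\<close>; the fourth power absorbs
  the factor 2. \<open>Suc\<close> is included because \<open>list_encode\<close> adds one at every
  element.\<close>

lemma prod_encode_less:
  assumes "a < Y" "b < Y" "2 \<le> Y"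
  shows "Suc (prod_encode (a, b)) < Y ^ 4"
proof -
  obtain Z where Z: "Y = Suc Z" using assms(3) by (cases Y) auto
  have ab: "a \<le> Z" "b \<le> Z" using assms Z by auto
  have "2 * triangle (a + b) \<le> (2 * Z) * (2 * Z + 1)"
    unfolding triangle_eq using ab by (intro mult_mono) auto
  then have "2 * Suc (prod_encode (a, b)) \<le> 4 * Z * Z + 4 * Z + 2"
    using ab by (simp add: prod_encode_def algebra_simps)
  also have "\<dots> < 4 * (Y * Y)" using Z by (simp add: algebra_simps)
  finally have 1: "Suc (prod_encode (a, b)) < 2 * (Y * Y)" by simp
  also have "2 * (Y * Y) \<le> Y * Y * (Y * Y)"
    using assms(3) mult_le_mono[OF assms(3), of 1 Y] by (intro mult_right_mono) auto
  finally show ?thesis by (simp add: power4_eq_xxxx mult.assoc)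
qed

text \<open>Every element raises the bound to its fourth power. The result is polynomial only
  because the lists packed into one word have constant length.\<close>

lemma list_encode_less:
  assumes "\<forall>x\<in>set xs. x < V" "2 \<le> V"
  shows "list_encode xs < V ^ (4 ^ length xs)"
  using assms(1)
proof (induction xs)
  case (Cons x xs)
  have le: "V \<le> V ^ (4 ^ length xs)" using assms(2) by (simp add: self_le_power)
  show ?case
    using prod_encode_less[of x "V ^ (4 ^ length xs)" "list_encode xs"] Cons le assms(2)
    by (simp add: mult.commute flip: power_mult)
qed (use assms in auto)

lemma list_encode_less':
  assumes "\<forall>x\<in>set xs. x < V" "2 \<le> V" "length xs \<le> Z"
  shows "list_encode xs < V ^ (4 ^ Z)"
proof -
  have "V ^ (4 ^ length xs) \<le> V ^ (4 ^ Z)" using assms by (intro power_increasing) auto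
  then show ?thesis using list_encode_less[OF assms(1,2)] by linarith
qed

lemma le_list_encode: "x \<in> set xs \<Longrightarrow> x \<le> list_encode xs"
  by (induction xs) (auto intro: le_prod_encode_1 le_SucI order_trans[OF _ le_prod_encode_2] le_trans[OF le_prod_encode_1])

text \<open>\<open>Suc\<close> keeps every word of a packed state positive: a nonzero last word is
  how \<open>prog\<close> recognises that it is being resumed.\<close>

definition pack :: "nat \<Rightarrow> nat \<Rightarrow> nat list \<Rightarrow> nat list" where
  "pack Z n xs = map (\<lambda>j. Suc (list_encode (take Z (drop (j * Z) xs)))) [0..<n]"

definition unpack :: "nat list \<Rightarrow> nat list" where
  "unpack ws = concat (map (\<lambda>w. list_decode (w - 1)) ws)"

lemma length_pack[simp]: "length (pack Z n xs) = n"
  by (simp add: pack_def)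

lemma unpack_pack: "length xs \<le> n * Z \<Longrightarrow> unpack (pack Z n xs) = xs"
proof -
  have "concat (map (\<lambda>j. take Z (drop (j * Z) xs)) [0..<n]) = take (n * Z) xs" for n
    by (induction n) (simp_all add: take_add add.commute[of Z])
  then show "length xs \<le> n * Z \<Longrightarrow> unpack (pack Z n xs) = xs"
    by (simp add: unpack_def pack_def comp_def)
qed

lemma pack_less:
  assumes "\<forall>x\<in>set xs. x < V" "2 \<le> V" "w \<in> set (pack Z n xs)"
  shows "0 < w" "w < V ^ (4 ^ Z + 1)"
proof -
  obtain j where w: "w = Suc (list_encode (take Z (drop (j * Z) xs)))"
    using assms(3) by (auto simp: pack_def)
  have "list_encode (take Z (drop (j * Z) xs)) < V ^ (4 ^ Z)"
    using assms(1,2) by (intro list_encode_less') (auto dest!: in_set_takeD in_set_dropD)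
  moreover have "V ^ (4 ^ Z) + 1 \<le> V ^ (4 ^ Z + 1)"
  proof -
    have "1 \<le> V ^ (4 ^ Z)" using assms(2) by simp
    moreover have "2 * V ^ (4 ^ Z) \<le> V * V ^ (4 ^ Z)" using assms(2) by simp
    ultimately have "V ^ (4 ^ Z) + 1 \<le> V * V ^ (4 ^ Z)" by linarith
    then show ?thesis by (simp add: power_add mult.commute)
  qed
  ultimately show "0 < w" "w < V ^ (4 ^ Z + 1)" using w by auto
qed


section \<open>From commands to programs\<close>

text \<open>
  A family of commands \<open>c M B N E\<close> is implemented by one program that keeps \<open>N\<close>, \<open>E\<close>, the
  continuation and the store in the internal memory.
\<close>

locale machine =
  fixes c :: "nat \<Rightarrow> nat \<Rightarrow> nat \<Rightarrow> nat \<Rightarrow> 's com"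
    and s0 :: 's
    and ha :: "nat \<Rightarrow> nat \<Rightarrow> nat \<Rightarrow> nat \<Rightarrow> nat"
    and enc :: "'s \<Rightarrow> nat list"
    and C Zc e :: nat
  assumes inj_enc: "inj enc"
    and csize: "\<And>M B N E. csize (c M B N E) \<le> C"
begin

text \<open>Entries per word: \<open>Zc\<close> for the store, and 4 for the header of
  \<open>code\<close>, which already fits if there is a single word.\<close>

definition Z :: nat where "Z = Zc + 4"

definition wide :: "nat \<Rightarrow> nat" where "wide V = V ^ (4 ^ Z + 1)"

text \<open>The entry \<open>N + E\<close> makes the number that codes the list at least
  \<open>N + E\<close> (\<open>le_list_encode\<close>), so that the \<open>mark\<close> of a state
  lies beyond the address bound \<open>A\<close>.\<close>

definition code :: "nat \<Rightarrow> nat \<Rightarrow> nat \<Rightarrow> nat \<Rightarrow> 's com list \<times> 's \<Rightarrow> nat list" where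
  "code M B N E x = [N, E, N + E, cont_index (c M B N E) (fst x)] @ enc (snd x)"

definition decode :: "nat \<Rightarrow> nat \<Rightarrow> nat list \<Rightarrow> 's com list \<times> 's" where
  "decode M B xs = (SOME x. fst x \<in> all_conts (c M B (xs ! 0) (xs ! 1)) \<and>
     code M B (xs ! 0) (xs ! 1) x = xs)"

lemma decode_code:
  assumes "fst x \<in> all_conts (c M B N E)"
  shows "decode M B (code M B N E x) = x"
proof -
  have "y = x" if "fst y \<in> all_conts (c M B N E)" "code M B N E y = code M B N E x" for y
    using that assms inj_enc cont_index(1)[of "c M B N E"]
    by (cases x; cases y) (auto simp: code_def dest: injD inj_onD)
  then show ?thesis
    unfolding decode_def using assms by (intro some_equality) (auto simp: code_def)
qed

text \<open>Memory layout for \<open>M >= 3\<close>: \<open>B\<close> words of IO buffer, then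
  \<open>M - B\<close> words with the configuration before the IO. Its head command tells
  \<open>resume\<close> what to do with the buffer afterwards.\<close>

definition emit :: "nat \<Rightarrow> nat \<Rightarrow> nat \<Rightarrow> nat \<Rightarrow> 's com list \<times> 's \<Rightarrow> nat list \<times> action" where
  "emit M B N E x = (let y = (THE y. norm x y); st = pack Z (M - B) (code M B N E y) in
     case fst y of
       Rd a g # K \<Rightarrow> (replicate B 0 @ st, Read (a (snd y)) 0)
     | Wr a w # K \<Rightarrow> (w (snd y) @ st, Write (a (snd y)) 0)
     | _ \<Rightarrow> (replicate M 0, Halt (ha M B N E)))"

definition resume :: "'s com list \<times> 's \<Rightarrow> nat list \<Rightarrow> 's com list \<times> 's" where
  "resume y b = (case fst y of
       Rd a g # K \<Rightarrow> (K, g b (snd y))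
     | Wr a w # K \<Rightarrow> (K, snd y)
     | _ \<Rightarrow> y)"

definition prog :: "nat \<Rightarrow> nat \<Rightarrow> program" where
  "prog M B mem =
     (if last mem = 0 then emit M B (mem ! 0) (mem ! 1) ([c M B (mem ! 0) (mem ! 1)], s0)
      else let xs = unpack (drop B mem) in
        emit M B (xs ! 0) (xs ! 1) (resume (decode M B xs) (take B mem)))"

text \<open>
  For \<open>M = 2\<close> and \<open>B = 1\<close> a word that was just read from the input, next to a single word of state,
  cannot be told from an initial memory. Before each IO of the command, the program therefore
  writes a mark to a block \<open>mark v\<close> beyond the used part of the disk, where \<open>v\<close> is the state. In a
  memory \<open>[v, x]\<close> with \<open>v \<ge> 2\<close>, a mark at \<open>mark v\<close> tells that \<open>v\<close> is a state and not a number of nodes.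
  Memories \<open>[z, y]\<close> with \<open>z \<le> 1\<close> and \<open>y \<ge> 2\<close> are never initial.
\<close>

definition mark :: "nat \<Rightarrow> nat" where
  "mark v = (v + 2) ^ e + 2 * v + 2 * (v * v)"

text \<open>The offset 2 keeps state words apart from the values 0 and 1 in the first memory
  cell.\<close>

definition codew :: "nat \<Rightarrow> nat \<Rightarrow> 's com list \<times> 's \<Rightarrow> nat" where
  "codew N E x = 2 + list_encode (code 2 1 N E x)"

definition decodew :: "nat \<Rightarrow> 's com list \<times> 's" where
  "decodew v = decode 2 1 (list_decode (v - 2))"

definition emit2 :: "nat \<Rightarrow> nat \<Rightarrow> 's com list \<times> 's \<Rightarrow> nat list \<times> action" where
  "emit2 N E x = (let y = (THE y. norm x y); v = codew N E y in
     if fst y = [] then ([0, 0], Halt (ha 2 1 N E))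
     else ([1, 2 + prod_encode (0, v)], Write (mark v) 0))"

definition io2 :: "nat \<Rightarrow> nat list \<times> action" where
  "io2 v = (let y = decodew v in
     case fst y of
       Rd a g # K \<Rightarrow> ([v, 0], Read (a (snd y)) 1)
     | Wr a w # K \<Rightarrow> ([v, w (snd y) ! 0], Write (a (snd y)) 1)
     | _ \<Rightarrow> ([0, 0], Halt 0))"

text \<open>One IO of the command with state word \<open>v\<close> takes three IOs. The second word
  \<open>(0, v)\<close> means that the mark has been written and the IO is due; the IO leaves
  \<open>[v, x]\<close>; then the mark is read into the first cell next to \<open>(1, v, x)\<close>.
  The digit read, 1 or 0, separates a resumption from a first call with \<open>N = v\<close> and
  \<open>E = x\<close>.\<close>

definition prog2 :: program where
  "prog2 mem = (let x = mem ! 0; y = mem ! 1 in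
     if x \<le> 1 then
       if y < 2 then emit2 x y ([c 2 1 x y], s0)
       else let (tag, p) = prod_decode (y - 2); (v, w) = prod_decode p in
         if tag = 0 then io2 p
         else if x = 0 then emit2 v w ([c 2 1 v w], s0)
         else let xs = list_decode (v - 2) in emit2 (xs ! 0) (xs ! 1) (resume (decodew v) [w])
     else ([0, 2 + prod_encode (1, prod_encode (x, y))], Read (mark x) 0))"

lemma mark_less:
  assumes "v < Y" "2 \<le> Y"
  shows "mark v < Y ^ (2 * e + 5)"
proof -
    have gen: "(u + 2) ^ e + 2 * u + 2 * (u * u) < Y ^ (2 * e + 5)" if "u < Y" "2 \<le> Y" for u Y :: nat
    proof -
      have "u + 2 \<le> Y ^ 2"
      proof -
        have "2 * Y \<le> Y * Y" using that by simp
        then have "u + 2 \<le> Y * Y" using that by linarith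
        then show ?thesis by (simp add: power2_eq_square)
      qed
      then have "(u + 2) ^ e \<le> (Y ^ 2) ^ e" by (intro power_mono) auto
      also have "\<dots> = Y ^ (2 * e)" by (simp add: power_mult)
      also have "\<dots> \<le> Y ^ (2 * e + 3)" using that by (intro power_increasing) auto
      finally have 1: "(u + 2) ^ e \<le> Y ^ (2 * e + 3)" .
      have "2 * u \<le> Y * Y" using that by (intro mult_mono) auto
      also have "\<dots> \<le> Y ^ (2 * e + 3)"
        using that power_increasing[of 2 "2 * e + 3" Y] by (simp add: power2_eq_square)
      finally have 2: "2 * u \<le> Y ^ (2 * e + 3)" .
      have "2 * (u * u) \<le> Y * (Y * Y)" using that by (intro mult_mono) auto
      also have "\<dots> \<le> Y ^ (2 * e + 3)"
        using that power_increasing[of 3 "2 * e + 3" Y] by (simp add: power3_eq_cube mult.assoc)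
      finally have 3: "2 * (u * u) \<le> Y ^ (2 * e + 3)" .
      have "2 ^ 2 \<le> Y ^ 2" using that by (intro power_mono) auto
      then have "4 * Y ^ (2 * e + 3) \<le> Y ^ 2 * Y ^ (2 * e + 3)" by (intro mult_right_mono) auto
      also have "\<dots> = Y ^ (2 * e + 5)" by (simp add: add.commute flip: power_add)
      finally have 4: "4 * Y ^ (2 * e + 3) \<le> Y ^ (2 * e + 5)" .
      have "0 < Y ^ (2 * e + 3)" using that by simp
      then show ?thesis using 1 2 3 4 by linarith
    qed
    show ?thesis using gen[OF assms] by (simp only: mark_def)
qed

section \<open>Correctness of the two simulations\<close>

context
  fixes M B N E V W A :: nat and ok :: "'s \<Rightarrow> bool"
  assumes MB: "1 \<le> B" "2 * B \<le> M"
    and ok: "\<forall>s. ok s \<longrightarrow> length (enc s) \<le> Zc * (M - B) \<and> (\<forall>x\<in>set (enc s). x < V)"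
    and V: "2 \<le> V" "N + E < V" "C < V"
    and W: "V ^ (4 ^ Z + 1) \<le> W"
    and AW: "A \<le> W" and haW: "ha M B N E < W"
begin

lemma ok_length: "ok s \<Longrightarrow> length (enc s) \<le> Zc * (M - B)"
  and ok_less: "ok s \<Longrightarrow> x \<in> set (enc s) \<Longrightarrow> x < V"
  using ok by auto

lemma W_pos: "V \<le> W" "2 \<le> W"
proof -
  have "V \<le> V ^ (4 ^ Z + 1)" using V(1) by (intro self_le_power) auto
  then show "V \<le> W" "2 \<le> W" using W V(1) by linarith+
qed

lemma code_length: "ok (snd x) \<Longrightarrow> length (code M B N E x) \<le> (M - B) * Z"
proof -
  assume "ok (snd x)"
  then have "length (code M B N E x) \<le> 4 + Zc * (M - B)"
    using ok_length by (simp add: code_def)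
  also have "\<dots> \<le> 4 * (M - B) + Zc * (M - B)" using MB by simp
  finally show ?thesis by (simp add: Z_def algebra_simps)
qed

lemma code_less:
  "ok (snd x) \<Longrightarrow> fst x \<in> all_conts (c M B N E) \<Longrightarrow> \<forall>z\<in>set (code M B N E x). z < V"
  using ok_less V csize[of M B N E] cont_index(2)[of "fst x" "c M B N E"]
  by (auto simp: code_def)

text \<open>The invariant concerns the next answer of the program, not the contents of the memory;
  so initial and resumed memories are treated alike.\<close>

lemma chain_runs:
  assumes "3 \<le> M"
  shows "chain B ok A V x D t D' \<Longrightarrow> fst x \<in> all_conts (c M B N E) \<Longrightarrow>
    prog M B mem = emit M B N E x \<Longrightarrow> runs M B W (prog M B) mem D t (ha M B N E) D'"
proof (induction arbitrary: mem rule: chain.induct)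
  case (chain_end x s D)
  then have "prog M B mem = (replicate M 0, Halt (ha M B N E))"
    by (simp add: emit_def the_norm)
  then show ?case using haW W_pos by (intro run_halt) (auto simp: valid_memory_def)
next
  case (chain_Rd x a g K s D t D')
  let ?y = "(Rd a g # K, s)" and ?st = "pack Z (M - B) (code M B N E (Rd a g # K, s))"
  have y: "fst ?y \<in> all_conts (c M B N E)" using all_conts_norm chain_Rd.hyps(1) chain_Rd.prems(1) by blast
  have em: "prog M B mem = (replicate B 0 @ ?st, Read (a s) 0)"
    using chain_Rd by (simp add: emit_def the_norm)
  have less: "\<And>w. w \<in> set ?st \<Longrightarrow> 0 < w \<and> w < W"
    using pack_less[OF code_less[OF _ y] V(1), of _ Z "M - B"] chain_Rd.hyps(2) W by fastforce
  have up: "unpack ?st = code M B N E ?y"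
    using code_length[of ?y] chain_Rd.hyps(2) by (intro unpack_pack) auto
  have len: "length (block B D (a s)) = B" by (simp add: block_def)
  have mem: "read_block B (a s) 0 D (replicate B 0 @ ?st) = block B D (a s) @ ?st"
    by (simp add: read_block_def block_def)
  have "?st \<noteq> []" using MB by (auto simp: pack_def)
  then have last: "last (block B D (a s) @ ?st) \<noteq> 0" using less[of "last ?st"] by simp
  have nxt: "prog M B (block B D (a s) @ ?st) = emit M B N E (K, g (block B D (a s)) s)"
    unfolding prog_def Let_def using last len
    by (simp add: up decode_code[OF y] resume_def del: last_appendR) (simp add: code_def)
  have K: "K \<in> all_conts (c M B N E)" using all_conts_io[of _ K _ s] y by fastforce
  show ?case
    using em
  proof (rule run_read)
    show "valid_memory M W (replicate B 0 @ ?st)"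
      using MB W_pos less by (auto simp: valid_memory_def)
    show "runs M B W (prog M B) (read_block B (a s) 0 D (replicate B 0 @ ?st)) D t (ha M B N E) D'"
      unfolding mem using nxt K by (intro chain_Rd.IH) auto
  qed (use chain_Rd.hyps(3) AW MB in auto)
next
  case (chain_Wr x a w K s D t D')
  let ?y = "(Wr a w # K, s)" and ?st = "pack Z (M - B) (code M B N E (Wr a w # K, s))"
  have y: "fst ?y \<in> all_conts (c M B N E)" using all_conts_norm chain_Wr.hyps(1) chain_Wr.prems(1) by blast
  have em: "prog M B mem = (w s @ ?st, Write (a s) 0)"
    using chain_Wr by (simp add: emit_def the_norm)
  have less: "\<And>w. w \<in> set ?st \<Longrightarrow> 0 < w \<and> w < W"
    using pack_less[OF code_less[OF _ y] V(1), of _ Z "M - B"] chain_Wr.hyps(2) W by fastforce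
  have up: "unpack ?st = code M B N E ?y"
    using code_length[of ?y] chain_Wr.hyps(2) by (intro unpack_pack) auto
  have "?st \<noteq> []" using MB by (auto simp: pack_def)
  then have last: "last (w s @ ?st) \<noteq> 0" using less[of "last ?st"] by simp
  have nxt: "prog M B (w s @ ?st) = emit M B N E (K, s)"
    unfolding prog_def Let_def using last chain_Wr.hyps(4)
    by (simp add: up decode_code[OF y] resume_def del: last_appendR) (simp add: code_def)
  have K: "K \<in> all_conts (c M B N E)" using all_conts_io[of _ K _ s] y by fastforce
  have wb: "write_block B (a s) 0 (w s @ ?st) D = put B (a s) (w s) D"
    using chain_Wr.hyps(4) by (intro ext) (auto simp: write_block_def put_def nth_append)
  show ?case
    using em
  proof (rule run_write)
    show "valid_memory M W (w s @ ?st)"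
      using MB W_pos less chain_Wr.hyps(4,5) by (auto simp: valid_memory_def)
    show "runs M B W (prog M B) (w s @ ?st) (write_block B (a s) 0 (w s @ ?st) D) t (ha M B N E) D'"
      unfolding wb using nxt K by (intro chain_Wr.IH) auto
  qed (use chain_Wr.hyps(3) AW MB in auto)
qed

lemma codew_facts:
  assumes M2: "M = 2"
    and A: "A \<le> (N + E + 2) ^ e"
    and W2: "wide V ^ (2 * e + 17) \<le> W"
    and y: "ok (snd y)" "fst y \<in> all_conts (c M B N E)"
  defines "v \<equiv> codew N E y"
  shows "2 \<le> v" "A \<le> mark v" "v < wide V"
    "decodew v = y \<and> list_decode (v - 2) ! 0 = N \<and> list_decode (v - 2) ! Suc 0 = E"
    "2 + prod_encode (0, v) < W" "mark v < W" "mark v < W" "v < W"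
proof -
  have B1: "B = 1" using MB M2 by simp
  define Y where "Y = wide V"
  note W2 = W2[folded Y_def]
  show v2: "2 \<le> v" by (simp add: v_def codew_def)
  have NE: "N + E \<le> v"
    using le_list_encode[of "N + E" "code 2 1 N E y"] by (simp add: v_def codew_def code_def)
  show "A \<le> mark v"
  proof -
    have "A \<le> (v + 2) ^ e" using A NE power_mono[of "N + E + 2" "v + 2" e] by simp
    then show ?thesis by (simp add: mark_def)
  qed
  have le: "list_encode (code 2 1 N E y) < V ^ (4 ^ Z)"
    using code_less[OF y] code_length[of y] y V M2 B1 by (intro list_encode_less') auto
  have "4 \<le> V ^ (4 ^ Z)"
  proof -
    have "(2::nat) ^ 2 \<le> V ^ 2" using V by (intro power_mono) auto
    also have "(2::nat) \<le> 4 ^ Z" using power_increasing[of 1 Z "4::nat"] by (simp add: Z_def)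
    then have "V ^ 2 \<le> V ^ (4 ^ Z)" using V by (intro power_increasing) auto
    finally show ?thesis by simp
  qed
  moreover have "2 * V ^ (4 ^ Z) \<le> Y" using V by (simp add: Y_def wide_def)
  ultimately have vY: "v < Y" using le unfolding v_def codew_def by linarith
  then show "v < wide V" by (simp add: Y_def)
  have Y2: "2 \<le> Y" using v2 vY by linarith
  have YW: "Y ^ n \<le> W" if "n \<le> 2 * e + 17" for n
    using power_increasing[OF that, of Y] Y2 W2 by linarith
  show "v < W" using vY YW[of 1] by simp
  have pe: "Suc (prod_encode (0, v)) < Y ^ 4" using vY Y2 by (intro prod_encode_less) auto
  have "Suc (Y ^ 4) \<le> Y ^ 5"
  proof -
    have "2 * Y ^ 4 \<le> Y * Y ^ 4" using Y2 by (intro mult_right_mono) auto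
    moreover have "1 \<le> Y ^ 4" using Y2 by simp
    moreover have "Y ^ 5 = Y * Y ^ 4" by (simp flip: power_Suc)
    ultimately show ?thesis by linarith
  qed
  then show "2 + prod_encode (0, v) < W" using pe YW[of 5] by linarith
  have "mark v < Y ^ (2 * e + 5)" using mark_less[OF vY Y2] .
  then show "mark v < W" "mark v < W" using YW[of "2 * e + 5"] by linarith+
  show "decodew v = y \<and> list_decode (v - 2) ! 0 = N \<and> list_decode (v - 2) ! Suc 0 = E"
    using decode_code[OF y(2)] M2 B1 by (simp add: v_def codew_def decodew_def) (simp add: code_def)
qed

text \<open>The probing step, common to both readings of a memory \<open>[v, d]\<close>: it is used
  with \<open>m = 1\<close> when \<open>v\<close> is a state and with \<open>m = 0\<close> for a
  first call.\<close>

lemma test_run: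
  assumes M2: "M = 2"
    and A: "A \<le> (N + E + 2) ^ e"
    and W2: "wide V ^ (2 * e + 17) \<le> W"
    and v: "2 \<le> v" "v < wide V" "mark v < W" and d: "d < V" and m: "D (mark v) = m"
    and r: "runs M B W prog2 [m, 2 + prod_encode (1, prod_encode (v, d))] D t a D'"
  shows "runs M B W prog2 [v, d] D (Suc t) a D'"
proof -
  define Y where "Y = wide V"
  note W2 = W2[folded Y_def]
  note v = v[folded Y_def]
  have "V \<le> Y" using V(1) unfolding Y_def wide_def by (intro self_le_power) auto
  then have pe: "Suc (prod_encode (v, d)) < Y ^ 4" using v d by (intro prod_encode_less) auto
  have "Suc (prod_encode (1, prod_encode (v, d))) < (Y ^ 4) ^ 4"
    using pe v by (intro prod_encode_less) linarith+
  also have "(Y ^ 4) ^ 4 = Y ^ 16" by (simp flip: power_mult)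
  finally have 1: "Suc (prod_encode (1, prod_encode (v, d))) < Y ^ 16" .
  have "Y ^ 16 < Y ^ (2 * e + 17)" using v by (intro power_strict_increasing) auto
  then have "2 + prod_encode (1, prod_encode (v, d)) < W" using 1 W2 by linarith
  moreover have "B = 1" using M2 MB by simp
  ultimately show ?thesis
    using v r m M2 W_pos
    by (intro run_read[where p = 0 and b = "mark v" and mem' = "[0, 2 + prod_encode (1, prod_encode (v, d))]"])
       (auto simp: prog2_def valid_memory_def read_block_def)
qed

text \<open>The marks change the real disk \<open>D2\<close>, which therefore agrees with the
  simulated disk \<open>D\<close> only below \<open>A\<close>. Here \<open>B = 1\<close>, so words
  and blocks coincide.\<close>

lemma chain_runs2:
  assumes M2: "M = 2"
    and A: "A \<le> (N + E + 2) ^ e"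
    and W2: "wide V ^ (2 * e + 17) \<le> W"
  shows "chain B ok A V x D t D' \<Longrightarrow> fst x \<in> all_conts (c M B N E) \<Longrightarrow> (\<forall>z. D z < V) \<Longrightarrow>
    (\<forall>z<A. D2 z = D z) \<Longrightarrow> prog2 mem = emit2 N E x \<Longrightarrow>
    \<exists>D2'. runs M B W prog2 mem D2 (3 * t) (ha M B N E) D2' \<and> (\<forall>z<A. D2' z = D' z)"
proof (induction arbitrary: mem D2 rule: chain.induct)
  case (chain_end x s D)
  then have "prog2 mem = ([0, 0], Halt (ha M B N E))"
    using M2 MB by (simp add: emit2_def the_norm)
  then have "runs M B W prog2 mem D2 0 (ha M B N E) D2"
    using haW W_pos M2 by (intro run_halt) (auto simp: valid_memory_def)
  then show ?case using chain_end by auto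
next
  case (chain_Rd x a g K s D t D')
  let ?y = "(Rd a g # K, s)"
  define v where "v = codew N E ?y"
  have B1: "B = 1" using MB M2 by simp
  have y: "fst ?y \<in> all_conts (c M B N E)" using all_conts_norm chain_Rd.hyps(1) chain_Rd.prems(1) by blast
  have oky: "ok (snd ?y)" using chain_Rd.hyps(2) by simp
  note v = codew_facts[OF M2 A W2 oky y, folded v_def]
  have em: "prog2 mem = ([1, 2 + prod_encode (0, v)], Write (mark v) 0)"
    using chain_Rd.hyps(1) chain_Rd.prems(4) by (simp add: emit2_def the_norm v_def Let_def)
  define D3 where "D3 = D2(mark v := 1)"
  have D3: "\<forall>z<A. D3 z = D z" "D3 (mark v) = 1" using chain_Rd.prems v(2) by (auto simp: D3_def)
  have wb: "write_block B (mark v) 0 [1, 2 + prod_encode (0, v)] D2 = D3"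
    using B1 by (intro ext) (auto simp: write_block_def D3_def)
  have rb: "read_block B (a s) 1 D3 [v, 0] = [v, D (a s)]"
    using B1 D3(1) chain_Rd.hyps(3) by (simp add: read_block_def)
  have K: "K \<in> all_conts (c M B N E)" using all_conts_io[of _ K _ s] y by fastforce
  have bl: "block B D (a s) = [D (a s)]" using B1 by (simp add: block_def)
  have "\<exists>D2'. runs M B W prog2 [1, 2 + prod_encode (1, prod_encode (v, D (a s)))] D3 (3 * t) (ha M B N E) D2'
      \<and> (\<forall>z<A. D2' z = D' z)"
  proof (rule chain_Rd.IH)
    show "prog2 [1, 2 + prod_encode (1, prod_encode (v, D (a s)))] =
        emit2 N E (K, g (block B D (a s)) s)"
      using v(4) by (simp add: prog2_def resume_def bl)
  qed (use chain_Rd.prems(2) D3(1) K in simp_all)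
  then obtain D2' where D2': "runs M B W prog2 [1, 2 + prod_encode (1, prod_encode (v, D (a s)))] D3 (3 * t) (ha M B N E) D2'"
    "\<forall>z<A. D2' z = D' z" by blast
  have rr: "runs M B W prog2 [v, D (a s)] D3 (Suc (3 * t)) (ha M B N E) D2'"
    using chain_Rd.prems(2) by (intro test_run[OF M2 A W2 v(1,3,7) _ D3(2) D2'(1)]) simp
  have "runs M B W prog2 [1, 2 + prod_encode (0, v)] D3 (Suc (Suc (3 * t))) (ha M B N E) D2'"
  proof (rule run_read[where p = 1 and b = "a s" and mem' = "[v, 0]"])
    show "prog2 [1, 2 + prod_encode (0, v)] = ([v, 0], Read (a s) 1)"
      using v(4) by (simp add: prog2_def io2_def)
  qed (use rr v(8) chain_Rd.hyps(3) AW W_pos M2 B1 rb in \<open>simp_all add: valid_memory_def\<close>)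
  then have "runs M B W prog2 mem D2 (Suc (Suc (Suc (3 * t)))) (ha M B N E) D2'"
    using v(5,6) W_pos M2 B1 wb em
    by - (rule run_write[where P = prog2 and b = "mark v" and p = 0 and mem' = "[1, 2 + prod_encode (0, v)]"],
        simp_all add: valid_memory_def)
  moreover have "Suc (Suc (Suc (3 * t))) = 3 * Suc t" by simp
  ultimately show ?case using D2'(2) by auto
next
  case (chain_Wr x a w K s D t D')
  let ?y = "(Wr a w # K, s)"
  define v where "v = codew N E ?y"
  have B1: "B = 1" using MB M2 by simp
  have y: "fst ?y \<in> all_conts (c M B N E)" using all_conts_norm chain_Wr.hyps(1) chain_Wr.prems(1) by blast
  have oky: "ok (snd ?y)" using chain_Wr.hyps(2) by simp
  note v = codew_facts[OF M2 A W2 oky y, folded v_def]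
  have em: "prog2 mem = ([1, 2 + prod_encode (0, v)], Write (mark v) 0)"
    using chain_Wr.hyps(1) chain_Wr.prems(4) by (simp add: emit2_def the_norm v_def Let_def)
  obtain d where d: "w s = [d]" using chain_Wr.hyps(4) B1 by (auto simp: length_Suc_conv)
  define D3 where "D3 = D2(mark v := 1)"
  define D4 where "D4 = D3(a s := d)"
  have D3: "\<forall>z<A. D3 z = D z" "D3 (mark v) = 1" using chain_Wr.prems v(2) by (auto simp: D3_def)
  have pt: "put B (a s) (w s) D = D(a s := d)" using B1 by (intro ext) (auto simp: put_def d)
  have D4: "\<forall>z<A. D4 z = put B (a s) (w s) D z" "D4 (mark v) = 1"
    using D3 v(2) chain_Wr.hyps(3) by (auto simp: D4_def pt)
  have wb: "write_block B (mark v) 0 [1, 2 + prod_encode (0, v)] D2 = D3"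
    using B1 by (intro ext) (auto simp: write_block_def D3_def)
  have wb2: "write_block B (a s) 1 [v, d] D3 = D4"
    using B1 by (intro ext) (auto simp: write_block_def D4_def)
  have K: "K \<in> all_conts (c M B N E)" using all_conts_io[of _ K _ s] y by fastforce
  have less: "\<forall>z. put B (a s) (w s) D z < V" using chain_Wr.prems(2) chain_Wr.hyps(5) d pt by auto
  have "\<exists>D2'. runs M B W prog2 [1, 2 + prod_encode (1, prod_encode (v, d))] D4 (3 * t) (ha M B N E) D2'
      \<and> (\<forall>z<A. D2' z = D' z)"
  proof (rule chain_Wr.IH)
    show "prog2 [1, 2 + prod_encode (1, prod_encode (v, d))] = emit2 N E (K, s)"
      using v(4) by (simp add: prog2_def resume_def)
  qed (use less D4(1) K in simp_all)
  then obtain D2' where D2': "runs M B W prog2 [1, 2 + prod_encode (1, prod_encode (v, d))] D4 (3 * t) (ha M B N E) D2'"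
    "\<forall>z<A. D2' z = D' z" by blast
  have dV: "d < V" using chain_Wr.hyps(5) d by simp
  have rr: "runs M B W prog2 [v, d] D4 (Suc (3 * t)) (ha M B N E) D2'"
    by (rule test_run[OF M2 A W2 v(1,3,7) dV D4(2) D2'(1)])
  have "runs M B W prog2 [1, 2 + prod_encode (0, v)] D3 (Suc (Suc (3 * t))) (ha M B N E) D2'"
  proof (rule run_write[where p = 1 and b = "a s" and mem' = "[v, d]"])
    show "prog2 [1, 2 + prod_encode (0, v)] = ([v, d], Write (a s) 1)"
      using v(4) by (simp add: prog2_def io2_def d)
  qed (use rr v(8) chain_Wr.hyps(3) AW W_pos M2 B1 wb2 dV in \<open>simp_all add: valid_memory_def\<close>)
  then have "runs M B W prog2 mem D2 (Suc (Suc (Suc (3 * t)))) (ha M B N E) D2'"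
    using v(5,6) W_pos M2 B1 wb em
    by - (rule run_write[where P = prog2 and b = "mark v" and p = 0 and mem' = "[1, 2 + prod_encode (0, v)]"],
        simp_all add: valid_memory_def)
  moreover have "Suc (Suc (Suc (3 * t))) = 3 * Suc t" by simp
  ultimately show ?case using D2'(2) by auto
qed

end

definition machine_prog :: "nat \<Rightarrow> nat \<Rightarrow> program" where
  "machine_prog M B = (if M = 2 then prog2 else prog M B)"

text \<open>The additional IO is the probe of a first call. It does not occur for
  \<open>N = 0\<close>, which matters because the sorting bound is 0 for the empty graph.\<close>

lemma exec_runs:
  fixes G :: "(nat, nat) lgraph"
  defines "N \<equiv> card (nodes G)" and "E \<equiv> card (edges G)"
  assumes MB: "1 \<le> B" "2 * B \<le> M"
    and ok: "\<forall>s. ok s \<longrightarrow> length (enc s) \<le> Zc * (M - B) \<and> (\<forall>x\<in>set (enc s). x < V)"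
    and V: "2 \<le> V" "N + E < V" "C < V"
    and W: "wide V ^ (2 * e + 17) \<le> W"
    and A: "A \<le> W" "M = 2 \<Longrightarrow> A \<le> (N + E + 2) ^ e" and haW: "ha M B N E < W"
    and G: "wf_lgraph G"
    and D: "\<And>x. D x < V" "\<And>x. 2 * N + 2 * E \<le> x \<Longrightarrow> B = 1 \<Longrightarrow> D x = 0"
    and ex: "exec B ok A V (c M B N E) s0 D t s' D'"
  shows "\<exists>t' D''. runs M B W (machine_prog M B) (init_memory M G) D t' (ha M B N E) D'' \<and>
    (\<forall>x<A * B. D'' x = D' x) \<and> t' \<le> 3 * t + 1 \<and> (N = 0 \<longrightarrow> t' \<le> 3 * t)"
proof -
  have fin: "finite (nodes G)" "edges G \<subseteq> nodes G \<times> nodes G" using G by (auto simp: wf_lgraph_def)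
  have E: "E \<le> N * N"
    using card_mono[OF _ fin(2)] fin(1) by (simp add: N_def E_def card_cartesian_product)
  let ?c = "c M B N E"
  have ch: "chain B ok A V ([?c], s0) D t D'"
    using exec_chain[OF ex chain_end[of "([], s')" s']] by (simp add: norm_stop)
  have mem: "fst ([?c], s0) \<in> all_conts (c M B N E)" by (simp add: all_conts_def conts_self)
  have Y2: "V \<le> wide V" using V(1) unfolding wide_def by (intro self_le_power) auto
  then have "wide V \<le> wide V ^ (2 * e + 17)" using V(1) by (intro self_le_power) auto
  then have W1: "wide V \<le> W" using W by linarith
  note basic = MB ok V W1[unfolded wide_def] A(1) haW
  show ?thesis
  proof (cases "M = 2")
    case False
    then have M3: "3 \<le> M" using MB by simp
    have "last (init_memory M G) = 0" "init_memory M G ! 0 = N" "init_memory M G ! 1 = E"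
      using M3 by (auto simp: init_memory_def N_def E_def)
    then have "prog M B (init_memory M G) = emit M B N E ([?c], s0)"
      by (simp add: prog_def)
    from chain_runs[OF basic M3 ch mem this] show ?thesis
      using False by (intro exI[of _ t] exI[of _ D']) (auto simp: machine_prog_def)
  next
    case True
    then have B1: "B = 1" using MB by simp
    have im: "init_memory M G = [N, E]" using True by (simp add: init_memory_def N_def E_def)
    have c: "c 2 1 N E = c M B N E" using True B1 by simp
    note cr = chain_runs2[OF basic True A(2)[OF True] W ch mem]
    have less: "\<forall>z. D z < V" using D(1) by simp
    show ?thesis
    proof (cases "N \<le> 1")
      case True
      \<comment> \<open>At most one node means at most one edge, so the second word is below 2 and
        cannot be mistaken for a tagged pair.\<close>
      then have "E < 2" using E mult_le_mono[of N 1 N 1] by linarith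
      then have "prog2 [N, E] = emit2 N E ([?c], s0)" using True c by (simp add: prog2_def)
      from cr[OF less _ this, of D] show ?thesis
        using im \<open>M = 2\<close> B1 by (auto simp: machine_prog_def intro!: exI[of _ "3 * t"])
    next
      case False
      let ?m = "[0, 2 + prod_encode (1, prod_encode (N, E))]"
      have "prog2 ?m = emit2 N E ([?c], s0)" using c by (simp add: prog2_def)
      from cr[OF less _ this, of D] obtain D2 where
        D2: "runs M B W prog2 ?m D (3 * t) (ha M B N E) D2" "\<forall>z<A. D2 z = D' z" by auto
      \<comment> \<open>The summands \<open>2 * v + 2 * (v * v)\<close> of \<open>mark\<close> serve
        this case: as \<open>E <= N * N\<close>, the probed address lies beyond the input, where the
        disk is still zero.\<close>
      have dm: "D (mark N) = 0"
      proof (rule D(2)[OF _ B1])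
        show "2 * N + 2 * E \<le> mark N" using E by (simp add: mark_def)
      qed
      have mW: "mark N < W"
      proof -
        have NV: "N < wide V" using V(2) Y2 by linarith
        then show ?thesis using mark_less[OF NV] Y2 V(1) W
          power_increasing[of "2 * e + 5" "2 * e + 17" "wide V"] by linarith
      qed
      have "runs M B W prog2 [N, E] D (Suc (3 * t)) (ha M B N E) D2"
        using False V Y2 mW by (intro test_run[OF basic True A(2)[OF True] W _ _ _ _ dm D2(1)]) auto
      then show ?thesis using im True B1 D2(2) False by (auto simp: machine_prog_def intro!: exI)
    qed
  qed
qed

end

section \<open>Hoare triples\<close>

text \<open>The third argument of an assertion is the number of IOs performed so far.\<close>

definition hoare :: "nat \<Rightarrow> ('s \<Rightarrow> bool) \<Rightarrow> nat \<Rightarrow> nat \<Rightarrow> ('s \<Rightarrow> (nat \<Rightarrow> nat) \<Rightarrow> nat \<Rightarrow> bool) \<Rightarrow> 's com \<Rightarrow>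
    ('s \<Rightarrow> (nat \<Rightarrow> nat) \<Rightarrow> nat \<Rightarrow> bool) \<Rightarrow> bool" where
  "hoare B ok A V P c Q \<longleftrightarrow> (\<forall>s D T. P s D T \<longrightarrow>
     (\<exists>t s' D'. exec B ok A V c s D t s' D' \<and> Q s' D' (T + t)))"

lemma hoare_Basic:
  "(\<And>s D T. P s D T \<Longrightarrow> Q (f s) D T) \<Longrightarrow> hoare B ok A V P (Basic f) Q"
  unfolding hoare_def by (intro allI impI exI[of _ 0] exI conjI, rule exec_Basic) simp

lemma hoare_Rd:
  assumes "\<And>s D T. P s D T \<Longrightarrow> ok s \<and> a s < A \<and> Q (g (block B D (a s)) s) D (T + 1)"
  shows "hoare B ok A V P (Rd a g) Q"
  unfolding hoare_def
proof (intro allI impI)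
  fix s D T assume "P s D T"
  from assms[OF this] show "\<exists>t s' D'. exec B ok A V (Rd a g) s D t s' D' \<and> Q s' D' (T + t)"
    using exec_Rd[of ok s a A B V g D] by blast
qed

lemma hoare_Wr:
  assumes "\<And>s D T. P s D T \<Longrightarrow> ok s \<and> a s < A \<and> length (w s) = B \<and> (\<forall>x\<in>set (w s). x < V) \<and>
    Q s (put B (a s) (w s) D) (T + 1)"
  shows "hoare B ok A V P (Wr a w) Q"
  unfolding hoare_def
proof (intro allI impI)
  fix s D T assume "P s D T"
  from assms[OF this] show "\<exists>t s' D'. exec B ok A V (Wr a w) s D t s' D' \<and> Q s' D' (T + t)"
    using exec_Wr[of ok s a A w B V D] by blast
qed

lemma hoare_Seq:
  assumes "hoare B ok A V P c R" "hoare B ok A V R d Q"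
  shows "hoare B ok A V P (c ;; d) Q"
  unfolding hoare_def
proof (intro allI impI)
  fix s D T assume "P s D T"
  then obtain t s' D' where 1: "exec B ok A V c s D t s' D'" "R s' D' (T + t)"
    using assms(1) unfolding hoare_def by blast
  then obtain u s'' D'' where "exec B ok A V d s' D' u s'' D''" "Q s'' D'' (T + t + u)"
    using assms(2) unfolding hoare_def by blast
  then show "\<exists>t s' D'. exec B ok A V (c ;; d) s D t s' D' \<and> Q s' D' (T + t)"
    using exec_Seq[OF 1(1)] by (intro exI[of _ "t + u"] exI conjI) (auto simp: add.assoc)
qed

lemma hoare_Cond:
  assumes "hoare B ok A V (\<lambda>s D T. P s D T \<and> b s) c Q" "hoare B ok A V (\<lambda>s D T. P s D T \<and> \<not> b s) d Q"
  shows "hoare B ok A V P (Cond b c d) Q"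
  unfolding hoare_def
proof (intro allI impI)
  fix s D T assume "P s D T"
  then show "\<exists>t s' D'. exec B ok A V (Cond b c d) s D t s' D' \<and> Q s' D' (T + t)"
    using assms unfolding hoare_def by (cases "b s") (blast intro: exec_CondT exec_CondF)+
qed

lemma hoare_conseq:
  assumes "hoare B ok A V P c Q"
    "\<And>s D T. P' s D T \<Longrightarrow> P s D T" "\<And>s D T. Q s D T \<Longrightarrow> Q' s D T"
  shows "hoare B ok A V P' c Q'"
  using assms unfolding hoare_def by blast

lemma hoare_While:
  fixes m :: "'s \<Rightarrow> (nat \<Rightarrow> nat) \<Rightarrow> nat \<Rightarrow> nat"
  assumes body: "\<And>n. hoare B ok A V (\<lambda>s D T. I s D T \<and> b s \<and> m s D T = n) c (\<lambda>s D T. I s D T \<and> m s D T < n)"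
    and pre: "\<And>s D T. P s D T \<Longrightarrow> I s D T"
    and post: "\<And>s D T. I s D T \<Longrightarrow> \<not> b s \<Longrightarrow> Q s D T"
  shows "hoare B ok A V P (While b c) Q"
proof -
  have "\<exists>t s' D'. exec B ok A V (While b c) s D t s' D' \<and> Q s' D' (T + t)" if "I s D T" for s D T
    using that
  proof (induction "m s D T" arbitrary: s D T rule: less_induct)
    case less
    show ?case
    proof (cases "b s")
      case False
      then show ?thesis using post[OF less.prems] exec_WhileF[of b s B ok A V c D]
        by (intro exI[of _ 0] exI conjI) auto
    next
      case True
      then obtain t s' D' where 1: "exec B ok A V c s D t s' D'" "I s' D' (T + t)" "m s' D' (T + t) < m s D T"
        using body[of "m s D T"] less.prems unfolding hoare_def by blast
      from less.hyps[OF this(3,2)] obtain u s'' D'' where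
        2: "exec B ok A V (While b c) s' D' u s'' D''" "Q s'' D'' (T + t + u)" by blast
      from exec_WhileT[where b=b, OF True 1(1) 2(1)] 2(2) show ?thesis
        by (intro exI[of _ "t + u"] exI conjI) (auto simp: add.assoc)
    qed
  qed
  then show ?thesis using pre unfolding hoare_def by blast
qed

lemma hoare_start:
  assumes "\<And>s0 D0 T0. P s0 D0 T0 \<Longrightarrow> hoare B ok A V (\<lambda>s D T. s = s0 \<and> D = D0 \<and> T = T0) c Q"
  shows "hoare B ok A V P c Q"
  using assms unfolding hoare_def by blast

section \<open>Bisimilarity by means of a priority queue\<close>

text \<open>The restriction to smaller children makes the recursion terminate on every graph; for a
  reverse topological numbering \<open>rank_eq\<close> removes it.\<close>

function rk :: "(nat, 'l) lgraph \<Rightarrow> nat \<Rightarrow> nat" where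
  "rk G v = Max (insert 0 ((\<lambda>n. Suc (rk G n)) ` {n \<in> children G v. n < v}))"
  by auto
termination by (relation "measure snd") auto

declare rk.simps [simp del]

locale dag =
  fixes G :: "(nat, nat) lgraph"
  assumes wf: "wf_lgraph G" and rt: "reverse_topological G"
begin

abbreviation "N \<equiv> nodes G"
abbreviation "E \<equiv> edges G"
abbreviation "ch \<equiv> children G"
abbreviation "lb \<equiv> label G"
abbreviation "rank \<equiv> rk G"

section \<open>Ranks in the acyclic graph\<close>

lemma finite_N [simp]: "finite N" and E_sub: "E \<subseteq> N \<times> N"
  using wf by (auto simp: wf_lgraph_def)

lemma finite_E [simp]: "finite E"
  by (rule finite_subset[OF E_sub]) simp

lemma E_D: "(m, n) \<in> E \<Longrightarrow> m \<in> N \<and> n \<in> N \<and> n < m \<and> n \<in> ch m"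
  using E_sub rt by (auto simp: reverse_topological_def children_def)

lemma ch_iff: "n \<in> ch m \<longleftrightarrow> (m, n) \<in> E"
  by (simp add: children_def)

lemma ch_D: "n \<in> ch m \<Longrightarrow> m \<in> N \<and> n \<in> N \<and> n < m"
  using E_D by (simp add: ch_iff)

lemma finite_ch [simp]: "finite (ch m)"
  by (rule finite_subset[OF _ finite_N]) (auto dest: ch_D)

lemma rank_eq: "rank v = Max (insert 0 ((\<lambda>n. Suc (rank n)) ` ch v))"
proof -
  have "{n \<in> ch v. n < v} = ch v" by (auto dest: ch_D)
  then show ?thesis by (subst rk.simps) simp
qed

lemma rank_less: "n \<in> ch m \<Longrightarrow> rank n < rank m"
proof -
  assume "n \<in> ch m"
  then have "Suc (rank n) \<le> Max (insert 0 ((\<lambda>n. Suc (rank n)) ` ch m))" by (intro Max_ge) auto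
  then show "rank n < rank m" using rank_eq[of m] by linarith
qed

lemma rank_attained: "ch v \<noteq> {} \<Longrightarrow> \<exists>n\<in>ch v. rank v = Suc (rank n)"
proof -
  assume "ch v \<noteq> {}"
  then obtain n where n: "n \<in> ch v" by blast
  have "rank v \<in> insert 0 ((\<lambda>n. Suc (rank n)) ` ch v)"
    unfolding rank_eq[of v] by (rule Max_in) auto
  moreover have "rank v \<noteq> 0" using rank_less[OF n] by simp
  ultimately show ?thesis by auto
qed

lemma rank_leaf: "ch v = {} \<Longrightarrow> rank v = 0"
  by (simp add: rank_eq[of v])

lemma rank_le: "rank v \<le> v"
proof (induction v rule: less_induct)
  case (less v)
  show ?case
  proof (cases "ch v = {}")
    case False
    then obtain n where "n \<in> ch v" "rank v = Suc (rank n)" using rank_attained by blast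
    moreover have "n < v" using ch_D calculation(1) by blast
    ultimately show ?thesis using less[of n] by linarith
  qed (simp add: rank_leaf)
qed

section \<open>Bisimilarity classes and their strings\<close>

definition cls :: "nat \<Rightarrow> nat" where
  "cls v = Min {u \<in> N. bisimilar G u v}"

lemma bisimilar_nodes: "bisimilar G u v \<Longrightarrow> u \<in> N \<and> v \<in> N"
  by (auto elim: bisimilar.cases)

lemma cls_props:
  assumes "v \<in> N"
  shows "cls v \<in> N" "bisimilar G (cls v) v"
proof -
  have "cls v \<in> {u \<in> N. bisimilar G u v}"
    unfolding cls_def by (rule Min_in) (use assms bisimilar_refl[OF wf] in auto)
  then show "cls v \<in> N" "bisimilar G (cls v) v" by auto
qed

lemma cls_eq_iff:
  assumes "u \<in> N" "v \<in> N"
  shows "cls u = cls v \<longleftrightarrow> bisimilar G u v"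
proof
  assume "cls u = cls v"
  then have "bisimilar G (cls v) u" using cls_props(2)[OF assms(1)] by simp
  then show "bisimilar G u v"
    using bisimilar_trans[OF bisimilar_sym cls_props(2)[OF assms(2)]] by blast
next
  assume uv: "bisimilar G u v"
  have "bisimilar G w u \<longleftrightarrow> bisimilar G w v" for w
    using bisimilar_trans[OF _ uv, of w] bisimilar_trans[OF _ bisimilar_sym[OF uv], of w] by blast
  then have "{w \<in> N. bisimilar G w u} = {w \<in> N. bisimilar G w v}" by simp
  then show "cls u = cls v" by (simp add: cls_def)
qed

definition Cs :: "nat \<Rightarrow> nat set" where "Cs v = cls ` ch v"
definition str :: "nat \<Rightarrow> nat list" where "str v = lb v # sorted_list_of_set (Cs v)"
abbreviation len :: "nat \<Rightarrow> nat" where "len v \<equiv> length (str v)"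

lemma finite_Cs [simp]: "finite (Cs v)"
  by (simp add: Cs_def)

lemma len_eq: "len v = Suc (card (Cs v))"
  by (simp add: str_def)

text \<open>Equal sets of child classes supply the matching children that the coinductive rule asks
  for, and conversely. Sorting only turns the set into a canonical string.\<close>

lemma bisimilar_iff:
  assumes "u \<in> N" "v \<in> N"
  shows "bisimilar G u v \<longleftrightarrow> str u = str v"
proof -
  have "str u = str v \<longleftrightarrow> lb u = lb v \<and> Cs u = Cs v"
    using sorted_list_of_set_inject[of "Cs u" "Cs v"] by (auto simp: str_def)
  also have "\<dots> \<longleftrightarrow> bisimilar G u v"
  proof
    assume *: "lb u = lb v \<and> Cs u = Cs v"
    show "bisimilar G u v"
    proof (rule bisimilar.intros)
      show "\<forall>m'\<in>ch u. \<exists>n'\<in>ch v. bisimilar G m' n'"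
      proof
        fix m' assume m: "m' \<in> ch u"
        then have "cls m' \<in> Cs v" using * by (auto simp: Cs_def)
        then obtain n' where "n' \<in> ch v" "cls m' = cls n'" by (auto simp: Cs_def)
        then show "\<exists>n'\<in>ch v. bisimilar G m' n'" using m cls_eq_iff ch_D by blast
      qed
      show "\<forall>n'\<in>ch v. \<exists>m'\<in>ch u. bisimilar G m' n'"
      proof
        fix n' assume n: "n' \<in> ch v"
        then have "cls n' \<in> Cs u" using * by (auto simp: Cs_def)
        then obtain m' where "m' \<in> ch u" "cls m' = cls n'" by (auto simp: Cs_def)
        then show "\<exists>m'\<in>ch u. bisimilar G m' n'" using n cls_eq_iff ch_D by blast
      qed
    qed (use assms * in auto)
  next
    assume "bisimilar G u v"
    then show "lb u = lb v \<and> Cs u = Cs v"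
    proof cases
      case 1
      have "cls m' \<in> Cs v" if m: "m' \<in> ch u" for m'
      proof -
        obtain n' where "n' \<in> ch v" "bisimilar G m' n'" using bspec[OF 1(4) m] by blast
        then show ?thesis using cls_eq_iff[of m' n'] bisimilar_nodes[of m' n'] by (auto simp: Cs_def)
      qed
      moreover have "cls n' \<in> Cs u" if n: "n' \<in> ch v" for n'
      proof -
        obtain m' where "m' \<in> ch u" "bisimilar G m' n'" using bspec[OF 1(5) n] by blast
        then show ?thesis using cls_eq_iff[of m' n'] bisimilar_nodes[of m' n']
          by (auto simp: Cs_def intro!: image_eqI[of _ _ m'])
      qed
      ultimately show ?thesis using 1 by (auto simp: Cs_def)
    qed
  qed
  finally show ?thesis by simp
qed

text \<open>Licenses the comparison rank by rank: no class is spread over two ranks.\<close>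

lemma bisimilar_rank: "bisimilar G u v \<Longrightarrow> rank u = rank v"
proof (induction u arbitrary: v rule: less_induct)
  case (less u)
  from less.prems show ?case
  proof cases
    case 1
    have "(\<lambda>n. Suc (rank n)) ` ch u = (\<lambda>n. Suc (rank n)) ` ch v"
    proof (rule set_eqI, rule iffI)
      fix r assume "r \<in> (\<lambda>n. Suc (rank n)) ` ch u"
      then obtain m where "m \<in> ch u" "r = Suc (rank m)" by blast
      moreover then obtain n where "n \<in> ch v" "bisimilar G m n" using 1 by blast
      moreover have "m < u" using ch_D calculation(1) by blast
      ultimately show "r \<in> (\<lambda>n. Suc (rank n)) ` ch v" using less.IH[of m n] by auto
    next
      fix r assume "r \<in> (\<lambda>n. Suc (rank n)) ` ch v"
      then obtain n where "n \<in> ch v" "r = Suc (rank n)" by blast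
      moreover then obtain m where "m \<in> ch u" "bisimilar G m n" using 1 by blast
      moreover have "m < u" using ch_D calculation(3) by blast
      ultimately show "r \<in> (\<lambda>n. Suc (rank n)) ` ch u" using less.IH[of m n] by (intro image_eqI[of _ _ m]) auto
    qed
    then show ?thesis by (simp add: rank_eq[of u] rank_eq[of v])
  qed
qed

section \<open>Prefixes of strings and their names in the trie\<close>

text \<open>The string of a node, shifted by one and continued with the end marker \<open>0\<close>.\<close>

definition sym :: "nat \<Rightarrow> nat \<Rightarrow> nat" where
  "sym v j = (if j < len v then Suc (str v ! j) else 0)"

text \<open>The root is named 0 rather than by a least node, since the item at level 0 is created
  from the item of \<open>v\<close> alone, without knowledge of the other nodes of its rank.\<close>

definition rep :: "nat \<Rightarrow> nat \<Rightarrow> nat" where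
  "rep j v = (if j = 0 then 0 else Min {u \<in> N. rank u = rank v \<and> (\<forall>i<j. sym u i = sym v i)})"

lemma rep_0 [simp]: "rep 0 v = 0"
  by (simp add: rep_def)

lemma rep_props:
  assumes "v \<in> N" "0 < j"
  shows "rep j v \<in> N" "rank (rep j v) = rank v" "\<forall>i<j. sym (rep j v) i = sym v i"
proof -
  have "Min {u \<in> N. rank u = rank v \<and> (\<forall>i<j. sym u i = sym v i)}
      \<in> {u \<in> N. rank u = rank v \<and> (\<forall>i<j. sym u i = sym v i)}"
    by (rule Min_in) (use assms in auto)
  then have "rep j v \<in> {u \<in> N. rank u = rank v \<and> (\<forall>i<j. sym u i = sym v i)}"
    using assms by (simp add: rep_def)
  then show "rep j v \<in> N" "rank (rep j v) = rank v" "\<forall>i<j. sym (rep j v) i = sym v i" by auto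
qed

lemma rep_eq_iff:
  assumes "u \<in> N" "v \<in> N" "rank u = rank v"
  shows "rep j u = rep j v \<longleftrightarrow> (\<forall>i<j. sym u i = sym v i)"
proof (cases "j = 0")
  case False
  show ?thesis
  proof
    assume "rep j u = rep j v"
    then show "\<forall>i<j. sym u i = sym v i"
      using rep_props(3)[OF assms(1), of j] rep_props(3)[OF assms(2), of j] False by simp
  next
    assume *: "\<forall>i<j. sym u i = sym v i"
    have "(\<forall>i<j. sym w i = sym u i) \<longleftrightarrow> (\<forall>i<j. sym w i = sym v i)" for w
      using * by simp
    then show "rep j u = rep j v" using assms(3) by (simp add: rep_def)
  qed
qed (simp add: rep_def)

text \<open>The end marker at position \<open>len v\<close> excludes a longer \<open>u\<close>, and
  the one at \<open>len u\<close> a shorter \<open>u\<close>; so the length of one string suffices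
  as the bound.\<close>

lemma sym_eq: "(\<forall>i<Suc (len v). sym u i = sym v i) \<longleftrightarrow> str u = str v"
proof
  assume *: "\<forall>i<Suc (len v). sym u i = sym v i"
  have "\<not> len v < len u" using *[rule_format, of "len v"] by (simp add: sym_def split: if_splits)
  moreover have "\<not> len u < len v" using *[rule_format, of "len u"] by (auto simp: sym_def split: if_splits)
  ultimately have "len u = len v" by simp
  then show "str u = str v"
  proof (intro nth_equalityI)
    fix i assume "i < len u"
    then show "str u ! i = str v ! i"
      using *[rule_format, of i] \<open>len u = len v\<close> by (simp add: sym_def)
  qed simp
qed (simp add: sym_def)

text \<open>Past the end marker a trie node contains exactly one class, so its least node is the
  class name.\<close>

lemma cls_rep: "v \<in> N \<Longrightarrow> cls v = rep (Suc (len v)) v"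
proof -
  assume v: "v \<in> N"
  have "{u \<in> N. rank u = rank v \<and> (\<forall>i<Suc (len v). sym u i = sym v i)} = {u \<in> N. bisimilar G u v}"
    using v bisimilar_iff bisimilar_rank unfolding sym_eq by blast
  then show ?thesis by (simp add: cls_def rep_def)
qed

text \<open>The position of the class \<open>c\<close> in \<open>str v\<close>. Position 0 holds the
  label, hence the count includes \<open>c\<close>.\<close>

definition idx :: "nat \<Rightarrow> nat \<Rightarrow> nat" where "idx v c = card {d \<in> Cs v. d \<le> c}"

lemma idx_less:
  assumes "c \<in> Cs v"
  shows "0 < idx v c" "idx v c < len v"
proof -
  have "{d \<in> Cs v. d \<le> c} \<noteq> {}" using assms by auto
  then show "0 < idx v c" by (auto simp: idx_def card_gt_0_iff)
  show "idx v c < len v" unfolding idx_def len_eq by (auto intro!: card_mono le_imp_less_Suc)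
qed

lemma str_idx:
  assumes "c \<in> Cs v"
  shows "str v ! idx v c = c"
proof -
  let ?l = "sorted_list_of_set (Cs v)"
  obtain i where i: "i < length ?l" "?l ! i = c"
    using assms by (metis finite_Cs in_set_conv_nth set_sorted_list_of_set)
  have "{d \<in> Cs v. d \<le> c} = (!) ?l ` {..i}"
  proof (intro equalityI subsetI)
    fix d assume d: "d \<in> {d \<in> Cs v. d \<le> c}"
    then have "d \<in> set ?l" by simp
    then obtain j where j: "j < length ?l" "?l ! j = d" unfolding in_set_conv_nth by blast
    have "j \<le> i"
    proof (rule ccontr)
      assume "\<not> j \<le> i"
      then have "?l ! i < ?l ! j" using j strict_sorted_list_of_set[of "Cs v"] sorted_wrt_nth_less[of "(<)" ?l i j] by simp
      then show False using i j d by simp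
    qed
    then show "d \<in> (!) ?l ` {..i}" using j by auto
  next
    fix d assume "d \<in> (!) ?l ` {..i}"
    then obtain j where j: "j \<le> i" "d = ?l ! j" by auto
    have "d \<in> set ?l" unfolding j(2) using i(1) j(1) by (intro nth_mem) simp
    moreover have "d \<le> c" using j i sorted_nth_mono[of ?l j i] by simp
    ultimately show "d \<in> {d \<in> Cs v. d \<le> c}" by simp
  qed
  moreover have "inj_on ((!) ?l) {..i}" using i by (intro inj_on_nth) auto
  ultimately have "idx v c = Suc i" by (simp add: idx_def card_image)
  then show ?thesis using i by (simp add: str_def)
qed

lemma idx_str:
  assumes "0 < j" "j < len v"
  shows "\<exists>c\<in>Cs v. j = idx v c"
proof -
  obtain i where i: "j = Suc i" using assms(1) by (cases j) auto
  let ?l = "sorted_list_of_set (Cs v)"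
  have "?l ! i \<in> set ?l" using assms i by (intro nth_mem) (simp add: str_def)
  then have c: "?l ! i \<in> Cs v" by simp
  have "str v ! idx v (?l ! i) = str v ! j" using str_idx[OF c] i by (simp add: str_def)
  moreover have "idx v (?l ! i) = Suc (idx v (?l ! i) - 1)" using idx_less[OF c] by simp
  ultimately have "?l ! (idx v (?l ! i) - 1) = ?l ! i" using i by (simp add: str_def)
  then have "idx v (?l ! i) - 1 = i"
    using idx_less[OF c] assms i nth_eq_iff_index_eq[of ?l "idx v (?l ! i) - 1" i]
    by (simp add: str_def)
  then show ?thesis using c i idx_less[OF c] by (intro bexI[of _ "?l ! i"]) auto
qed


subsection \<open>The items of the priority queue\<close>

text \<open>
  Items are ordered lexicographically. Their first component is the phase: phase 1 visits the nodes
  in the order of their numbers and computes ranks, phase 2 tells every node the ranks of its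
  parents, and phase 3 visits the ranks, each in three steps. Step 0 sorts the classes of the
  children of each node, which gives its string. Step 1 walks down the trie of the strings of
  the nodes of this rank, one level after the other, where \<open>rep j v\<close> serves as the name of the trie
  node of the prefix of length \<open>j\<close>. Step 2 sends the classes to the parents.
\<close>

definition iG :: "nat \<Rightarrow> nat list" where "iG v = [3, rank v, 0, v, 0, lb v]"
definition iJ :: "nat \<Rightarrow> nat \<Rightarrow> nat list" where "iJ j v = [3, rank v, 1, j, 0, v, 1, rep j v]"
definition iK :: "nat \<Rightarrow> nat \<Rightarrow> nat list" where "iK j v = [3, rank v, 1, j, 1, rep j v, sym v j, v]"

inductive init :: "nat list \<Rightarrow> bool" where
  init_node: "v \<in> N \<Longrightarrow> init [1, v, 1, lb v]"
| init_edge: "(m, n) \<in> E \<Longrightarrow> init [1, n, 2, m]"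

text \<open>Within a group the small discriminators fix the order in which information arrives. For
  a node of phase 1, the ranks sent by its children (0) precede its record (1), and this precedes
  the edges to its parents (2), so the rank is known when it is forwarded. Likewise the symbol of a
  node in step 1 (0) precedes its trie name (1). The side condition of \<open>cI\<close> selects one
  child per class, so every class enters the string once.\<close>

inductive creates :: "nat list \<Rightarrow> nat list \<Rightarrow> bool" where
  cD: "v \<in> N \<Longrightarrow> creates [1, v, 1, lb v] [2, v, 0, rank v]"
| cG: "v \<in> N \<Longrightarrow> creates [1, v, 1, lb v] (iG v)"
| cA: "(m, n) \<in> E \<Longrightarrow> creates [1, n, 2, m] [1, m, 0, rank n, n]"
| cE: "(m, n) \<in> E \<Longrightarrow> creates [1, n, 2, m] [2, m, 1, n, rank n]"
| cF: "(m, n) \<in> E \<Longrightarrow> creates [2, m, 1, n, rank n] [3, rank n, 2, n, 1, m, rank m]"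
| cH: "(m, n) \<in> E \<Longrightarrow> creates [3, rank n, 2, n, 1, m, rank m] [3, rank m, 0, m, 1, cls n, n]"
| cI0: "v \<in> N \<Longrightarrow> creates (iG v) [3, rank v, 1, 0, 0, v, 0, lb v]"
| cJ0: "v \<in> N \<Longrightarrow> creates (iG v) (iJ 0 v)"
| cI: "(v, n) \<in> E \<Longrightarrow> (\<forall>n'\<in>ch v. cls n' = cls n \<longrightarrow> n \<le> n') \<Longrightarrow>
    creates [3, rank v, 0, v, 1, cls n, n] [3, rank v, 1, idx v (cls n), 0, v, 0, cls n]"
| cK: "v \<in> N \<Longrightarrow> j \<le> len v \<Longrightarrow> creates (iJ j v) (iK j v)"
| cJ: "v \<in> N \<Longrightarrow> j < len v \<Longrightarrow> creates (iK j v) (iJ (Suc j) v)"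
| cL: "v \<in> N \<Longrightarrow> creates (iK (len v) v) [3, rank v, 2, v, 0, cls v]"

text \<open>All items that ever occur, described from the graph and not from a run;
  \<open>stage_end\<close> shows that a run extracts exactly these.\<close>

definition X :: "nat list set" where
  "X = {z. init z \<or> (\<exists>x. creates x z)}"

lemmas item_defs = iG_def iJ_def iK_def

text \<open>The condition of time-forward processing: nothing is ever inserted below the item just
  extracted, so extraction enumerates \<open>X\<close> in increasing order.\<close>

lemma creates_less: "creates x z \<Longrightarrow> x < z"
  by (induction rule: creates.induct) (auto simp: item_defs dest: E_D intro: rank_less)

lemma creates_not_init: "creates x z \<Longrightarrow> \<not> init z"
  by (auto elim!: creates.cases init.cases simp: item_defs)

lemma creates_symD:
  assumes "creates y [3, r, 1, j, 0, v, 0, c]"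
  shows "j = 0 \<and> y = iG v \<or> 0 < j \<and> (\<exists>n\<in>ch v. c = cls n \<and> (\<forall>n'\<in>ch v. cls n' = c \<longrightarrow> n \<le> n') \<and>
    y = [3, r, 0, v, 1, c, n])"
  using assms
proof (cases rule: creates.cases)
  case (cI n)
  then show ?thesis using idx_less(1)[of "cls n" v] by (auto simp: Cs_def ch_iff)
qed (auto simp: item_defs)

lemma creates_msgD: "creates y [1, m, 0, r, n] \<Longrightarrow> y = [1, n, 2, m]"
  by (cases rule: creates.cases, assumption) (simp_all add: item_defs)

text \<open>Together with \<open>creates_not_init\<close> this makes the content of the queue a set,
  which lets \<open>stage\<close> describe it by \<open>mset_set\<close>.\<close>

lemma creates_unique: "creates x z \<Longrightarrow> creates y z \<Longrightarrow> x = y"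
proof (induction rule: creates.induct)
  case (cI v n)
  have n: "n \<in> ch v" using cI(1) by (simp add: ch_iff)
  have "0 < idx v (cls n)" using idx_less(1)[of "cls n" v] n by (auto simp: Cs_def)
  then obtain n' where n': "n' \<in> ch v" "cls n = cls n'" "\<forall>n''\<in>ch v. cls n'' = cls n \<longrightarrow> n' \<le> n''"
    "y = [3, rank v, 0, v, 1, cls n, n']"
    using creates_symD[OF cI(3)] by auto
  have "n \<le> n'" "n' \<le> n" using cI(2) n n' by auto
  then show ?case using n'(4) by simp
next
  case (cI0 v)
  from creates_symD[OF cI0(2)] show ?case by auto
next
  case (cD v)
  from cD(2) show ?case by (cases rule: creates.cases) (simp_all add: item_defs)
next
  case (cG v)
  from cG(2) show ?case by (cases rule: creates.cases) (simp_all add: item_defs)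
next
  case (cA m n)
  from creates_msgD[OF cA(2)] show ?case by simp
next
  case (cE m n)
  from cE(2) show ?case by (cases rule: creates.cases) (simp_all add: item_defs)
next
  case (cF m n)
  from cF(2) show ?case by (cases rule: creates.cases) (simp_all add: item_defs)
next
  case (cH m n)
  from cH(2) show ?case by (cases rule: creates.cases) (simp_all add: item_defs)
next
  case (cJ0 v)
  from cJ0(2) show ?case by (cases rule: creates.cases) (simp_all add: item_defs)
next
  case (cK v j)
  from cK(3) show ?case by (cases rule: creates.cases) (simp_all add: item_defs)
next
  case (cJ v j)
  from cJ(3) show ?case by (cases rule: creates.cases) (simp_all add: item_defs)
next
  case (cL v)
  from cL(2) show ?case by (cases rule: creates.cases) (simp_all add: item_defs)
qed

lemma Xi: "init z \<Longrightarrow> z \<in> X" and Xc: "creates x z \<Longrightarrow> z \<in> X"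
  by (auto simp: X_def)

lemma iJ_X: "v \<in> N \<Longrightarrow> j \<le> len v \<Longrightarrow> iJ j v \<in> X"
  using Xc[OF cJ0] Xc[OF cJ] by (cases j) (auto simp: less_eq_Suc_le)

lemma creates_X: "creates x z \<Longrightarrow> x \<in> X"
proof (cases rule: creates.cases, assumption)
  fix v n assume "x = [3, rank v, 0, v, 1, cls n, n]" "(v, n) \<in> E"
  then show "x \<in> X" using Xc[OF cH] by simp
next
  fix v j assume "x = iJ j v" "v \<in> N" "j \<le> len v"
  then show "x \<in> X" using iJ_X by simp
next
  fix v j assume "x = iK j v" "v \<in> N" "j < len v"
  then show "x \<in> X" using Xc[OF cK] by simp
next
  fix v assume "x = iK (len v) v" "v \<in> N"
  then show "x \<in> X" using Xc[OF cK] by simp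
next
  fix v assume "x = iG v" "v \<in> N"
  then show "x \<in> X" "x \<in> X" using Xc[OF cG] by simp_all
next
  fix v assume "x = [1, v, 1, lb v]" "v \<in> N"
  then show "x \<in> X" "x \<in> X" using Xi[OF init_node] by simp_all
next
  fix m n assume "x = [1, n, 2, m]" "(m, n) \<in> E"
  then show "x \<in> X" "x \<in> X" using Xi[OF init_edge] by simp_all
next
  fix m n assume "x = [2, m, 1, n, rank n]" "(m, n) \<in> E"
  then show "x \<in> X" using Xc[OF cE] by simp
next
  fix m n assume "x = [3, rank n, 2, n, 1, m, rank m]" "(m, n) \<in> E"
  then show "x \<in> X" using Xc[OF cF] by simp
qed

lemma X_cases [consumes 1, case_names A B C D E F G H I J K L]:
  assumes "z \<in> X"
  obtains m n where "(m, n) \<in> E" "z = [1, m, 0, rank n, n]"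
  | v where "v \<in> N" "z = [1, v, 1, lb v]"
  | m n where "(m, n) \<in> E" "z = [1, n, 2, m]"
  | v where "v \<in> N" "z = [2, v, 0, rank v]"
  | m n where "(m, n) \<in> E" "z = [2, m, 1, n, rank n]"
  | m n where "(m, n) \<in> E" "z = [3, rank n, 2, n, 1, m, rank m]"
  | v where "v \<in> N" "z = [3, rank v, 0, v, 0, lb v]"
  | m n where "(m, n) \<in> E" "z = [3, rank m, 0, m, 1, cls n, n]"
  | v j where "v \<in> N" "j < len v" "z = [3, rank v, 1, j, 0, v, 0, str v ! j]"
  | v j where "v \<in> N" "j \<le> len v" "z = [3, rank v, 1, j, 0, v, 1, rep j v]"
  | v j where "v \<in> N" "j \<le> len v" "z = [3, rank v, 1, j, 1, rep j v, sym v j, v]"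
  | v where "v \<in> N" "z = [3, rank v, 2, v, 0, cls v]"
proof -
  from assms consider "init z" | x where "creates x z" by (auto simp: X_def)
  then show thesis
  proof cases
    case 1
    then show ?thesis using that(2,3) by cases auto
  next
    case 2
    then show ?thesis
    proof (cases rule: creates.cases)
      case (cI v n)
      have "cls n \<in> Cs v" using cI by (auto simp: Cs_def ch_iff)
      then show ?thesis using cI that(9)[of v "idx v (cls n)"] idx_less str_idx E_D by auto
    next
      case (cI0 v)
      then show ?thesis using that(9)[of v 0] by (simp add: str_def)
    qed (use that E_D in \<open>auto simp: item_defs\<close>)
  qed
qed

lemma X_intros:
  "(m, n) \<in> E \<Longrightarrow> [1, m, 0, rank n, n] \<in> X"
  "v \<in> N \<Longrightarrow> [1, v, 1, lb v] \<in> X"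
  "v \<in> N \<Longrightarrow> [2, v, 0, rank v] \<in> X"
  "v \<in> N \<Longrightarrow> [3, rank v, 0, v, 0, lb v] \<in> X"
  "v \<in> N \<Longrightarrow> j < len v \<Longrightarrow> [3, rank v, 1, j, 0, v, 0, str v ! j] \<in> X"
  "v \<in> N \<Longrightarrow> j \<le> len v \<Longrightarrow> [3, rank v, 1, j, 1, rep j v, sym v j, v] \<in> X"
  "v \<in> N \<Longrightarrow> [3, rank v, 2, v, 0, cls v] \<in> X"
proof -
  show "[3, rank v, 0, v, 0, lb v] \<in> X" if "v \<in> N"
    using Xc[OF cG[OF that]] by (simp add: iG_def)
  show "[3, rank v, 1, j, 1, rep j v, sym v j, v] \<in> X" if "v \<in> N" "j \<le> len v"
    using Xc[OF cK[OF that]] by (simp add: iK_def)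
  show "[3, rank v, 1, j, 0, v, 0, str v ! j] \<in> X" if v: "v \<in> N" and j: "j < len v"
  proof (cases "j = 0")
    case True
    then show ?thesis using Xc[OF cI0[OF v]] by (simp add: str_def)
  next
    case False
    then obtain c where c: "c \<in> Cs v" "j = idx v c" using idx_str[of j v] j by auto
    let ?S = "{n \<in> ch v. cls n = c}"
    have "?S \<noteq> {}" using c by (auto simp: Cs_def)
    then have "Min ?S \<in> ?S" by (intro Min_in) auto
    moreover have "\<forall>n'\<in>ch v. cls n' = c \<longrightarrow> Min ?S \<le> n'" by (auto intro: Min_le)
    ultimately show ?thesis using Xc[OF cI[of v "Min ?S"]] c str_idx[OF c(1)] by (auto simp: ch_iff)
  qed
qed (fact Xc[OF cA] Xi[OF init_node] Xc[OF cD] Xc[OF cL])+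

subsection \<open>The automaton\<close>

text \<open>
  The state consists of the key of the group of items to which the last item belongs and of two
  numbers that depend on the items of this group seen so far.
\<close>

end

definition delta :: "nat list \<times> nat \<times> nat \<Rightarrow> nat list \<Rightarrow> (nat list \<times> nat \<times> nat) \<times> nat list list \<times> nat list" where
  "delta q x = (let K = fst q; a = fst (snd q); b = snd (snd q) in
    if x ! 0 = 1 then
      let v = x ! 1; K' = [1, v]; a' = (if K = K' then a else 0) in
      if x ! 2 = 0 then ((K', Suc (x ! 3), 0), [], [])
      else if x ! 2 = 1 then ((K', a', 0), [[2, v, 0, a'], [3, a', 0, v, 0, x ! 3]], [])
      else ((K', a', 0), [[1, x ! 3, 0, a', v], [2, x ! 3, 1, v, a']], [])
    else if x ! 0 = 2 then
      let K' = [2, x ! 1] in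
      if x ! 2 = 0 then ((K', x ! 3, 0), [], [])
      else ((K', a, 0), [[3, x ! 4, 2, x ! 3, 1, x ! 1, a]], [])
    else
      let r = x ! 1 in
      if x ! 2 = 0 then
        let v = x ! 3; K' = [3, r, 0, v]; c = x ! 5 in
        if x ! 4 = 0 then ((K', 0, 0), [[3, r, 1, 0, 0, v, 0, c], [3, r, 1, 0, 0, v, 1, 0]], [])
        else if b = Suc c then ((K', a, b), [], [])
        else ((K', Suc a, Suc c), [[3, r, 1, Suc a, 0, v, 0, c]], [])
      else if x ! 2 = 1 then
        let j = x ! 3 in
        if x ! 4 = 0 then
          let v = x ! 5; K' = [3, r, 1, j, 0, v]; a' = (if K = K' then a else 0) in
          if x ! 6 = 0 then ((K', Suc (x ! 7), 0), [], [])
          else ((K', a', 0), [[3, r, 1, j, 1, x ! 7, a', v]], [])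
        else
          let p = x ! 5; s = x ! 6; v = x ! 7; K' = [3, r, 1, j, 1, p, s]; a' = (if K = K' then a else v) in
          ((K', a', 0), [if s = 0 then [3, r, 2, v, 0, a'] else [3, r, 1, Suc j, 0, v, 1, a']], [])
      else
        let v = x ! 3; K' = [3, r, 2, v] in
        if x ! 4 = 0 then ((K', x ! 5, 0), [], [v, x ! 5])
        else ((K', a, 0), [[3, x ! 6, 0, x ! 5, 1, a, v]], []))"

context dag
begin

text \<open>The claimed state once \<open>y\<close> has been processed, in terms of the true ranks,
  indices and trie names; \<open>step\<close> proves the claim. In phase 1 the messages of a node
  are sorted by rank, so the last one yields the maximum. In step 0 the last class is stored with
  \<open>Suc\<close>, so that 0 means that no class has been seen.\<close>

definition after :: "nat list \<Rightarrow> nat list \<times> nat \<times> nat" where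
  "after y =
    (if y ! 0 = 1 then ([1, y ! 1], (if y ! 2 = 0 then Suc (y ! 3) else rank (y ! 1)), 0)
     else if y ! 0 = 2 then ([2, y ! 1], rank (y ! 1), 0)
     else if y ! 2 = 0 then
       ([3, y ! 1, 0, y ! 3], (if y ! 4 = 0 then 0 else idx (y ! 3) (y ! 5)), (if y ! 4 = 0 then 0 else Suc (y ! 5)))
     else if y ! 2 = 1 then
       if y ! 4 = 0 then ([3, y ! 1, 1, y ! 3, 0, y ! 5], sym (y ! 5) (y ! 3), 0)
       else ([3, y ! 1, 1, y ! 3, 1, y ! 5, y ! 6], rep (Suc (y ! 3)) (y ! 7), 0)
     else ([3, y ! 1, 2, y ! 3], cls (y ! 3), 0))"

definition before :: "nat list \<Rightarrow> nat list \<times> nat \<times> nat" where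
  "before x = (if {y \<in> X. y < x} = {} then ([], 0, 0) else after (Max {y \<in> X. y < x}))"

definition outw :: "nat list \<Rightarrow> nat list" where
  "outw x = (if x ! 0 = 3 \<and> x ! 2 = 2 \<and> x ! 4 = 0 then [x ! 3, x ! 5] else [])"

text \<open>The reason why walking down the tries stays linear: a string has at most one symbol per
  child besides the label, and each position costs a constant number of items.\<close>

lemma card_strings: "(\<Sum>v\<in>N. Suc (len v)) \<le> 2 * card N + card E"
proof -
  have "card (Cs v) \<le> card (ch v)" for v unfolding Cs_def by (rule card_image_le) simp
  then have "(\<Sum>v\<in>N. Suc (len v)) \<le> (\<Sum>v\<in>N. 2 + card (ch v))"
    unfolding len_eq by (intro sum_mono) simp
  also have "\<dots> = 2 * card N + card (Sigma N ch)" by (subst card_SigmaI) (simp_all only: sum.distrib sum_constant finite_N finite_ch ball_simps, simp_all)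
  also have "Sigma N ch = E" using E_D by (auto simp: ch_iff)
  finally show ?thesis .
qed

text \<open>Five items per node, six per edge and two per string position, end markers included,
  give at most \<open>9 * card N + 8 * card E\<close>. The symbol item of a position
  \<open>j > 0\<close> is charged to an edge, by \<open>idx_str\<close>.\<close>

lemma X_finite_card: "finite X \<and> card X \<le> 10 * (card N + card E)"
proof -
  define fN where "fN = (\<lambda>v. [[1, v, 1, lb v], [2, v, 0, rank v], [3, rank v, 0, v, 0, lb v],
    [3, rank v, 1, 0, 0, v, 0, str v ! 0], [3, rank v, 2, v, 0, cls v]])"
  define fE where "fE = (\<lambda>(m, n). [[1, m, 0, rank n, n], [1, n, 2, m], [2, m, 1, n, rank n],
    [3, rank n, 2, n, 1, m, rank m], [3, rank m, 0, m, 1, cls n, n],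
    [3, rank m, 1, idx m (cls n), 0, m, 0, str m ! (idx m (cls n))]])"
  define fS where "fS = (\<lambda>(v, j). [[3, rank v, 1, j, 0, v, 1, rep j v], [3, rank v, 1, j, 1, rep j v, sym v j, v]])"
  let ?S = "Sigma N (\<lambda>v. {..len v})"
  let ?U = "(\<lambda>(i, v). fN v ! i) ` ({..<5} \<times> N) \<union> (\<lambda>(i, e). fE e ! i) ` ({..<6} \<times> E) \<union>
    (\<lambda>(i, e). fS e ! i) ` ({..<2} \<times> ?S)"
  have fin: "finite ?S" by auto
  have cS: "card ?S \<le> 2 * card N + card E" using card_strings by (subst card_SigmaI) auto
  have c: "card (g ` ({..<k} \<times> A)) \<le> k * card A" if "finite A" for g :: "nat \<times> 'x \<Rightarrow> nat list" and k A
    using card_image_le[of "{..<k} \<times> A" g] that by (simp add: card_cartesian_product)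
  have sub: "X \<subseteq> ?U"
  proof
    fix z assume "z \<in> X"
    then show "z \<in> ?U"
    proof (cases rule: X_cases)
      case (A m n)
      then show ?thesis by (intro UnI1 UnI2 image_eqI[of _ _ "(0, m, n)"]) (auto simp: fE_def)
    next
      case (B v)
      then show ?thesis by (intro UnI1 image_eqI[of _ _ "(0, v)"]) (auto simp: fN_def)
    next
      case (C m n)
      then show ?thesis by (intro UnI1 UnI2 image_eqI[of _ _ "(1, m, n)"]) (auto simp: fE_def)
    next
      case (D v)
      then show ?thesis by (intro UnI1 image_eqI[of _ _ "(1, v)"]) (auto simp: fN_def)
    next
      case (E m n)
      then show ?thesis by (intro UnI1 UnI2 image_eqI[of _ _ "(2, m, n)"]) (auto simp: fE_def)
    next
      case (F m n)
      then show ?thesis by (intro UnI1 UnI2 image_eqI[of _ _ "(3, m, n)"]) (auto simp: fE_def)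
    next
      case (G v)
      then show ?thesis by (intro UnI1 image_eqI[of _ _ "(2, v)"]) (auto simp: fN_def)
    next
      case (H m n)
      then show ?thesis by (intro UnI1 UnI2 image_eqI[of _ _ "(4, m, n)"]) (auto simp: fE_def)
    next
      case (I v j)
      show ?thesis
      proof (cases "j = 0")
        case True
        then show ?thesis using I by (intro UnI1 image_eqI[of _ _ "(3, v)"]) (auto simp: fN_def)
      next
        case False
        then obtain c where "c \<in> Cs v" "j = idx v c" using idx_str[of j v] I by auto
        then obtain n where "n \<in> ch v" "j = idx v (cls n)" by (auto simp: Cs_def)
        then show ?thesis using I by (intro UnI1 UnI2 image_eqI[of _ _ "(5, v, n)"]) (auto simp: fE_def ch_iff)
      qed
    next
      case (J v j)
      then show ?thesis by (intro UnI2 image_eqI[of _ _ "(0, v, j)"]) (auto simp: fS_def)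
    next
      case (K v j)
      then show ?thesis by (intro UnI2 image_eqI[of _ _ "(1, v, j)"]) (auto simp: fS_def)
    next
      case (L v)
      then show ?thesis by (intro UnI1 image_eqI[of _ _ "(4, v)"]) (auto simp: fN_def)
    qed
  qed
  have finU: "finite ?U" using fin by auto
  have X: "finite X" "card X \<le> card ?U" using finite_subset[OF sub finU] card_mono[OF finU sub] by simp_all
  have "card ?U \<le> 5 * card N + 6 * card E + 2 * card ?S"
    by (intro order_trans[OF card_Un_le] add_mono c fin) auto
  with X(2) have "card X \<le> 5 * card N + 6 * card E + 2 * card ?S" by (rule order_trans)
  also have "\<dots> \<le> 5 * card N + 6 * card E + 2 * (2 * card N + card E)" using cS by (intro add_mono mult_le_mono) simp_all
  also have "\<dots> \<le> 10 * (card N + card E)" by simp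
  finally show ?thesis using X(1) by simp
qed

section \<open>The state of the automaton in front of each item\<close>

lemma finite_X [simp]: "finite X" using X_finite_card by simp

text \<open>The predecessor of \<open>x\<close> in \<open>X\<close> lies between a known item
  \<open>w\<close> and \<open>x\<close>, so only this interval has to be inspected.\<close>

lemma before_eq:
  assumes "w \<in> X" "w < x"
    and "\<And>y. y \<in> X \<Longrightarrow> w \<le> y \<Longrightarrow> y < x \<Longrightarrow> (\<And>u. u \<in> X \<Longrightarrow> u < x \<Longrightarrow> u \<le> y) \<Longrightarrow> after y = q"
  shows "before x = q"
proof -
  let ?P = "{y \<in> X. y < x}"
  have ne: "?P \<noteq> {}" and fin: "finite ?P" using assms by auto
  have "Max ?P \<in> ?P" using ne fin by (rule Max_in[rotated])
  then show ?thesis using assms ne fin by (auto simp: before_def)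
qed

lemma before_key:
  assumes "\<And>y. y \<in> X \<Longrightarrow> y < x \<Longrightarrow> fst (after y) \<noteq> k" "k \<noteq> []"
  shows "fst (before x) \<noteq> k"
proof (cases "{y \<in> X. y < x} = {}")
  case False
  then have "Max {y \<in> X. y < x} \<in> {y \<in> X. y < x}" by (intro Max_in) auto
  then show ?thesis using assms False by (auto simp: before_def)
qed (use assms in \<open>auto simp: before_def\<close>)

text \<open>Lists with a common prefix form an interval of the lexicographic order; this keeps the
  predecessor in the group of \<open>x\<close>.\<close>

lemma sandwich: "p @ a \<le> y \<Longrightarrow> y < p @ b \<Longrightarrow> \<exists>c. y = p @ (c :: nat list)"
proof (induction p arbitrary: y)
  case (Cons h p)
  then show ?case by (cases y) auto
qed simp

lemma createsD:
  "\<not> creates [1, v, 0, r, n] z"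
  "creates [1, v, 1, l] z \<Longrightarrow> z = [2, v, 0, rank v] \<or> z = [3, rank v, 0, v, 0, lb v]"
  "creates [1, n, 2, m] z \<Longrightarrow> z = [1, m, 0, rank n, n] \<or> z = [2, m, 1, n, rank n]"
  "\<not> creates [2, m, 0, k] z"
  "creates [2, m, 1, n, k] z \<Longrightarrow> z = [3, k, 2, n, 1, m, rank m]"
  "creates [3, r, 2, n, 1, m, k] z \<Longrightarrow> z = [3, k, 0, m, 1, cls n, n]"
  "creates [3, r, 0, v, 0, l] z \<Longrightarrow> z = [3, r, 1, 0, 0, v, 0, l] \<or> z = [3, r, 1, 0, 0, v, 1, 0]"
  "creates [3, r, 0, v, 1, c, n] z \<Longrightarrow>
     (\<forall>n'\<in>ch v. cls n' = c \<longrightarrow> n \<le> n') \<and> z = [3, r, 1, idx v c, 0, v, 0, c]"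
  "\<not> creates [3, r, 1, j, 0, v, 0, s] z"
  "creates [3, r, 1, j, 0, v, 1, p] z \<Longrightarrow> z = [3, r, 1, j, 1, p, sym v j, v]"
  "creates [3, r, 1, j, 1, p, s, v] z \<Longrightarrow>
     j < len v \<and> z = [3, r, 1, Suc j, 0, v, 1, rep (Suc j) v] \<or> j = len v \<and> z = [3, r, 2, v, 0, cls v]"
  "\<not> creates [3, r, 2, v, 0, c] z"
  by ((intro notI)?, erule creates.cases, simp_all add: item_defs rep_0; fail)+

text \<open>Messages are sorted by rank, so the last one in front of the record of \<open>v\<close>
  comes from a child of maximal rank. For a leaf no earlier item has the key \<open>[1, v]\<close>,
  and the default 0 is its rank.\<close>

lemma before_B:
  assumes "v \<in> N"
  shows "(if fst (before [1, v, 1, lb v]) = [1, v] then fst (snd (before [1, v, 1, lb v])) else 0) = rank v"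
proof (cases "ch v = {}")
  case True
  have "fst (before [1, v, 1, lb v]) \<noteq> [1, v]"
    by (rule before_key) (use True in \<open>auto elim!: X_cases simp: after_def ch_iff split: if_splits\<close>)
  then show ?thesis using rank_leaf[OF True] by simp
next
  case False
  then obtain n where n: "n \<in> ch v" "rank v = Suc (rank n)" using rank_attained by blast
  have "before [1, v, 1, lb v] = ([1, v], rank v, 0)"
  proof (rule before_eq)
    show "[1, v, 0, rank n, n] \<in> X" using n X_intros(1) by (simp add: ch_iff)
    fix y assume y: "y \<in> X" "[1, v, 0, rank n, n] \<le> y" "y < [1, v, 1, lb v]"
    from y(1) show "after y = ([1, v], rank v, 0)"
    proof (cases rule: X_cases)
      case (A m n')
      then have "m = v" "rank n \<le> rank n'" using y(2,3) by auto
      moreover have "rank n' < rank m" using A rank_less by (simp add: ch_iff)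
      ultimately show ?thesis using A n by (simp add: after_def)
    qed (use y(2,3) in auto)
  qed simp
  then show ?thesis by simp
qed

lemma before_C:
  assumes "(m, n) \<in> E"
  shows "before [1, n, 2, m] = ([1, n], rank n, 0)"
proof (rule before_eq)
  show "[1, n, 1, lb n] \<in> X" using E_D[OF assms] X_intros(2) by blast
  fix y assume y: "y \<in> X" "[1, n, 1, lb n] \<le> y" "y < [1, n, 2, m]"
  from y(1) show "after y = ([1, n], rank n, 0)"
    by (cases rule: X_cases) (use y(2,3) in \<open>auto simp: after_def\<close>)
qed simp

lemma before_E:
  assumes "(m, n) \<in> E"
  shows "before [2, m, 1, n, rank n] = ([2, m], rank m, 0)"
proof (rule before_eq)
  show "[2, m, 0, rank m] \<in> X" using E_D[OF assms] X_intros(3) by blast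
  fix y assume y: "y \<in> X" "[2, m, 0, rank m] \<le> y" "y < [2, m, 1, n, rank n]"
  have "\<exists>c. y = [2, m] @ c" by (rule sandwich) (use y(2,3) in simp_all)
  with y(1) show "after y = ([2, m], rank m, 0)"
    by (cases rule: X_cases) (auto simp: after_def)
qed simp

lemma before_F:
  assumes "(m, n) \<in> E"
  shows "before [3, rank n, 2, n, 1, m, rank m] = ([3, rank n, 2, n], cls n, 0)"
proof (rule before_eq)
  show "[3, rank n, 2, n, 0, cls n] \<in> X" using E_D[OF assms] X_intros(7) by blast
  fix y assume y: "y \<in> X" "[3, rank n, 2, n, 0, cls n] \<le> y" "y < [3, rank n, 2, n, 1, m, rank m]"
  have "\<exists>c. y = [3, rank n, 2, n] @ c" by (rule sandwich) (use y(2,3) in simp_all)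
  with y(1) show "after y = ([3, rank n, 2, n], cls n, 0)"
    by (cases rule: X_cases) (auto simp: after_def)
qed simp

text \<open>At \<open>j = len v\<close> there is no symbol item, and the default 0 is precisely the
  end marker.\<close>

lemma before_J:
  assumes "v \<in> N" "j \<le> len v"
  shows "(if fst (before [3, rank v, 1, j, 0, v, 1, rep j v]) = [3, rank v, 1, j, 0, v]
    then fst (snd (before [3, rank v, 1, j, 0, v, 1, rep j v])) else 0) = sym v j"
proof (cases "j < len v")
  case True
  have "before [3, rank v, 1, j, 0, v, 1, rep j v] = ([3, rank v, 1, j, 0, v], sym v j, 0)"
  proof (rule before_eq)
    show "[3, rank v, 1, j, 0, v, 0, str v ! j] \<in> X" using assms True X_intros(5) by blast
    fix y assume y: "y \<in> X" "[3, rank v, 1, j, 0, v, 0, str v ! j] \<le> y" "y < [3, rank v, 1, j, 0, v, 1, rep j v]"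
    have "\<exists>c. y = [3, rank v, 1, j, 0, v] @ c" by (rule sandwich) (use y(2,3) in simp_all)
    with y(1) show "after y = ([3, rank v, 1, j, 0, v], sym v j, 0)"
      by (cases rule: X_cases) (auto simp: after_def)
  qed simp
  then show ?thesis by simp
next
  case False
  have "fst (before [3, rank v, 1, j, 0, v, 1, rep j v]) \<noteq> [3, rank v, 1, j, 0, v]"
    by (rule before_key) (use False in \<open>auto elim!: X_cases simp: after_def split: if_splits\<close>)
  then show ?thesis using False by (simp add: sym_def)
qed

text \<open>Items with the same trie node and the same symbol are consecutive and sorted by node.
  The first one, recognised by the change of key, belongs to the least node with the longer prefix
  and names the new trie node; the later ones inherit the name.\<close>

lemma before_K:
  assumes v: "v \<in> N" "j \<le> len v"
  defines "x \<equiv> [3, rank v, 1, j, 1, rep j v, sym v j, v]"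
  shows "(if fst (before x) = [3, rank v, 1, j, 1, rep j v, sym v j]
    then fst (snd (before x)) else v) = rep (Suc j) v"
proof (cases "\<exists>u\<in>N. u < v \<and> rank u = rank v \<and> (\<forall>i<Suc j. sym u i = sym v i)")
  case True
  then obtain u where u: "u \<in> N" "u < v" "rank u = rank v" "\<forall>i<Suc j. sym u i = sym v i" by blast
  have ju: "j \<le> len u"
  proof (cases j)
    case (Suc i)
    then have "sym u i = sym v i" "i < len v" using u v by auto
    then show ?thesis using Suc by (auto simp: sym_def split: if_splits)
  qed simp
  have rp: "rep j u = rep j v" using u v rep_eq_iff[of u v j] by simp
  have "before x = ([3, rank v, 1, j, 1, rep j v, sym v j], rep (Suc j) v, 0)"
  proof (rule before_eq)
    show "[3, rank v, 1, j, 1, rep j v, sym v j, u] \<in> X"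
      using X_intros(6)[OF u(1) ju] u rp by simp
    fix y assume y: "y \<in> X" "[3, rank v, 1, j, 1, rep j v, sym v j, u] \<le> y" "y < x"
    have "\<exists>c. y = [3, rank v, 1, j, 1, rep j v, sym v j] @ c"
      by (rule sandwich) (use y(2,3) in \<open>simp_all add: x_def\<close>)
    then obtain c where c: "y = [3, rank v, 1, j, 1, rep j v, sym v j] @ c" ..
    from y(1) show "after y = ([3, rank v, 1, j, 1, rep j v, sym v j], rep (Suc j) v, 0)"
    proof (cases rule: X_cases)
      case (K w i)
      then have w: "rank w = rank v" "i = j" "rep j w = rep j v" "sym w j = sym v j"
        using c by auto
      then have "\<forall>i<Suc j. sym w i = sym v i"
        using rep_eq_iff[OF K(1) v(1) w(1), of j] less_Suc_eq by auto
      then have "rep (Suc j) w = rep (Suc j) v" using rep_eq_iff[OF K(1) v(1) w(1)] by blast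
      then show ?thesis using K w by (simp add: after_def)
    qed (use c in auto)
  qed (use u in \<open>simp add: x_def\<close>)
  then show ?thesis by simp
next
  case False
  have "fst (before x) \<noteq> [3, rank v, 1, j, 1, rep j v, sym v j]"
  proof (rule before_key)
    fix y assume y: "y \<in> X" "y < x"
    from y(1) show "fst (after y) \<noteq> [3, rank v, 1, j, 1, rep j v, sym v j]"
    proof (cases rule: X_cases)
      case (K w i)
      show ?thesis
      proof
        assume *: "fst (after y) = [3, rank v, 1, j, 1, rep j v, sym v j]"
        then have w: "rank w = rank v" "i = j" "rep j w = rep j v" "sym w j = sym v j"
          using K by (auto simp: after_def)
        have "w < v" using y(2) K w by (simp add: x_def)
        moreover have "\<forall>i<Suc j. sym w i = sym v i"
          using rep_eq_iff[OF K(1) v(1) w(1), of j] w less_Suc_eq by auto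
        ultimately show False using False K(1) w by blast
      qed
    qed (auto simp: after_def)
  qed simp
  moreover have "rep (Suc j) v = v"
    using v False by (auto simp: rep_def not_less intro!: Min_eqI)
  ultimately show ?thesis by simp
qed

text \<open>\<open>a\<close> counts the distinct classes seen in the group and \<open>b\<close> is
  the successor of the last one. The alternatives are a repeated class and a new one; in the second
  case \<open>n\<close> is the least child in its class, because items of equal class are sorted by
  node.\<close>

lemma before_H:
  assumes e: "(m, n) \<in> E"
  defines "x \<equiv> [3, rank m, 0, m, 1, cls n, n]"
  shows "\<exists>a b. before x = ([3, rank m, 0, m], a, b) \<and>
    (b = Suc (cls n) \<and> a = idx m (cls n) \<and> (\<exists>n'\<in>ch m. cls n' = cls n \<and> n' < n) \<or>
     b \<noteq> Suc (cls n) \<and> Suc a = idx m (cls n) \<and> (\<forall>n'\<in>ch m. cls n' = cls n \<longrightarrow> n \<le> n'))"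
proof -
  let ?w = "[3, rank m, 0, m, 0, lb m]"
  let ?P = "{y \<in> X. y < x}"
  have n: "n \<in> ch m" "m \<in> N" using E_D[OF e] by auto
  have w: "?w \<in> ?P" using n X_intros(4) by (simp add: x_def)
  define y where "y = Max ?P"
  have "y \<in> ?P" unfolding y_def by (rule Max_in) (use w in auto)
  then have y: "y \<in> X" "y < x" by auto
  have ge: "u \<le> y" if "u \<in> X" "u < x" for u unfolding y_def using that by (intro Max_ge) auto
  have bf: "before x = after y" using w unfolding before_def y_def by auto
  have wy: "?w \<le> y" using ge w by simp
  have "\<exists>c. y = [3, rank m, 0, m] @ c"
    by (rule sandwich) (use wy y(2) in \<open>simp_all add: x_def\<close>)
  then obtain c where c: "y = [3, rank m, 0, m] @ c" ..
  have msg: "[3, rank m, 0, m, 1, cls n', n'] \<in> X" if "n' \<in> ch m" for n'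
    using Xc[OF cH] that by (simp add: ch_iff)
  have low: "cls n' < cls n \<or> cls n' = cls n \<and> n' < n \<Longrightarrow> [3, rank m, 0, m, 1, cls n', n'] < x" for n'
    by (auto simp: x_def)
  from y(1) show ?thesis
  proof (cases rule: X_cases)
    case (G v)
    then have v: "v = m" using c by auto
    have none: "\<not> (cls n' < cls n \<or> cls n' = cls n \<and> n' < n)" if "n' \<in> ch m" for n'
      using ge[OF msg[OF that] low] G v by auto
    have "{d \<in> Cs m. d \<le> cls n} = {cls n}" using none n by (fastforce simp: Cs_def)
    then have "idx m (cls n) = 1" by (simp add: idx_def)
    then show ?thesis using G v bf none by (auto simp: after_def not_less)
  next
    case (H m' n')
    have m'1: "m' = m" using c H by auto
    then have m': "m' = m" "cls n' < cls n \<or> cls n' = cls n \<and> n' < n" using y(2) H by (auto simp: x_def)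
    then have n': "n' \<in> ch m" using H by (simp add: ch_iff)
    show ?thesis
    proof (cases "cls n' = cls n")
      case True
      then show ?thesis using H m' n' bf by (auto simp: after_def)
    next
      case False
      then have less: "cls n' < cls n" using m' by simp
      have none: "cls n'' \<le> cls n'" if "n'' \<in> ch m" "cls n'' < cls n \<or> cls n'' = cls n \<and> n'' < n" for n''
        using ge[OF msg[OF that(1)] low[OF that(2)]] H m' by auto
      have "{d \<in> Cs m. d \<le> cls n} = insert (cls n) {d \<in> Cs m. d \<le> cls n'}"
        using none n less by (fastforce simp: Cs_def)
      then have "idx m (cls n) = Suc (idx m (cls n'))" using less by (simp add: idx_def)
      moreover have "n \<le> n''" if "n'' \<in> ch m" "cls n'' = cls n" for n''
        using none[OF that(1)] that(2) less by fastforce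
      ultimately show ?thesis using H m' bf False by (auto simp: after_def)
    qed
  qed (use c in auto)
qed

text \<open>Local correctness: in the state left by the predecessor of \<open>x\<close>, one
  transition yields exactly the items that \<open>x\<close> creates. No run is mentioned, which
  decouples the automaton from the queue.\<close>

lemma step:
  assumes "x \<in> X"
  shows "\<exists>new. delta (before x) x = (after x, new, outw x) \<and> distinct new \<and> set new = {z. creates x z}"
  using assms
proof (cases rule: X_cases)
  case (A m n)
  then show ?thesis using createsD(1) by (simp add: delta_def after_def outw_def Let_def)
next
  case (B v)
  have "{z. creates x z} = {[2, v, 0, rank v], [3, rank v, 0, v, 0, lb v]}"
    using createsD(2)[of v "lb v"] cD[OF B(1)] cG[OF B(1), unfolded iG_def] unfolding B(2) by blast
  moreover obtain q a b where q: "before x = (q, a, b)" by (cases "before x")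
  ultimately show ?thesis using before_B[OF B(1), folded B(2), unfolded q fst_conv snd_conv] q B(2)
    by (simp add: delta_def after_def outw_def Let_def split del: if_split cong: if_cong)
next
  case (C m n)
  have "{z. creates x z} = {[1, m, 0, rank n, n], [2, m, 1, n, rank n]}"
    using createsD(3)[of n m] cA[OF C(1)] cE[OF C(1)] unfolding C(2) by blast
  then show ?thesis using before_C[OF C(1)] C by (simp add: delta_def after_def outw_def Let_def)
next
  case (D v)
  then show ?thesis using createsD(4) by (simp add: delta_def after_def outw_def Let_def)
next
  case (E m n)
  have "{z. creates x z} = {[3, rank n, 2, n, 1, m, rank m]}"
    using createsD(5)[of m n "rank n"] cF[OF E(1)] unfolding E(2) by blast
  then show ?thesis using before_E[OF E(1)] E by (simp add: delta_def after_def outw_def Let_def)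
next
  case (F m n)
  have "{z. creates x z} = {[3, rank m, 0, m, 1, cls n, n]}"
    using createsD(6)[of "rank n" n m "rank m"] cH[OF F(1)] unfolding F(2) by blast
  then show ?thesis using before_F[OF F(1)] F by (simp add: delta_def after_def outw_def Let_def)
next
  case (G v)
  have "{z. creates x z} = {[3, rank v, 1, 0, 0, v, 0, lb v], [3, rank v, 1, 0, 0, v, 1, 0]}"
    using createsD(7)[of "rank v" v "lb v"] cI0[OF G(1), unfolded iG_def]
      cJ0[OF G(1), unfolded iG_def iJ_def rep_0] unfolding G(2) by blast
  then show ?thesis using G by (simp add: delta_def after_def outw_def Let_def)
next
  case (H m n)
  obtain a b where ab: "before x = ([3, rank m, 0, m], a, b)"
    "b = Suc (cls n) \<and> a = idx m (cls n) \<and> (\<exists>n'\<in>ch m. cls n' = cls n \<and> n' < n) \<or>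
     b \<noteq> Suc (cls n) \<and> Suc a = idx m (cls n) \<and> (\<forall>n'\<in>ch m. cls n' = cls n \<longrightarrow> n \<le> n')"
    using before_H[OF H(1)] H(2) by auto
  show ?thesis
  proof (cases "b = Suc (cls n)")
    case True
    then have ex: "a = idx m (cls n)" "\<exists>n'\<in>ch m. cls n' = cls n \<and> n' < n" using ab(2) by auto
    then have "{z. creates x z} = {}" using createsD(8)[of "rank m" m "cls n" n] unfolding H(2) by (auto dest: leD)
    then show ?thesis using H True ab(1) ex(1) by (simp add: delta_def after_def outw_def Let_def)
  next
    case False
    then have ex: "Suc a = idx m (cls n)" "\<forall>n'\<in>ch m. cls n' = cls n \<longrightarrow> n \<le> n'" using ab(2) by auto
    have "{z. creates x z} = {[3, rank m, 1, idx m (cls n), 0, m, 0, cls n]}"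
      using createsD(8)[of "rank m" m "cls n" n] cI[OF H(1) ex(2)] unfolding H(2) by blast
    then show ?thesis using H False ab(1) ex(1) by (simp add: delta_def after_def outw_def Let_def)
  qed
next
  case (I v j)
  then show ?thesis using createsD(9) by (simp add: delta_def after_def outw_def Let_def sym_def)
next
  case (J v j)
  have "{z. creates x z} = {[3, rank v, 1, j, 1, rep j v, sym v j, v]}"
    using createsD(10)[of "rank v" j v "rep j v"] cK[OF J(1,2), unfolded iJ_def iK_def] unfolding J(3) by blast
  moreover obtain q a b where q: "before x = (q, a, b)" by (cases "before x")
  ultimately show ?thesis using before_J[OF J(1,2), folded J(3), unfolded q fst_conv snd_conv] q J(3)
    by (simp add: delta_def after_def outw_def Let_def split del: if_split cong: if_cong)
next
  case (K v j)
  have "{z. creates x z} = {if sym v j = 0 then [3, rank v, 2, v, 0, rep (Suc j) v] else [3, rank v, 1, Suc j, 0, v, 1, rep (Suc j) v]}"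
  proof (cases "j < len v")
    case True
    then have *: "sym v j \<noteq> 0" "j \<noteq> len v" by (simp_all add: sym_def)
    show ?thesis
      using createsD(11)[of "rank v" j "rep j v" "sym v j" v] cJ[OF K(1) True, unfolded iJ_def iK_def] *(2)
      unfolding K(3) if_not_P[OF *(1)] by blast
  next
    case False
    then have "j = len v" using K by simp
    then have *: "sym v j = 0" "cls v = rep (Suc j) v" "\<not> j < len v"
      using cls_rep[OF K(1)] by (simp_all add: sym_def)
    show ?thesis
      using createsD(11)[of "rank v" j "rep j v" "sym v j" v]
        cL[OF K(1), unfolded iK_def \<open>j = len v\<close>[symmetric]] *(3)
      unfolding K(3) if_P[OF *(1)] *(2)[symmetric] by blast
  qed
  moreover obtain q a b where q: "before x = (q, a, b)" by (cases "before x")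
  ultimately show ?thesis using before_K[OF K(1,2), folded K(3), unfolded q fst_conv snd_conv] q K(3)
    by (cases "sym v j = 0") (simp_all add: delta_def after_def outw_def Let_def split del: if_split)
next
  case (L v)
  then show ?thesis using createsD(12) by (simp add: delta_def after_def outw_def Let_def)
qed

section \<open>Runs of the queue as initial segments of \<open>X\<close>\<close>

definition content :: "nat list set \<Rightarrow> nat list set" where
  "content P = {z \<in> X. z \<notin> P \<and> (init z \<or> (\<exists>x\<in>P. creates x z))}"

text \<open>The situation when exactly the items in \<open>P\<close> have been extracted.\<close>

definition stage ::
  "nat list set \<Rightarrow> nat list \<times> nat \<times> nat \<Rightarrow> nat list multiset \<Rightarrow> nat list \<Rightarrow> bool" where
  "stage P q C out \<longleftrightarrow> P \<subseteq> X \<and> (\<forall>x\<in>P. \<forall>y\<in>X. y < x \<longrightarrow> y \<in> P) \<and> C = mset_set (content P) \<and>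
     q = (if P = {} then ([], 0, 0) else after (Max P)) \<and>
     out = concat (map outw (sorted_list_of_set P))"

lemma finite_content [simp]: "finite (content P)"
  by (simp add: content_def)

lemma stage_start: "stage {} ([], 0, 0) (mset_set {z. init z}) []"
  by (auto simp: stage_def content_def X_def intro!: arg_cong[of _ _ mset_set])

text \<open>The least item of \<open>X\<close> outside \<open>P\<close> is already waiting: unless
  it is initial, its creator is smaller and hence in \<open>P\<close>. So the minimum of the queue
  is always the next item of \<open>X\<close>.\<close>

lemma Min_content:
  assumes P: "P \<subseteq> X" "\<forall>x\<in>P. \<forall>y\<in>X. y < x \<longrightarrow> y \<in> P" and ne: "P \<noteq> X"
  shows "content P \<noteq> {}" "Min (content P) \<in> X" "Min (content P) \<notin> P" "P = {y \<in> X. y < Min (content P)}"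
proof -
  let ?z = "Min (X - P)"
  have nz: "X - P \<noteq> {}" using P ne by auto
  then have z: "?z \<in> X - P" by (intro Min_in) auto
  have low: "y \<in> P" if "y \<in> X" "y < ?z" for y
  proof (rule ccontr)
    assume "y \<notin> P"
    then have "?z \<le> y" using that by (intro Min_le) auto
    then show False using that by simp
  qed
  have zc: "?z \<in> content P"
  proof (cases "init ?z")
    case False
    then obtain x where "creates x ?z" using z by (auto simp: X_def)
    then show ?thesis using low[OF creates_X creates_less] z by (auto simp: content_def)
  qed (use z in \<open>simp add: content_def\<close>)
  then show "content P \<noteq> {}" by auto
  have "Min (content P) = ?z"
  proof (rule Min_eqI)
    fix y assume "y \<in> content P"
    then show "?z \<le> y" by (intro Min_le) (auto simp: content_def)
  qed (use zc in auto)
  then show "Min (content P) \<in> X" "Min (content P) \<notin> P" "P = {y \<in> X. y < Min (content P)}"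
    using z low P by (auto simp: not_less[symmetric]) (metis DiffD1 DiffD2 linorder_cases)
qed

lemma stage_end: "stage P q {#} out \<Longrightarrow> P = X"
  using Min_content(1)[of P] by (auto simp: stage_def mset_set_empty_iff)

lemma stage_step:
  assumes st: "stage P q C out" and C: "C \<noteq> {#}"
  defines "x \<equiv> Min (set_mset C)"
  assumes d: "delta q x = (q', new, w)"
  shows "x \<in> X - P" "stage (insert x P) q' (C - {#x#} + mset new) (out @ w)" "x \<in># C"
proof -
  have P: "P \<subseteq> X" "\<forall>x\<in>P. \<forall>y\<in>X. y < x \<longrightarrow> y \<in> P" and Cc: "C = mset_set (content P)"
    and q: "q = (if P = {} then ([], 0, 0) else after (Max P))"
    and out: "out = concat (map outw (sorted_list_of_set P))"
    using st by (auto simp: stage_def)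
  have fP: "finite P" using finite_subset[OF P(1) finite_X] .
  have "P \<noteq> X" using C Cc by (auto simp: content_def mset_set_empty_iff)
  note mc = Min_content[OF P this]
  have x: "x = Min (content P)" by (simp add: x_def Cc)
  show xX: "x \<in> X - P" using mc x by simp
  have Pe: "P = {y \<in> X. y < x}" using mc(4) x by simp
  have xc: "x \<in> content P" using mc(1) x by simp
  then show "x \<in># C" by (simp add: Cc)
  have "q = before x" using q unfolding before_def Pe[symmetric] .
  then have d': "q' = after x" "w = outw x" "distinct new" "set new = {z. creates x z}"
    using step[of x] d xX by auto
  have "z \<in> content (insert x P) \<longleftrightarrow> z \<in> (content P - {x}) \<union> set new" for z
    using xX creates_less[of x z] Xc[of x z] Pe unfolding d'(4) content_def by (auto dest: less_asym)
  then have "content (insert x P) = (content P - {x}) \<union> set new" by blast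
  \<comment> \<open>A waiting item is initial or was created by an element of \<open>P\<close>;
    either way \<open>x\<close> does not create it again.\<close>
  moreover have "(content P - {x}) \<inter> set new = {}"
  proof (rule ccontr)
    assume "(content P - {x}) \<inter> set new \<noteq> {}"
    then obtain z where z: "z \<in> content P" "creates x z" using d'(4) by blast
    then obtain y where "y \<in> P" "creates y z" using creates_not_init by (auto simp: content_def)
    then show False using creates_unique[OF z(2)] xX by blast
  qed
  ultimately have "mset_set (content (insert x P)) = mset_set (content P - {x}) + mset_set (set new)"
    by (simp add: mset_set_Union)
  also have "\<dots> = C - {#x#} + mset new"
    using xc d'(3) by (simp add: Cc mset_set_Diff mset_set_set)
  finally have 1: "C - {#x#} + mset new = mset_set (content (insert x P))" by simp
  have 2: "Max (insert x P) = x" using fP Pe by (intro Max_eqI) (auto intro: less_imp_le)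
  have "sorted_list_of_set (insert x P) = sorted_list_of_set P @ [x]"
  proof (rule sorted_list_of_set_unique[THEN iffD1])
    show "sorted_wrt (<) (sorted_list_of_set P @ [x]) \<and> set (sorted_list_of_set P @ [x]) = insert x P \<and>
        length (sorted_list_of_set P @ [x]) = card (insert x P)"
      using fP Pe by (auto simp: sorted_wrt_append)
  qed (use fP in simp)
  then show "stage (insert x P) q' (C - {#x#} + mset new) (out @ w)"
    using P xX Pe 1 2 d' out unfolding stage_def by (auto dest: less_trans)
qed

lemma stage_card:
  assumes "stage P q C out"
  shows "size C + card P \<le> card X" "set_mset C \<subseteq> X"
proof -
  have P: "P \<subseteq> X" and C: "C = mset_set (content P)" using assms by (auto simp: stage_def)
  have "card (content P) + card P = card (content P \<union> P)"
    using P finite_subset[OF P] by (intro card_Un_disjoint[symmetric]) (auto simp: content_def)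
  also have "\<dots> \<le> card X" using P by (intro card_mono) (auto simp: content_def)
  finally show "size C + card P \<le> card X" using C by simp
  show "set_mset C \<subseteq> X" using C by (auto simp: content_def)
qed

section \<open>Initial content, sizes of numbers, and the final output\<close>

lemma mset_init:
  assumes "distinct es" "set es = E"
  shows "mset (map (\<lambda>v. [1, v, 1, lb v]) (sorted_list_of_set N) @ map (\<lambda>(m, n). [1, n, 2, m]) es) =
    mset_set {z. init z}" (is "mset (?a @ ?b) = _")
proof -
  have "distinct (?a @ ?b)" using assms by (auto simp: distinct_map inj_on_def)
  moreover have "init z \<longleftrightarrow> (\<exists>v\<in>N. z = [1, v, 1, lb v]) \<or> (\<exists>(m, n)\<in>E. z = [1, n, 2, m])" for z
    by (subst init.simps) blast
  then have "set (?a @ ?b) = {z. init z}" using assms by auto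
  ultimately show ?thesis using mset_set_set[of "?a @ ?b"] by simp
qed

text \<open>The base of \<open>word_limit\<close>. All entries of items and states are at most
  \<open>top + 3\<close>.\<close>

definition top :: nat where
  "top = 2 + card N + card E + Max (insert 0 (N \<union> lb ` N))"

lemma top_bounds:
  assumes "v \<in> N"
  shows "v + 2 \<le> top" "lb v + 2 \<le> top" "rank v + 2 \<le> top" "cls v + 2 \<le> top" "len v + 1 \<le> top"
proof -
  have fin: "finite (insert 0 (N \<union> lb ` N))" by simp
  have N: "u \<le> Max (insert 0 (N \<union> lb ` N))" if "u \<in> N" for u using that by (intro Max_ge[OF fin]) simp
  show "v + 2 \<le> top" "cls v + 2 \<le> top" using N[OF assms] N[OF cls_props(1)[OF assms]] by (auto simp: top_def)
  have "lb v \<le> Max (insert 0 (N \<union> lb ` N))" using assms by (intro Max_ge[OF fin]) simp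
  then show "lb v + 2 \<le> top" by (simp add: top_def)
  show "rank v + 2 \<le> top" using rank_le[of v] N[OF assms] by (auto simp: top_def)
  have "Cs v \<subseteq> N" using cls_props(1) ch_D by (auto simp: Cs_def)
  then have "card (Cs v) \<le> card N" by (intro card_mono) auto
  then show "len v + 1 \<le> top" by (simp add: len_eq top_def)
qed

lemma str_bound: "v \<in> N \<Longrightarrow> j < len v \<Longrightarrow> str v ! j + 2 \<le> top"
proof -
  assume v: "v \<in> N" "j < len v"
  then have "str v ! j \<in> set (str v)" by simp
  then have "str v ! j = lb v \<or> (\<exists>n\<in>ch v. str v ! j = cls n)" by (auto simp: str_def Cs_def)
  then show ?thesis using top_bounds(2)[OF v(1)] top_bounds(4) ch_D by auto
qed

lemma rep_bound: "v \<in> N \<Longrightarrow> rep j v + 2 \<le> top"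
  using rep_props(1)[of v j] top_bounds(1) by (cases "j = 0") (auto simp: top_def)

lemma sym_bound: "v \<in> N \<Longrightarrow> sym v j + 1 \<le> top"
  using str_bound[of v j] top_bounds(1)[of v] by (auto simp: sym_def)

lemma X_bound:
  assumes "z \<in> X"
  shows "length z \<le> 8 \<and> (\<forall>e\<in>set z. e \<le> top + 3) \<and> z \<noteq> []"
  using assms
proof (cases rule: X_cases)
  case (A m n) then show ?thesis using top_bounds[of m] top_bounds[of n] E_D[of m n] by auto
next
  case (B v) then show ?thesis using top_bounds[of v] by auto
next
  case (C m n) then show ?thesis using top_bounds[of m] top_bounds[of n] E_D[of m n] by auto
next
  case (D v) then show ?thesis using top_bounds[of v] by auto
next
  case (E m n) then show ?thesis using top_bounds[of m] top_bounds[of n] E_D[of m n] by auto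
next
  case (F m n) then show ?thesis using top_bounds[of m] top_bounds[of n] E_D[of m n] by auto
next
  case (G v) then show ?thesis using top_bounds[of v] by auto
next
  case (H m n) then show ?thesis using top_bounds[of m] top_bounds[of n] E_D[of m n] by auto
next
  case (I v j) then show ?thesis using top_bounds[of v] str_bound[of v j] by auto
next
  case (J v j) then show ?thesis using top_bounds[of v] rep_bound[of v j] by auto
next
  case (K v j) then show ?thesis using top_bounds[of v] rep_bound[of v j] sym_bound[of v j] by auto
next
  case (L v) then show ?thesis using top_bounds[of v] by auto
qed

lemma after_bound:
  assumes "z \<in> X"
  shows "length (fst (after z)) \<le> 7 \<and> (\<forall>e\<in>set (fst (after z)). e \<le> top + 3) \<and>
    fst (snd (after z)) \<le> top + 3 \<and> snd (snd (after z)) \<le> top + 3"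
  using assms
proof (cases rule: X_cases)
  case (A m n) then show ?thesis using top_bounds[of m] top_bounds[of n] E_D[of m n] by (auto simp: after_def)
next
  case (B v) then show ?thesis using top_bounds[of v] by (auto simp: after_def)
next
  case (C m n) then show ?thesis using top_bounds[of m] top_bounds[of n] E_D[of m n] by (auto simp: after_def)
next
  case (D v) then show ?thesis using top_bounds[of v] by (auto simp: after_def)
next
  case (E m n) then show ?thesis using top_bounds[of m] top_bounds[of n] E_D[of m n] by (auto simp: after_def)
next
  case (F m n) then show ?thesis using top_bounds[of m] top_bounds[of n] E_D[of m n] by (auto simp: after_def)
next
  case (G v) then show ?thesis using top_bounds[of v] by (auto simp: after_def)
next
  case (H m n)
  have "idx m (cls n) < len m" using H by (intro idx_less) (auto simp: Cs_def ch_iff)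
  with H show ?thesis using top_bounds[of m] top_bounds[of n] E_D[of m n] by (auto simp: after_def)
next
  case (I v j) then show ?thesis using top_bounds[of v] sym_bound[of v j] by (auto simp: after_def)
next
  case (J v j) then show ?thesis using top_bounds[of v] sym_bound[of v j] by (auto simp: after_def)
next
  case (K v j)
  then show ?thesis using top_bounds[of v] rep_bound[of v j] rep_bound[of v "Suc j"] sym_bound[of v j]
    by (auto simp: after_def)
next
  case (L v) then show ?thesis using top_bounds[of v] by (auto simp: after_def)
qed

lemma stage_state_bound:
  assumes "stage P q C out"
  shows "length (fst q) \<le> 7 \<and> (\<forall>e\<in>set (fst q). e \<le> top + 3) \<and> fst (snd q) \<le> top + 3 \<and> snd (snd q) \<le> top + 3"
proof (cases "P = {}")
  case False
  have P: "P \<subseteq> X" using assms by (simp add: stage_def)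
  have "Max P \<in> P" using finite_subset[OF P finite_X] False by (intro Max_in)
  then show ?thesis using after_bound[of "Max P"] P False assms by (auto simp: stage_def)
qed (use assms in \<open>auto simp: stage_def\<close>)

subsection \<open>The output\<close>

lemma stage_out_bound:
  assumes "x \<in> X"
  shows "length (outw x) \<le> 2" "\<forall>e\<in>set (outw x). e \<le> top + 3"
  using X_bound[OF assms] assms by (auto simp: outw_def elim!: X_cases)

theorem stage_final:
  assumes "stage X q C out"
  shows "\<exists>rs. out = pair_file rs \<and> length rs = card N \<and> represents_partition rs (bisim_partition G)"
proof -
  define isL where "isL = (\<lambda>z :: nat list. z ! 0 = 3 \<and> z ! 2 = 2 \<and> z ! 4 = 0)"
  define xs where "xs = sorted_list_of_set X"
  define rs where "rs = map (\<lambda>z. (z ! 3, z ! 5)) (filter isL xs)"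
  have "concat (map outw ys) = pair_file (map (\<lambda>z. (z ! 3, z ! 5)) (filter isL ys))" for ys
    by (induction ys) (auto simp: pair_file_def outw_def isL_def)
  then have 1: "out = pair_file rs" using assms by (simp add: stage_def rs_def xs_def)
  have "isL z \<longleftrightarrow> (\<exists>v\<in>N. z = [3, rank v, 2, v, 0, cls v])" if "z \<in> X" for z
    using that by (cases rule: X_cases) (auto simp: isL_def)
  then have L: "{z \<in> X. isL z} = (\<lambda>v. [3, rank v, 2, v, 0, cls v]) ` N"
    using X_intros(7) by blast
  have dis: "distinct (filter isL xs)" "set (filter isL xs) = {z \<in> X. isL z}" by (auto simp: xs_def)
  have inj: "inj_on (\<lambda>z. z ! 3) {z \<in> X. isL z}" unfolding L by (auto simp: inj_on_def)
  have 2: "distinct (map fst rs)" using dis inj by (simp add: rs_def distinct_map comp_def del: set_filter)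
  have srs: "set rs = (\<lambda>v. (v, cls v)) ` N"
    unfolding rs_def set_map dis(2) L image_image by simp
  have len: "length rs = card N"
  proof -
    have "length rs = card (set (map fst rs))" using distinct_card[OF 2] by simp
    then show ?thesis using srs by (simp add: image_image)
  qed
  have cl: "{n. (n, cls v) \<in> set rs} = {(m, n). bisimilar G m n} `` {v}" if "v \<in> N" for v
  proof -
    have "(n, cls v) \<in> set rs \<longleftrightarrow> bisimilar G v n" for n
      unfolding srs using that cls_eq_iff[of v n] bisimilar_nodes[of v n] by auto
    then show ?thesis by auto
  qed
  have "(\<lambda>c. {n. (n, c) \<in> set rs}) ` snd ` set rs = (\<lambda>v. {n. (n, cls v) \<in> set rs}) ` N"
    by (subst (2) srs) (simp add: image_image)
  also have "\<dots> = (\<lambda>v. {(m, n). bisimilar G m n} `` {v}) ` N" by (rule image_cong) (simp_all add: cl)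
  also have "\<dots> = bisim_partition G" by (auto simp: bisim_partition_def quotient_def)
  finally show ?thesis using 1 2 len by (auto simp: represents_partition_def)
qed

end

section \<open>The external priority queue\<close>

lemma sorted_take_le:
  assumes "sorted (map k G)" "n \<le> length (filter (\<lambda>x. k x \<le> z) G)" "x \<in> set (take n G)"
  shows "k x \<le> (z :: 'b :: linorder)"
proof (rule ccontr)
  assume nle: "\<not> k x \<le> z"
  obtain i where i: "i < n" "i < length G" "x = G ! i"
    using assms(3) by (auto simp: in_set_conv_nth)
  have "\<not> k y \<le> z" if y: "y \<in> set (drop i G)" for y
  proof -
    obtain m where "m < length (drop i G)" "drop i G ! m = y"
      using y unfolding in_set_conv_nth by blast
    then have "m < length G - i" "y = G ! (i + m)" by auto
    then have "k x \<le> k y" using sorted_nth_mono[OF assms(1), of i "i + m"] i by simp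
    then show ?thesis using nle by simp
  qed
  then have "filter (\<lambda>x. k x \<le> z) (drop i G) = []" by (simp add: filter_empty_conv)
  then have "length (filter (\<lambda>x. k x \<le> z) G) = length (filter (\<lambda>x. k x \<le> z) (take i G))"
    by (metis append_Nil2 append_take_drop_id filter_append)
  also have "\<dots> \<le> i" by (rule order_trans[OF length_filter_le]) simp
  finally show False using assms(2) i(1) by simp
qed

text \<open>The rejected part \<open>Z\<close> is hidden by the existential quantifier: it is never
  stored, and \<open>F\<close> alone decides whether later elements can matter.\<close>

definition smallest :: "nat \<Rightarrow> ('a \<Rightarrow> 'b :: linorder) \<Rightarrow> 'a list \<Rightarrow> 'a multiset \<Rightarrow> bool" where
  "smallest U k F Y \<longleftrightarrow> sorted (map k F) \<and> length F \<le> U \<and>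
     (\<exists>Z. Y = mset F + Z \<and> (\<forall>x\<in>set F. \<forall>z\<in>#Z. k x \<le> k z) \<and> (Z = {#} \<or> length F = U))"

lemma smallest_add:
  assumes "smallest U k F Y"
  shows "smallest U k (take U (sort_key k (F @ xs))) (Y + mset xs)"
proof -
  let ?G = "sort_key k (F @ xs)"
  obtain Z where F: "length F \<le> U" and Z: "Y = mset F + Z"
    "\<forall>x\<in>set F. \<forall>z\<in>#Z. k x \<le> k z" "Z = {#} \<or> length F = U"
    using assms by (auto simp: smallest_def)
  have so: "sorted (map k ?G)" by simp
  have m: "mset ?G = mset F + mset xs" by simp
  have tz: "k x \<le> k z" if "x \<in> set (take U ?G)" "z \<in># Z" for x z
  proof -
    have U: "length F = U" using Z(3) that(2) by auto
    have "filter (\<lambda>x. k x \<le> k z) F = F" using Z(2) that(2) by (simp add: filter_id_conv)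
    then have "U = size (filter_mset (\<lambda>x. k x \<le> k z) (mset F))"
      using U by (simp flip: mset_filter)
    also have "\<dots> \<le> size (filter_mset (\<lambda>x. k x \<le> k z) (mset ?G))"
      unfolding m by simp
    also have "\<dots> = length (filter (\<lambda>x. k x \<le> k z) ?G)" by (metis mset_filter size_mset)
    finally show ?thesis using sorted_take_le[OF so _ that(1)] by simp
  qed
  have td: "k x \<le> k z" if "x \<in> set (take U ?G)" "z \<in> set (drop U ?G)" for x z
  proof -
    have "sorted (map k (take U ?G) @ map k (drop U ?G))"
      using so unfolding map_append[symmetric] append_take_drop_id .
    then show ?thesis using that unfolding sorted_append by auto
  qed
  have "Y + mset xs = mset ?G + Z" using Z(1) m by simp
  also have "mset ?G = mset (take U ?G) + mset (drop U ?G)"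
    by (metis append_take_drop_id mset_append)
  finally have "Y + mset xs = mset (take U ?G) + (mset (drop U ?G) + Z)" by simp
  moreover have "sorted (map k (take U ?G))" using so by (metis sorted_wrt_take take_map)
  moreover have "mset (drop U ?G) + Z = {#} \<or> length (take U ?G) = U"
    using Z(3) F by (cases "U \<le> length ?G") auto
  ultimately show ?thesis using tz td unfolding smallest_def by (intro conjI exI) auto
qed

text \<open>Justifies leaving blocks unread: once the buffer is full, elements no less than all of
  it may join \<open>Y\<close> without being looked at.\<close>

lemma smallest_skip:
  assumes "smallest U k F Y" "length F = U" "\<And>w x. w \<in># W \<Longrightarrow> x \<in> set F \<Longrightarrow> k x \<le> k w"
  shows "smallest U k F (Y + W)"
proof -
  obtain Z where "Y = mset F + Z" "\<forall>x\<in>set F. \<forall>z\<in>#Z. k x \<le> k z"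
    using assms(1) by (auto simp: smallest_def)
  then have "Y + W = mset F + (Z + W)" "\<forall>x\<in>set F. \<forall>z\<in>#Z + W. k x \<le> k z" using assms(3) by auto
  then show ?thesis using assms(1,2) unfolding smallest_def by blast
qed

text \<open>The source of the IO bound: as long as the buffer is not full or its largest key is
  above \<open>m\<close>, fewer than \<open>U\<close> of the elements seen are at most
  \<open>m\<close>.\<close>

lemma smallest_count:
  assumes "smallest U k F Y" "length F < U \<or> F \<noteq> [] \<and> m < k (last F)"
  shows "size (filter_mset (\<lambda>x. k x \<le> m) Y) < U \<or> U = 0"
proof -
  obtain Z where so: "sorted (map k F)" "length F \<le> U" and Z: "Y = mset F + Z"
    "\<forall>x\<in>set F. \<forall>z\<in>#Z. k x \<le> k z" "Z = {#} \<or> length F = U"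
    using assms(1) by (auto simp: smallest_def)
  show ?thesis
  proof (cases "length F < U")
    case True
    then have "Y = mset F" using Z by auto
    then have "size (filter_mset (\<lambda>x. k x \<le> m) Y) \<le> length F"
      using size_filter_mset_lesseq[of "\<lambda>x. k x \<le> m" "mset F"] by simp
    then show ?thesis using True by simp
  next
    case False
    then have F: "F \<noteq> []" "m < k (last F)" using assms(2) by auto
    then have "\<forall>z\<in>#Z. \<not> k z \<le> m" using Z(2) last_in_set[OF F(1)] by fastforce
    then have "filter_mset (\<lambda>x. k x \<le> m) Z = {#}" by (auto simp: filter_mset_eq_conv)
    then have "filter_mset (\<lambda>x. k x \<le> m) Y = mset (filter (\<lambda>x. k x \<le> m) F)" using Z(1) by simp
    also have "filter (\<lambda>x. k x \<le> m) F = filter (\<lambda>x. k x \<le> m) (butlast F)"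
      by (subst append_butlast_last_id[OF F(1), symmetric], subst filter_append) (use F(2) in simp)
    finally have "size (filter_mset (\<lambda>x. k x \<le> m) Y) \<le> length (butlast F)"
      by (metis length_filter_le size_mset)
    moreover have "length (butlast F) < length F" using F(1) by simp
    ultimately show ?thesis using so(2) by linarith
  qed
qed

lemma mset_partition:
  assumes "finite I" "\<forall>x\<in>#M. g x \<in> I"
  shows "M = (\<Sum>p\<in>I. filter_mset (\<lambda>x. g x = p) M)"
  using assms(2)
proof (induction M)
  case (add x M)
  have "(\<Sum>p\<in>I. filter_mset (\<lambda>y. g y = p) (add_mset x M)) =
      (\<Sum>p\<in>I. (if g x = p then {#x#} else {#}) + filter_mset (\<lambda>y. g y = p) M)"
    by (intro sum.cong) auto
  also have "\<dots> = {#x#} + M" using add assms(1) by (simp add: sum.distrib)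
  finally show ?case by simp
qed simp

text \<open>For each run, the selected items followed by the sorted rest form a sorted list with the
  multiset of the run, hence the run itself. So the selection takes a prefix of each run, and
  removing it means advancing the head by \<open>n p\<close>.\<close>

lemma smallest_split:
  fixes xs :: "'p \<Rightarrow> 'b :: linorder list"
  assumes I: "finite I" and so: "\<forall>p\<in>I. sorted (xs p)"
    and sm: "smallest U fst F (\<Sum>p\<in>I. mset (map (\<lambda>x. (x, p)) (xs p)))"
  defines "n \<equiv> \<lambda>p. length (filter (\<lambda>x. snd x = p) F)"
  shows "(\<Sum>p\<in>I. mset (xs p)) = mset (map fst F) + (\<Sum>p\<in>I. mset (drop (n p) (xs p)))"
    "\<And>p. p \<in> I \<Longrightarrow> n p \<le> length (xs p)"
    "\<And>p x y. p \<in> I \<Longrightarrow> x \<in> set F \<Longrightarrow> y \<in> set (drop (n p) (xs p)) \<Longrightarrow> fst x \<le> y"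
    "length F = U \<or> (\<forall>p\<in>I. drop (n p) (xs p) = [])"
    "\<forall>x\<in>set F. \<exists>p\<in>I. fst x \<in> set (xs p) \<and> snd x = p"
proof -
  let ?Y = "\<Sum>p\<in>I. mset (map (\<lambda>x. (x, p)) (xs p))"
  obtain Z where sF: "sorted (map fst F)" and Z: "?Y = mset F + Z"
    "\<forall>x\<in>set F. \<forall>z\<in>#Z. fst x \<le> fst z" "Z = {#} \<or> length F = U"
    using sm unfolding smallest_def by blast
  have Yp: "filter_mset (\<lambda>x. snd x = p) ?Y = mset (map (\<lambda>x. (x, p)) (xs p))" if "p \<in> I" for p
  proof -
    have "filter_mset (\<lambda>x. snd x = p) ?Y =
        (\<Sum>q\<in>I. filter_mset (\<lambda>x. snd x = p) (mset (map (\<lambda>x. (x, q)) (xs q))))"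
      using I by (induction I rule: finite_induct) auto
    also have "\<dots> = (\<Sum>q\<in>I. if p = q then mset (map (\<lambda>x. (x, q)) (xs q)) else {#})"
      by (intro sum.cong refl) (auto simp: filter_mset_eq_conv)
    finally show ?thesis using I that by simp
  qed
  have inY: "x \<in># ?Y \<Longrightarrow> snd x \<in> I \<and> fst x \<in> set (xs (snd x))" for x
    using I by (auto simp: in_Union_mset_iff set_mset_sum)
  have tags: "\<forall>x\<in>#Z. snd x \<in> I" using inY Z(1) by auto
  show "\<forall>x\<in>set F. \<exists>p\<in>I. fst x \<in> set (xs p) \<and> snd x = p" using inY Z(1) by auto
  have main: "xs p = map fst (filter (\<lambda>x. snd x = p) F) @
      sorted_list_of_multiset (image_mset fst (filter_mset (\<lambda>x. snd x = p) Z))" if p: "p \<in> I" for p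
  proof -
    let ?a = "map fst (filter (\<lambda>x. snd x = p) F)"
    let ?b = "sorted_list_of_multiset (image_mset fst (filter_mset (\<lambda>x. snd x = p) Z))"
    have "mset (xs p) = image_mset fst (filter_mset (\<lambda>x. snd x = p) ?Y)"
      unfolding Yp[OF p] by (simp add: multiset.map_comp comp_def)
    also have "\<dots> = mset (?a @ ?b)" unfolding Z(1) by simp
    finally have "mset (xs p) = mset (?a @ ?b)" .
    moreover have "sorted (?a @ ?b)"
    proof -
      have "sorted ?a" using sF by (rule sorted_filter)
      moreover have "\<forall>x\<in>set ?a. \<forall>y\<in>set ?b. x \<le> y" using Z(2) by fastforce
      ultimately show ?thesis by (simp add: sorted_append)
    qed
    ultimately show ?thesis using bspec[OF so p] by (metis properties_for_sort)
  qed
  have dr: "drop (n p) (xs p) = sorted_list_of_multiset (image_mset fst (filter_mset (\<lambda>x. snd x = p) Z))"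
    if "p \<in> I" for p using main[OF that] unfolding n_def by (metis append_eq_conv_conj length_map)
  show "n p \<le> length (xs p)" if "p \<in> I" for p
    using arg_cong[OF main[OF that], of length] unfolding n_def by simp
  show "fst x \<le> y" if "p \<in> I" "x \<in> set F" "y \<in> set (drop (n p) (xs p))" for p x y
    using that dr[OF that(1)] Z(2) by auto
  show "length F = U \<or> (\<forall>p\<in>I. drop (n p) (xs p) = [])"
    using Z(3) dr by auto
  have "(\<Sum>p\<in>I. mset (xs p)) = image_mset fst ?Y"
    using I by (induction I rule: finite_induct) (auto simp: multiset.map_comp comp_def)
  also have "\<dots> = mset (map fst F) + image_mset fst Z" unfolding Z(1) by simp
  also have "image_mset fst Z = image_mset fst (\<Sum>p\<in>I. filter_mset (\<lambda>x. snd x = p) Z)"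
    using mset_partition[OF I tags] by simp
  also have "\<dots> = (\<Sum>p\<in>I. image_mset fst (filter_mset (\<lambda>x. snd x = p) Z))"
    using I by (induction I rule: finite_induct) auto
  also have "\<dots> = (\<Sum>p\<in>I. mset (drop (n p) (xs p)))"
    by (intro sum.cong refl) (simp add: dr)
  finally show "(\<Sum>p\<in>I. mset (xs p)) = mset (map fst F) + (\<Sum>p\<in>I. mset (drop (n p) (xs p)))" .
qed

text \<open>\<open>heap\<close>: sorted items in memory; \<open>safe\<close>, \<open>onD\<close>,
  \<open>nfl\<close>: numbers of safe items, items on disk, flushes. \<open>sta\<close>: the
  automaton. \<open>ib\<close>, \<open>ibuf\<close>, \<open>prv\<close>, \<open>ip\<close> and
  \<open>obuf\<close>, \<open>ob\<close>: input and output. \<open>ci\<close>: the level being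
  merged. \<open>wb\<close>, \<open>wi\<close>, \<open>wj\<close>, \<open>wp\<close>,
  \<open>tot\<close>: the run being written (pending items, level, slot, next data block, length).
  \<open>mg\<close>: whether the merge goes on. \<open>lo\<close>, \<open>hi\<close>: the levels
  selected from. \<open>fr\<close>: selected items, tagged by their runs. \<open>rt\<close>: for
  each run of level \<open>lv\<close>, its head, length, end of the loaded part, and last loaded
  item.\<close>

record st =
  heap :: "nat list list"
  safe :: nat
  onD :: nat
  nfl :: nat
  sta :: "nat list \<times> nat \<times> nat"
  ib :: nat
  ibuf :: "nat list"
  prv :: nat
  ip :: nat
  obuf :: "nat list"
  ob :: nat
  ci :: nat
  wb :: "nat list list"
  wi :: nat
  wj :: nat
  wp :: nat
  tot :: nat
  mg :: nat
  lo :: nat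
  hi :: nat
  fr :: "(nat list \<times> nat \<times> nat) list"
  lv :: nat
  rt :: "(nat \<times> nat \<times> nat \<times> nat list) list"
  xx :: nat
  tmp :: nat

text \<open>The fields that the selection of small items does not change.\<close>

definition frame :: "st \<Rightarrow> _" where
  "frame s = ((heap s, safe s, onD s, nfl s, sta s, ib s, ibuf s, prv s, ip s, obuf s, ob s),
     (ci s, wb s, wi s, wj s, wp s, tot s, mg s, lo s, hi s))"

text \<open>The queue owns the blocks from \<open>rbase\<close> on. The bounds in \<open>big\<close>
  are guarded because runs are written only when \<open>3 * U\<close> items are in memory, and then
  \<open>3 * U <= Q\<close> in the application.\<close>

locale em =
  fixes B f L rbase A Q V0 :: nat and X :: "nat list set"
  assumes B: "1 \<le> B" and f: "2 \<le> f"
    and X: "\<And>x. x \<in> X \<Longrightarrow> list_encode x < V0 \<and> x \<noteq> []"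
    and V0: "64 \<le> V0"
    and rbase: "rbase \<le> A"
    and big: "3 * (f * B) \<le> Q \<Longrightarrow> rbase + 4 * f ^ (L + 1) \<le> A \<and> f ^ (L + 2) * B < V0"
begin

definition U :: nat where "U = f * B"

lemma U: "2 \<le> U" "0 < U" "B \<le> U" "f \<le> U"
  using B f mult_le_mono[of 2 f 1 B] mult_le_mono[of 1 f B B] mult_le_mono[of f f 1 B] by (auto simp: U_def)

text \<open>A slot of level \<open>i\<close> has \<open>2 * f ^ (i + 1)\<close> blocks, enough for a
  header and \<open>f ^ (i + 1)\<close> data blocks. Level \<open>i\<close> occupies the offsets
  from \<open>2 * f ^ (i + 2)\<close> to \<open>4 * f ^ (i + 2)\<close>, so \<open>2 <= f\<close>
  keeps the levels disjoint.\<close>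

definition rad :: "nat \<Rightarrow> nat \<Rightarrow> nat \<Rightarrow> nat" where
  "rad i j b = rbase + 2 * f ^ (i + 1) * (f + j) + b"

text \<open>The store invariant is split so that \<open>okm\<close> depends only on fields in
  \<open>frame\<close>; procedures that preserve \<open>frame\<close> only have to re-establish
  \<open>okf\<close>.\<close>

definition okm :: "st \<Rightarrow> bool" where
  "okm s \<longleftrightarrow> length (heap s) \<le> 10 * U \<and> set (heap s) \<subseteq> X \<and> safe s < V0 \<and> onD s < V0 \<and> nfl s < V0 \<and>
     length (fst (sta s)) \<le> 7 \<and> (\<forall>x\<in>set (fst (sta s)). x < V0) \<and> fst (snd (sta s)) < V0 \<and> snd (snd (sta s)) < V0 \<and>
     ib s < V0 \<and> length (ibuf s) \<le> B \<and> (\<forall>x\<in>set (ibuf s). x < V0) \<and> prv s < V0 \<and> ip s < V0 \<and>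
     length (obuf s) \<le> B + 2 \<and> (\<forall>x\<in>set (obuf s). x < V0) \<and> ob s < V0 \<and>
     ci s < V0 \<and> length (wb s) \<le> 10 * U \<and> set (wb s) \<subseteq> X \<and> wi s < V0 \<and> wj s < V0 \<and> wp s < V0 \<and> tot s < V0 \<and>
     mg s < V0 \<and> lo s < V0 \<and> hi s < V0"

definition okf :: "st \<Rightarrow> bool" where
  "okf s \<longleftrightarrow> length (fr s) \<le> U \<and> (\<forall>x\<in>set (fr s). fst x \<in> X \<and> fst (snd x) < V0 \<and> snd (snd x) < V0) \<and>
     lv s < V0 \<and> xx s < V0 \<and> tmp s < V0 ^ 4 \<and> length (rt s) \<le> f \<and>
     (\<forall>x\<in>set (rt s). fst x < V0 \<and> fst (snd x) < V0 \<and> fst (snd (snd x)) < V0 \<and> list_encode (snd (snd (snd x))) < V0)"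

definition ok :: "st \<Rightarrow> bool" where
  "ok s \<longleftrightarrow> okm s \<and> okf s"

text \<open>\<open>fields\<close> nests \<open>prod_encode\<close> twice, which costs the exponent
  16; the rest is slack for \<open>Suc\<close>.\<close>

definition V :: nat where "V = V0 ^ 20"

lemma okm_frame: "frame s = frame s' \<Longrightarrow> okm s \<longleftrightarrow> okm s'"
  by (simp add: frame_def okm_def)

abbreviation "hoareM \<equiv> hoare B ok A V"

text \<open>
  Run \<open>j\<close> of level \<open>i\<close> lists the items \<open>ys\<close>, the first \<open>h\<close> of which have been removed already. Block
  \<open>rad i j 0\<close> holds \<open>h\<close> and the length, and the items are stored from block \<open>rad i j 1\<close> on, one per word.
\<close>

definition run_at :: "(nat \<Rightarrow> nat) \<Rightarrow> nat \<times> nat \<Rightarrow> nat \<times> nat list list \<Rightarrow> bool" where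
  "run_at D p r \<longleftrightarrow> (case p of (i, j) \<Rightarrow> case r of (h, ys) \<Rightarrow>
     D (rad i j 0 * B) = prod_encode (h, length ys) \<and> h \<le> length ys \<and> sorted ys \<and>
     length ys \<le> f ^ i * U \<and> set ys \<subseteq> X \<and>
     (\<forall>p. h \<le> p \<longrightarrow> p < length ys \<longrightarrow> D (rad i j 1 * B + p) = list_encode (ys ! p)))"

definition disk_ok :: "(nat \<Rightarrow> nat) \<Rightarrow> (nat \<times> nat \<Rightarrow> nat \<times> nat list list) \<Rightarrow> bool" where
  "disk_ok D R \<longleftrightarrow> (\<forall>p\<in>{..<L} \<times> {..<f}. run_at D p (R p))"

definition rem :: "(nat \<times> nat \<Rightarrow> nat \<times> nat list list) \<Rightarrow> nat \<times> nat \<Rightarrow> nat list list" where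
  "rem R p = drop (fst (R p)) (snd (R p))"

subsection \<open>Selecting the smallest items of some levels\<close>

definition read_metas :: "st com" where
  "read_metas = Basic (\<lambda>s. s\<lparr>rt := []\<rparr>) ;; While (\<lambda>s. length (rt s) < f)
     (Rd (\<lambda>s. rad (lv s) (length (rt s)) 0)
        (\<lambda>b s. s\<lparr>rt := rt s @ [(fst (prod_decode (hd b)), snd (prod_decode (hd b)), fst (prod_decode (hd b)), [])]\<rparr>))"

definition cand :: "st \<Rightarrow> nat set" where
  "cand s = {j. j < f \<and> fst (snd (snd (rt s ! j))) < fst (snd (rt s ! j))}"

definition lamr :: "st \<Rightarrow> nat \<Rightarrow> nat list" where
  "lamr s j = snd (snd (snd (rt s ! j)))"

text \<open>Read on in the run whose last loaded item is least, because its unread part may start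
  lowest. An untouched run has \<open>[]\<close> there, which is below every item, so it is
  preferred.\<close>

definition best :: "st \<Rightarrow> nat" where
  "best s = (SOME b. b \<in> cand s \<and> (\<forall>j\<in>cand s. lamr s b \<le> lamr s j))"

text \<open>Reading stops when the buffer is full and its largest item is at most the last loaded
  item of every unfinished run. The strict comparison is what \<open>smallest_count\<close> needs
  for the cost.\<close>

definition loadable :: "st \<Rightarrow> bool" where
  "loadable s \<longleftrightarrow> cand s \<noteq> {} \<and> (length (fr s) < U \<or> lamr s (best s) < fst (last (fr s)))"

definition load :: "nat list \<Rightarrow> st \<Rightarrow> st" where
  "load b s = (let j = best s; (h, t, q, l) = rt s ! j; q' = min t ((q div B + 1) * B);
     its = map list_decode (take (q' - q) (drop (q mod B) b)) in
     s\<lparr>rt := (rt s)[j := (h, t, q', last its)],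
       fr := take U (sort_key fst (fr s @ map (\<lambda>x. (x, lv s, j)) its))\<rparr>)"

definition load_level :: "st com" where
  "load_level = read_metas ;; While loadable
     (Rd (\<lambda>s. rad (lv s) (best s) 1 + fst (snd (snd (rt s ! best s))) div B) load)"

definition taken :: "st \<Rightarrow> nat \<times> nat \<Rightarrow> nat" where
  "taken s p = length (filter (\<lambda>x. snd x = p) (fr s))"

text \<open>
  The first loop collects the \<open>U\<close> least items of the levels from \<open>lo s\<close> to \<open>hi s - 1\<close> in \<open>fr s\<close>, each
  tagged with its run; the second one removes them from their runs by updating \<open>h\<close>.
\<close>

definition select :: "st com" where
  "select = Basic (\<lambda>s. s\<lparr>fr := [], lv := lo s\<rparr>) ;;
     While (\<lambda>s. lv s < hi s) (load_level ;; Basic (\<lambda>s. s\<lparr>lv := lv s + 1\<rparr>)) ;;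
     Basic (\<lambda>s. s\<lparr>xx := lo s * f\<rparr>) ;;
     While (\<lambda>s. xx s < hi s * f)
       (Rd (\<lambda>s. rad (xx s div f) (xx s mod f) 0) (\<lambda>b s. s\<lparr>tmp := hd b\<rparr>) ;;
        Wr (\<lambda>s. rad (xx s div f) (xx s mod f) 0)
          (\<lambda>s. prod_encode (fst (prod_decode (tmp s)) + taken s (xx s div f, xx s mod f), snd (prod_decode (tmp s)))
             # replicate (B - 1) 0) ;;
        Basic (\<lambda>s. s\<lparr>xx := xx s + 1\<rparr>))"

section \<open>Bounds on addresses and words\<close>

lemma block_hd: "hd (block B D a) = D (a * B)"
  using B by (simp add: block_def upt_rec)

lemma block_nth: "i < B \<Longrightarrow> block B D a ! i = D (a * B + i)"
  by (simp add: block_def)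

lemma length_block [simp]: "length (block B D a) = B"
  by (simp add: block_def)

lemma rad_less:
  assumes "3 * U \<le> Q" "i < L" "j < f" "b \<le> f ^ (i + 1)"
  shows "rad i j b < A"
proof -
  have 1: "1 \<le> f ^ (i + 1)" using f by simp
  have "2 * f ^ (i + 1) * (f + j) \<le> 2 * f ^ (i + 1) * (2 * f - 1)" using assms(3) by (intro mult_left_mono) auto
  also have "\<dots> = 4 * (f * f ^ (i + 1)) - 2 * f ^ (i + 1)" using f by (simp add: algebra_simps)
  finally have "2 * f ^ (i + 1) * (f + j) + b < 4 * (f * f ^ (i + 1))"
    using assms(4) 1 f mult_le_mono[of 1 f "f ^ (i + 1)" "f ^ (i + 1)"] by linarith
  also have "f * f ^ (i + 1) = f ^ (i + 2)" by simp
  also have "f ^ (i + 2) \<le> f ^ (L + 1)" using assms(2) f by (intro power_increasing) auto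
  finally show ?thesis using big assms(1) by (simp add: rad_def U_def)
qed

lemma pos_bound:
  assumes "3 * U \<le> Q" "i \<le> L"
  shows "f ^ i * U < V0"
proof -
  have "f ^ i * U = f ^ (i + 1) * B" by (simp add: U_def)
  also have "\<dots> \<le> f ^ (L + 2) * B" using assms(2) f by (intro mult_right_mono power_increasing) auto
  finally show ?thesis using big[folded U_def, OF assms(1)] by linarith
qed

lemma level_bound:
  assumes "3 * U \<le> Q"
  shows "L * f < V0" "L < V0" "f < V0" "U < V0"
proof -
  have "L < 2 ^ L" by (rule less_exp)
  also have "2 ^ L \<le> f ^ L" using f by (intro power_mono) auto
  finally have "L < f ^ L" .
  then have "L * f \<le> f ^ L * f" by simp
  also have "\<dots> \<le> f ^ L * U" using U by simp
  finally show 1: "L * f < V0" using pos_bound[OF assms, of L] by simp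
  show "U < V0" using pos_bound[OF assms, of 0] by simp
  then show "f < V0" using U by simp
  show "L < V0" using 1 f mult_le_mono2[of 1 f L] by linarith
qed

lemma V_ge: "V0 \<le> V" "V0 ^ 4 \<le> V" "V0 ^ 16 \<le> V"
  using V0 power_increasing[of 1 20 V0] by (auto simp: V_def intro!: power_increasing)

lemma best:
  assumes "cand s \<noteq> {}"
  shows "best s \<in> cand s" "j \<in> cand s \<Longrightarrow> lamr s (best s) \<le> lamr s j"
proof -
  have fin: "finite (lamr s ` cand s)" by (simp add: cand_def)
  have "Min (lamr s ` cand s) \<in> lamr s ` cand s" using assms fin by (intro Min_in) auto
  then obtain b where "b \<in> cand s" "lamr s b = Min (lamr s ` cand s)" by (metis imageE)
  then have "\<exists>b. b \<in> cand s \<and> (\<forall>j\<in>cand s. lamr s b \<le> lamr s j)" using fin by auto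
  from someI_ex[OF this] show "best s \<in> cand s" "j \<in> cand s \<Longrightarrow> lamr s (best s) \<le> lamr s j"
    unfolding best_def by auto
qed

lemma run_bounds:
  assumes "3 * U \<le> Q" "run_at D (i, j) (h, ys)" "i < L"
  shows "h \<le> length ys" "length ys < V0" "\<And>x. x \<in> set ys \<Longrightarrow> x \<in> X" "sorted ys" "length ys \<le> f ^ (i + 1) * B"
  using assms pos_bound[of i] by (auto simp: run_at_def U_def mult_ac)

lemma run_atD:
  assumes "run_at D (i, j) (h, ys)"
  shows "D (rad i j 0 * B) = prod_encode (h, length ys)"
    "h \<le> p \<Longrightarrow> p < length ys \<Longrightarrow> D (rad i j 1 * B + p) = list_encode (ys ! p)"
  using assms by (auto simp: run_at_def)

lemma disk_okD: "disk_ok D R \<Longrightarrow> i < L \<Longrightarrow> j < f \<Longrightarrow> run_at D (i, j) (fst (R (i, j)), snd (R (i, j)))"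
  by (auto simp: disk_ok_def)

lemma read_metas:
  assumes Q: "3 * U \<le> Q" and dk: "disk_ok D0 R" and ok0: "okm s0" "okf s0" "lv s0 < L"
  shows "hoareM (\<lambda>s D T. s = s0 \<and> D = D0 \<and> T = T0) read_metas
    (\<lambda>s D T. frame s = frame s0 \<and> fr s = fr s0 \<and> lv s = lv s0 \<and> xx s = xx s0 \<and> tmp s = tmp s0 \<and> D = D0 \<and>
      T = T0 + f \<and> length (rt s) = f \<and>
      (\<forall>j<f. rt s ! j = (fst (R (lv s0, j)), length (snd (R (lv s0, j))), fst (R (lv s0, j)), [])))"
    (is "hoareM _ _ ?post")
proof -
  define inv where "inv = (\<lambda>s D T. frame s = frame s0 \<and> fr s = fr s0 \<and> lv s = lv s0 \<and> xx s = xx s0 \<and>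
      tmp s = tmp s0 \<and> D = D0 \<and> T = T0 + length (rt s) \<and> length (rt s) \<le> f \<and>
      (\<forall>j<length (rt s). rt s ! j = (fst (R (lv s0, j)), length (snd (R (lv s0, j))), fst (R (lv s0, j)), [])))"
  show ?thesis
    unfolding read_metas_def
  proof (rule hoare_Seq[where R = inv])
    show "hoareM (\<lambda>s D T. s = s0 \<and> D = D0 \<and> T = T0) (Basic (\<lambda>s. s\<lparr>rt := []\<rparr>)) inv"
      by (rule hoare_Basic) (auto simp: inv_def frame_def)
    show "hoareM inv (While (\<lambda>s. length (rt s) < f) (Rd (\<lambda>s. rad (lv s) (length (rt s)) 0)
        (\<lambda>b s. s\<lparr>rt := rt s @ [(fst (prod_decode (hd b)), snd (prod_decode (hd b)), fst (prod_decode (hd b)), [])]\<rparr>)))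
        ?post"
    proof (rule hoare_While[where I = inv and m = "\<lambda>s D T. f - length (rt s)"])
      show "hoareM (\<lambda>s D T. inv s D T \<and> length (rt s) < f \<and> f - length (rt s) = n)
        (Rd (\<lambda>s. rad (lv s) (length (rt s)) 0)
        (\<lambda>b s. s\<lparr>rt := rt s @ [(fst (prod_decode (hd b)), snd (prod_decode (hd b)), fst (prod_decode (hd b)), [])]\<rparr>))
        (\<lambda>s D T. inv s D T \<and> f - length (rt s) < n)" for n
      proof (rule hoare_Rd)
        fix s D T assume a: "inv s D T \<and> length (rt s) < f \<and> f - length (rt s) = n"
        let ?j = "length (rt s)"
        have run: "run_at D0 (lv s0, ?j) (fst (R (lv s0, ?j)), snd (R (lv s0, ?j)))"
          using disk_okD[OF dk ok0(3)] a by blast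
        have fr: "frame s = frame s0" and len: "?j < f"
          and nth: "\<forall>j<?j. rt s ! j = (fst (R (lv s0, j)), length (snd (R (lv s0, j))), fst (R (lv s0, j)), [])"
          using a by (auto simp: inv_def)
        have rb: "fst (R (lv s0, j)) < V0 \<and> length (snd (R (lv s0, j))) < V0" if "j < f" for j
          using run_bounds(1,2)[OF Q disk_okD[OF dk ok0(3) that] ok0(3)] by auto
        have "okf s"
          using ok0(2) a len nth rb V0 by (auto simp: okf_def inv_def in_set_conv_nth)
        then have "ok s" using okm_frame[OF fr] ok0 by (simp add: ok_def)
        moreover have "rad (lv s) ?j 0 < A" using rad_less[OF Q ok0(3) len] a by (simp add: inv_def)
        moreover have "D0 (rad (lv s0) ?j 0 * B) = prod_encode (fst (R (lv s0, ?j)), length (snd (R (lv s0, ?j))))"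
          using run_atD(1)[OF run] .
        ultimately show "ok s \<and> rad (lv s) ?j 0 < A \<and>
            inv (s\<lparr>rt := rt s @ [(fst (prod_decode (hd (block B D (rad (lv s) ?j 0)))),
              snd (prod_decode (hd (block B D (rad (lv s) ?j 0)))),
              fst (prod_decode (hd (block B D (rad (lv s) ?j 0)))), [])]\<rparr>) D (T + 1) \<and>
            f - length (rt (s\<lparr>rt := rt s @ [(fst (prod_decode (hd (block B D (rad (lv s) ?j 0)))),
              snd (prod_decode (hd (block B D (rad (lv s) ?j 0)))),
              fst (prod_decode (hd (block B D (rad (lv s) ?j 0)))), [])]\<rparr>)) < n"
          using a by (auto simp: inv_def block_hd frame_def nth_append less_Suc_eq)
      qed
    qed (auto simp: inv_def)
  qed
qed

section \<open>Blocks read from partially consumed runs\<close>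

text \<open>
  If the part of a run from \<open>h\<close> to \<open>q\<close> has been loaded, then \<open>pst h q\<close> is where the last loaded
  block starts and \<open>wgt h q\<close> is the number of blocks.
\<close>

definition pst :: "nat \<Rightarrow> nat \<Rightarrow> nat" where
  "pst h q = (if q = h then h else max h ((q - 1) div B * B))"

definition wgt :: "nat \<Rightarrow> nat \<Rightarrow> nat" where
  "wgt h q = (if q = h then 0 else 1 + (pst h q - h + B - 1) div B)"

lemma next_pos:
  assumes "q < t" "q2 = min t ((q div B + 1) * B)"
  shows "q < q2" "q2 \<le> t" "q2 = t \<or> B dvd q2" "(q2 - 1) div B = q div B" "q mod B + (q2 - q) \<le> B"
proof -
  have q: "q div B * B + q mod B = q" "q mod B < B" using B by auto
  have 1: "q < (q div B + 1) * B" using dividend_less_div_times[of B q] B by simp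
  show q2: "q < q2" using 1 assms by simp
  show "q2 \<le> t" "q2 = t \<or> B dvd q2" using assms by (auto simp: min_def)
  have le: "q2 \<le> (q div B + 1) * B" using assms by simp
  show "(q2 - 1) div B = q div B"
  proof (rule div_nat_eqI)
    have "B * (q div B) \<le> q" by simp
    then show "B * (q div B) \<le> q2 - 1" using q2 by linarith
    show "q2 - 1 < B * Suc (q div B)" using le q2 by (simp add: algebra_simps)
  qed
  have "q2 \<le> q div B * B + B" using le by simp
  then show "q mod B + (q2 - q) \<le> B" using q q2 by linarith
qed

lemma pst_first:
  assumes "h < t" "q2 = min t ((h div B + 1) * B)"
  shows "pst h q2 = h" "wgt h q2 = 1"
proof -
  note np = next_pos[OF assms]
  have "h div B * B \<le> h" by simp
  then show "pst h q2 = h" using np by (simp add: pst_def)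
  then show "wgt h q2 = 1" using np B by (simp add: wgt_def)
qed

lemma pst_next:
  assumes "h < q" "q < t" "B dvd q" "q2 = min t ((q div B + 1) * B)"
  shows "pst h q2 = q" "wgt h q2 = wgt h q + 1"
proof -
  note np = next_pos[OF assms(2,4)]
  have "q div B * B = q" using assms(3) by simp
  then show p: "pst h q2 = q" using np assms(1) by (simp add: pst_def)
  obtain c where c: "q = B * Suc c" using assms(1,3) by (metis dvd_def mult_0_right not_less0 old.nat.exhaust)
  have "(q - 1) div B = c"
    by (rule div_nat_eqI) (use c B in \<open>auto simp: algebra_simps\<close>)
  then have pq: "pst h q = max h (q - B)" using c assms(1) by (simp add: pst_def mult.commute)
  have w2: "wgt h q2 = 1 + (q - h + B - 1) div B" using p np(1) assms(1) by (simp add: wgt_def)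
  have w1: "wgt h q = 1 + (max h (q - B) - h + B - 1) div B" using pq assms(1) by (simp add: wgt_def)
  show "wgt h q2 = wgt h q + 1"
  proof (cases "h \<le> q - B")
    case True
    have "B \<le> q" using c by simp
    define k where "k = q - B - h"
    have k: "q - h + B - 1 = (k + B - 1) + B" using True B \<open>B \<le> q\<close> by (simp add: k_def)
    have "(q - h + B - 1) div B = (k + B - 1) div B + 1" unfolding k using B by (subst div_add_self2) auto
    moreover have "max h (q - B) - h = k" using True by (simp add: k_def max_def)
    ultimately show ?thesis using w1 w2 by simp
  next
    case False
    then have "(q - h + B - 1) div B = 1" using assms(1) B by (intro div_nat_eqI) auto
    then show ?thesis using False w1 w2 B by simp
  qed
qed

lemma pst_le: "h \<le> q \<Longrightarrow> h \<le> pst h q \<and> pst h q \<le> q"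
proof -
  assume "h \<le> q"
  moreover have "(q - 1) div B * B \<le> q - 1" by simp
  then have "(q - 1) div B * B \<le> q" by linarith
  ultimately show ?thesis by (simp add: pst_def)
qed

text \<open>Two blocks per run are paid unconditionally, the others by the items in front of the
  last loaded block, of which there are fewer than \<open>U = f * B\<close> over all runs of the
  level.\<close>

lemma wgt_le: "wgt h q \<le> 2 + (pst h q - h) div B"
proof -
  have "(x + B - 1) div B \<le> 1 + x div B" for x
    using B div_le_mono[of "x + B - 1" "x + B" B] by simp
  then show ?thesis by (simp add: wgt_def)
qed

lemma sum_upd:
  fixes g :: "nat \<Rightarrow> 'x \<Rightarrow> 'y :: comm_monoid_add"
  assumes "b < n"
  shows "(\<Sum>j<n. g j ((q(b := v)) j)) + g b (q b) = (\<Sum>j<n. g j (q j)) + g b v"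
proof -
  have b: "b \<in> {..<n}" "finite {..<n}" using assms by auto
  have "(\<Sum>j\<in>{..<n} - {b}. g j ((q(b := v)) j)) = (\<Sum>j\<in>{..<n} - {b}. g j (q j))"
    by (intro sum.cong) auto
  then show ?thesis using sum.remove[OF b(2,1), of "\<lambda>j. g j ((q(b := v)) j)"] sum.remove[OF b(2,1), of "\<lambda>j. g j (q j)"]
    by (simp add: add_ac)
qed

lemma sum_div_le:
  assumes "(\<Sum>j<n. g j) < U"
  shows "(\<Sum>j<n. g j div B) \<le> f"
proof -
  have "(\<Sum>j<n. g j div B) * B \<le> (\<Sum>j<n. g j)"
    unfolding sum_distrib_right by (intro sum_mono) simp
  then have "(\<Sum>j<n. g j div B) * B < f * B" using assms unfolding U_def by linarith
  then have "(\<Sum>j<n. g j div B) < f" by (simp only: mult_less_cancel2)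
  then show ?thesis by simp
qed

lemma prefix_count:
  assumes "\<forall>p<n. xs ! p \<le> m" "n \<le> length xs"
  shows "n \<le> length (filter (\<lambda>x. x \<le> (m :: 'b :: linorder)) xs)"
proof -
  have "filter (\<lambda>x. x \<le> m) (take n xs) = take n xs"
    using assms by (auto simp: filter_id_conv in_set_conv_nth)
  then have "n = length (filter (\<lambda>x. x \<le> m) (take n xs))" using assms(2) by simp
  also have "\<dots> \<le> length (filter (\<lambda>x. x \<le> m) (take n xs @ drop n xs))"
    unfolding filter_append by simp
  finally show ?thesis by simp
qed

lemma loaded_items:
  assumes run: "run_at D (i, j) (h, ys)" and q: "h \<le> q" "q < length ys"
    and q2: "q2 = min (length ys) ((q div B + 1) * B)"
  shows "map list_decode (take (q2 - q) (drop (q mod B) (block B D (rad i j 1 + q div B)))) = take (q2 - q) (drop q ys)"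
proof (rule nth_equalityI)
  note np = next_pos[OF q(2) q2]
  show len: "length (map list_decode (take (q2 - q) (drop (q mod B) (block B D (rad i j 1 + q div B))))) =
      length (take (q2 - q) (drop q ys))"
    using np by simp
  fix o' assume "o' < length (map list_decode (take (q2 - q) (drop (q mod B) (block B D (rad i j 1 + q div B)))))"
  then have o: "o' < q2 - q" by simp
  have "D ((rad i j 1 + q div B) * B + (q mod B + o')) = D (rad i j 1 * B + (q + o'))"
    by (rule arg_cong[of _ _ D]) (simp add: algebra_simps)
  also have "\<dots> = list_encode (ys ! (q + o'))" using o np q by (intro run_atD(2)[OF run]) auto
  finally show "map list_decode (take (q2 - q) (drop (q mod B) (block B D (rad i j 1 + q div B)))) ! o' =
      take (q2 - q) (drop q ys) ! o'"
    using o np q by (simp add: block_nth)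
qed

text \<open>The invariant has a ghost threshold \<open>mu\<close>: loaded items in front of the last
  block of their run are at most \<open>mu\<close>, and \<open>mu\<close> is at most the last loaded
  item of every unfinished run. There are fewer than \<open>U\<close> such items, hence at most
  \<open>2 * f + f\<close> block reads after \<open>f\<close> header reads.\<close>

lemma load_level:
  assumes Q: "3 * U \<le> Q" and dk: "disk_ok D0 R" and ok0: "okm s0" "okf s0" "lv s0 < L"
    and sm: "smallest U fst (fr s0) Y"
  shows "hoareM (\<lambda>s D T. s = s0 \<and> D = D0 \<and> T = T0) load_level
    (\<lambda>s D T. frame s = frame s0 \<and> lv s = lv s0 \<and> okf s \<and> D = D0 \<and> T \<le> T0 + 4 * f \<and>
      smallest U fst (fr s) (Y + (\<Sum>j<f. mset (map (\<lambda>x. (x, (lv s0, j))) (rem R (lv s0, j))))))"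
    (is "hoareM _ _ ?post")
proof -
  define i where "i = lv s0"
  define h where "h = (\<lambda>j. fst (R (i, j)))"
  define ys where "ys = (\<lambda>j. snd (R (i, j)))"
  define t where "t = (\<lambda>j. length (ys j))"
  define lam where "lam = (\<lambda>j q. if q = h j then [] else ys j ! (q - 1))"
  define tag where "tag = (\<lambda>j q. mset (map (\<lambda>x. (x, (i, j))) (take (q - h j) (drop (h j) (ys j)))))"
  have iL: "i < L" using ok0 by (simp add: i_def)
  have run: "run_at D0 (i, j) (h j, ys j)" if "j < f" for j
    using disk_okD[OF dk iL that] by (simp add: h_def ys_def)
  note rb = run_bounds[OF Q run iL]
  have ht: "h j \<le> t j" "t j < V0" "t j \<le> f ^ (i + 1) * B" "sorted (ys j)" if "j < f" for j
    using rb[OF that] by (auto simp: t_def)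
  define I where "I = (\<lambda>q mu s D T. frame s = frame s0 \<and> lv s = i \<and> okf s \<and> D = D0 \<and> length (rt s) = f \<and>
    (\<forall>j<f. h j \<le> q j \<and> q j \<le> t j \<and> (q j = h j \<or> q j = t j \<or> B dvd q j) \<and> rt s ! j = (h j, t j, q j, lam j (q j))) \<and>
    smallest U fst (fr s) (Y + (\<Sum>j<f. tag j (q j))) \<and>
    (\<forall>j<f. q j < t j \<longrightarrow> mu \<le> lam j (q j)) \<and>
    (\<forall>j<f. \<forall>p. h j \<le> p \<longrightarrow> p < pst (h j) (q j) \<longrightarrow> ys j ! p \<le> mu) \<and>
    (\<Sum>j<f. pst (h j) (q j) - h j) < U \<and> T \<le> T0 + f + (\<Sum>j<f. wgt (h j) (q j)))"
  define inv where "inv = (\<lambda>s D T. \<exists>q mu. I q mu s D T)"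
  define mes where "mes = (\<lambda>s :: st. \<Sum>j<f. fst (snd (rt s ! j)) - fst (snd (snd (rt s ! j))))"
  have tag_h: "tag j (h j) = {#}" for j by (simp add: tag_def)
  have start: "inv s D T" if a: "frame s = frame s0 \<and> fr s = fr s0 \<and> lv s = lv s0 \<and> xx s = xx s0 \<and> tmp s = tmp s0 \<and> D = D0 \<and>
      T = T0 + f \<and> length (rt s) = f \<and>
      (\<forall>j<f. rt s ! j = (fst (R (lv s0, j)), length (snd (R (lv s0, j))), fst (R (lv s0, j)), []))" for s D T
  proof -
    have "fst (R (lv s0, j)) < V0 \<and> length (snd (R (lv s0, j))) < V0" if "j < f" for j
      using ht[OF that] by (simp add: h_def t_def ys_def i_def)
    then have okf: "okf s" using ok0(2) a V0 by (auto simp: okf_def in_set_conv_nth)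
    have "\<forall>j<f. rt s ! j = (h j, t j, h j, [])" using a by (simp add: h_def t_def ys_def i_def)
    then have "I h [] s D T"
      unfolding I_def using a okf sm ht U by (simp add: tag_h pst_def wgt_def lam_def i_def)
    then show ?thesis by (auto simp: inv_def)
  qed
  have step: "ok s \<and> rad (lv s) (best s) 1 + fst (snd (snd (rt s ! best s))) div B < A \<and>
      inv (load (block B D (rad (lv s) (best s) 1 + fst (snd (snd (rt s ! best s))) div B)) s) D (T + 1) \<and>
      mes (load (block B D (rad (lv s) (best s) 1 + fst (snd (snd (rt s ! best s))) div B)) s) < mes s"
    if iv: "inv s D T" and ld: "loadable s" for s D T
  proof -
    obtain q mu where I: "I q mu s D T" using iv by (auto simp: inv_def)
    have s: "frame s = frame s0" "lv s = i" "okf s" "D = D0" "length (rt s) = f" 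
      and qs: "\<And>j. j < f \<Longrightarrow> h j \<le> q j \<and> q j \<le> t j \<and> (q j = h j \<or> q j = t j \<or> B dvd q j)"
      and rts: "\<And>j. j < f \<Longrightarrow> rt s ! j = (h j, t j, q j, lam j (q j))"
      and sms: "smallest U fst (fr s) (Y + (\<Sum>j<f. tag j (q j)))"
      and mu: "\<And>j. j < f \<Longrightarrow> q j < t j \<Longrightarrow> mu \<le> lam j (q j)"
      and pre: "\<And>j p. j < f \<Longrightarrow> h j \<le> p \<Longrightarrow> p < pst (h j) (q j) \<Longrightarrow> ys j ! p \<le> mu"
      and sum: "(\<Sum>j<f. pst (h j) (q j) - h j) < U" and T: "T \<le> T0 + f + (\<Sum>j<f. wgt (h j) (q j))"
      using I unfolding I_def by blast+
    define b where "b = best s"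
    have cand: "cand s = {j. j < f \<and> q j < t j}" using rts by (auto simp: cand_def)
    have lamr: "lamr s j = lam j (q j)" if "j < f" for j using rts[OF that] by (simp add: lamr_def)
    have ne: "cand s \<noteq> {}" using ld by (simp add: loadable_def)
    have b: "b < f" "q b < t b" using best(1)[OF ne] cand by (auto simp: b_def)
    have bmin: "lam b (q b) \<le> lam j (q j)" if "j < f" "q j < t j" for j
      using best(2)[OF ne, of j] that cand lamr b by (auto simp: b_def)
    have thr: "length (fr s) < U \<or> lam b (q b) < fst (last (fr s))"
      using ld lamr[OF b(1)] by (auto simp: loadable_def b_def)
    define q2 where "q2 = min (t b) ((q b div B + 1) * B)"
    note np = next_pos[OF b(2) q2_def]
    define its where "its = take (q2 - q b) (drop (q b) (ys b))"
    have its: "map list_decode (take (q2 - q b) (drop (q b mod B) (block B D (rad i b 1 + q b div B)))) = its"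
      unfolding its_def s(4) by (rule loaded_items[OF run[OF b(1)]]) (use qs[OF b(1)] b(2) q2_def in \<open>auto simp: t_def\<close>)
    have len_its: "length its = q2 - q b" using np by (simp add: its_def t_def)
    have last_its: "last its = ys b ! (q2 - 1)"
    proof -
      have "its \<noteq> []" using len_its np by auto
      then have "last its = its ! (q2 - q b - 1)" using len_its by (simp add: last_conv_nth)
      also have "\<dots> = ys b ! (q b + (q2 - q b - 1))" using np by (simp add: its_def t_def)
      finally show ?thesis using np by simp
    qed
    have its_X: "set its \<subseteq> X" using rb(3)[OF b(1)] by (auto simp: its_def dest!: in_set_takeD in_set_dropD)
    define s' where "s' = s\<lparr>rt := (rt s)[b := (h b, t b, q2, last its)],
       fr := take U (sort_key fst (fr s @ map (\<lambda>x. (x, i, b)) its))\<rparr>"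
    have ls: "load (block B D (rad (lv s) (best s) 1 + fst (snd (snd (rt s ! best s))) div B)) s = s'"
      unfolding load_def Let_def b_def[symmetric] s(2) rts[OF b(1)] s'_def
      by (simp add: its[symmetric] q2_def)
    define q' where "q' = q(b := q2)"
    have tag2: "tag b q2 = tag b (q b) + mset (map (\<lambda>x. (x, (i, b))) its)"
    proof -
      have "q2 - h b = (q b - h b) + (q2 - q b)" using np qs[OF b(1)] by simp
      then have "take (q2 - h b) (drop (h b) (ys b)) =
          take (q b - h b) (drop (h b) (ys b)) @ take (q2 - q b) (drop (q b - h b) (drop (h b) (ys b)))"
        by (simp only: take_add)
      also have "drop (q b - h b) (drop (h b) (ys b)) = drop (q b) (ys b)" using qs[OF b(1)] by simp
      finally show ?thesis by (simp add: tag_def its_def)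
    qed
    have sumtag: "(\<Sum>j<f. tag j (q' j)) = (\<Sum>j<f. tag j (q j)) + mset (map (\<lambda>x. (x, (i, b))) its)"
      using sum_upd[OF b(1), of tag q q2] unfolding q'_def tag2
      by (simp add: add.assoc[symmetric] del: mset_map)
    have sm': "smallest U fst (fr s') (Y + (\<Sum>j<f. tag j (q' j)))"
      using smallest_add[OF sms, of "map (\<lambda>x. (x, i, b)) its"]
      unfolding sumtag by (simp add: s'_def add.assoc)
    \<comment> \<open>The first block of a run leaves the threshold unchanged. Otherwise the last
      loaded item of run \<open>b\<close>, minimal among the unfinished runs, becomes the new
      threshold.\<close>
    define mu' where "mu' = (if q b = h b then mu else lam b (q b))"
    have lam2: "lam b q2 = ys b ! (q2 - 1)" using np qs[OF b(1)] by (simp add: lam_def)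
    have srt: "ys b ! p \<le> ys b ! p'" if "p \<le> p'" "p' < t b" for p p'
      using ht(4)[OF b(1)] that by (simp add: t_def sorted_nth_mono)
    have mumu: "mu \<le> mu'" using mu[OF b] by (simp add: mu'_def)
    have pst_b: "q b \<noteq> h b \<Longrightarrow> B dvd q b" using qs[OF b(1)] b(2) by auto
    have hq: "h b \<le> q b" using qs[OF b(1)] by simp
    have pb: "pst (h b) q2 = (if q b = h b then h b else q b) \<and> wgt (h b) q2 = wgt (h b) (q b) + 1"
    proof (cases "q b = h b")
      case True
      then show ?thesis using pst_first[of "h b" "t b" q2] b(2) by (simp add: q2_def wgt_def)
    next
      case False
      then show ?thesis using pst_next[of "h b" "q b" "t b" q2] b(2) hq pst_b by (simp add: q2_def)
    qed
    have pre': "ys j ! p \<le> mu'" if "j < f" "h j \<le> p" "p < pst (h j) (q' j)" for j p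
    proof (cases "j = b")
      case True
      then have "q b \<noteq> h b" "p < q b" using that pb by (auto simp: q'_def split: if_splits)
      then show ?thesis using True srt[of p "q b - 1"] b(2) by (simp add: mu'_def lam_def)
    next
      case False
      then show ?thesis using pre[of j p] that mumu by (auto simp: q'_def)
    qed
    have cand': "mu' \<le> lam j (q' j)" if "j < f" "q' j < t j" for j
    proof (cases "j = b")
      case True
      show ?thesis
      proof (cases "q b = h b")
        case True
        then have "mu \<le> []" using mu[OF b] by (simp add: lam_def)
        then show ?thesis using True by (simp add: mu'_def)
      next
        case False
        then show ?thesis using True lam2 srt[of "q b - 1" "q2 - 1"] np
          by (simp add: mu'_def lam_def q'_def)
      qed
    next
      case False
      then show ?thesis using that mu[of j] bmin[of j] by (auto simp: mu'_def q'_def)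
    qed
    have sum': "(\<Sum>j<f. pst (h j) (q' j) - h j) < U"
    proof (cases "q b = h b")
      case True
      then have "pst (h j) (q' j) - h j = pst (h j) (q j) - h j" for j
        using pb by (cases "j = b") (auto simp: q'_def pst_def)
      then show ?thesis using sum by simp
    next
      case False
      have fne: "length (fr s) < U \<or> fr s \<noteq> [] \<and> mu' < fst (last (fr s))"
        using thr False U by (cases "fr s") (auto simp: mu'_def)
      \<comment> \<open>The loop condition puts \<open>mu'\<close> below the largest buffered item
        or leaves the buffer not full; so it suffices to count the loaded items that are at most
        \<open>mu'\<close>.\<close>
      have "pst (h j) (q' j) - h j \<le> size (filter_mset (\<lambda>x. fst x \<le> mu') (tag j (q j)))" if j: "j < f" for j
      proof -
        let ?xs = "take (q j - h j) (drop (h j) (ys j))"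
        have le: "pst (h j) (q' j) \<le> q j"
          using pb False pst_le[of "h j" "q j"] qs[OF j] by (auto simp: q'_def)
        have l: "length ?xs = q j - h j" using qs[OF j] by (auto simp: t_def min_def)
        have "pst (h j) (q' j) - h j \<le> length (filter (\<lambda>x. x \<le> mu') ?xs)"
        proof (rule prefix_count)
          show "\<forall>p<pst (h j) (q' j) - h j. ?xs ! p \<le> mu'"
            using pre'[OF j] le l qs[OF j] by (auto simp: t_def)
        qed (use le l in simp)
        also have "\<dots> = size (filter_mset (\<lambda>x. fst x \<le> mu') (tag j (q j)))"
          by (simp add: tag_def filter_mset_image_mset comp_def flip: mset_filter)
        finally show ?thesis .
      qed
      then have "(\<Sum>j<f. pst (h j) (q' j) - h j) \<le> (\<Sum>j<f. size (filter_mset (\<lambda>x. fst x \<le> mu') (tag j (q j))))"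
        by (intro sum_mono) auto
      also have "\<dots> = size (filter_mset (\<lambda>x. fst x \<le> mu') (\<Sum>j<f. tag j (q j)))"
        by (induction f) auto
      also have "\<dots> \<le> size (filter_mset (\<lambda>x. fst x \<le> mu') (Y + (\<Sum>j<f. tag j (q j))))" by simp
      also have "\<dots> < U" using smallest_count[OF sms fne] U by simp
      finally show ?thesis .
    qed
    have T': "T + 1 \<le> T0 + f + (\<Sum>j<f. wgt (h j) (q' j))"
      using T sum_upd[OF b(1), of "\<lambda>j. wgt (h j)" q q2] pb by (simp add: q'_def)
    have q'p: "h j \<le> q' j \<and> q' j \<le> t j \<and> (q' j = h j \<or> q' j = t j \<or> B dvd q' j)" if "j < f" for j
      using qs[OF that] np hq by (auto simp: q'_def)
    have rt': "rt s' ! j = (h j, t j, q' j, lam j (q' j))" if "j < f" for j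
      using rts[OF that] that s(5) last_its lam2 by (auto simp: s'_def q'_def nth_list_update)
    have okf': "okf s'"
    proof -
      have "last its \<in> X" using its_X len_its np 
      proof -
        have "its \<noteq> []" using len_its np(1) by auto
        then show ?thesis using its_X last_in_set by blast
      qed
      then have "list_encode (last its) < V0" using X by blast
      moreover have "h b < V0" "t b < V0" "q2 < V0" using ht[OF b(1)] np by auto
      moreover have "i < V0" "b < V0" using level_bound[OF Q] iL b by auto
      ultimately show ?thesis using s(3) its_X
        by (auto simp: okf_def s'_def dest!: in_set_takeD set_update_subset_insert[THEN subsetD]) (force, blast)
    qed
    have "I q' mu' s' D (T + 1)"
      unfolding I_def using s okf' q'p rt' sm' cand' pre' sum' T' by (simp add: s'_def frame_def)
    moreover have "mes s' < mes s"
    proof -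
      have "mes s = (\<Sum>j<f. t j - q j)" unfolding mes_def by (intro sum.cong) (auto simp: rts)
      moreover have "mes s' = (\<Sum>j<f. t j - q' j)" unfolding mes_def by (intro sum.cong) (auto simp: rt')
      moreover have "(\<Sum>j<f. t j - q' j) + (t b - q b) = (\<Sum>j<f. t j - q j) + (t b - q2)"
        using sum_upd[OF b(1), of "\<lambda>j x. t j - x" q q2] by (simp add: q'_def)
      ultimately show ?thesis using np b by linarith
    qed
    moreover have "ok s" using okm_frame[OF s(1)] s(3) ok0(1) by (simp add: ok_def)
    moreover have "rad (lv s) (best s) 1 + fst (snd (snd (rt s ! best s))) div B < A"
    proof -
      have "q b < f ^ (i + 1) * B" using b ht(3)[OF b(1)] by linarith
      then have "q b div B < f ^ (i + 1)" by (rule less_mult_imp_div_less)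
      then have "1 + q b div B \<le> f ^ (i + 1)" by simp
      from rad_less[OF Q iL b(1) this] show ?thesis using rts[OF b(1)] s(2) by (simp add: rad_def b_def)
    qed
    ultimately show ?thesis unfolding ls by (auto simp: inv_def)
  qed
  have fin: "?post s D T" if iv: "inv s D T" and ld: "\<not> loadable s" for s D T
  proof -
    obtain q mu where I: "I q mu s D T" using iv by (auto simp: inv_def)
    have s: "frame s = frame s0" "lv s = i" "okf s" "D = D0" "length (rt s) = f" 
      and qs: "\<And>j. j < f \<Longrightarrow> h j \<le> q j \<and> q j \<le> t j \<and> (q j = h j \<or> q j = t j \<or> B dvd q j)"
      and rts: "\<And>j. j < f \<Longrightarrow> rt s ! j = (h j, t j, q j, lam j (q j))"
      and sms: "smallest U fst (fr s) (Y + (\<Sum>j<f. tag j (q j)))"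
      and sum: "(\<Sum>j<f. pst (h j) (q j) - h j) < U" and T: "T \<le> T0 + f + (\<Sum>j<f. wgt (h j) (q j))"
      using I unfolding I_def by blast+
    have cand: "cand s = {j. j < f \<and> q j < t j}" using rts by (auto simp: cand_def)
    have lamr: "lamr s j = lam j (q j)" if "j < f" for j using rts[OF that] by (simp add: lamr_def)
    have "(\<Sum>j<f. wgt (h j) (q j)) \<le> (\<Sum>j<f. 2 + (pst (h j) (q j) - h j) div B)"
      by (intro sum_mono wgt_le)
    also have "\<dots> = 2 * f + (\<Sum>j<f. (pst (h j) (q j) - h j) div B)" unfolding sum.distrib by simp
    also have "\<dots> \<le> 3 * f" using sum_div_le[OF sum] by simp
    finally have T': "T \<le> T0 + 4 * f" using T by simp
    have full: "mset (map (\<lambda>x. (x, (i, j))) (rem R (i, j))) =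
        tag j (q j) + mset (map (\<lambda>x. (x, (i, j))) (drop (q j) (ys j)))" if "j < f" for j
    proof -
      have "rem R (i, j) = take (q j - h j) (drop (h j) (ys j)) @ drop (q j - h j) (drop (h j) (ys j))"
        unfolding append_take_drop_id by (simp add: rem_def h_def ys_def)
      also have "drop (q j - h j) (drop (h j) (ys j)) = drop (q j) (ys j)" using qs[OF that] by simp
      finally show ?thesis by (simp add: tag_def)
    qed
    have tot: "(\<Sum>j<f. mset (map (\<lambda>x. (x, (i, j))) (rem R (i, j)))) =
        (\<Sum>j<f. tag j (q j)) + (\<Sum>j<f. mset (map (\<lambda>x. (x, (i, j))) (drop (q j) (ys j))))"
      using full by (simp add: sum.distrib del: mset_map)
    have "smallest U fst (fr s) (Y + (\<Sum>j<f. mset (map (\<lambda>x. (x, (i, j))) (rem R (i, j)))))"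
    proof (cases "cand s = {}")
      case True
      then have "drop (q j) (ys j) = []" if "j < f" for j using that cand qs[OF that] by (auto simp: t_def)
      then show ?thesis using sms unfolding tot by simp
    next
      case False
      then have thr: "length (fr s) = U" "fst (last (fr s)) \<le> lamr s (best s)"
        using ld s(3) by (auto simp: loadable_def okf_def)
      \<comment> \<open>An unread item is no less than the last loaded item of its run, and by the
        exit condition that is no less than the whole buffer.\<close>
      have "fst x \<le> fst w"
        if w: "w \<in># (\<Sum>j<f. mset (map (\<lambda>x. (x, (i, j))) (drop (q j) (ys j))))" and x: "x \<in> set (fr s)" for w x
      proof -
        have fin: "finite {..<f}" by simp
        obtain j y where j: "j < f" "fst w = y" "y \<in> set (drop (q j) (ys j))"
          using w unfolding set_mset_sum[OF fin] by auto
        from j(3) obtain p where p: "p < length (drop (q j) (ys j))" "drop (q j) (ys j) ! p = y"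
          unfolding in_set_conv_nth by blast
        have qt: "q j < t j" using p by (simp add: t_def)
        have "fst x \<le> fst (last (fr s))"
        proof -
          have so: "sorted (map fst (fr s))" using sms by (simp add: smallest_def)
          have ne: "fr s \<noteq> []" using x by auto
          obtain m where m: "m < length (fr s)" "fr s ! m = x" using x unfolding in_set_conv_nth by blast
          have "map fst (fr s) ! m \<le> map fst (fr s) ! (length (fr s) - 1)"
            using so m(1) by (intro sorted_nth_mono) auto
          then show ?thesis using m ne by (simp add: last_conv_nth)
        qed
        also have "\<dots> \<le> lam j (q j)" using thr(2) best(2)[OF False, of j] cand j qt lamr by auto
        finally have xl: "fst x \<le> lam j (q j)" .
        \<comment> \<open>An untouched run would have the value \<open>[]\<close>, below the
          nonempty item \<open>fst x\<close>; so the run has been started.\<close>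
        have "fst x \<noteq> []" using x s(3) X by (auto simp: okf_def)
        then have "q j \<noteq> h j" using xl by (auto simp: lam_def)
        then have "lam j (q j) \<le> ys j ! (q j + p)" using ht(4)[OF j(1)] p qs[OF j(1)]
          by (auto simp: lam_def t_def intro!: sorted_nth_mono)
        moreover have "ys j ! (q j + p) = fst w" using p j(2) by simp
        ultimately show ?thesis using xl by simp
      qed
      from smallest_skip[OF sms thr(1) this] show ?thesis unfolding tot by (simp add: add.assoc)
    qed
    then show ?thesis using s T' by (simp add: i_def)
  qed
  show ?thesis
    unfolding load_level_def
  proof (rule hoare_Seq[OF read_metas[OF Q dk ok0]])
    show "hoareM (\<lambda>s D T. frame s = frame s0 \<and> fr s = fr s0 \<and> lv s = lv s0 \<and> xx s = xx s0 \<and> tmp s = tmp s0 \<and> D = D0 \<and>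
      T = T0 + f \<and> length (rt s) = f \<and>
      (\<forall>j<f. rt s ! j = (fst (R (lv s0, j)), length (snd (R (lv s0, j))), fst (R (lv s0, j)), [])))
      (While loadable (Rd (\<lambda>s. rad (lv s) (best s) 1 + fst (snd (snd (rt s ! best s))) div B) load)) ?post"
    proof (rule hoare_While[where I = inv and m = "\<lambda>s D T. mes s"])
      show "hoareM (\<lambda>s D T. inv s D T \<and> loadable s \<and> mes s = n)
        (Rd (\<lambda>s. rad (lv s) (best s) 1 + fst (snd (snd (rt s ! best s))) div B) load)
        (\<lambda>s D T. inv s D T \<and> mes s < n)" for n
        by (rule hoare_Rd) (use step in blast)
    qed (use start fin in blast)+
  qed
qed

section \<open>Writes that leave the other runs intact\<close>

lemma put_div: "put B a ws D x = (if x div B = a then ws ! (x mod B) else D x)"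
proof -
  have "a * B \<le> x \<and> x < a * B + B \<longleftrightarrow> x div B = a"
  proof
    assume "a * B \<le> x \<and> x < a * B + B"
    then show "x div B = a" by (intro div_nat_eqI) (auto simp: mult.commute)
  next
    assume "x div B = a"
    then show "a * B \<le> x \<and> x < a * B + B" using dividend_less_div_times[of B x] B by auto
  qed
  moreover have "x div B = a \<Longrightarrow> x - a * B = x mod B" by (auto simp: minus_div_mult_eq_mod)
  ultimately show ?thesis by (simp add: put_def)
qed

lemma rad_inj:
  assumes "rad i j b = rad i' j' b'" "j < f" "j' < f" "b \<le> f ^ (i + 1)" "b' \<le> f ^ (i' + 1)"
  shows "i = i' \<and> j = j' \<and> b = b'"
proof -
  have lt: "rad i j b < rad i' j' b'" if "i < i'" "j < f" "b \<le> f ^ (i + 1)" for i j b i' j' b'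
  proof -
    have 1: "1 \<le> f ^ (i + 1)" using f by simp
    have "2 * f ^ (i + 1) * (f + j) + 2 * f ^ (i + 1) = 2 * f ^ (i + 1) * (f + j + 1)" by (simp add: algebra_simps)
    also have "\<dots> \<le> 2 * f ^ (i + 1) * (2 * f)" using that(2) by (intro mult_left_mono) auto
    finally have "2 * f ^ (i + 1) * (f + j) + b < 2 * f ^ (i + 1) * (2 * f)" using that(3) 1 by linarith
    also have "\<dots> \<le> 2 * f ^ (i + 1) * (f * f)" using f by (intro mult_left_mono) auto
    also have "\<dots> = 2 * f ^ (i + 2) * f" by simp
    also have "\<dots> \<le> 2 * f ^ (i' + 1) * (f + j')"
      using that(1) f by (intro mult_mono power_increasing) auto
    finally show ?thesis by (simp add: rad_def)
  qed
  have "i = i'" using lt[of i i' j b j' b'] lt[of i' i j' b' j b] assms by (metis less_irrefl linorder_neqE_nat)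
  moreover have "j = j' \<and> b = b'"
  proof -
    let ?P = "2 * f ^ (i + 1)"
    have "1 \<le> f ^ (i + 1)" using f by simp
    moreover have "b' \<le> f ^ (i + 1)" using assms(5) \<open>i = i'\<close> by blast
    ultimately have P: "b < ?P" "b' < ?P" using assms(4) by linarith+
    have "?P * (f + j) + b = ?P * (f + j') + b'" using assms(1) \<open>i = i'\<close> by (simp add: rad_def)
    moreover have "x = y \<and> c = d" if "P * x + c = P * y + d" "c < P" "d < P" for P x y c d :: nat
    proof -
      have e: "(P * x + c) div P = x" "(P * y + d) div P = y" using that(2,3) by auto
      have "x = (P * x + c) div P" by (rule e(1)[symmetric])
      also have "\<dots> = y" unfolding that(1) by (rule e(2))
      finally show ?thesis using that(1) by simp
    qed
    ultimately show ?thesis using P by (metis add_left_cancel)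
  qed
  ultimately show ?thesis by simp
qed

lemma run_words:
  assumes "p < f ^ i * U"
  shows "(rad i j 1 * B + p) div B = rad i j (1 + p div B)" "1 + p div B \<le> f ^ (i + 1)"
    "rad i j 0 * B div B = rad i j 0"
proof -
  show "(rad i j 1 * B + p) div B = rad i j (1 + p div B)" using B by (simp add: rad_def div_add1_eq)
  have "p < f ^ (i + 1) * B" using assms by (simp add: U_def mult_ac)
  then have "p div B < f ^ (i + 1)" using B by (simp add: less_mult_imp_div_less)
  then show "1 + p div B \<le> f ^ (i + 1)" by simp
qed (use B in simp)

text \<open>Only the header of an exhausted run has to survive. Its data blocks may be overwritten,
  so a new run can be written into the slot before its header is.\<close>

lemma run_at_put:
  assumes "run_at D (i, j) (h, ys)"
    and "\<And>b. b \<le> f ^ (i + 1) \<Longrightarrow> b = 0 \<or> h < length ys \<Longrightarrow> a \<noteq> rad i j b"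
  shows "run_at (put B a ws D) (i, j) (h, ys)"
proof -
  have "put B a ws D (rad i j 0 * B) = D (rad i j 0 * B)"
    using assms(2)[of 0] B by (auto simp: put_div)
  moreover have "put B a ws D (rad i j 1 * B + p) = D (rad i j 1 * B + p)" if "h \<le> p" "p < length ys" for p
  proof -
    have "p < f ^ i * U" using assms(1) that by (auto simp: run_at_def)
    note w = run_words(1)[OF this, of j] run_words(2)[OF this]
    have "a \<noteq> rad i j (1 + p div B)" using assms(2)[OF w(2)] that by auto
    then show ?thesis unfolding put_div w(1) by simp
  qed
  ultimately show ?thesis using assms(1) by (simp add: run_at_def)
qed

text \<open>Writing the header commits a run: either a new one whose data is in place, or an old one
  with an advanced head.\<close>

lemma disk_ok_meta:
  assumes dk: "disk_ok D R" and p: "i < L" "j < f"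
    and r: "h \<le> length ys" "sorted ys" "length ys \<le> f ^ i * U" "set ys \<subseteq> X"
      "\<And>p. h \<le> p \<Longrightarrow> p < length ys \<Longrightarrow> D (rad i j 1 * B + p) = list_encode (ys ! p)"
  shows "disk_ok (put B (rad i j 0) (prod_encode (h, length ys) # w) D) (R((i, j) := (h, ys)))"
  unfolding disk_ok_def
proof
  let ?D = "put B (rad i j 0) (prod_encode (h, length ys) # w) D"
  fix q assume q: "q \<in> {..<L} \<times> {..<f}"
  obtain i' j' where ij: "q = (i', j')" "i' < L" "j' < f" using q by auto
  show "run_at ?D q ((R((i, j) := (h, ys))) q)"
  proof (cases "q = (i, j)")
    case True
    have "?D (rad i j 1 * B + p) = D (rad i j 1 * B + p)" if "p < length ys" for p
    proof -
      have "p < f ^ i * U" using r that by simp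
      then have "(rad i j 1 * B + p) div B \<noteq> rad i j 0" unfolding run_words(1)[OF \<open>p < f ^ i * U\<close>] by (simp add: rad_def)
      then show ?thesis by (simp add: put_div)
    qed
    moreover have "?D (rad i j 0 * B) = prod_encode (h, length ys)" using B by (simp add: put_div)
    ultimately show ?thesis using True r by (simp add: run_at_def)
  next
    case False
    have "run_at ?D (i', j') (fst (R (i', j')), snd (R (i', j')))"
    proof (rule run_at_put[OF disk_okD[OF dk ij(2,3)]])
      fix b assume "b \<le> f ^ (i' + 1)"
      then show "rad i j 0 \<noteq> rad i' j' b" using rad_inj[of i j 0 i' j' b] p ij False by auto
    qed
    then show ?thesis using False ij by auto
  qed
qed

definition indices :: "nat \<Rightarrow> nat \<Rightarrow> (nat \<times> nat) set" where
  "indices l h = {l..<h} \<times> {..<f}"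

lemma finite_indices [simp]: "finite (indices l h)"
  by (simp add: indices_def)

text \<open>Per level, \<open>4 * f\<close> IOs load the runs and \<open>2 * f\<close> read and
  rewrite the headers. Removal touches header blocks only, so a run under construction elsewhere is
  safe.\<close>

lemma select:
  assumes Q: "3 * U \<le> Q" and dk: "disk_ok D0 R" and ok0: "okm s0" "okf s0"
    and lh: "lo s0 \<le> hi s0" "hi s0 \<le> L" and DV: "\<forall>x. D0 x < V"
  defines "I \<equiv> indices (lo s0) (hi s0)"
  shows "hoareM (\<lambda>s D T. s = s0 \<and> D = D0 \<and> T = T0) select
    (\<lambda>s D T. frame s = frame s0 \<and> okf s \<and> (\<forall>x. D x < V) \<and> T \<le> T0 + 6 * f * (hi s0 - lo s0) \<and>
      (\<forall>x. (\<forall>(i, j)\<in>I. x div B \<noteq> rad i j 0) \<longrightarrow> D x = D0 x) \<and> sorted (map fst (fr s)) \<and>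
      (\<exists>R'. disk_ok D R' \<and> (\<forall>p. p \<notin> I \<longrightarrow> R' p = R p) \<and> (\<forall>p. \<exists>n. rem R' p = drop n (rem R p)) \<and>
        (\<Sum>p\<in>I. mset (rem R p)) = mset (map fst (fr s)) + (\<Sum>p\<in>I. mset (rem R' p)) \<and>
        (\<forall>x\<in>set (fr s). \<forall>p\<in>I. \<forall>y\<in>set (rem R' p). fst x \<le> y) \<and>
        (length (fr s) = U \<or> (\<forall>p\<in>I. rem R' p = []))))"
    (is "hoareM _ _ ?post")
proof -
  define l where "l = lo s0"
  define u where "u = hi s0"
  define tagp where "tagp = (\<lambda>p. mset (map (\<lambda>x. (x, p)) (rem R p)))"
  have lu: "l \<le> u" "u \<le> L" using lh by (auto simp: l_def u_def)
  have I: "I = indices l u" by (simp add: I_def l_def u_def)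
  have LV: "L < V0" "L * f < V0" using level_bound[OF Q] by auto
  define inv where "inv = (\<lambda>s D T. frame s = frame s0 \<and> okf s \<and> D = D0 \<and> l \<le> lv s \<and> lv s \<le> u \<and>
    smallest U fst (fr s) (\<Sum>p\<in>indices l (lv s). tagp p) \<and> T \<le> T0 + 4 * f * (lv s - l))"
  have fr0: "frame s = frame s0 \<Longrightarrow> lo s = l \<and> hi s = u" for s by (simp add: frame_def l_def u_def)
  have start: "inv (s0\<lparr>fr := [], lv := lo s0\<rparr>) D0 T0"
    using ok0(2) lu LV by (auto simp: inv_def frame_def okf_def l_def indices_def smallest_def u_def)
  have level: "hoareM (\<lambda>s D T. inv s D T \<and> lv s < hi s \<and> u - lv s = n)
      (load_level ;; Basic (\<lambda>s. s\<lparr>lv := lv s + 1\<rparr>)) (\<lambda>s D T. inv s D T \<and> u - lv s < n)" for n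
  proof (rule hoare_start)
    fix s1 D1 T1 assume a: "inv s1 D1 T1 \<and> lv s1 < hi s1 \<and> u - lv s1 = n"
    then have b: "frame s1 = frame s0" "okf s1" "D1 = D0" "l \<le> lv s1" "lv s1 < u"
      "smallest U fst (fr s1) (\<Sum>p\<in>indices l (lv s1). tagp p)" "T1 \<le> T0 + 4 * f * (lv s1 - l)"
      using fr0[of s1] by (auto simp: inv_def)
    have okm1: "okm s1" using okm_frame[OF b(1)] ok0 by simp
    have lvL: "lv s1 < L" using b lu by simp
    note ll = load_level[OF Q dk okm1 b(2) lvL b(6), of T1]
    have ind: "(\<Sum>p\<in>indices l (Suc (lv s1)). tagp p) = (\<Sum>p\<in>indices l (lv s1). tagp p) + (\<Sum>j<f. tagp (lv s1, j))"
    proof -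
      have "indices l (Suc (lv s1)) = indices l (lv s1) \<union> Pair (lv s1) ` {..<f}"
        using b(4) by (auto simp: indices_def)
      moreover have "sum tagp (indices l (lv s1) \<union> Pair (lv s1) ` {..<f}) =
          sum tagp (indices l (lv s1)) + sum tagp (Pair (lv s1) ` {..<f})"
        by (rule sum.union_disjoint) (auto simp: indices_def)
      moreover have "sum tagp (Pair (lv s1) ` {..<f}) = (\<Sum>j<f. tagp (lv s1, j))"
        by (subst sum.reindex) (simp_all add: inj_on_def)
      ultimately show ?thesis by presburger
    qed
    have t: "4 * f * (Suc (lv s1) - l) = 4 * f * (lv s1 - l) + 4 * f"
      using b(4) by (simp add: Suc_diff_le)
    show "hoareM (\<lambda>s D T. s = s1 \<and> D = D1 \<and> T = T1) (load_level ;; Basic (\<lambda>s. s\<lparr>lv := lv s + 1\<rparr>))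
        (\<lambda>s D T. inv s D T \<and> u - lv s < n)"
      unfolding b(3)
    proof (rule hoare_Seq[OF ll], rule hoare_Basic)
      fix s D T assume c: "frame s = frame s1 \<and> lv s = lv s1 \<and> okf s \<and> D = D0 \<and> T \<le> T1 + 4 * f \<and>
        smallest U fst (fr s) ((\<Sum>p\<in>indices l (lv s1). tagp p) +
          (\<Sum>j<f. mset (map (\<lambda>x. (x, lv s1, j)) (rem R (lv s1, j)))))"
      then have "okf (s\<lparr>lv := lv s + 1\<rparr>)" using lvL LV by (simp add: okf_def)
      moreover have "frame (s\<lparr>lv := lv s + 1\<rparr>) = frame s" by (simp add: frame_def)
      moreover have "smallest U fst (fr s) (\<Sum>p\<in>indices l (Suc (lv s1)). tagp p)"
        unfolding ind using c unfolding tagp_def by blast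
      moreover have "T \<le> T0 + 4 * f * (Suc (lv s1) - l)" using b(7) c unfolding t by linarith
      moreover have "u - Suc (lv s1) < n" using a b(5) by linarith
      ultimately show "inv (s\<lparr>lv := lv s + 1\<rparr>) D T \<and> u - lv (s\<lparr>lv := lv s + 1\<rparr>) < n"
        using b(1,4,5) c unfolding inv_def by simp
    qed
  qed
  define n where "n = (\<lambda>F :: (nat list \<times> nat \<times> nat) list. \<lambda>p. length (filter (\<lambda>x. snd x = p) F))"
  \<comment> \<open>Runs are numbered by \<open>i * f + j\<close>; those with a number below
    \<open>v\<close> have already been advanced.\<close>
  define Rx where "Rx = (\<lambda>F v p. if l \<le> fst p \<and> snd p < f \<and> fst p * f + snd p < v
    then (fst (R p) + n F p, snd (R p)) else R p)"
  define inv2 where "inv2 = (\<lambda>s D T. frame s = frame s0 \<and> okf s \<and> l * f \<le> xx s \<and> xx s \<le> u * f \<and>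
    smallest U fst (fr s) (\<Sum>p\<in>I. tagp p) \<and> T \<le> T0 + 4 * f * (u - l) + 2 * (xx s - l * f) \<and>
    (\<forall>x. D x < V) \<and> (\<forall>x. (\<forall>(i, j)\<in>I. x div B \<noteq> rad i j 0) \<longrightarrow> D x = D0 x) \<and> disk_ok D (Rx (fr s) (xx s)))"
  have so: "\<forall>p\<in>I. sorted (rem R p)"
  proof
    fix p assume "p \<in> I"
    then have "run_at D0 p (R p)" using dk lu by (auto simp: disk_ok_def I indices_def)
    then show "sorted (rem R p)" by (cases p; cases "R p") (auto simp: run_at_def rem_def)
  qed
  have fI: "finite I" by (simp add: I)
  note split = smallest_split[where I = I and U = U and xs = "rem R", OF fI so, folded tagp_def n_def]
  have uf: "u * f < V0" using lu LV by (meson le_less_trans mult_le_mono1)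
  have start2: "inv2 (s\<lparr>xx := lo s * f\<rparr>) D T" if iv: "inv s D T" "\<not> lv s < hi s" for s D T
  proof -
    have fs: "frame s = frame s0" using iv by (simp add: inv_def)
    have lvu: "lv s = u" "lo s = l" using iv fr0[OF fs] by (auto simp: inv_def)
    have no: "l \<le> a \<Longrightarrow> \<not> a * f + b < l * f" for a b
      using mult_le_mono1[of l a f] by linarith
    have "Rx (fr s) (l * f) = R"
      by (rule ext) (use no in \<open>auto simp: Rx_def\<close>)
    moreover have lf: "l * f \<le> u * f" using lu by simp
    moreover have "lo s * f < V0" unfolding lvu(2) using lf uf by (rule le_less_trans)
    ultimately show ?thesis
      using iv lvu dk DV by (auto simp: inv2_def inv_def frame_def okf_def I)
  qed
  have upd: "hoareM (\<lambda>s D T. inv2 s D T \<and> xx s < hi s * f \<and> u * f - xx s = m)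
      (Rd (\<lambda>s. rad (xx s div f) (xx s mod f) 0) (\<lambda>b s. s\<lparr>tmp := hd b\<rparr>) ;;
        Wr (\<lambda>s. rad (xx s div f) (xx s mod f) 0)
          (\<lambda>s. prod_encode (fst (prod_decode (tmp s)) + taken s (xx s div f, xx s mod f), snd (prod_decode (tmp s)))
             # replicate (B - 1) 0) ;;
        Basic (\<lambda>s. s\<lparr>xx := xx s + 1\<rparr>)) (\<lambda>s D T. inv2 s D T \<and> u * f - xx s < m)" for m
  proof (rule hoare_start)
    fix s1 D1 T1 assume a: "inv2 s1 D1 T1 \<and> xx s1 < hi s1 * f \<and> u * f - xx s1 = m"
    then have fs: "frame s1 = frame s0" by (simp add: inv2_def)
    define i where "i = xx s1 div f"
    define j where "j = xx s1 mod f"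
    define F where "F = fr s1"
    have b: "okf s1" "l * f \<le> xx s1" "xx s1 < u * f" "smallest U fst F (\<Sum>p\<in>I. tagp p)"
      "T1 \<le> T0 + 4 * f * (u - l) + 2 * (xx s1 - l * f)" "\<forall>x. D1 x < V"
      "\<forall>x. (\<forall>(i, j)\<in>I. x div B \<noteq> rad i j 0) \<longrightarrow> D1 x = D0 x" "disk_ok D1 (Rx F (xx s1))"
      using a fr0[OF fs] unfolding inv2_def F_def by auto
    have okm1: "okm s1" using okm_frame[OF fs] ok0 by simp
    have xij: "xx s1 = i * f + j" by (simp add: i_def j_def)
    have j: "j < f" using f by (simp add: j_def)
    have "l * f div f \<le> xx s1 div f" using b(2) by (rule div_le_mono)
    then have i: "i < u" "l \<le> i" using b(3) f by (simp_all add: i_def less_mult_imp_div_less)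
    have iL: "i < L" using i lu by simp
    have pI: "(i, j) \<in> I" using i j by (simp add: I indices_def)
    have Rp: "Rx F (xx s1) (i, j) = R (i, j)" by (simp add: Rx_def xij)
    define h where "h = fst (R (i, j))"
    define ys where "ys = snd (R (i, j))"
    have run: "run_at D1 (i, j) (h, ys)" using disk_okD[OF b(8) iL j] unfolding Rp h_def ys_def .
    note rb = run_bounds[OF Q run iL]
    have ad: "rad i j 0 < A" using rad_less[OF Q iL j, of 0] by simp
    define k where "k = n F (i, j)"
    have k: "h + k \<le> length ys"
      using split(2)[OF b(4) pI] rb(1) by (simp add: k_def n_def rem_def h_def ys_def)
    define s2 where "s2 = s1\<lparr>tmp := prod_encode (h, length ys)\<rparr>"
    have pe: "prod_encode (h, length ys) < V0 ^ 4" "prod_encode (h + k, length ys) < V0 ^ 4"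
      using prod_encode_less[of h V0 "length ys"] prod_encode_less[of "h + k" V0 "length ys"] rb k V0 by auto
    have fs2: "frame s2 = frame s0" using fs by (simp add: s2_def frame_def)
    have ok2: "okf s2" using b(1) pe by (simp add: s2_def okf_def)
    have okm2: "okm s2" using okm_frame[OF fs2] ok0 by simp
    define w where "w = prod_encode (h + k, length ys) # replicate (B - 1) 0"
    define D2 where "D2 = put B (rad i j 0) w D1"
    have wV: "\<forall>x\<in>set w. x < V" using pe V_ge V0 by (auto simp: w_def)
    have lw: "length w = B" using B by (simp add: w_def)
    have D2: "disk_ok D2 (Rx F (Suc (xx s1)))"
    proof -
      have "disk_ok D2 ((Rx F (xx s1))((i, j) := (h + k, ys)))"
        unfolding D2_def w_def
        by (rule disk_ok_meta[OF b(8) iL j k]) (use run in \<open>auto simp: run_at_def\<close>)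
      also have "(Rx F (xx s1))((i, j) := (h + k, ys)) = Rx F (Suc (xx s1))"
      proof (rule ext)
        fix p :: "nat \<times> nat"
        show "((Rx F (xx s1))((i, j) := (h + k, ys))) p = Rx F (Suc (xx s1)) p"
        proof (cases "p = (i, j)")
          case True
          then show ?thesis using i j by (simp add: Rx_def xij h_def ys_def k_def)
        next
          case False
          have "fst p * f + snd p \<noteq> xx s1" if "snd p < f"
          proof
            assume "fst p * f + snd p = xx s1"
            then have "i = (fst p * f + snd p) div f" "j = (fst p * f + snd p) mod f" by (simp_all add: i_def j_def)
            then show False using False that by (cases p) auto
          qed
          then have "snd p < f \<Longrightarrow> fst p * f + snd p < Suc (xx s1) \<longleftrightarrow> fst p * f + snd p < xx s1"
            by (auto simp: less_Suc_eq)
          then show ?thesis using False unfolding Rx_def by auto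
        qed
      qed
      finally show ?thesis .
    qed
    have D2V: "\<forall>x. D2 x < V"
      using b(6) wV lw B by (auto simp: D2_def put_div)
    have D2f: "\<forall>x. (\<forall>(i, j)\<in>I. x div B \<noteq> rad i j 0) \<longrightarrow> D2 x = D0 x"
    proof (intro allI impI)
      fix x assume x: "\<forall>(i, j)\<in>I. x div B \<noteq> rad i j 0"
      then have "x div B \<noteq> rad i j 0" using pI by blast
      then show "D2 x = D0 x" using b(7) x by (simp add: D2_def put_div)
    qed
    have "hd (block B D1 (rad i j 0)) = prod_encode (h, length ys)"
      using run_atD(1)[OF run] by (simp add: block_hd)
    then have rd: "hoareM (\<lambda>s D T. s = s1 \<and> D = D1 \<and> T = T1)
        (Rd (\<lambda>s. rad (xx s div f) (xx s mod f) 0) (\<lambda>b s. s\<lparr>tmp := hd b\<rparr>)) (\<lambda>s D T. s = s2 \<and> D = D1 \<and> T = T1 + 1)"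
      by (intro hoare_Rd) (use ad okm1 b(1) in \<open>auto simp: i_def j_def ok_def s2_def\<close>)
    have x2: "xx s2 = xx s1" "fr s2 = F" by (simp_all add: s2_def F_def)
    have tk: "taken s2 (i, j) = k" by (simp add: taken_def k_def n_def x2)
    have wr: "hoareM (\<lambda>s D T. s = s2 \<and> D = D1 \<and> T = T1 + 1)
        (Wr (\<lambda>s. rad (xx s div f) (xx s mod f) 0)
          (\<lambda>s. prod_encode (fst (prod_decode (tmp s)) + taken s (xx s div f, xx s mod f), snd (prod_decode (tmp s)))
             # replicate (B - 1) 0)) (\<lambda>s D T. s = s2 \<and> D = D2 \<and> T = T1 + 2)"
    proof (rule hoare_Wr)
      fix s D T assume e: "s = s2 \<and> D = D1 \<and> T = T1 + 1"
      have weq: "prod_encode (fst (prod_decode (tmp s)) + taken s (xx s div f, xx s mod f), snd (prod_decode (tmp s)))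
             # replicate (B - 1) 0 = w"
        using e tk by (simp add: w_def x2 i_def[symmetric] j_def[symmetric]) (simp add: s2_def)
      show "ok s \<and> rad (xx s div f) (xx s mod f) 0 < A \<and>
        length (prod_encode (fst (prod_decode (tmp s)) + taken s (xx s div f, xx s mod f), snd (prod_decode (tmp s)))
             # replicate (B - 1) 0) = B \<and>
        (\<forall>x\<in>set (prod_encode (fst (prod_decode (tmp s)) + taken s (xx s div f, xx s mod f), snd (prod_decode (tmp s)))
             # replicate (B - 1) 0). x < V) \<and>
        s = s2 \<and> put B (rad (xx s div f) (xx s mod f) 0)
          (prod_encode (fst (prod_decode (tmp s)) + taken s (xx s div f, xx s mod f), snd (prod_decode (tmp s)))
             # replicate (B - 1) 0) D = D2 \<and> T + 1 = T1 + 2"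
        unfolding weq using e ad ok2 okm2 wV lw x2 by (simp add: ok_def D2_def i_def j_def)
    qed
    have bs: "hoareM (\<lambda>s D T. s = s2 \<and> D = D2 \<and> T = T1 + 2) (Basic (\<lambda>s. s\<lparr>xx := xx s + 1\<rparr>))
        (\<lambda>s D T. inv2 s D T \<and> u * f - xx s < m)"
    proof (rule hoare_Basic)
      fix s D T assume e: "s = s2 \<and> D = D2 \<and> T = T1 + 2"
      have tm: "T1 + 2 \<le> T0 + 4 * f * (u - l) + 2 * (Suc (xx s1) - l * f)" "u * f - Suc (xx s1) < m"
        using b(2,3,5) a by linarith+
      have "okf (s2\<lparr>xx := xx s2 + 1\<rparr>)" using ok2 b(3) uf x2 by (simp add: okf_def)
      moreover have "frame (s2\<lparr>xx := xx s2 + 1\<rparr>) = frame s0" using fs2 by (simp add: frame_def)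
      ultimately show "inv2 (s\<lparr>xx := xx s + 1\<rparr>) D T \<and> u * f - xx (s\<lparr>xx := xx s + 1\<rparr>) < m"
        using e b(2-4) D2 D2V D2f x2 tm unfolding inv2_def by simp
    qed
    show "hoareM (\<lambda>s D T. s = s1 \<and> D = D1 \<and> T = T1)
      (Rd (\<lambda>s. rad (xx s div f) (xx s mod f) 0) (\<lambda>b s. s\<lparr>tmp := hd b\<rparr>) ;;
        Wr (\<lambda>s. rad (xx s div f) (xx s mod f) 0)
          (\<lambda>s. prod_encode (fst (prod_decode (tmp s)) + taken s (xx s div f, xx s mod f), snd (prod_decode (tmp s)))
             # replicate (B - 1) 0) ;;
        Basic (\<lambda>s. s\<lparr>xx := xx s + 1\<rparr>)) (\<lambda>s D T. inv2 s D T \<and> u * f - xx s < m)"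
      by (rule hoare_Seq[OF rd hoare_Seq[OF wr bs]])
  qed
  have fin: "?post s D T" if iv: "inv2 s D T" "\<not> xx s < hi s * f" for s D T
  proof -
    have fs: "frame s = frame s0" using iv by (simp add: inv2_def)
    have xu: "xx s = u * f" using iv fr0[OF fs] by (auto simp: inv2_def)
    define F where "F = fr s"
    have b: "okf s" "smallest U fst F (\<Sum>p\<in>I. tagp p)" "disk_ok D (Rx F (u * f))"
      using iv xu by (auto simp: inv2_def F_def)
    note sp = split[OF b(2)]
    have RI: "Rx F (u * f) p = (fst (R p) + n F p, snd (R p))" if "p \<in> I" for p
    proof -
      have "fst p * f + snd p < fst p * f + f" using that by (auto simp: I indices_def)
      also have "\<dots> = (fst p + 1) * f" by simp
      also have "\<dots> \<le> u * f" using that by (intro mult_le_mono1) (auto simp: I indices_def)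
      finally show ?thesis using that by (auto simp: Rx_def I indices_def)
    qed
    have Rn: "Rx F (u * f) p = R p" if "p \<notin> I" for p
    proof -
      have "\<not> (l \<le> fst p \<and> snd p < f \<and> fst p * f + snd p < u * f)"
      proof
        assume c: "l \<le> fst p \<and> snd p < f \<and> fst p * f + snd p < u * f"
        then have "fst p * f < u * f" by linarith
        then have "fst p < u" by simp
        then show False using c that by (cases p) (auto simp: I indices_def)
      qed
      then show ?thesis by (auto simp: Rx_def)
    qed
    have rI: "rem (Rx F (u * f)) p = drop (n F p) (rem R p)" if "p \<in> I" for p
      using RI[OF that] by (simp add: rem_def add.commute)
    have drp: "\<exists>m. rem (Rx F (u * f)) p = drop m (rem R p)" for p
      using rI Rn[of p] by (cases "p \<in> I") (auto simp: rem_def intro: exI[of _ 0])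
    have T: "T \<le> T0 + 6 * f * (hi s0 - lo s0)"
    proof -
      have "T \<le> T0 + 4 * f * (u - l) + 2 * (u * f - l * f)" using iv xu by (simp add: inv2_def)
      also have "u * f - l * f = f * (u - l)" by (simp add: algebra_simps)
      finally show ?thesis by (simp add: u_def l_def)
    qed
    have "\<exists>R'. disk_ok D R' \<and> (\<forall>p. p \<notin> I \<longrightarrow> R' p = R p) \<and> (\<forall>p. \<exists>n. rem R' p = drop n (rem R p)) \<and>
        (\<Sum>p\<in>I. mset (rem R p)) = mset (map fst (fr s)) + (\<Sum>p\<in>I. mset (rem R' p)) \<and>
        (\<forall>x\<in>set (fr s). \<forall>p\<in>I. \<forall>y\<in>set (rem R' p). fst x \<le> y) \<and>
        (length (fr s) = U \<or> (\<forall>p\<in>I. rem R' p = []))"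
    proof (intro exI[of _ "Rx F (u * f)"] conjI)
      show "(\<Sum>p\<in>I. mset (rem R p)) = mset (map fst (fr s)) + (\<Sum>p\<in>I. mset (rem (Rx F (u * f)) p))"
        using sp(1) rI by (simp add: F_def n_def)
      show "\<forall>x\<in>set (fr s). \<forall>p\<in>I. \<forall>y\<in>set (rem (Rx F (u * f)) p). fst x \<le> y"
        using sp(3) rI by (simp add: F_def n_def)
      show "length (fr s) = U \<or> (\<forall>p\<in>I. rem (Rx F (u * f)) p = [])"
        using sp(4) rI by (auto simp: F_def n_def)
    qed (use b(3) Rn drp in auto)
    moreover have "sorted (map fst (fr s))" using b(2) by (simp add: smallest_def F_def)
    ultimately show ?thesis using iv fs b(1) T unfolding inv2_def by blast
  qed
  show ?thesis
    unfolding select_def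
    by (rule hoare_Seq[OF hoare_Basic[where Q = inv] hoare_Seq[OF hoare_While[where I = inv and m = "\<lambda>s D T. u - lv s"
        and Q = "\<lambda>s D T. inv s D T \<and> \<not> lv s < hi s", OF level] hoare_Seq[OF hoare_Basic[where Q = inv2]
        hoare_While[where I = inv2 and m = "\<lambda>s D T. u * f - xx s", OF upd]]]])
      (use start start2 fin in blast)+
qed

end

lemma exec_SeqE:
  assumes "exec B ok A V (c ;; d) s D t s'' D''"
  obtains t1 t2 s' D' where "exec B ok A V c s D t1 s' D'" "exec B ok A V d s' D' t2 s'' D''" "t = t1 + t2"
  using assms by (cases rule: exec.cases) auto

lemma hoare_assoc:
  assumes "hoare B ok A V P ((c1 ;; c2) ;; c3) Z"
  shows "hoare B ok A V P (c1 ;; c2 ;; c3) Z"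
  unfolding hoare_def
proof (intro allI impI)
  fix s D T assume "P s D T"
  then obtain t s' D' where 1: "exec B ok A V ((c1 ;; c2) ;; c3) s D t s' D'" "Z s' D' (T + t)"
    using assms unfolding hoare_def by blast
  from 1(1) obtain t1 s1 D1 t2 s2 D2 t3 where
    2: "exec B ok A V c1 s D t1 s1 D1" "exec B ok A V c2 s1 D1 t2 s2 D2" "exec B ok A V c3 s2 D2 t3 s' D'"
      "t = t1 + t2 + t3"
    by (elim exec_SeqE) simp
  have "exec B ok A V (c1 ;; c2 ;; c3) s D t s' D'"
    using exec_Seq[OF 2(1) exec_Seq[OF 2(2,3)]] unfolding 2(4) by (simp only: add.assoc)
  then show "\<exists>t s' D'. exec B ok A V (c1 ;; c2 ;; c3) s D t s' D' \<and> Z s' D' (T + t)"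
    using 1(2) by blast
qed

lemma hoare_assoc':
  assumes "hoare B ok A V P (c1 ;; c2 ;; c3) Z"
  shows "hoare B ok A V P ((c1 ;; c2) ;; c3) Z"
  unfolding hoare_def
proof (intro allI impI)
  fix s D T assume "P s D T"
  then obtain t s' D' where 1: "exec B ok A V (c1 ;; c2 ;; c3) s D t s' D'" "Z s' D' (T + t)"
    using assms unfolding hoare_def by blast
  from 1(1) obtain t1 s1 D1 t2 s2 D2 t3 where
    2: "exec B ok A V c1 s D t1 s1 D1" "exec B ok A V c2 s1 D1 t2 s2 D2" "exec B ok A V c3 s2 D2 t3 s' D'"
      "t = t1 + t2 + t3"
    by (elim exec_SeqE) simp
  have "exec B ok A V ((c1 ;; c2) ;; c3) s D t s' D'"
    using exec_Seq[OF exec_Seq[OF 2(1,2)] 2(3)] unfolding 2(4) by (simp only: add.assoc)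
  then show "\<exists>t s' D'. exec B ok A V ((c1 ;; c2) ;; c3) s D t s' D' \<and> Z s' D' (T + t)"
    using 1(2) by blast
qed

context em
begin

subsection \<open>Flushing and refilling\<close>

definition padded :: "nat list \<Rightarrow> nat list" where
  "padded ws = ws @ replicate (B - length ws) 0"

definition write_out :: "st com" where
  "write_out = While (\<lambda>s. wb s \<noteq> [])
     (Wr (\<lambda>s. rad (wi s) (wj s) (1 + wp s)) (\<lambda>s. padded (map list_encode (take B (wb s)))) ;;
      Basic (\<lambda>s. s\<lparr>wb := drop B (wb s), wp := wp s + 1\<rparr>))"

definition write_meta :: "st com" where
  "write_meta = Wr (\<lambda>s. rad (wi s) (wj s) 0) (\<lambda>s. prod_encode (0, tot s) # replicate (B - 1) 0)"

text \<open>Merging by repeated selection: the \<open>U\<close> least items of the level are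
  appended to the new run until fewer than \<open>U\<close> come. The target slot is a digit of
  \<open>nfl s - 1\<close>, the number of earlier flushes.\<close>

definition merge :: "st com" where
  "merge = Basic (\<lambda>s. s\<lparr>wi := ci s + 1, wj := (nfl s - 1) div f ^ (ci s + 1) mod f, wp := 0, tot := 0, mg := 1,
       lo := ci s, hi := ci s + 1\<rparr>) ;;
     While (\<lambda>s. mg s \<noteq> 0)
       (select ;;
        Basic (\<lambda>s. s\<lparr>wb := map fst (fr s), tot := tot s + length (fr s), mg := (if length (fr s) < U then 0 else 1)\<rparr>) ;;
        write_out) ;;
     write_meta"

text \<open>The \<open>U\<close> largest items leave memory. Incrementing \<open>nfl\<close> is an
  addition with carry in base \<open>f\<close>: a carry means that a level has \<open>f\<close>
  runs, and these are merged.\<close>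

definition flush :: "st com" where
  "flush = Basic (\<lambda>s. let m = length (heap s) - U in
       s\<lparr>wb := drop m (heap s), heap := take m (heap s), safe := (if onD s = 0 then m else min (safe s) m),
         onD := onD s + U, wi := 0, wj := nfl s mod f, wp := 0, tot := U\<rparr>) ;;
     write_out ;; write_meta ;;
     Basic (\<lambda>s. s\<lparr>nfl := nfl s + 1, ci := 0\<rparr>) ;;
     While (\<lambda>s. nfl s mod f ^ (ci s + 1) = 0) (merge ;; Basic (\<lambda>s. s\<lparr>ci := ci s + 1\<rparr>))"

definition refill :: "st com" where
  "refill = Basic (\<lambda>s. s\<lparr>lo := 0, hi := L\<rparr>) ;; select ;;
     Basic (\<lambda>s. s\<lparr>heap := sort (heap s @ map fst (fr s)), safe := length (fr s), onD := onD s - length (fr s)\<rparr>)"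

section \<open>Correctness of writing and merging runs\<close>

lemma f_le_pos: "f ^ (i + 1) \<le> f ^ i * U"
  using U by simp

lemma rad_ge: "rbase \<le> rad i j b"
  by (simp add: rad_def)

lemma put_low: "x < rbase * B \<Longrightarrow> rbase \<le> a \<Longrightarrow> put B a ws D x = D x"
proof -
  assume "x < rbase * B" "rbase \<le> a"
  then have "x div B \<noteq> a" using less_mult_imp_div_less[of x rbase B] by auto
  then show ?thesis by (simp add: put_div)
qed

lemma put_less_V:
  assumes "\<forall>x. D x < V" "\<forall>x\<in>set w. x < V" "length w = B"
  shows "\<forall>x. put B a w D x < V"
  using assms B by (auto simp: put_div)

definition data :: "(nat \<Rightarrow> nat) \<Rightarrow> nat \<Rightarrow> nat \<Rightarrow> nat list list \<Rightarrow> bool" where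
  "data D i j ys \<longleftrightarrow> (\<forall>p<length ys. D (rad i j 1 * B + p) = list_encode (ys ! p))"

text \<open>Since \<open>B\<close> divides \<open>U\<close>, a full portion of \<open>U\<close>
  items ends at a block boundary, where the next portion of the same run continues. The slot holds
  an exhausted run, hence \<open>disk_ok D R\<close> persists.\<close>

lemma write_out:
  assumes Q: "3 * U \<le> Q" and dk: "disk_ok D0 R" and ok0: "okm s0" "okf s0"
    and ij: "wi s0 < L" "wj s0 < f" and emp: "rem R (wi s0, wj s0) = []"
    and dat: "data D0 (wi s0) (wj s0) ys" "length ys = wp s0 * B"
    and len: "length ys + length (wb s0) \<le> f ^ wi s0 * U" "length (wb s0) \<le> U"
    and DV: "\<forall>x. D0 x < V"
  shows "hoareM (\<lambda>s D T. s = s0 \<and> D = D0 \<and> T = T0) write_out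
    (\<lambda>s D T. s = s0\<lparr>wb := [], wp := wp s\<rparr> \<and> T \<le> T0 + f \<and> disk_ok D R \<and> data D (wi s0) (wj s0) (ys @ wb s0) \<and>
      (\<forall>x. D x < V) \<and> (\<forall>x<rbase * B. D x = D0 x) \<and> (length (wb s0) = U \<longrightarrow> wp s * B = length (ys @ wb s0)) \<and>
      okm s \<and> okf s)"
    (is "hoareM _ _ ?post")
proof -
  define i where "i = wi s0"
  define j where "j = wj s0"
  define ws where "ws = wb s0"
  define w0 where "w0 = wp s0"
  have iL: "i < L" and jf: "j < f" using ij by (auto simp: i_def j_def)
  have wsX: "set ws \<subseteq> X" using ok0(1) by (simp add: okm_def ws_def)
  have lys: "length ys = w0 * B" using dat by (simp add: w0_def)
  define S where "S = (\<lambda>k. s0\<lparr>wb := drop (k * B) ws, wp := w0 + k\<rparr>)"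
  define P where "P = (\<lambda>D k. (\<forall>p<length ys + min (k * B) (length ws). D (rad i j 1 * B + p) = list_encode ((ys @ ws) ! p)) \<and>
    disk_ok D R \<and> (\<forall>x. D x < V) \<and> (\<forall>x<rbase * B. D x = D0 x))"
  define inv where "inv = (\<lambda>s D T. \<exists>k. s = S k \<and> T = T0 + k \<and> k * B < length ws + B \<and> P D k)"
  have pB: "f ^ i * U < V0" using pos_bound[OF Q, of i] iL by simp
  have total: "w0 * B + length ws \<le> f ^ (i + 1) * B"
  proof -
    have "f ^ i * U = f ^ (i + 1) * B" by (simp add: U_def mult_ac)
    note e = this
    show ?thesis unfolding e[symmetric] using len lys by (simp add: i_def ws_def)
  qed
  have kf: "k \<le> f" if "k * B < length ws + B" for k
  proof -
    have "k * B < (f + 1) * B" using that len by (simp add: ws_def U_def)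
    then have "k < f + 1" by (simp only: mult_less_cancel2)
    then show ?thesis by simp
  qed
  have wk: "w0 + k \<le> f ^ (i + 1)" if "k * B < length ws + B" for k
  proof -
    have "(w0 + k) * B < (f ^ (i + 1) + 1) * B" using that total by (simp add: algebra_simps)
    then have "w0 + k < f ^ (i + 1) + 1" by (simp only: mult_less_cancel2)
    then show ?thesis by simp
  qed
  have okS: "okm (S k) \<and> okf (S k)" if "k * B < length ws + B" for k
  proof -
    have "w0 + k < V0" using wk[OF that] f_le_pos[of i] pB by linarith
    then show ?thesis using ok0 wsX unfolding okm_def okf_def S_def ws_def
      by (auto dest!: in_set_dropD)
  qed
  have S0: "S 0 = s0" by (simp add: S_def ws_def w0_def)
  have pre: "inv s0 D0 T0"
    unfolding inv_def P_def
    using dk DV dat B by (intro exI[of _ 0]) (auto simp: S0 data_def i_def j_def nth_append)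
  have body: "hoareM (\<lambda>s D T. inv s D T \<and> wb s \<noteq> [] \<and> length (wb s) = n)
     (Wr (\<lambda>s. rad (wi s) (wj s) (1 + wp s)) (\<lambda>s. padded (map list_encode (take B (wb s)))) ;;
      Basic (\<lambda>s. s\<lparr>wb := drop B (wb s), wp := wp s + 1\<rparr>))
     (\<lambda>s D T. inv s D T \<and> length (wb s) < n)" for n
  proof (rule hoare_Seq[where R = "\<lambda>s D T. \<exists>k. s = S k \<and> T = T0 + k + 1 \<and> k * B < length ws \<and> n = length ws - k * B \<and> P D (Suc k)"])
    show "hoareM (\<lambda>s D T. inv s D T \<and> wb s \<noteq> [] \<and> length (wb s) = n)
      (Wr (\<lambda>s. rad (wi s) (wj s) (1 + wp s)) (\<lambda>s. padded (map list_encode (take B (wb s)))))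
      (\<lambda>s D T. \<exists>k. s = S k \<and> T = T0 + k + 1 \<and> k * B < length ws \<and> n = length ws - k * B \<and> P D (Suc k))"
    proof (rule hoare_Wr)
      fix s D T assume a: "inv s D T \<and> wb s \<noteq> [] \<and> length (wb s) = n"
      then obtain k where k: "s = S k" "T = T0 + k" "k * B < length ws + B" "P D k" by (auto simp: inv_def)
      have kl: "k * B < length ws" "n = length ws - k * B" using a k by (auto simp: S_def)
      have "(w0 + k) * B < f ^ (i + 1) * B" using kl(1) total by (simp add: algebra_simps)
      then have "w0 + k < f ^ (i + 1)" by (simp only: mult_less_cancel2)
      then have wk1: "1 + (w0 + k) \<le> f ^ (i + 1)" by simp
      let ?a = "rad i j (1 + (w0 + k))"
      let ?b = "take B (drop (k * B) ws)"
      let ?w = "padded (map list_encode ?b)"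
      have lw: "length ?w = B" by (simp add: padded_def)
      have "\<forall>x\<in>set ?b. list_encode x < V0" using wsX X by (auto dest!: in_set_takeD in_set_dropD)
      then have wV: "\<forall>x\<in>set ?w. x < V" using V_ge V0 by (auto simp: padded_def intro: less_le_trans)
      have e: "wi s = i" "wj s = j" "wp s = w0 + k" "wb s = drop (k * B) ws"
        by (simp_all add: k(1) S_def i_def j_def)
      have PD: "P (put B ?a ?w D) (Suc k)"
        unfolding P_def
      proof (intro conjI allI impI)
        fix p assume p: "p < length ys + min (Suc k * B) (length ws)"
        have lt: "p < f ^ i * U" using p len by (simp add: i_def ws_def)
        note rw = run_words(1)[OF lt, of j]
        show "put B ?a ?w D (rad i j 1 * B + p) = list_encode ((ys @ ws) ! p)"
        proof (cases "p div B = w0 + k")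
          case True
          have pe: "p = (w0 + k) * B + p mod B" using True div_mult_mod_eq[of p B] by simp
          have pm: "p mod B < B" using B by simp
          have m: "p mod B < length ?b" using p pe lys pm by (simp add: algebra_simps)
          have "put B ?a ?w D (rad i j 1 * B + p) = ?w ! ((rad i j 1 * B + p) mod B)"
            unfolding put_div rw True by simp
          also have "(rad i j 1 * B + p) mod B = p mod B" by simp
          also have "?w ! (p mod B) = list_encode (ws ! (k * B + p mod B))"
            using m kl(1) by (simp add: padded_def nth_append nth_drop)
          also have "ws ! (k * B + p mod B) = (ys @ ws) ! p"
          proof -
            have "(w0 + k) * B = w0 * B + k * B" by (rule add_mult_distrib)
            then have "\<not> p < length ys" "p - length ys = k * B + p mod B" using pe lys by linarith+
            then show ?thesis unfolding nth_append by simp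
          qed
          finally show ?thesis .
        next
          case False
          have "p < (w0 + Suc k) * B" using p lys by (simp add: algebra_simps)
          then have "p div B < w0 + Suc k" by (rule less_mult_imp_div_less)
          then have "p div B < w0 + k" using False by simp
          then have "p < (w0 + k) * B" using B by (simp add: div_less_iff_less_mult)
          then have "p < length ys + min (k * B) (length ws)" using kl(1) lys by (simp add: algebra_simps)
          then have "D (rad i j 1 * B + p) = list_encode ((ys @ ws) ! p)" using k(4) unfolding P_def by blast
          moreover have "rad i j (1 + p div B) \<noteq> ?a" using False by (simp add: rad_def)
          ultimately show ?thesis unfolding put_div rw by simp
        qed
      next
        show "disk_ok (put B ?a ?w D) R"
          unfolding disk_ok_def
        proof
          fix q assume q: "q \<in> {..<L} \<times> {..<f}"
          obtain i' j' where ij': "q = (i', j')" "i' < L" "j' < f" using q by auto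
          have dkD: "disk_ok D R" using k(4) by (simp add: P_def)
          have "run_at (put B ?a ?w D) (i', j') (fst (R (i', j')), snd (R (i', j')))"
          proof (rule run_at_put[OF disk_okD[OF dkD ij'(2,3)]])
            fix b assume b: "b \<le> f ^ (i' + 1)" "b = 0 \<or> fst (R (i', j')) < length (snd (R (i', j')))"
            show "?a \<noteq> rad i' j' b"
            proof
              assume "?a = rad i' j' b"
              from rad_inj[OF this jf ij'(3) wk1 b(1)] have "i = i'" "j = j'" "b = 1 + (w0 + k)" by auto
              then show False using b(2) emp by (auto simp: rem_def i_def j_def)
            qed
          qed
          then show "run_at (put B ?a ?w D) q (R q)" using ij' by simp
        qed
      next
        fix x show "put B ?a ?w D x < V" using k(4) wV lw B by (auto simp: P_def put_div)
      next
        fix x assume "x < rbase * B"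
        then show "put B ?a ?w D x = D0 x" using put_low[OF _ rad_ge] k(4) by (simp add: P_def)
      qed
      have "?a < A" by (rule rad_less[OF Q iL jf wk1])
      then show "ok s \<and> rad (wi s) (wj s) (1 + wp s) < A \<and> length (padded (map list_encode (take B (wb s)))) = B \<and>
          (\<forall>x\<in>set (padded (map list_encode (take B (wb s)))). x < V) \<and>
          (\<exists>k. s = S k \<and> T + 1 = T0 + k + 1 \<and> k * B < length ws \<and> n = length ws - k * B \<and>
            P (put B (rad (wi s) (wj s) (1 + wp s)) (padded (map list_encode (take B (wb s)))) D) (Suc k))"
        unfolding e using okS[OF k(3)] k(1,2) kl PD lw wV by (auto simp: ok_def intro!: exI[of _ k])
    qed
    show "hoareM (\<lambda>s D T. \<exists>k. s = S k \<and> T = T0 + k + 1 \<and> k * B < length ws \<and> n = length ws - k * B \<and> P D (Suc k))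
      (Basic (\<lambda>s. s\<lparr>wb := drop B (wb s), wp := wp s + 1\<rparr>)) (\<lambda>s D T. inv s D T \<and> length (wb s) < n)"
    proof (rule hoare_Basic)
      fix s D T assume "\<exists>k. s = S k \<and> T = T0 + k + 1 \<and> k * B < length ws \<and> n = length ws - k * B \<and> P D (Suc k)"
      then obtain k where k: "s = S k" "T = T0 + k + 1" "k * B < length ws" "n = length ws - k * B" "P D (Suc k)" by blast
      have e: "s\<lparr>wb := drop B (wb s), wp := wp s + 1\<rparr> = S (Suc k)" by (simp add: k(1) S_def)
      have "inv (S (Suc k)) D T"
        unfolding inv_def by (rule exI[of _ "Suc k"]) (use k in simp)
      moreover have "length (wb (S (Suc k))) < n" using k B by (simp add: S_def)
      ultimately show "inv (s\<lparr>wb := drop B (wb s), wp := wp s + 1\<rparr>) D T \<and> length (wb (s\<lparr>wb := drop B (wb s), wp := wp s + 1\<rparr>)) < n"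
        unfolding e ..
    qed
  qed
  have fin: "?post s D T" if iv: "inv s D T" "\<not> wb s \<noteq> []" for s D T
  proof -
    obtain k where k: "s = S k" "T = T0 + k" "k * B < length ws + B" "P D k" using iv by (auto simp: inv_def)
    have kl: "length ws \<le> k * B" using iv k(1) by (simp add: S_def)
    have "wp s * B = length (ys @ ws)" if "length ws = U"
    proof -
      have "f * B \<le> k * B" using kl that by (simp add: U_def)
      then have "k = f" using kf[OF k(3)] B by simp
      then show ?thesis using that lys k(1) by (simp add: S_def U_def algebra_simps)
    qed
    moreover have "s = s0\<lparr>wb := [], wp := wp s\<rparr>" using k(1) kl by (simp add: S_def)
    moreover have "data D i j (ys @ ws)" using k(4) kl by (simp add: P_def data_def min_def)
    ultimately show ?thesis using k kf[OF k(3)] okS[OF k(3)] by (simp add: P_def i_def j_def ws_def)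
  qed
  show ?thesis
    unfolding write_out_def
    by (rule hoare_While[where I = inv and m = "\<lambda>s D T. length (wb s)", OF body]) (use pre fin in blast)+
qed

lemma write_meta:
  assumes Q: "3 * U \<le> Q" and dk: "disk_ok D0 R" and ok0: "okm s0" "okf s0"
    and ij: "wi s0 < L" "wj s0 < f"
    and dat: "data D0 (wi s0) (wj s0) ys" "tot s0 = length ys" "sorted ys" "set ys \<subseteq> X" "length ys \<le> f ^ wi s0 * U"
    and DV: "\<forall>x. D0 x < V"
  shows "hoareM (\<lambda>s D T. s = s0 \<and> D = D0 \<and> T = T0) write_meta
    (\<lambda>s D T. s = s0 \<and> T = T0 + 1 \<and> disk_ok D (R((wi s0, wj s0) := (0, ys))) \<and>
      (\<forall>x. D x < V) \<and> (\<forall>x<rbase * B. D x = D0 x))"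
  unfolding write_meta_def
proof (rule hoare_Wr)
  fix s D T assume s: "s = s0 \<and> D = D0 \<and> T = T0"
  let ?w = "prod_encode (0, length ys) # replicate (B - 1) 0"
  have "length ys < V0" using dat(5) pos_bound[OF Q, of "wi s0"] ij by simp
  then have "prod_encode (0, length ys) < V0 ^ 4" using prod_encode_less[of 0 V0 "length ys"] V0 by auto
  then have w: "\<forall>x\<in>set ?w. x < V" using V_ge V0 by auto
  have lw: "length ?w = B" using B by simp
  have "disk_ok (put B (rad (wi s0) (wj s0) 0) ?w D0) (R((wi s0, wj s0) := (0, ys)))"
    by (rule disk_ok_meta[OF dk ij]) (use dat in \<open>auto simp: data_def\<close>)
  moreover have "\<forall>x. put B (rad (wi s0) (wj s0) 0) ?w D0 x < V" by (rule put_less_V[OF DV w lw])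
  moreover have "\<forall>x<rbase * B. put B (rad (wi s0) (wj s0) 0) ?w D0 x = D0 x" using put_low[OF _ rad_ge] by simp
  moreover have "rad (wi s0) (wj s0) 0 < A" using rad_less[OF Q ij, of 0] by simp
  ultimately show "ok s \<and> rad (wi s) (wj s) 0 < A \<and> length (prod_encode (0, tot s) # replicate (B - 1) 0) = B \<and>
      (\<forall>x\<in>set (prod_encode (0, tot s) # replicate (B - 1) 0). x < V) \<and>
      s = s0 \<and> T + 1 = T0 + 1 \<and> disk_ok (put B (rad (wi s) (wj s) 0) (prod_encode (0, tot s) # replicate (B - 1) 0) D)
        (R((wi s0, wj s0) := (0, ys))) \<and>
      (\<forall>x. put B (rad (wi s) (wj s) 0) (prod_encode (0, tot s) # replicate (B - 1) 0) D x < V) \<and>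
      (\<forall>x<rbase * B. put B (rad (wi s) (wj s) 0) (prod_encode (0, tot s) # replicate (B - 1) 0) D x = D0 x)"
    using s w lw ok0 dat(2) by (simp add: ok_def)
qed

text \<open>The fields that merging does not change.\<close>

definition mframe :: "st \<Rightarrow> _" where
  "mframe s = ((heap s, safe s, onD s, nfl s, sta s, ib s, ibuf s, prv s, ip s, obuf s, ob s), ci s)"

definition total :: "(nat \<times> nat \<Rightarrow> nat \<times> nat list list) \<Rightarrow> (nat \<times> nat) set \<Rightarrow> nat list multiset" where
  "total R I = (\<Sum>p\<in>I. mset (rem R p))"

lemma rem_bounds:
  assumes "disk_ok D R" "i < L" "j < f"
  shows "length (rem R (i, j)) \<le> f ^ i * U" "set (rem R (i, j)) \<subseteq> X" "sorted (rem R (i, j))"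
  using disk_okD[OF assms] by (auto simp: run_at_def rem_def dest!: in_set_dropD intro: sorted_wrt_drop)

lemma total_level_size:
  assumes "disk_ok D R" "c < L"
  shows "size (total R (indices c (Suc c))) \<le> f ^ (c + 1) * U"
proof -
  have I: "indices c (Suc c) = Pair c ` {..<f}" by (auto simp: indices_def)
  have "size (total R (indices c (Suc c))) = (\<Sum>j<f. length (rem R (c, j)))"
    unfolding total_def I by (subst sum.reindex) (simp_all add: inj_on_def size_multiset_sum)
  also have "\<dots> \<le> (\<Sum>j<f. f ^ c * U)" using rem_bounds[OF assms] by (intro sum_mono) auto
  finally show ?thesis by simp
qed

lemma total_insert:
  assumes "finite I" "p \<notin> I"
  shows "total R (insert p I) = mset (rem R p) + total R I"
  using assms by (simp add: total_def)

lemma total_cong: "(\<And>p. p \<in> I \<Longrightarrow> R p = R' p) \<Longrightarrow> total R I = total R' I"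
  unfolding total_def by (intro sum.cong) (auto simp: rem_def)

lemma total_split: "J \<subseteq> I \<Longrightarrow> finite I \<Longrightarrow> total R I = total R (I - J) + total R J"
  unfolding total_def by (rule sum.subset_diff)

lemma in_total: "finite I \<Longrightarrow> y \<in># total R I \<longleftrightarrow> (\<exists>p\<in>I. y \<in> set (rem R p))"
  by (simp add: total_def set_mset_sum)

lemma total_empty: "finite I \<Longrightarrow> total R I = {#} \<longleftrightarrow> (\<forall>p\<in>I. rem R p = [])"
  unfolding total_def by (induction I rule: finite_induct) auto

lemma hoare_after:
  assumes "hoareM P c Z" "\<And>s D T. Z s D T \<Longrightarrow> hoareM (\<lambda>s' D' T'. s' = s \<and> D' = D \<and> T' = T) d Z'"
  shows "hoareM P (c ;; d) Z'"
  by (rule hoare_Seq[OF assms(1) hoare_start]) (rule assms(2))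

lemma hoare_Basic_start:
  "Z (g s0) D0 T0 \<Longrightarrow> hoareM (\<lambda>s D T. s = s0 \<and> D = D0 \<and> T = T0) (Basic g) Z"
  by (rule hoare_Basic) auto

lemma hoare_first:
  assumes "hoareM (\<lambda>s D T. s = g s0 \<and> D = D0 \<and> T = T0) d Z"
  shows "hoareM (\<lambda>s D T. s = s0 \<and> D = D0 \<and> T = T0) (Basic g ;; d) Z"
  by (rule hoare_Seq[OF hoare_Basic_start assms]) auto

text \<open>The level has at most \<open>f ^ (ci s0 + 1) * U\<close> items, so there are at most
  \<open>f ^ (ci s0 + 1) + 1\<close> rounds, each with \<open>6 * f\<close> IOs for the selection
  and \<open>f\<close> for writing; the last IO is the header.\<close>

lemma merge:
  assumes Q: "3 * U \<le> Q" and dk: "disk_ok D0 R" and ok0: "okm s0" "okf s0"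
    and c: "ci s0 + 1 < L" and DV: "\<forall>x. D0 x < V"
  defines "I \<equiv> indices (ci s0) (Suc (ci s0))" and "tgt \<equiv> (ci s0 + 1, (nfl s0 - 1) div f ^ (ci s0 + 1) mod f)"
  assumes emp: "rem R tgt = []"
  shows "hoareM (\<lambda>s D T. s = s0 \<and> D = D0 \<and> T = T0) merge
    (\<lambda>s D T. mframe s = mframe s0 \<and> okm s \<and> okf s \<and> (\<forall>x. D x < V) \<and> (\<forall>x<rbase * B. D x = D0 x) \<and>
      T \<le> T0 + 7 * f * (f ^ (ci s0 + 1) + 1) + 1 \<and>
      (\<exists>R'. disk_ok D R' \<and> (\<forall>p. p \<notin> insert tgt I \<longrightarrow> R' p = R p) \<and> total R' I = {#} \<and>
        mset (rem R' tgt) = total R I))"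
    (is "hoareM _ _ ?post")
proof -
  define cc where "cc = ci s0"
  define j where "j = (nfl s0 - 1) div f ^ (cc + 1) mod f"
  define cap where "cap = f ^ (cc + 1) * U"
  have I: "I = indices cc (Suc cc)" and tgt: "tgt = (cc + 1, j)" by (simp_all add: I_def tgt_def cc_def j_def)
  have fI: "finite I" by (simp add: I)
  have jf: "j < f" using f by (simp add: j_def)
  have cL: "cc < L" "cc + 1 < L" using c by (auto simp: cc_def)
  have tI: "tgt \<notin> I" by (auto simp: I tgt indices_def)
  have VL: "L < V0" "f < V0" using level_bound[OF Q] by auto
  define inv where "inv = (\<lambda>s D T. \<exists>R1 ys m. mframe s = mframe s0 \<and> okm s \<and> okf s \<and> wi s = cc + 1 \<and> wj s = j \<and>
    lo s = cc \<and> hi s = Suc cc \<and> (\<forall>x. D x < V) \<and> (\<forall>x<rbase * B. D x = D0 x) \<and> disk_ok D R1 \<and>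
    (\<forall>p. p \<notin> I \<longrightarrow> R1 p = R p) \<and> data D (cc + 1) j ys \<and> tot s = length ys \<and> sorted ys \<and> set ys \<subseteq> X \<and>
    total R I = mset ys + total R1 I \<and> (\<forall>x\<in>set ys. \<forall>p\<in>I. \<forall>y\<in>set (rem R1 p). x \<le> y) \<and> T \<le> T0 + 7 * f * m \<and>
    (if mg s = 0 then total R1 I = {#} \<and> m * U \<le> length ys + U else length ys = wp s * B \<and> m * U = length ys))"
  define mes where "mes = (\<lambda>s :: st. if mg s = 0 then 0 else cap + 1 - tot s)"
  have capsize: "size (total R I) \<le> cap" using total_level_size[OF dk cL(1)] by (simp add: I cap_def)
  define s1 where "s1 = s0\<lparr>wi := ci s0 + 1, wj := (nfl s0 - 1) div f ^ (ci s0 + 1) mod f, wp := 0, tot := 0, mg := 1,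
       lo := ci s0, hi := ci s0 + 1\<rparr>"
  have "j < V0" "cc + 1 < V0" "1 < V0" using jf VL cL V0 by auto
  then have ok1: "okm s1 \<and> okf s1" using ok0 by (simp add: s1_def okm_def okf_def cc_def j_def)
  have start: "inv s1 D0 T0"
    unfolding inv_def using ok1 DV dk
    by (intro exI[of _ R] exI[of _ "[]"] exI[of _ 0]) (simp add: s1_def mframe_def cc_def j_def data_def)
  have body: "hoareM (\<lambda>s D T. inv s D T \<and> mg s \<noteq> 0 \<and> mes s = n)
     (select ;;
        Basic (\<lambda>s. s\<lparr>wb := map fst (fr s), tot := tot s + length (fr s), mg := (if length (fr s) < U then 0 else 1)\<rparr>) ;;
        write_out) (\<lambda>s D T. inv s D T \<and> mes s < n)" for n
  proof (rule hoare_start)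
    fix s2 D2 T2 assume a: "inv s2 D2 T2 \<and> mg s2 \<noteq> 0 \<and> mes s2 = n"
    then obtain R1 ys m where b: "mframe s2 = mframe s0" "okm s2" "okf s2" "wi s2 = cc + 1" "wj s2 = j"
      "lo s2 = cc" "hi s2 = Suc cc" "\<forall>x. D2 x < V" "\<forall>x<rbase * B. D2 x = D0 x" "disk_ok D2 R1"
      "\<forall>p. p \<notin> I \<longrightarrow> R1 p = R p" "data D2 (cc + 1) j ys" "tot s2 = length ys" "sorted ys" "set ys \<subseteq> X"
      "total R I = mset ys + total R1 I" "\<forall>x\<in>set ys. \<forall>p\<in>I. \<forall>y\<in>set (rem R1 p). x \<le> y" "T2 \<le> T0 + 7 * f * m"
      "length ys = wp s2 * B" "m * U = length ys"
      unfolding inv_def by auto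
    have lh: "lo s2 \<le> hi s2" "hi s2 \<le> L" using b cL by auto
    note sel = select[OF Q b(10,2,3) lh b(8), of T2, unfolded b(6,7), folded I total_def]
    have lys: "length ys \<le> cap" using capsize b(16) by simp
    show "hoareM (\<lambda>s D T. s = s2 \<and> D = D2 \<and> T = T2) (select ;;
        Basic (\<lambda>s. s\<lparr>wb := map fst (fr s), tot := tot s + length (fr s), mg := (if length (fr s) < U then 0 else 1)\<rparr>) ;;
        write_out) (\<lambda>s D T. inv s D T \<and> mes s < n)"
    proof (rule hoare_after[OF sel], rule hoare_first)
      fix s3 D3 T3 assume p: "frame s3 = frame s2 \<and> okf s3 \<and> (\<forall>x. D3 x < V) \<and> T3 \<le> T2 + 6 * f * (Suc cc - cc) \<and>
        (\<forall>x. (\<forall>(i, j)\<in>I. x div B \<noteq> rad i j 0) \<longrightarrow> D3 x = D2 x) \<and> sorted (map fst (fr s3)) \<and>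
        (\<exists>R'. disk_ok D3 R' \<and> (\<forall>p. p \<notin> I \<longrightarrow> R' p = R1 p) \<and> (\<forall>p. \<exists>n. rem R' p = drop n (rem R1 p)) \<and>
          total R1 I = mset (map fst (fr s3)) + total R' I \<and>
          (\<forall>x\<in>set (fr s3). \<forall>p\<in>I. \<forall>y\<in>set (rem R' p). fst x \<le> y) \<and>
          (length (fr s3) = U \<or> (\<forall>p\<in>I. rem R' p = [])))"
      then obtain R2 where r: "disk_ok D3 R2" "\<forall>p. p \<notin> I \<longrightarrow> R2 p = R1 p" "\<forall>p. \<exists>n. rem R2 p = drop n (rem R1 p)"
        "total R1 I = mset (map fst (fr s3)) + total R2 I"
        "\<forall>x\<in>set (fr s3). \<forall>p\<in>I. \<forall>y\<in>set (rem R2 p). fst x \<le> y"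
        "length (fr s3) = U \<or> (\<forall>p\<in>I. rem R2 p = [])" by blast
      have fs: "frame s3 = frame s2" and okf3: "okf s3" and DV3: "\<forall>x. D3 x < V" and T3: "T3 \<le> T2 + 6 * f"
        and D32: "\<And>x. (\<forall>(i, j)\<in>I. x div B \<noteq> rad i j 0) \<Longrightarrow> D3 x = D2 x" and so: "sorted (map fst (fr s3))"
        using p by auto
      have okm3: "okm s3" using okm_frame[OF fs] b(2) by simp
      define fs3 where "fs3 = map fst (fr s3)"
      have frU: "length (fr s3) \<le> U" "set fs3 \<subseteq> X" using okf3 by (auto simp: okf_def fs3_def)
      define ys' where "ys' = ys @ fs3"
      have tot': "total R I = mset ys' + total R2 I" using b(16) r(4) by (simp add: ys'_def fs3_def)
      have lys': "length ys' \<le> cap" using capsize tot' by simp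
      have mem: "y \<in> set fs3 \<Longrightarrow> \<exists>p\<in>I. y \<in> set (rem R1 p)" for y
        using in_total[OF fI, of y R1] r(4) by (simp add: fs3_def)
      have sub: "y \<in> set (rem R2 p) \<Longrightarrow> y \<in> set (rem R1 p)" for y p
        using r(3) by (metis in_set_dropD)
      have so': "sorted ys'" using b(14) so b(17) mem by (fastforce simp: ys'_def sorted_append fs3_def)
      have le': "\<forall>x\<in>set ys'. \<forall>p\<in>I. \<forall>y\<in>set (rem R2 p). x \<le> y"
        using b(17) sub r(5) by (auto simp: ys'_def fs3_def)
      define s4 where "s4 = s3\<lparr>wb := map fst (fr s3), tot := tot s3 + length (fr s3), mg := (if length (fr s3) < U then 0 else 1)\<rparr>"
      have e: "wi s4 = cc + 1" "wj s4 = j" "wp s4 = wp s2" "wb s4 = fs3" "lo s4 = cc" "hi s4 = Suc cc"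
        "tot s4 = length ys'" "mframe s4 = mframe s0"
        using fs b by (auto simp: s4_def fs3_def ys'_def frame_def mframe_def)
      have "cap < V0" using pos_bound[OF Q, of "cc + 1"] cL by (simp add: cap_def)
      then have okm4: "okm s4" using okm3 frU lys' e(7) V0 by (auto simp: s4_def okm_def fs3_def)
      have okf4: "okf s4" using okf3 by (simp add: s4_def okf_def)
      have dat: "data D3 (cc + 1) j ys"
        unfolding data_def
      proof (intro allI impI)
        fix q assume q: "q < length ys"
        then have "q < f ^ (cc + 1) * U" using lys by (simp add: cap_def)
        note rw = run_words(1)[OF this, of j] run_words(2)[OF this]
        have "\<forall>(i, j')\<in>I. (rad (cc + 1) j 1 * B + q) div B \<noteq> rad i j' 0"
        proof safe
          fix i j' assume ij: "(i, j') \<in> I" "(rad (cc + 1) j 1 * B + q) div B = rad i j' 0"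
          then have "rad (cc + 1) j (1 + q div B) = rad i j' 0" using rw(1) by simp
          from rad_inj[OF this jf _ rw(2)] ij(1) show False by (auto simp: I indices_def)
        qed
        then have "D3 (rad (cc + 1) j 1 * B + q) = D2 (rad (cc + 1) j 1 * B + q)" by (rule D32)
        then show "D3 (rad (cc + 1) j 1 * B + q) = list_encode (ys ! q)" using b(12) q by (simp add: data_def)
      qed
      have emp2: "rem R2 (wi s4, wj s4) = []"
      proof -
        have "R2 tgt = R1 tgt" "R1 tgt = R tgt" using r(2) b(11) tI by blast+
        then have "rem R2 tgt = []" using emp by (simp add: rem_def)
        then show ?thesis unfolding e tgt .
      qed
      have low3: "\<forall>x<rbase * B. D3 x = D0 x"
      proof (intro allI impI)
        fix x assume x: "x < rbase * B"
        then have "x div B < rbase" by (rule less_mult_imp_div_less)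
        then have "\<forall>(i, j)\<in>I. x div B \<noteq> rad i j 0" using rad_ge by (auto simp: not_le[symmetric])
        from D32[OF this] show "D3 x = D0 x" using b(9) x by simp
      qed
      have wo: "hoareM (\<lambda>s D T. s = s4 \<and> D = D3 \<and> T = T3) write_out
        (\<lambda>s D T. s = s4\<lparr>wb := [], wp := wp s\<rparr> \<and> T \<le> T3 + f \<and> disk_ok D R2 \<and> data D (wi s4) (wj s4) (ys @ wb s4) \<and>
        (\<forall>x. D x < V) \<and> (\<forall>x<rbase * B. D x = D3 x) \<and> (length (wb s4) = U \<longrightarrow> wp s * B = length (ys @ wb s4)) \<and>
        okm s \<and> okf s)"
      proof (rule write_out[OF Q r(1) okm4 okf4 _ _ emp2 _ _ _ _ DV3])
        show "length ys + length (wb s4) \<le> f ^ wi s4 * U" using lys' by (simp add: e ys'_def cap_def)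
      qed (use e cL jf dat b(19) frU in \<open>simp_all add: fs3_def\<close>)
      show "hoareM (\<lambda>s D T. s = s3\<lparr>wb := map fst (fr s3), tot := tot s3 + length (fr s3), mg := (if length (fr s3) < U then 0 else 1)\<rparr> \<and>
          D = D3 \<and> T = T3) write_out (\<lambda>s D T. inv s D T \<and> mes s < n)"
        unfolding s4_def[symmetric]
      proof (rule hoare_conseq[OF wo])
        fix s D T assume q: "s = s4\<lparr>wb := [], wp := wp s\<rparr> \<and> T \<le> T3 + f \<and> disk_ok D R2 \<and> data D (wi s4) (wj s4) (ys @ wb s4) \<and>
          (\<forall>x. D x < V) \<and> (\<forall>x<rbase * B. D x = D3 x) \<and> (length (wb s4) = U \<longrightarrow> wp s * B = length (ys @ wb s4)) \<and>
          okm s \<and> okf s"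
        obtain w where w: "s = s4\<lparr>wb := [], wp := w\<rparr>" using q by blast
        have T: "T \<le> T0 + 7 * f * (m + 1)" using q T3 b(18) by (simp add: algebra_simps)
        have mgs: "mg s = (if length fs3 < U then 0 else 1)" by (simp add: w s4_def fs3_def)
        have if1: "if mg s = 0 then total R2 I = {#} \<and> (m + 1) * U \<le> length ys' + U
            else length ys' = wp s * B \<and> (m + 1) * U = length ys'"
        proof (cases "length fs3 < U")
          case True
          then have "total R2 I = {#}" using r(6) total_empty[OF fI] by (auto simp: fs3_def)
          then show ?thesis using True mgs b(20) by (simp add: ys'_def)
        next
          case False
          then have lU: "length fs3 = U" using frU by (simp add: fs3_def)
          then have "wp s * B = length ys'" using q e by (simp add: ys'_def)
          then show ?thesis using False lU mgs b(20) by (simp add: ys'_def)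
        qed
        have "inv s D T"
          unfolding inv_def
        proof (intro exI[of _ R2] exI[of _ ys'] exI[of _ "m + 1"] conjI)
          show "mframe s = mframe s0" using e(8) by (simp add: w mframe_def)
          show "\<forall>p. p \<notin> I \<longrightarrow> R2 p = R p" using r(2) b(11) by simp
          show "\<forall>x<rbase * B. D x = D0 x" using q low3 by simp
          show "set ys' \<subseteq> X" using b(15) frU by (simp add: ys'_def)
        qed (use q T if1 tot' so' le' e in \<open>simp_all add: w ys'_def\<close>)
        moreover have "mes s < n"
        proof -
          have n: "n = cap + 1 - length ys" using a b(13) by (auto simp: mes_def)
          show ?thesis
          proof (cases "length fs3 < U")
            case True
            then show ?thesis using n lys mgs by (simp add: mes_def)
          next
            case False
            then have "0 < length fs3" using U by linarith
            then have "length ys < length ys'" by (simp add: ys'_def)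
            moreover have "mes s = cap + 1 - length ys'" using False mgs e by (simp add: mes_def w)
            ultimately show ?thesis using n lys' by simp
          qed
        qed
        ultimately show "inv s D T \<and> mes s < n" ..
      qed
    qed
  qed
  have fin: "hoareM (\<lambda>s D T. s = s2 \<and> D = D2 \<and> T = T2) write_meta ?post"
    if iv: "inv s2 D2 T2 \<and> \<not> mg s2 \<noteq> 0" for s2 D2 T2
  proof -
    obtain R1 ys m where b: "mframe s2 = mframe s0" "okm s2" "okf s2" "wi s2 = cc + 1" "wj s2 = j"
      "\<forall>x. D2 x < V" "\<forall>x<rbase * B. D2 x = D0 x" "disk_ok D2 R1"
      "\<forall>p. p \<notin> I \<longrightarrow> R1 p = R p" "data D2 (cc + 1) j ys" "tot s2 = length ys" "sorted ys" "set ys \<subseteq> X"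
      "total R I = mset ys + total R1 I" "T2 \<le> T0 + 7 * f * m"
      "total R1 I = {#}" "m * U \<le> length ys + U"
      using iv unfolding inv_def by auto
    have lys: "length ys \<le> cap" using capsize b(14) by simp
    have "m * U \<le> (f ^ (cc + 1) + 1) * U" using b(17) lys by (simp add: cap_def algebra_simps)
    then have "m \<le> f ^ (cc + 1) + 1" using U by (simp only: mult_le_cancel2)
    then have T: "T2 \<le> T0 + 7 * f * (f ^ (cc + 1) + 1)"
      using b(15) mult_le_mono2[of m "f ^ (cc + 1) + 1" "7 * f"] by linarith
    note wm = write_meta[OF Q b(8,2,3) _ _ _ _ b(12,13) _ b(6), unfolded b(4,5), OF cL(2) jf b(10,11) lys[unfolded cap_def], of T2]
    show ?thesis
    proof (rule hoare_conseq[OF wm])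
      fix s D T assume q: "s = s2 \<and> T = T2 + 1 \<and> disk_ok D (R1((cc + 1, j) := (0, ys))) \<and>
        (\<forall>x. D x < V) \<and> (\<forall>x<rbase * B. D x = D2 x)"
      have "\<exists>R'. disk_ok D R' \<and> (\<forall>p. p \<notin> insert tgt I \<longrightarrow> R' p = R p) \<and> total R' I = {#} \<and>
        mset (rem R' tgt) = total R I"
      proof (intro exI[of _ "R1(tgt := (0, ys))"] conjI)
        show "total (R1(tgt := (0, ys))) I = {#}"
          using tI b(16) total_cong[of I "R1(tgt := (0, ys))" R1] by (metis fun_upd_other)
        show "mset (rem (R1(tgt := (0, ys))) tgt) = total R I" using b(14,16) by (simp add: rem_def)
      qed (use q b(9) in \<open>simp_all add: tgt\<close>)
      then show "?post s D T" using q b T by (simp add: cc_def)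
    qed simp
  qed
  show ?thesis
    unfolding merge_def
    by (rule hoare_first, fold s1_def, rule hoare_after[OF hoare_While[where I = inv and m = "\<lambda>s D T. mes s"
        and Q = "\<lambda>s D T. inv s D T \<and> \<not> mg s \<noteq> 0", OF body] fin]) (use start in blast)+
qed

section \<open>The queue invariant and the flush counter\<close>

text \<open>
  Every item on the disk has at least \<open>safe s\<close> smaller or equal items in memory, so the least item is in
  memory as long as \<open>safe s\<close> is positive. The digits in base \<open>f\<close> of the number \<open>nfl s\<close> of flushes tell
  how many runs of each level are in use.
\<close>

definition pq :: "st \<Rightarrow> (nat \<Rightarrow> nat) \<Rightarrow> nat list multiset \<Rightarrow> bool" where
  "pq s D C \<longleftrightarrow> okm s \<and> okf s \<and> (\<forall>x. D x < V) \<and> sorted (heap s) \<and> (\<exists>R. disk_ok D R \<and>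
     C = mset (heap s) + total R (indices 0 L) \<and> onD s = size (total R (indices 0 L)) \<and>
     (\<forall>y\<in>#total R (indices 0 L). safe s \<le> length (filter (\<lambda>x. x \<le> y) (heap s))) \<and>
     (\<forall>i<L. \<forall>j<f. nfl s div f ^ i mod f \<le> j \<longrightarrow> rem R (i, j) = []))"

definition mainf :: "st \<Rightarrow> _" where
  "mainf s = (sta s, ib s, ibuf s, prv s, ip s, obuf s, ob s)"

text \<open>The merge of level \<open>i\<close> costs at most \<open>mcost i\<close>; flush \<open>k\<close> merges level \<open>i\<close> iff \<open>f ^ (i + 1)\<close> divides \<open>k\<close>.\<close>

definition mcost :: "nat \<Rightarrow> nat" where
  "mcost i = 7 * f * (f ^ (i + 1) + 1) + 1"

definition cascade :: "nat \<Rightarrow> nat" where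
  "cascade k = (\<Sum>i\<in>{i. i < L \<and> f ^ (i + 1) dvd k}. mcost i)"

text \<open>The arithmetic of the carry: if \<open>f ^ c\<close> is the highest power of
  \<open>f\<close> dividing \<open>k\<close>, then the step from \<open>k - 1\<close> to
  \<open>k\<close> raises digit \<open>c\<close> by one without overflow and keeps the higher
  digits.\<close>

lemma digit_eq:
  assumes "0 < k" "f ^ c dvd k" "\<not> f ^ (c + 1) dvd k"
  shows "(k - 1) div f ^ c mod f + 1 = k div f ^ c mod f" "c < i \<Longrightarrow> (k - 1) div f ^ i = k div f ^ i"
proof -
  have fc: "0 < f ^ c" using f by simp
  obtain q where q: "k = f ^ c * q" using assms(2) by blast
  have q0: "0 < q" using assms(1) q by (cases q) auto
  have nd: "\<not> f dvd q" using assms(3) q fc by auto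
  have d1: "(k - 1) div f ^ c = q - 1"
  proof (rule div_nat_eqI)
    have "f ^ c * (q - 1) + f ^ c = k" using q q0 by (cases q) auto
    then show "f ^ c * (q - 1) \<le> k - 1" using fc by linarith
    show "k - 1 < f ^ c * Suc (q - 1)" using q q0 assms(1) by simp
  qed
  have d2: "k div f ^ c = q" using q fc by simp
  define r where "r = q mod f"
  have r: "0 < r" "r < f" using nd f by (auto simp: r_def dvd_eq_mod_eq_0)
  define r' where "r' = r - 1"
  have r'f: "r' < f" using r by (simp add: r'_def)
  have qe: "q - 1 = q div f * f + r'" using r q0 div_mult_mod_eq[of q f] unfolding r_def r'_def by linarith
  have m: "(q - 1) mod f = r'" "(q - 1) div f = q div f" unfolding qe using r'f by auto
  show "(k - 1) div f ^ c mod f + 1 = k div f ^ c mod f" 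
  proof -
    have "r' + 1 = r" using r by (simp add: r'_def)
    then show ?thesis unfolding d1 d2 m(1) r_def[symmetric] .
  qed
  show "(k - 1) div f ^ i = k div f ^ i" if ci: "c < i"
  proof -
    define e where "e = i - c - 1"
    have e: "i = c + 1 + e" using ci by (simp add: e_def)
    have p: "f ^ i = f ^ c * f * f ^ e" by (simp add: e power_add)
    show ?thesis unfolding p div_mult2_eq d1 d2 m(2) by simp
  qed
qed

lemma flush:
  assumes Q: "3 * U \<le> Q" and pq: "pq s0 D0 C"
    and len: "3 * U \<le> length (heap s0)" and nf: "nfl s0 + 1 < f ^ L" and sC: "size C < V0"
  shows "hoareM (\<lambda>s D T. s = s0 \<and> D = D0 \<and> T = T0) flush
    (\<lambda>s D T. pq s D C \<and> mainf s = mainf s0 \<and> nfl s = nfl s0 + 1 \<and> length (heap s) + U = length (heap s0) \<and>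
      0 < onD s \<and> safe s = (if onD s0 = 0 then length (heap s) else min (safe s0) (length (heap s))) \<and>
      T \<le> T0 + f + 1 + cascade (nfl s0 + 1) \<and> (\<forall>x<rbase * B. D x = D0 x))"
    (is "hoareM _ _ ?post")
proof -
  define All where "All = indices 0 L"
  define k where "k = nfl s0 + 1"
  define m where "m = length (heap s0) - U"
  define w where "w = drop m (heap s0)"
  define j0 where "j0 = nfl s0 mod f"
  have fA: "finite All" by (simp add: All_def)
  obtain R where ok0: "okm s0" "okf s0" and DV: "\<forall>x. D0 x < V" and so: "sorted (heap s0)" and dk: "disk_ok D0 R"
    and C: "C = mset (heap s0) + total R All" and onD: "onD s0 = size (total R All)"
    and sf: "\<forall>y\<in>#total R All. safe s0 \<le> length (filter (\<lambda>x. x \<le> y) (heap s0))"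
    and emp: "\<forall>i<L. \<forall>j<f. nfl s0 div f ^ i mod f \<le> j \<longrightarrow> rem R (i, j) = []"
    using pq unfolding pq_def All_def by blast
  have L0: "0 < L" using nf by (cases L) auto
  have j0: "j0 < f" using f by (simp add: j0_def)
  have VL: "L < V0" "f < V0" "U < V0" using level_bound[OF Q] by auto
  have mU: "m + U = length (heap s0)" "2 * U \<le> m" using len by (auto simp: m_def)
  have lw: "length w = U" using mU by (simp add: w_def)
  have szC: "length (heap s0) + onD s0 < V0" using sC C onD by simp
  define s1 where "s1 = (let m = length (heap s0) - U in
       s0\<lparr>wb := drop m (heap s0), heap := take m (heap s0), safe := (if onD s0 = 0 then m else min (safe s0) m),
         onD := onD s0 + U, wi := 0, wj := nfl s0 mod f, wp := 0, tot := U\<rparr>)"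
  have s1: "s1 = s0\<lparr>wb := w, heap := take m (heap s0), safe := (if onD s0 = 0 then m else min (safe s0) m),
         onD := onD s0 + U, wi := 0, wj := j0, wp := 0, tot := U\<rparr>"
    by (simp add: s1_def Let_def m_def w_def j0_def)
  have wX: "set w \<subseteq> X" using ok0(1) by (auto simp: okm_def w_def dest!: in_set_dropD)
  have okm1: "okm s1"
    using ok0(1) wX lw mU szC VL j0 V0 by (auto simp: okm_def s1 dest!: in_set_takeD)
  have okf1: "okf s1" using ok0(2) by (simp add: okf_def s1)
  have emp0: "rem R (0, j0) = []" using emp L0 j0 by (simp add: j0_def)
  have wo: "hoareM (\<lambda>s D T. s = s1 \<and> D = D0 \<and> T = T0) write_out
    (\<lambda>s D T. s = s1\<lparr>wb := [], wp := wp s\<rparr> \<and> T \<le> T0 + f \<and> disk_ok D R \<and> data D (wi s1) (wj s1) ([] @ wb s1) \<and>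
      (\<forall>x. D x < V) \<and> (\<forall>x<rbase * B. D x = D0 x) \<and> (length (wb s1) = U \<longrightarrow> wp s * B = length ([] @ wb s1)) \<and>
      okm s \<and> okf s)"
    by (rule write_out[OF Q dk okm1 okf1]) (use L0 j0 emp0 lw DV in \<open>simp_all add: s1 data_def\<close>)
  have sow: "sorted w" using so by (simp add: w_def sorted_wrt_drop)
  define R1 where "R1 = R((0, j0) := (0, w))"
  have tgA: "(0, j0) \<in> All" using L0 j0 by (simp add: All_def indices_def)
  have tot1: "total R1 All = total R All + mset w"
  proof -
    have a: "All = insert (0, j0) (All - {(0, j0)})" using tgA by auto
    have "total R1 All = mset (rem R1 (0, j0)) + total R1 (All - {(0, j0)})"
      by (subst a, rule total_insert) (use fA in auto)
    also have "total R1 (All - {(0, j0)}) = total R (All - {(0, j0)})" by (rule total_cong) (auto simp: R1_def)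
    also have "mset (rem R1 (0, j0)) = mset w" by (simp add: R1_def rem_def)
    also have "total R (All - {(0, j0)}) = total R All"
      by (subst (2) a, subst total_insert) (use fA emp0 in auto)
    finally show ?thesis by simp
  qed
  \<comment> \<open>The occupied slots while the carry is at level \<open>c\<close>: lower levels
    are empty, level \<open>c\<close> has one run more than the old digit, and higher levels are as
    before.\<close>
  define stg where "stg = (\<lambda>c i. if i < c then 0 else if i = c then (k - 1) div f ^ c mod f + 1 else (k - 1) div f ^ i mod f)"
  define inv where "inv = (\<lambda>s D T. \<exists>R'. ci s < L \<and> mainf s = mainf s0 \<and> heap s = heap s1 \<and> safe s = safe s1 \<and>
    onD s = onD s1 \<and> nfl s = k \<and> okm s \<and> okf s \<and> (\<forall>x. D x < V) \<and> (\<forall>x<rbase * B. D x = D0 x) \<and> disk_ok D R' \<and>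
    (\<forall>i<ci s. f ^ (i + 1) dvd k) \<and> total R' All = total R1 All \<and>
    (\<forall>i<L. \<forall>j<f. stg (ci s) i \<le> j \<longrightarrow> rem R' (i, j) = []) \<and>
    T \<le> T0 + f + 1 + (\<Sum>i<ci s. mcost i))"
  have kV: "k < V0"
  proof -
    have "f ^ L \<le> f ^ L * U" using U by simp
    then show ?thesis unfolding k_def using nf pos_bound[OF Q, of L] by linarith
  qed
  have upto: "hoareM (\<lambda>s D T. s = s1 \<and> D = D0 \<and> T = T0)
    ((write_out ;; write_meta) ;; Basic (\<lambda>s. s\<lparr>nfl := nfl s + 1, ci := 0\<rparr>)) inv"
  proof (rule hoare_assoc', rule hoare_after[OF wo])
    fix s D T assume p: "s = s1\<lparr>wb := [], wp := wp s\<rparr> \<and> T \<le> T0 + f \<and> disk_ok D R \<and> data D (wi s1) (wj s1) ([] @ wb s1) \<and>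
      (\<forall>x. D x < V) \<and> (\<forall>x<rbase * B. D x = D0 x) \<and> (length (wb s1) = U \<longrightarrow> wp s * B = length ([] @ wb s1)) \<and>
      okm s \<and> okf s"
    obtain v where v: "s = s1\<lparr>wb := [], wp := v\<rparr>" using p by blast
    have wm: "hoareM (\<lambda>s' D' T'. s' = s \<and> D' = D \<and> T' = T) write_meta
      (\<lambda>s' D' T'. s' = s \<and> T' = T + 1 \<and> disk_ok D' (R((wi s, wj s) := (0, w))) \<and>
      (\<forall>x. D' x < V) \<and> (\<forall>x<rbase * B. D' x = D x))"
      by (rule write_meta[OF Q]) (use p v L0 j0 lw sow wX in \<open>simp_all add: s1\<close>)
    show "hoareM (\<lambda>s' D' T'. s' = s \<and> D' = D \<and> T' = T) (write_meta ;; Basic (\<lambda>s. s\<lparr>nfl := nfl s + 1, ci := 0\<rparr>)) inv"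
    proof (rule hoare_Seq[OF wm], rule hoare_Basic)
      fix s' D' T' assume q: "s' = s \<and> T' = T + 1 \<and> disk_ok D' (R((wi s, wj s) := (0, w))) \<and>
        (\<forall>x. D' x < V) \<and> (\<forall>x<rbase * B. D' x = D x)"
      let ?s = "s'\<lparr>nfl := nfl s' + 1, ci := 0\<rparr>"
      have "okm ?s" using p q kV V0 by (simp add: okm_def v s1 k_def)
      moreover have "okf ?s" using p q by (simp add: okf_def v s1)
      moreover have "rem R1 (i, j) = []" if "i < L" "j < f" "stg 0 i \<le> j" for i j
      proof (cases "i = 0")
        case True
        then have "j0 < j" using that by (simp add: stg_def k_def j0_def)
        then have "rem R1 (i, j) = rem R (i, j)" by (simp add: R1_def rem_def)
        then show ?thesis using emp that True \<open>j0 < j\<close> by (simp add: j0_def)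
      next
        case False
        then have "rem R1 (i, j) = rem R (i, j)" by (simp add: R1_def rem_def)
        then show ?thesis using emp that False by (simp add: stg_def k_def)
      qed
      ultimately show "inv ?s D' T'"
        unfolding inv_def using p q L0
        by (intro exI[of _ R1]) (auto simp: v s1 mainf_def k_def R1_def)
    qed
  qed
  have body: "hoareM (\<lambda>s D T. inv s D T \<and> nfl s mod f ^ (ci s + 1) = 0 \<and> L - ci s = n)
    (merge ;; Basic (\<lambda>s. s\<lparr>ci := ci s + 1\<rparr>)) (\<lambda>s D T. inv s D T \<and> L - ci s < n)" for n
  proof (rule hoare_start)
    fix s D T assume a: "inv s D T \<and> nfl s mod f ^ (ci s + 1) = 0 \<and> L - ci s = n"
    define c where "c = ci s"
    obtain R' where b: "c < L" "mainf s = mainf s0" "heap s = heap s1" "safe s = safe s1"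
      "onD s = onD s1" "nfl s = k" "okm s" "okf s" "\<forall>x. D x < V" "\<forall>x<rbase * B. D x = D0 x" "disk_ok D R'"
      "\<forall>i<c. f ^ (i + 1) dvd k" "total R' All = total R1 All"
      "\<forall>i<L. \<forall>j<f. stg c i \<le> j \<longrightarrow> rem R' (i, j) = []" "T \<le> T0 + f + 1 + (\<Sum>i<c. mcost i)"
      using a unfolding inv_def c_def by blast
    have dv: "f ^ (c + 1) dvd k" using a b(6) by (auto simp: c_def)
    \<comment> \<open>A carry out of level \<open>c\<close> means that \<open>f ^ (c + 1)\<close>
      divides \<open>k\<close>; since \<open>k < f ^ L\<close>, the target level
      \<open>c + 1\<close> exists.\<close>
    have "f ^ (c + 1) \<le> k" using dv by (rule dvd_imp_le) (simp add: k_def)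
    then have "f ^ (c + 1) < f ^ L" using nf by (simp add: k_def)
    moreover have "1 < f" using f by simp
    ultimately have cL: "c + 1 < L" by (metis power_less_imp_less_exp)
    define tgt where "tgt = (c + 1, (k - 1) div f ^ (c + 1) mod f)"
    define I where "I = indices c (Suc c)"
    have tf: "snd tgt < f" using f by (simp add: tgt_def)
    have tI: "tgt \<notin> I" by (simp add: tgt_def I_def indices_def)
    have IA: "insert tgt I \<subseteq> All" using cL tf by (auto simp: All_def I_def indices_def tgt_def)
    have et: "rem R' tgt = []" using b(14) cL tf by (simp add: stg_def tgt_def)
    have mg: "hoareM (\<lambda>s' D' T'. s' = s \<and> D' = D \<and> T' = T) merge
      (\<lambda>s' D' T'. mframe s' = mframe s \<and> okm s' \<and> okf s' \<and> (\<forall>x. D' x < V) \<and> (\<forall>x<rbase * B. D' x = D x) \<and>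
      T' \<le> T + 7 * f * (f ^ (c + 1) + 1) + 1 \<and>
      (\<exists>R''. disk_ok D' R'' \<and> (\<forall>p. p \<notin> insert tgt I \<longrightarrow> R'' p = R' p) \<and> total R'' I = {#} \<and>
        mset (rem R'' tgt) = total R' I))"
      using merge[OF Q b(11,7,8) _ b(9), of T] cL et b(6) by (simp add: c_def tgt_def I_def)
    show "hoareM (\<lambda>s' D' T'. s' = s \<and> D' = D \<and> T' = T) (merge ;; Basic (\<lambda>s. s\<lparr>ci := ci s + 1\<rparr>))
      (\<lambda>s D T. inv s D T \<and> L - ci s < n)"
    proof (rule hoare_Seq[OF mg], rule hoare_Basic)
      fix s' D' T' assume p: "mframe s' = mframe s \<and> okm s' \<and> okf s' \<and> (\<forall>x. D' x < V) \<and> (\<forall>x<rbase * B. D' x = D x) \<and>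
        T' \<le> T + 7 * f * (f ^ (c + 1) + 1) + 1 \<and>
        (\<exists>R''. disk_ok D' R'' \<and> (\<forall>p. p \<notin> insert tgt I \<longrightarrow> R'' p = R' p) \<and> total R'' I = {#} \<and>
        mset (rem R'' tgt) = total R' I)"
      then obtain R'' where r: "disk_ok D' R''" "\<forall>p. p \<notin> insert tgt I \<longrightarrow> R'' p = R' p" "total R'' I = {#}"
        "mset (rem R'' tgt) = total R' I" by blast
      have fr: "ci s' = c" "heap s' = heap s" "safe s' = safe s" "onD s' = onD s" "nfl s' = nfl s" "mainf s' = mainf s"
        using p by (auto simp: mframe_def mainf_def c_def)
      let ?s = "s'\<lparr>ci := ci s' + 1\<rparr>"
      have fI: "finite I" by (simp add: I_def)
      have "total R'' All = total R'' (All - insert tgt I) + (mset (rem R'' tgt) + total R'' I)"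
        using total_split[OF IA fA] total_insert[OF fI tI] by simp
      also have "total R'' (All - insert tgt I) = total R' (All - insert tgt I)" by (rule total_cong) (use r(2) in auto)
      also have "mset (rem R'' tgt) + total R'' I = mset (rem R' tgt) + total R' I" using r et by simp
      also have "total R' (All - insert tgt I) + (mset (rem R' tgt) + total R' I) = total R' All"
        using total_split[OF IA fA] total_insert[OF fI tI] by simp
      finally have t: "total R'' All = total R1 All" using b(13) by simp
      have em: "rem R'' (i, j) = []" if "i < L" "j < f" "stg (c + 1) i \<le> j" for i j
      proof (cases "i = c")
        case True
        then have "(i, j) \<in> I" using that by (simp add: I_def indices_def)
        then show ?thesis using r(3) total_empty[OF fI] by blast
      next
        case False
        have "(i, j) \<noteq> tgt" using that by (auto simp: tgt_def stg_def)
        moreover have "(i, j) \<notin> I" using False by (simp add: I_def indices_def)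
        ultimately have "rem R'' (i, j) = rem R' (i, j)" using r(2) by (simp add: rem_def)
        moreover have "stg c i \<le> j" using that False by (auto simp: stg_def split: if_splits)
        ultimately show ?thesis using b(14) that by simp
      qed
      have T: "T' \<le> T0 + f + 1 + (\<Sum>i<c + 1. mcost i)" using p b(15) by (simp add: mcost_def)
      have "okm ?s" using p VL cL fr by (simp add: okm_def)
      moreover have "okf ?s" using p by (simp add: okf_def)
      moreover have "mainf ?s = mainf s0" using fr b(2) by (simp add: mainf_def)
      moreover have "\<forall>i<c + 1. f ^ (i + 1) dvd k" using b(12) dv less_Suc_eq by auto
      ultimately have "inv ?s D' T'"
        unfolding inv_def using p b(3-6,10) fr r(1) t em T cL by (intro exI[of _ R'']) simp
      moreover have "L - (c + 1) < n" using a cL unfolding c_def by linarith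
      ultimately show "inv ?s D' T' \<and> L - ci ?s < n" using fr by simp
    qed
  qed
  have fin: "?post s D T" if iv: "inv s D T" "\<not> nfl s mod f ^ (ci s + 1) = 0" for s D T
  proof -
    define c where "c = ci s"
    obtain R' where b: "c < L" "mainf s = mainf s0" "heap s = heap s1" "safe s = safe s1"
      "onD s = onD s1" "nfl s = k" "okm s" "okf s" "\<forall>x. D x < V" "\<forall>x<rbase * B. D x = D0 x" "disk_ok D R'"
      "\<forall>i<c. f ^ (i + 1) dvd k" "total R' All = total R1 All"
      "\<forall>i<L. \<forall>j<f. stg c i \<le> j \<longrightarrow> rem R' (i, j) = []" "T \<le> T0 + f + 1 + (\<Sum>i<c. mcost i)"
      using iv unfolding inv_def c_def by blast
    have nd: "\<not> f ^ (c + 1) dvd k" using iv b(6) by (simp add: c_def dvd_eq_mod_eq_0)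
    have dv: "f ^ c dvd k" using b(12) by (cases c) auto
    have k0: "0 < k" by (simp add: k_def)
    note de = digit_eq[OF k0 dv nd]
    have emp': "rem R' (i, j) = []" if "i < L" "j < f" "k div f ^ i mod f \<le> j" for i j
    proof -
      have "stg c i \<le> j" using that de by (cases i c rule: linorder_cases) (auto simp: stg_def)
      then show ?thesis using b(14) that by blast
    qed
    have "(\<Sum>i<c. mcost i) \<le> cascade k"
      unfolding cascade_def by (rule sum_mono2) (use b(1,12) in auto)
    then have T: "T \<le> T0 + f + 1 + cascade k" using b(15) by linarith
    have hs: "heap s = take m (heap s0)" using b(3) by (simp add: s1)
    have lh: "length (heap s) = m" using hs mU by simp
    have Ceq: "C = mset (heap s) + total R' All"
      using C b(13) tot1 hs by (simp add: w_def flip: mset_append)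
    have on: "onD s = size (total R' All)" using b(5,13) tot1 onD lw by (simp add: s1)
    have app: "sorted (heap s @ w)" using so by (simp add: hs w_def)
    have sfs: "safe s = (if onD s0 = 0 then m else min (safe s0) m)" using b(4) by (simp add: s1)
    \<comment> \<open>The flushed items are no less than the whole remaining heap. Older items on
      the disk keep their bound, cut down to the \<open>m\<close> items that remain.\<close>
    have safe: "safe s \<le> length (filter (\<lambda>x. x \<le> y) (heap s))" if y: "y \<in># total R' All" for y
    proof -
      consider "y \<in> set w" | "y \<in># total R All" using y b(13) tot1 by auto
      then show ?thesis
      proof cases
        case 1
        then have "\<forall>x\<in>set (heap s). x \<le> y" using app by (simp add: sorted_append)
        then have "filter (\<lambda>x. x \<le> y) (heap s) = heap s" by (simp add: filter_id_conv)
        then show ?thesis using sfs lh by simp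
      next
        case 2
        then have "onD s0 \<noteq> 0" using onD by auto
        then have ss: "safe s = min (safe s0) m" using sfs by simp
        have "\<forall>p<min (safe s0) m. heap s ! p \<le> y"
        proof (intro allI impI)
          fix p assume p: "p < min (safe s0) m"
          then have "heap s ! p = take (safe s0) (heap s0) ! p" by (simp add: hs)
          moreover have "take (safe s0) (heap s0) ! p \<in> set (take (safe s0) (heap s0))"
            using p mU by (intro nth_mem) simp
          ultimately show "heap s ! p \<le> y"
            using sorted_take_le[of id "heap s0" "safe s0" y] so sf 2 by simp
        qed
        then show ?thesis unfolding ss by (rule prefix_count) (simp add: lh)
      qed
    qed
    have "pq s D C"
      unfolding pq_def All_def[symmetric]
      using b(6-9,11) app Ceq on safe emp' by (auto simp: sorted_append intro!: exI[of _ R'])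
    moreover have "0 < onD s" using b(5) U by (simp add: s1)
    ultimately show ?thesis using b(2,6,10) T lh mU sfs by (simp add: k_def)
  qed
  have wh: "hoareM inv (While (\<lambda>s. nfl s mod f ^ (ci s + 1) = 0) (merge ;; Basic (\<lambda>s. s\<lparr>ci := ci s + 1\<rparr>))) ?post"
    by (rule hoare_While[where I = inv and m = "\<lambda>s D T. L - ci s", OF body]) (use fin in blast)+
  have um: "hoareM (\<lambda>s D T. s = s1 \<and> D = D0 \<and> T = T0) (((write_out ;; write_meta) ;;
      Basic (\<lambda>s. s\<lparr>nfl := nfl s + 1, ci := 0\<rparr>)) ;;
      While (\<lambda>s. nfl s mod f ^ (ci s + 1) = 0) (merge ;; Basic (\<lambda>s. s\<lparr>ci := ci s + 1\<rparr>))) ?post"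
    by (rule hoare_Seq[OF _ wh]) (rule upto)
  show ?thesis
    unfolding flush_def
    by (rule hoare_first, fold s1_def, rule hoare_assoc, rule hoare_assoc, rule um)
qed

text \<open>Everything left on the disk is no less than each fetched item, so the number of fetched
  items becomes the new value of \<open>safe\<close>.\<close>

lemma refill:
  assumes Q: "3 * U \<le> Q" and pq: "pq s0 D0 C" and len: "length (heap s0) + U \<le> 10 * U"
  shows "hoareM (\<lambda>s D T. s = s0 \<and> D = D0 \<and> T = T0) refill
    (\<lambda>s D T. pq s D C \<and> mainf s = mainf s0 \<and> nfl s = nfl s0 \<and> length (heap s) + onD s = length (heap s0) + onD s0 \<and>
      length (heap s) = length (heap s0) + safe s \<and> safe s \<le> U \<and> (safe s = U \<or> onD s = 0) \<and>
      T \<le> T0 + 6 * f * L \<and> (\<forall>x<rbase * B. D x = D0 x))"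
    (is "hoareM _ _ ?post")
proof -
  define All where "All = indices 0 L"
  have fA: "finite All" by (simp add: All_def)
  obtain R where ok0: "okm s0" "okf s0" and DV: "\<forall>x. D0 x < V" and so: "sorted (heap s0)" and dk: "disk_ok D0 R"
    and C: "C = mset (heap s0) + total R All" and onD: "onD s0 = size (total R All)"
    and emp: "\<forall>i<L. \<forall>j<f. nfl s0 div f ^ i mod f \<le> j \<longrightarrow> rem R (i, j) = []"
    using pq unfolding pq_def All_def by blast
  define s1 where "s1 = s0\<lparr>lo := 0, hi := L\<rparr>"
  have VL: "L < V0" "U < V0" using level_bound[OF Q] by auto
  have okm1: "okm s1" using ok0(1) VL V0 by (simp add: okm_def s1_def)
  have okf1: "okf s1" using ok0(2) by (simp add: okf_def s1_def)
  have lh: "lo s1 \<le> hi s1" "hi s1 \<le> L" by (simp_all add: s1_def)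
  have e: "lo s1 = 0" "hi s1 = L" by (simp_all add: s1_def)
  note sel = select[OF Q dk okm1 okf1 lh DV, of T0, unfolded e, folded All_def total_def]
  show ?thesis
    unfolding refill_def
  proof (rule hoare_first, fold s1_def, rule hoare_Seq[OF sel], rule hoare_Basic)
    fix s D T assume p: "frame s = frame s1 \<and> okf s \<and> (\<forall>x. D x < V) \<and> T \<le> T0 + 6 * f * (L - 0) \<and>
        (\<forall>x. (\<forall>(i, j)\<in>All. x div B \<noteq> rad i j 0) \<longrightarrow> D x = D0 x) \<and> sorted (map fst (fr s)) \<and>
        (\<exists>R'. disk_ok D R' \<and> (\<forall>p. p \<notin> All \<longrightarrow> R' p = R p) \<and> (\<forall>p. \<exists>n. rem R' p = drop n (rem R p)) \<and>
          total R All = mset (map fst (fr s)) + total R' All \<and>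
          (\<forall>x\<in>set (fr s). \<forall>p\<in>All. \<forall>y\<in>set (rem R' p). fst x \<le> y) \<and>
          (length (fr s) = U \<or> (\<forall>p\<in>All. rem R' p = [])))"
    then obtain R' where r: "disk_ok D R'" "\<forall>p. \<exists>n. rem R' p = drop n (rem R p)"
      "total R All = mset (map fst (fr s)) + total R' All"
      "\<forall>x\<in>set (fr s). \<forall>p\<in>All. \<forall>y\<in>set (rem R' p). fst x \<le> y"
      "length (fr s) = U \<or> (\<forall>p\<in>All. rem R' p = [])" by blast
    have fs: "frame s = frame s1" and okf: "okf s" and DV': "\<forall>x. D x < V" and T: "T \<le> T0 + 6 * f * L"
      using p by auto
    have okm: "okm s" using okm_frame[OF fs] okm1 by simp
    have g: "heap s = heap s0" "onD s = onD s0" "nfl s = nfl s0" "mainf s = mainf s0"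
      using fs by (auto simp: frame_def s1_def mainf_def)
    let ?n = "length (fr s)"
    define s2 where "s2 = s\<lparr>heap := sort (heap s @ map fst (fr s)), safe := ?n, onD := onD s - ?n\<rparr>"
    have nU: "?n \<le> U" "fst ` set (fr s) \<subseteq> X" using okf by (auto simp: okf_def)
    have on: "onD s0 = ?n + size (total R' All)" using onD r(3) by simp
    have okm2: "okm s2" using okm nU len g VL on by (auto simp: okm_def s2_def)
    have okf2: "okf s2" using okf by (simp add: okf_def s2_def)
    have Ceq: "C = mset (heap s2) + total R' All" using C r(3) by (simp add: s2_def g)
    have on2: "onD s2 = size (total R' All)" using on g by (simp add: s2_def)
    have sf: "safe s2 \<le> length (filter (\<lambda>x. x \<le> y) (heap s2))" if y: "y \<in># total R' All" for y
    proof -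
      have "filter (\<lambda>x. x \<le> y) (map fst (fr s)) = map fst (fr s)"
        using r(4) in_total[OF fA, THEN iffD1, OF y] by (auto simp: filter_id_conv)
      then have "?n = size (filter_mset (\<lambda>x. x \<le> y) (mset (map fst (fr s))))"
        by (metis length_map mset_filter size_mset)
      also have "\<dots> \<le> size (filter_mset (\<lambda>x. x \<le> y) (mset (heap s2)))" by (simp add: s2_def)
      also have "\<dots> = length (filter (\<lambda>x. x \<le> y) (heap s2))" by (metis mset_filter size_mset)
      finally show ?thesis by (simp add: s2_def)
    qed
    have emp': "\<forall>i<L. \<forall>j<f. nfl s2 div f ^ i mod f \<le> j \<longrightarrow> rem R' (i, j) = []"
    proof (intro allI impI)
      fix i j assume "i < L" "j < f" "nfl s2 div f ^ i mod f \<le> j"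
      then have "rem R (i, j) = []" using emp g by (simp add: s2_def)
      moreover obtain n where "rem R' (i, j) = drop n (rem R (i, j))" using r(2) by blast
      ultimately show "rem R' (i, j) = []" by simp
    qed
    have "pq s2 D C"
      unfolding pq_def All_def[symmetric] using okm2 okf2 DV' r(1) Ceq on2 sf emp'
      by (auto simp: s2_def intro!: exI[of _ R'])
    moreover have "safe s2 = U \<or> onD s2 = 0"
      using r(5) on2 total_empty[OF fA, of R'] by (auto simp: s2_def)
    moreover have "\<forall>x<rbase * B. D x = D0 x"
    proof (intro allI impI)
      fix x assume x: "x < rbase * B"
      then have "x div B < rbase" by (rule less_mult_imp_div_less)
      then have "\<forall>(i, j)\<in>All. x div B \<noteq> rad i j 0" using rad_ge by (auto simp: not_le[symmetric])
      then show "D x = D0 x" using p by blast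
    qed
    ultimately show "?post (s\<lparr>heap := sort (heap s @ map fst (fr s)), safe := length (fr s), onD := onD s - length (fr s)\<rparr>) D T"
      unfolding s2_def[symmetric] using g T nU on on2 by (auto simp: s2_def mainf_def)
  qed
qed

end

context em
begin

section \<open>The main program\<close>

definition blocks :: "nat \<Rightarrow> nat" where
  "blocks n = (n + B - 1) div B"

text \<open>The input is consumed word by word because a block may split a record: the first
  component waits in \<open>prv\<close> until the second arrives at an odd position.\<close>

definition input_step :: "nat \<Rightarrow> st \<Rightarrow> st" where
  "input_step n s = (let w = hd (ibuf s); p = ip s in
     s\<lparr>ibuf := tl (ibuf s), ip := p + 1, prv := w,
       heap := (if odd p then insort (if p < 2 * n then [1, prv s, 1, w] else [1, w, 2, prv s]) (heap s) else heap s)\<rparr>)"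

definition ext_step :: "st \<Rightarrow> st" where
  "ext_step s = (let d = delta (sta s) (hd (heap s)) in
     s\<lparr>heap := sort (tl (heap s) @ fst (snd d)), safe := safe s - 1, sta := fst d, obuf := obuf s @ snd (snd d)\<rparr>)"

definition flushes :: "st com" where
  "flushes = While (\<lambda>s. 3 * U \<le> length (heap s)) flush"

definition input_loop :: "nat \<Rightarrow> nat \<Rightarrow> st com" where
  "input_loop n e = While (\<lambda>s. ib s < blocks (2 * n) + blocks (2 * e))
     (Rd ib (\<lambda>b s. s\<lparr>ibuf := (if ib s < blocks (2 * n) then take (2 * n - ib s * B) b
         else take (2 * e - (ib s - blocks (2 * n)) * B) b)\<rparr>) ;;
      While (\<lambda>s. ibuf s \<noteq> []) (Basic (input_step n) ;; flushes) ;;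
      Basic (\<lambda>s. s\<lparr>ib := ib s + 1\<rparr>))"

definition write_obuf :: "nat \<Rightarrow> st com" where
  "write_obuf o' = While (\<lambda>s. B \<le> length (obuf s))
     (Wr (\<lambda>s. o' + ob s) (\<lambda>s. take B (obuf s)) ;; Basic (\<lambda>s. s\<lparr>obuf := drop B (obuf s), ob := ob s + 1\<rparr>))"

definition extract_loop :: "nat \<Rightarrow> st com" where
  "extract_loop o' = While (\<lambda>s. heap s \<noteq> [] \<or> onD s \<noteq> 0)
     (Cond (\<lambda>s. safe s = 0 \<and> onD s \<noteq> 0) refill (Basic (\<lambda>s. s)) ;;
      Basic ext_step ;; write_obuf o' ;; flushes)"

definition main :: "nat \<Rightarrow> nat \<Rightarrow> nat \<Rightarrow> st com" where
  "main n e o' = input_loop n e ;; extract_loop o' ;;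
     Cond (\<lambda>s. obuf s \<noteq> []) (Wr (\<lambda>s. o' + ob s) (\<lambda>s. padded (obuf s))) (Basic (\<lambda>s. s))"

definition flush_cost :: "nat \<Rightarrow> nat" where
  "flush_cost k = (\<Sum>i\<in>{1..k}. f + 1 + cascade i)"

text \<open>
  \<open>a\<close> is the number of refills. Between two refills, \<open>U\<close> items are extracted, because
  a refill makes \<open>U\<close> items safe unless the disk becomes empty.
\<close>

definition account :: "nat \<Rightarrow> nat \<Rightarrow> st \<Rightarrow> bool" where
  "account a x s \<longleftrightarrow> U * nfl s \<le> onD s + U * a \<and> onD s \<le> U * nfl s \<and>
     U * a \<le> x + (if onD s = 0 then U else min (safe s) U) \<and>
     (0 < a \<longrightarrow> 0 < nfl s) \<and> (0 < nfl s \<longrightarrow> 3 * U \<le> Q)"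

section \<open>Queue operations and their effect on the invariant\<close>

lemma pq_size: "pq s D C \<Longrightarrow> size C = length (heap s) + onD s"
  by (auto simp: pq_def)

lemma flushes:
  assumes L: "2 * Q div U + 3 < f ^ L" "Q < V0"
    and pq: "pq s0 D0 C" and sC: "size C + x \<le> Q" and ac: "account a x s0"
  shows "hoareM (\<lambda>s D T. s = s0 \<and> D = D0 \<and> T = T0) flushes
    (\<lambda>s D T. pq s D C \<and> mainf s = mainf s0 \<and> account a x s \<and> length (heap s) < 3 * U \<and>
      T + flush_cost (nfl s0) \<le> T0 + flush_cost (nfl s) \<and> (\<forall>x<rbase * B. D x = D0 x))"
    (is "hoareM _ _ ?post")
proof -
  define inv where "inv = (\<lambda>s D T. pq s D C \<and> mainf s = mainf s0 \<and> account a x s \<and>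
      T + flush_cost (nfl s0) \<le> T0 + flush_cost (nfl s) \<and> (\<forall>x<rbase * B. D x = D0 x))"
  have body: "hoareM (\<lambda>s D T. inv s D T \<and> 3 * U \<le> length (heap s) \<and> length (heap s) = n) flush
      (\<lambda>s D T. inv s D T \<and> length (heap s) < n)" for n
  proof (rule hoare_start)
    fix s1 D1 T1 assume a: "inv s1 D1 T1 \<and> 3 * U \<le> length (heap s1) \<and> length (heap s1) = n"
    then have pq1: "pq s1 D1 C" and ac1: "account a x s1" and m1: "mainf s1 = mainf s0"
      and T1: "T1 + flush_cost (nfl s0) \<le> T0 + flush_cost (nfl s1)" and D1: "\<forall>x<rbase * B. D1 x = D0 x"
      and len: "3 * U \<le> length (heap s1)" by (auto simp: inv_def)
    have sz: "size C = length (heap s1) + onD s1" using pq_size[OF pq1] .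
    then have Q: "3 * U \<le> Q" using len sC by linarith
    \<comment> \<open>By \<open>account\<close>, a flush is matched by \<open>U\<close> items on the
      disk or by a refill, and all but one refill by \<open>U\<close> extractions. So there were at
      most \<open>2 * Q div U + 1\<close> flushes.\<close>
    have nf: "nfl s1 + 1 < f ^ L"
    proof -
      have "U * nfl s1 \<le> onD s1 + U * a" "U * a \<le> x + U"
        using ac1 by (auto simp: account_def split: if_splits)
      then have "U * nfl s1 \<le> 2 * Q + U" using sz sC by linarith
      then have "nfl s1 * U div U \<le> (2 * Q + U) div U" by (intro div_le_mono) (simp add: mult.commute)
      then have "nfl s1 \<le> 2 * Q div U + 1" using U by simp
      then show ?thesis using L by linarith
    qed
    have szV: "size C < V0" using sC L by linarith
    show "hoareM (\<lambda>s D T. s = s1 \<and> D = D1 \<and> T = T1) flush (\<lambda>s D T. inv s D T \<and> length (heap s) < n)"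
    proof (rule hoare_conseq[OF flush[OF Q pq1 len nf szV]])
      fix s D T assume p: "pq s D C \<and> mainf s = mainf s1 \<and> nfl s = nfl s1 + 1 \<and> length (heap s) + U = length (heap s1) \<and>
        0 < onD s \<and> safe s = (if onD s1 = 0 then length (heap s) else min (safe s1) (length (heap s))) \<and>
        T \<le> T1 + f + 1 + cascade (nfl s1 + 1) \<and> (\<forall>x<rbase * B. D x = D1 x)"
      have onD: "onD s = onD s1 + U" using pq_size[of s D C] p sz by simp
      have "flush_cost (nfl s) = flush_cost (nfl s1) + (f + 1 + cascade (nfl s1 + 1))"
        using p by (simp add: flush_cost_def)
      then have T: "T + flush_cost (nfl s0) \<le> T0 + flush_cost (nfl s)" using p T1 by linarith
      have lh: "2 * U \<le> length (heap s)" using p len by linarith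
      have "account a x s"
        using ac1 p onD lh Q by (auto simp: account_def algebra_simps min_def split: if_splits)
      then show "inv s D T \<and> length (heap s) < n"
        using p T m1 D1 a U by (auto simp: inv_def)
    qed simp
  qed
  show ?thesis
    unfolding flushes_def
    by (rule hoare_While[where I = inv and m = "\<lambda>s D T. length (heap s)", OF body])
      (use pq ac in \<open>auto simp: inv_def\<close>)
qed

text \<open>Insertion only enlarges the counts that bound \<open>safe\<close>, so any item may be
  inserted, even a least one.\<close>

lemma pq_insert:
  assumes "pq s D C" "okm s'" "okf s'" "heap s' = insort x (heap s)" "safe s' = safe s" "onD s' = onD s" "nfl s' = nfl s"
  shows "pq s' D (add_mset x C)"
proof -
  have le: "length (filter P (heap s)) \<le> length (filter P (insort x (heap s)))" for P
  proof -
    have "size (filter_mset P (mset (heap s))) \<le> size (filter_mset P (mset (insort x (heap s))))" by simp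
    then show ?thesis by (metis mset_filter size_mset)
  qed
  obtain R where R: "sorted (heap s)" "disk_ok D R" "C = mset (heap s) + total R (indices 0 L)"
    "onD s = size (total R (indices 0 L))"
    "\<forall>y\<in>#total R (indices 0 L). safe s \<le> length (filter (\<lambda>x. x \<le> y) (heap s))"
    "\<forall>i<L. \<forall>j<f. nfl s div f ^ i mod f \<le> j \<longrightarrow> rem R (i, j) = []" "\<forall>x. D x < V"
    using assms(1) unfolding pq_def by blast
  have "\<forall>y\<in>#total R (indices 0 L). safe s' \<le> length (filter (\<lambda>x. x \<le> y) (heap s'))"
    using R(5) le unfolding assms(4,5) by (meson le_trans)
  then show ?thesis unfolding pq_def using R assms
    by (intro conjI exI[of _ R]) (simp_all add: sorted_insort)
qed

lemma pq_same:
  assumes "pq s D C" "okm s'" "okf s'" "heap s' = heap s" "safe s' = safe s" "onD s' = onD s" "nfl s' = nfl s"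
  shows "pq s' D C"
  using assms unfolding pq_def by simp

lemma pq_min:
  assumes "pq s D C" "C \<noteq> {#}" "0 < safe s \<or> onD s = 0"
  shows "heap s \<noteq> []" "hd (heap s) = Min (set_mset C)"
proof -
  obtain R where R: "sorted (heap s)" "C = mset (heap s) + total R (indices 0 L)"
    "onD s = size (total R (indices 0 L))"
    "\<forall>y\<in>#total R (indices 0 L). safe s \<le> length (filter (\<lambda>x. x \<le> y) (heap s))"
    using assms(1) unfolding pq_def by blast
  have ex: "\<exists>x\<in>set (heap s). x \<le> y" if y: "y \<in># total R (indices 0 L)" for y
  proof -
    have "0 < safe s" using assms(3) R(3) y by (cases "onD s = 0") auto
    then have "0 < length (filter (\<lambda>x. x \<le> y) (heap s))" using R(4) y by fastforce
    then show ?thesis by (auto simp: filter_empty_conv)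
  qed
  show ne: "heap s \<noteq> []"
  proof
    assume "heap s = []"
    moreover obtain y where "y \<in># C" using assms(2) by blast
    ultimately show False using R(2) ex by auto
  qed
  have hd: "hd (heap s) \<le> x" if "x \<in> set (heap s)" for x
    using R(1) ne that by (cases "heap s") auto
  show "hd (heap s) = Min (set_mset C)"
  proof (rule Min_eqI[symmetric])
    show "hd (heap s) \<in> set_mset C" using R(2) ne by simp
    fix y assume "y \<in> set_mset C"
    then consider "y \<in> set (heap s)" | "y \<in># total R (indices 0 L)" using R(2) by auto
    then show "hd (heap s) \<le> y" using hd ex by cases force+
  qed simp
qed

text \<open>Removing the head lowers each count of small items by at most one, which
  \<open>safe s - 1\<close> allows for.\<close>

lemma pq_extract:
  assumes "pq s D C" "heap s \<noteq> []" "okm s'" "okf s'" "heap s' = sort (tl (heap s) @ new)" "safe s' = safe s - 1"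
    "onD s' = onD s" "nfl s' = nfl s"
  shows "pq s' D (C - {#hd (heap s)#} + mset new)"
proof -
  obtain x h where h: "heap s = x # h" using assms(2) by (cases "heap s") auto
  obtain R where R: "sorted (heap s)" "disk_ok D R" "C = mset (heap s) + total R (indices 0 L)"
    "onD s = size (total R (indices 0 L))"
    "\<forall>y\<in>#total R (indices 0 L). safe s \<le> length (filter (\<lambda>x. x \<le> y) (heap s))"
    "\<forall>i<L. \<forall>j<f. nfl s div f ^ i mod f \<le> j \<longrightarrow> rem R (i, j) = []" "\<forall>x. D x < V"
    using assms(1) unfolding pq_def by blast
  have le: "length (filter P (x # h)) - 1 \<le> length (filter P (sort (h @ new)))" for P
  proof -
    have "size (filter_mset P (mset h)) \<le> size (filter_mset P (mset (sort (h @ new))))" by simp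
    then have "length (filter P h) \<le> length (filter P (sort (h @ new)))" by (metis mset_filter size_mset)
    moreover have "length (filter P (x # h)) - 1 \<le> length (filter P h)" by simp
    ultimately show ?thesis by linarith
  qed
  have "\<forall>y\<in>#total R (indices 0 L). safe s' \<le> length (filter (\<lambda>x. x \<le> y) (heap s'))"
  proof
    fix y assume "y \<in># total R (indices 0 L)"
    then have "safe s \<le> length (filter (\<lambda>x. x \<le> y) (x # h))" using R(5) h by simp
    then have "safe s - 1 \<le> length (filter (\<lambda>x. x \<le> y) (x # h)) - 1" by simp
    then show "safe s' \<le> length (filter (\<lambda>x. x \<le> y) (heap s'))"
      using le[of "\<lambda>x. x \<le> y"] unfolding assms(5,6) h by simp
  qed
  then show ?thesis unfolding pq_def using R assms h
    by (intro conjI exI[of _ R]) simp_all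
qed

lemma pq_put:
  assumes "pq s D C" "a < rbase" "\<forall>x\<in>set w. x < V" "length w = B"
  shows "pq s (put B a w D) C"
proof -
  obtain R where R: "disk_ok D R" and rest: "C = mset (heap s) + total R (indices 0 L)"
    "onD s = size (total R (indices 0 L))"
    "\<forall>y\<in>#total R (indices 0 L). safe s \<le> length (filter (\<lambda>x. x \<le> y) (heap s))"
    "\<forall>i<L. \<forall>j<f. nfl s div f ^ i mod f \<le> j \<longrightarrow> rem R (i, j) = []"
    using assms(1) unfolding pq_def by blast
  have "disk_ok (put B a w D) R"
    unfolding disk_ok_def
  proof
    fix q assume "q \<in> {..<L} \<times> {..<f}"
    then obtain i j where ij: "q = (i, j)" "i < L" "j < f" by auto
    have "run_at (put B a w D) (i, j) (fst (R (i, j)), snd (R (i, j)))"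
      by (rule run_at_put[OF disk_okD[OF R ij(2,3)]]) (use assms(2) rad_ge[of i j] in \<open>auto simp: not_less[symmetric]\<close>)
    then show "run_at (put B a w D) q (R q)" using ij by simp
  qed
  moreover have "\<forall>x. put B a w D x < V" using assms unfolding pq_def by (intro put_less_V) auto
  ultimately show ?thesis using assms(1) rest unfolding pq_def by blast
qed

end

lemma length_delta: "length (fst (snd (delta q x))) \<le> 2" "length (snd (snd (delta q x))) \<le> 2"
  by (simp_all add: delta_def Let_def)

lemma length_pair_file: "length (pair_file rs) = 2 * length rs"
  by (induction rs) (auto simp: pair_file_def)

lemma nth_pair_file:
  "k < length rs \<Longrightarrow> pair_file rs ! (2 * k) = fst (rs ! k) \<and> pair_file rs ! (2 * k + 1) = snd (rs ! k)"
proof (induction rs arbitrary: k)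
  case (Cons r rs)
  have "pair_file (r # rs) = fst r # snd r # pair_file rs" by (cases r) (simp add: pair_file_def)
  then show ?case using Cons by (cases k) auto
qed simp

lemma pair_file_append: "pair_file (xs @ ys) = pair_file xs @ pair_file ys"
  by (simp add: pair_file_def)

text \<open>For loops whose progress is a ghost quantity that cannot be read off the store, such as
  the number of items still to be extracted.\<close>

lemma hoare_While_ex:
  fixes I :: "nat \<Rightarrow> 's \<Rightarrow> (nat \<Rightarrow> nat) \<Rightarrow> nat \<Rightarrow> bool"
  assumes body: "\<And>n. hoare B ok A V (\<lambda>s D T. I n s D T \<and> b s) c (\<lambda>s D T. \<exists>m<n. I m s D T)"
    and pre: "\<And>s D T. P s D T \<Longrightarrow> \<exists>n. I n s D T"
    and post: "\<And>n s D T. I n s D T \<Longrightarrow> \<not> b s \<Longrightarrow> Q s D T"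
  shows "hoare B ok A V P (While b c) Q"
proof (rule hoare_While[where I = "\<lambda>s D T. \<exists>n. I n s D T" and m = "\<lambda>s D T. LEAST n. I n s D T"])
  fix n
  show "hoare B ok A V (\<lambda>s D T. (\<exists>n. I n s D T) \<and> b s \<and> (LEAST n. I n s D T) = n) c
    (\<lambda>s D T. (\<exists>n. I n s D T) \<and> (LEAST n. I n s D T) < n)"
  proof (rule hoare_conseq[OF body])
    fix s D T assume "(\<exists>n. I n s D T) \<and> b s \<and> (LEAST n. I n s D T) = n"
    then show "I n s D T \<and> b s" by (metis LeastI)
  next
    fix s D T assume "\<exists>m<n. I m s D T"
    then show "(\<exists>n. I n s D T) \<and> (LEAST n. I n s D T) < n" by (meson Least_le le_less_trans)
  qed
qed (use pre post in blast)+

definition start :: st where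
  "start = \<lparr>heap = [], safe = 0, onD = 0, nfl = 0, sta = ([], 0, 0), ib = 0, ibuf = [], prv = 0, ip = 0, obuf = [],
    ob = 0, ci = 0, wb = [], wi = 0, wj = 0, wp = 0, tot = 0, mg = 0, lo = 0, hi = 0, fr = [], lv = 0, rt = [],
    xx = 0, tmp = 0\<rparr>"

text \<open>The disk holds the input, then as many blocks for the output as the node file has, then
  the queue from \<open>rbase\<close> on. By \<open>D0_zero\<close> all headers read 0, the code of
  the pair \<open>(0, 0)\<close>, so all runs are empty without any initialising IO.\<close>

locale em_dag = dag G + em B f L rbase A Q V0 "dag.X G"
  for G :: "(nat, nat) lgraph" and B f L rbase A Q V0 :: nat +
  fixes es :: "(nat \<times> nat) list" and D0 :: "nat \<Rightarrow> nat"
  assumes es: "distinct es" "set es = edges G"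
    and levels: "2 * Q div (f * B) + 3 < f ^ L" "Q < V0"
    and Q: "10 * (card (nodes G) + card (edges G)) \<le> Q"
    and rbase_eq: "rbase = 2 * ((2 * card (nodes G) + B - 1) div B) + (2 * card (edges G) + B - 1) div B"
    and top: "top + 3 < V0"
    and input: "\<And>x. x < 2 * card (nodes G) \<Longrightarrow> D0 x = node_file G ! x"
      "\<And>x. x < 2 * card (edges G) \<Longrightarrow> D0 ((2 * card (nodes G) + B - 1) div B * B + x) = pair_file es ! x"
    and D0_less: "\<And>x. D0 x < V"
    and D0_zero: "\<And>x. rbase * B \<le> x \<Longrightarrow> D0 x = 0"
begin

section \<open>Reading the input\<close>

definition n where "n = card (nodes G)"
definition e where "e = card (edges G)"
definition nb where "nb = blocks (2 * n)"
definition eb where "eb = blocks (2 * e)"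

lemma rbase': "rbase = 2 * nb + eb"
  by (simp add: rbase_eq nb_def eb_def blocks_def n_def e_def)

lemma blocks: "k \<le> blocks k * B" "i < blocks k \<Longrightarrow> i * B < k" "blocks k \<le> k"
proof -
  have "k + B - 1 < (blocks k + 1) * B"
    using B unfolding blocks_def by (metis Suc_eq_plus1 dividend_less_div_times add.commute mult_Suc less_le_trans zero_less_one)
  then show "k \<le> blocks k * B" by (simp add: algebra_simps)
  show *: "i * B < k" if "i < blocks k" for i
  proof -
    have "(i + 1) * B \<le> blocks k * B" using that by (intro mult_le_mono1) simp
    also have "\<dots> \<le> k + B - 1" by (simp add: blocks_def)
    finally show ?thesis using B by (simp add: algebra_simps)
  qed
  show "blocks k \<le> k"
  proof (rule ccontr)
    assume "\<not> blocks k \<le> k"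
    then have "k * B < k" by (intro *) simp
    then show False using B by (cases B) auto
  qed
qed

definition ins :: "nat list" where
  "ins = node_file G @ pair_file es"

definition items :: "nat list list" where
  "items = map (\<lambda>v. [1, v, 1, label G v]) (sorted_list_of_set (nodes G)) @ map (\<lambda>(m, n). [1, n, 2, m]) es"

lemma length_es: "length es = e"
  using es distinct_card[of es] by (simp add: e_def)

lemma length_node_file: "length (node_file G) = 2 * n"
  by (simp add: node_file_def length_pair_file n_def)

lemma length_ins: "length ins = 2 * n + 2 * e"
  by (simp add: ins_def length_node_file length_pair_file length_es)

lemma length_items: "length items = n + e"
  by (simp add: items_def length_es n_def)

lemma items_nth:
  assumes "p < n + e"
  shows "items ! p = (if p < n then [1, ins ! (2 * p), 1, ins ! (2 * p + 1)] else [1, ins ! (2 * p + 1), 2, ins ! (2 * p)])"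
proof -
  let ?rs = "map (\<lambda>v. (v, label G v)) (sorted_list_of_set (nodes G)) @ es"
  have l: "length (sorted_list_of_set (nodes G)) = n" by (simp add: n_def)
  have ins: "ins = pair_file ?rs" by (simp add: ins_def node_file_def pair_file_append)
  have "ins ! (2 * p) = fst (?rs ! p) \<and> ins ! (2 * p + 1) = snd (?rs ! p)"
    unfolding ins by (rule nth_pair_file) (use assms l length_es in simp)
  then show ?thesis using assms l length_es by (auto simp: items_def nth_append split_beta)
qed

lemma ins_less: "x \<in> set ins \<Longrightarrow> x < V0"
proof -
  have t: "y \<le> top" if "y \<in> nodes G \<or> y \<in> label G ` nodes G" for y
  proof -
    have "y \<le> Max (insert 0 (nodes G \<union> label G ` nodes G))" using that by (intro Max_ge) auto
    then show ?thesis by (simp add: top_def)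
  qed
  assume "x \<in> set ins"
  then have "x \<in> nodes G \<or> x \<in> label G ` nodes G"
    using E_sub by (auto simp: ins_def node_file_def pair_file_def es)
  then show "x < V0" using t[of x] top by linarith
qed

lemma items_X: "set items \<subseteq> X"
proof -
  have "mset items = mset_set {z. init z}" unfolding items_def by (rule mset_init) (use es in auto)
  moreover have "finite {z. init z}" by (rule finite_subset[of _ X]) (use X_finite_card in \<open>auto simp: X_def\<close>)
  ultimately have "set items = {z. init z}" by (metis finite_set_mset_mset_set set_mset_mset)
  then show ?thesis by (auto simp: X_def)
qed

text \<open>The number of input words in the first \<open>i\<close> blocks; the padding behind the
  node file is not counted.\<close>

definition pos :: "nat \<Rightarrow> nat" where
  "pos i = min (i * B) (2 * n) + min ((i - nb) * B) (2 * e)"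

lemma pos_le: "pos i \<le> 2 * n + 2 * e"
  by (simp add: pos_def add_mono)

lemma pos_end: "pos (nb + eb) = 2 * n + 2 * e"
  using blocks(1)[of "2 * n"] blocks(1)[of "2 * e"] unfolding pos_def nb_def eb_def
  by (simp add: min_def algebra_simps)

lemma pos_step:
  "i < nb \<Longrightarrow> pos i = i * B \<and> i * B < 2 * n \<and> pos (i + 1) = min (i * B + B) (2 * n)"
  "nb \<le> i \<Longrightarrow> i < nb + eb \<Longrightarrow> pos i = 2 * n + (i - nb) * B \<and> (i - nb) * B < 2 * e \<and>
     pos (i + 1) = 2 * n + min ((i - nb) * B + B) (2 * e)"
proof -
  show "pos i = i * B \<and> i * B < 2 * n \<and> pos (i + 1) = min (i * B + B) (2 * n)" if "i < nb"
    using blocks(2)[of i "2 * n"] that by (simp add: pos_def nb_def add.commute)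
  show "pos i = 2 * n + (i - nb) * B \<and> (i - nb) * B < 2 * e \<and>
     pos (i + 1) = 2 * n + min ((i - nb) * B + B) (2 * e)" if i: "nb \<le> i" "i < nb + eb"
  proof -
    have "2 * n \<le> nb * B" using blocks(1) by (simp add: nb_def)
    also have "\<dots> \<le> i * B" using i by (intro mult_le_mono1)
    finally have 1: "2 * n \<le> i * B" .
    have 2: "(i - nb) * B < 2 * e" by (rule blocks(2)) (use i in \<open>simp add: eb_def less_diff_conv2\<close>)
    have 3: "(i + 1 - nb) * B = (i - nb) * B + B" using i by (simp add: Suc_diff_le add.commute)
    show ?thesis using 1 2 3 unfolding pos_def by (simp add: add.commute min_def)
  qed
qed

lemma read_input:
  assumes i: "i < nb + eb" and D: "\<forall>x<rbase * B. D x = D0 x"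
  shows "(if i < nb then take (2 * n - i * B) (block B D i) else take (2 * e - (i - nb) * B) (block B D i)) =
    take (pos (i + 1) - pos i) (drop (pos i) ins)"
proof -
  have D': "D (i * B + k) = D0 (i * B + k)" if "k < B" for k
  proof -
    have "i * B + k < (i + 1) * B" using that by simp
    also have "\<dots> \<le> rbase * B" using i by (intro mult_le_mono1) (simp add: rbase')
    finally show ?thesis using D by blast
  qed
  show ?thesis
  proof (cases "i < nb")
    case True
    note p = pos_step(1)[OF True]
    have "take (2 * n - i * B) (block B D i) = take (pos (i + 1) - pos i) (drop (pos i) ins)"
    proof (rule nth_equalityI)
      show len: "length (take (2 * n - i * B) (block B D i)) = length (take (pos (i + 1) - pos i) (drop (pos i) ins))"
        unfolding length_take length_drop length_ins length_block using p by linarith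
      fix k assume "k < length (take (2 * n - i * B) (block B D i))"
      then have k: "k < B" "i * B + k < 2 * n" by auto
      have "D (i * B + k) = node_file G ! (i * B + k)" using D'[OF k(1)] input(1) k(2) by (simp add: n_def)
      also have "\<dots> = ins ! (i * B + k)" using k(2) by (simp add: ins_def nth_append length_node_file)
      finally show "take (2 * n - i * B) (block B D i) ! k = take (pos (i + 1) - pos i) (drop (pos i) ins) ! k"
        using p k length_ins by (simp add: block_nth)
    qed
    then show ?thesis using True by simp
  next
    case False
    then have nbi: "nb \<le> i" by simp
    note p = pos_step(2)[OF nbi i]
    define q where "q = (i - nb) * B"
    have iB: "i * B = nb * B + q" using nbi by (simp add: q_def flip: add_mult_distrib)
    have p': "pos i = 2 * n + q" "q < 2 * e" "pos (i + 1) = 2 * n + min (q + B) (2 * e)" using p by (auto simp: q_def)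
    have "take (2 * e - q) (block B D i) = take (pos (i + 1) - pos i) (drop (pos i) ins)"
    proof (rule nth_equalityI)
      show len: "length (take (2 * e - q) (block B D i)) = length (take (pos (i + 1) - pos i) (drop (pos i) ins))"
        unfolding length_take length_drop length_ins length_block using p' by linarith
      fix k assume "k < length (take (2 * e - q) (block B D i))"
      then have k: "k < B" "q + k < 2 * e" by auto
      have "D (i * B + k) = D0 (nb * B + (q + k))" using D'[OF k(1)] by (simp add: iB add.assoc)
      also have "\<dots> = pair_file es ! (q + k)"
        using input(2)[of "q + k"] k(2) by (simp add: nb_def blocks_def n_def e_def)
      also have "\<dots> = ins ! (2 * n + q + k)" by (simp add: ins_def nth_append length_node_file add.assoc)
      finally show "take (2 * e - q) (block B D i) ! k = take (pos (i + 1) - pos i) (drop (pos i) ins) ! k"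
        using p' k length_ins by (simp add: block_nth)
    qed
    then show ?thesis using False by (simp add: q_def)
  qed
qed

lemma account_cong:
  assumes "account a x s" "onD s' = onD s" "nfl s' = nfl s" "safe s' = safe s"
  shows "account a x s'"
  using assms(1) unfolding account_def assms(2-4) .

lemma small: "2 * n + 2 * e < V0" "nb + eb < V0" "2 * nb \<le> rbase" "nb + eb \<le> A"
proof -
  have "2 * n + 2 * e \<le> Q" using Q by (simp add: n_def e_def)
  then show 1: "2 * n + 2 * e < V0" using levels(2) by linarith
  then show "nb + eb < V0" using blocks(3)[of "2 * n"] blocks(3)[of "2 * e"] by (simp add: nb_def eb_def)
  show "2 * nb \<le> rbase" "nb + eb \<le> A" using rbase rbase' by linarith+
qed

lemma pq_start: "pq start D0 {#}"
proof -
  define R where "R = (\<lambda>p :: nat \<times> nat. (0 :: nat, [] :: nat list list))"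
  have rem: "rem R p = []" for p by (simp add: R_def rem_def)
  have tot: "total R (indices 0 L) = {#}" by (simp add: total_def rem)
  have "disk_ok D0 R"
    unfolding disk_ok_def
  proof
    fix p assume "p \<in> {..<L} \<times> {..<f}"
    have "D0 (rad i j 0 * B) = 0" for i j by (rule D0_zero) (simp add: rad_ge)
    then show "run_at D0 p (R p)" by (auto simp: run_at_def R_def prod_encode_def split: prod.split)
  qed
  moreover have "okm start" "okf start" using V0 by (auto simp: okm_def okf_def start_def)
  ultimately show ?thesis using tot rem D0_less unfolding pq_def
    by (intro conjI exI[of _ R]) (auto simp: start_def)
qed

definition inv_in :: "st \<Rightarrow> (nat \<Rightarrow> nat) \<Rightarrow> nat \<Rightarrow> bool" where
  "inv_in s D T \<longleftrightarrow> pq s D (mset (take (ip s div 2) items)) \<and> (0 < ip s \<longrightarrow> prv s = ins ! (ip s - 1)) \<and>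
     account 0 0 s \<and> length (heap s) < 3 * U \<and> (\<forall>x<rbase * B. D x = D0 x) \<and> ib s \<le> nb + eb \<and>
     ip s \<le> 2 * n + 2 * e \<and> sta s = ([], 0, 0) \<and> obuf s = [] \<and> ob s = 0"

lemma input_step:
  assumes iv: "inv_in s0 D1 T0" and ne: "ibuf s0 \<noteq> []" and buf: "ibuf s0 = take (m - ip s0) (drop (ip s0) ins)"
    and m: "m \<le> 2 * n + 2 * e"
  shows "hoareM (\<lambda>s D T. s = s0 \<and> D = D1 \<and> T = T0) (Basic (input_step n) ;; flushes)
    (\<lambda>s D T. inv_in s D T \<and> ib s = ib s0 \<and> ip s = ip s0 + 1 \<and> ibuf s = take (m - ip s) (drop (ip s) ins) \<and>
      length (ibuf s) < length (ibuf s0) \<and> T + flush_cost (nfl s0) \<le> T0 + flush_cost (nfl s))"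
proof (rule hoare_first)
  define p where "p = ip s0"
  define s1 where "s1 = input_step n s0"
  define C where "C = mset (take (ip s1 div 2) items)"
  have pm: "p < m" using ne buf by (auto simp: p_def)
  then have pl: "p < length ins" using m length_ins by simp
  have b: "ibuf s0 = ins ! p # take (m - (p + 1)) (drop (p + 1) ins)"
  proof -
    have "drop p ins = ins ! p # drop (p + 1) ins" using Cons_nth_drop_Suc[OF pl] by simp
    moreover have "m - p = Suc (m - (p + 1))" using pm by simp
    ultimately show ?thesis unfolding buf p_def[symmetric] by (metis take_Suc_Cons)
  qed
  have pq0: "pq s0 D1 (mset (take (p div 2) items))" and prv: "0 < p \<longrightarrow> prv s0 = ins ! (p - 1)"
    and ac: "account 0 0 s0" and lh: "length (heap s0) < 3 * U" and ibn: "ib s0 \<le> nb + eb"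
    and D1: "\<forall>x<rbase * B. D1 x = D0 x" and st: "sta s0 = ([], 0, 0)" "obuf s0 = []" "ob s0 = 0"
    using iv by (auto simp: inv_in_def p_def)
  have ok0: "okm s0" "okf s0" using pq0 by (auto simp: pq_def)
  have w: "ins ! p < V0" using ins_less pl by simp
  have eq: "ibuf s1 = take (m - (p + 1)) (drop (p + 1) ins)" "ip s1 = p + 1" "prv s1 = ins ! p" "safe s1 = safe s0"
    "onD s1 = onD s0" "nfl s1 = nfl s0" "sta s1 = sta s0" "obuf s1 = obuf s0" "ob s1 = ob s0" "ib s1 = ib s0"
    by (simp_all add: s1_def input_step_def Let_def b p_def)
  have heap1: "heap s1 = (if odd p then insort (items ! (p div 2)) (heap s0) else heap s0)"
  proof (cases "odd p")
    case True
    then have pk: "p = 2 * (p div 2) + 1" "p - 1 = 2 * (p div 2)" by presburger+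
    have pr: "prv s0 = ins ! (p - 1)" using prv pk by auto
    have "p div 2 < n + e" using pl length_ins by linarith
    note it = items_nth[OF this, folded pk]
    have "p < 2 * n \<longleftrightarrow> p div 2 < n" using pk by linarith
    then show ?thesis using True it pr by (simp add: s1_def input_step_def Let_def b p_def)
  qed (simp add: s1_def input_step_def Let_def p_def)
  have frs: "fr s1 = fr s0" "lv s1 = lv s0" "xx s1 = xx s0" "tmp s1 = tmp s0" "rt s1 = rt s0"
    by (simp_all add: s1_def input_step_def Let_def)
  have okf1: "okf s1" using ok0(2) frs by (simp add: okf_def)
  have itX: "items ! (p div 2) \<in> X" if "odd p"
  proof -
    have "p div 2 < length items" using pl length_ins length_items by linarith
    then show ?thesis using items_X nth_mem by blast
  qed
  have okm1: "okm s1"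
  proof -
    have rest: "ci s1 = ci s0" "wb s1 = wb s0" "wi s1 = wi s0" "wj s1 = wj s0" "wp s1 = wp s0" "tot s1 = tot s0"
      "mg s1 = mg s0" "lo s1 = lo s0" "hi s1 = hi s0"
      by (simp_all add: s1_def input_step_def Let_def)
    have h: "length (heap s1) \<le> 10 * U" "set (heap s1) \<subseteq> X"
      using heap1 lh itX ok0(1) U by (auto simp: okm_def set_insort_key)
    have bu: "length (ibuf s1) \<le> B" "\<forall>x\<in>set (ibuf s1). x < V0"
      using ok0(1) unfolding eq(1) okm_def b by auto
    have "p + 1 < V0" using pl length_ins small(1) by linarith
    then show ?thesis using ok0(1) h bu w unfolding okm_def rest eq(2-) by simp
  qed
  have pq1: "pq s1 D1 C"
  proof (cases "odd p")
    case True
    then have "(p + 1) div 2 = Suc (p div 2)" by presburger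
    moreover have "p div 2 < length items" using pl length_ins length_items by linarith
    ultimately have "C = add_mset (items ! (p div 2)) (mset (take (p div 2) items))"
      by (simp add: C_def eq take_Suc_conv_app_nth)
    then show ?thesis using pq_insert[OF pq0 okm1 okf1] heap1 True eq by simp
  next
    case False
    then have "(p + 1) div 2 = p div 2" by presburger
    then have "C = mset (take (p div 2) items)" by (simp add: C_def eq)
    then show ?thesis using pq_same[OF pq0 okm1 okf1] heap1 False eq by simp
  qed
  have ac1: "account 0 0 s1" by (rule account_cong[OF ac]) (simp_all add: eq)
  have sC: "size C + 0 \<le> Q"
  proof -
    have "size C \<le> n + e" by (simp add: C_def length_items)
    then show ?thesis using Q by (simp add: n_def e_def)
  qed
  show "hoareM (\<lambda>s D T. s = input_step n s0 \<and> D = D1 \<and> T = T0) flushes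
    (\<lambda>s D T. inv_in s D T \<and> ib s = ib s0 \<and> ip s = ip s0 + 1 \<and> ibuf s = take (m - ip s) (drop (ip s) ins) \<and>
      length (ibuf s) < length (ibuf s0) \<and> T + flush_cost (nfl s0) \<le> T0 + flush_cost (nfl s))"
    unfolding s1_def[symmetric]
  proof (rule hoare_conseq[OF flushes[OF levels(1)[folded U_def] levels(2) pq1 sC ac1]])
    fix s D T assume a: "pq s D C \<and> mainf s = mainf s1 \<and> account 0 0 s \<and> length (heap s) < 3 * U \<and>
      T + flush_cost (nfl s1) \<le> T0 + flush_cost (nfl s) \<and> (\<forall>x<rbase * B. D x = D1 x)"
    then have mf: "sta s = sta s1" "ib s = ib s1" "ibuf s = ibuf s1" "prv s = prv s1" "ip s = ip s1" "obuf s = obuf s1"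
      "ob s = ob s1" by (auto simp: mainf_def)
    have pn: "p + 1 \<le> 2 * n + 2 * e" using pm m by linarith
    have len: "length (ibuf s1) < length (ibuf s0)" unfolding eq(1) b by simp
    show "inv_in s D T \<and> ib s = ib s0 \<and> ip s = ip s0 + 1 \<and> ibuf s = take (m - ip s) (drop (ip s) ins) \<and>
      length (ibuf s) < length (ibuf s0) \<and> T + flush_cost (nfl s0) \<le> T0 + flush_cost (nfl s)"
      using a D1 st ibn pn len unfolding inv_in_def mf eq C_def by (simp add: p_def)
  qed simp
qed

lemma input_loop:
  "hoareM (\<lambda>s D T. s = start \<and> D = D0 \<and> T = 0) (input_loop n e)
    (\<lambda>s D T. inv_in s D T \<and> ip s = 2 * n + 2 * e \<and> T \<le> nb + eb + flush_cost (nfl s))"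
proof -
  define I where "I = (\<lambda>s D T. inv_in s D T \<and> ip s = pos (ib s) \<and> T \<le> ib s + flush_cost (nfl s))"
  have body: "hoareM (\<lambda>s D T. I s D T \<and> ib s < blocks (2 * n) + blocks (2 * e) \<and> nb + eb - ib s = k)
     (Rd ib (\<lambda>b s. s\<lparr>ibuf := (if ib s < blocks (2 * n) then take (2 * n - ib s * B) b
         else take (2 * e - (ib s - blocks (2 * n)) * B) b)\<rparr>) ;;
      While (\<lambda>s. ibuf s \<noteq> []) (Basic (input_step n) ;; flushes) ;;
      Basic (\<lambda>s. s\<lparr>ib := ib s + 1\<rparr>)) (\<lambda>s D T. I s D T \<and> nb + eb - ib s < k)" for k
  proof (rule hoare_start)
    fix s0 D1 T0
    assume a: "I s0 D1 T0 \<and> ib s0 < blocks (2 * n) + blocks (2 * e) \<and> nb + eb - ib s0 = k"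
    define i where "i = ib s0"
    have i: "i < nb + eb" using a by (simp add: i_def nb_def eb_def)
    have iv: "inv_in s0 D1 T0" and ipi: "ip s0 = pos i" and T0: "T0 \<le> i + flush_cost (nfl s0)"
      using a by (auto simp: I_def i_def)
    have pq0: "pq s0 D1 (mset (take (ip s0 div 2) items))" and D1: "\<forall>x<rbase * B. D1 x = D0 x"
      using iv by (auto simp: inv_in_def)
    have ok0: "okm s0" "okf s0" using pq0 by (auto simp: pq_def)
    define bu where "bu = take (pos (i + 1) - pos i) (drop (pos i) ins)"
    define s1 where "s1 = s0\<lparr>ibuf := bu\<rparr>"
    have bu': "bu = (if i < nb then take (2 * n - i * B) (block B D1 i) else take (2 * e - (i - nb) * B) (block B D1 i))"
      using read_input[OF i D1] by (simp add: bu_def)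
    have bul: "length bu \<le> B" "\<forall>x\<in>set bu. x < V0"
    proof -
      show "length bu \<le> B" unfolding bu' by simp
      show "\<forall>x\<in>set bu. x < V0" unfolding bu_def using ins_less in_set_takeD in_set_dropD by metis
    qed
    have ok1: "okm s1" "okf s1" using ok0 bul by (auto simp: okm_def okf_def s1_def)
    have iv1: "inv_in s1 D1 T" for T
    proof -
      have "pq s1 D1 (mset (take (ip s0 div 2) items))"
        by (rule pq_same[OF pq0 ok1]) (simp_all add: s1_def)
      then show ?thesis using iv account_cong[of 0 0 s0 s1] unfolding inv_in_def s1_def by simp
    qed
    define J where "J = (\<lambda>s D T. inv_in s D T \<and> ib s = i \<and> ip s \<le> pos (i + 1) \<and>
      ibuf s = take (pos (i + 1) - ip s) (drop (ip s) ins) \<and> T \<le> i + 1 + flush_cost (nfl s))"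
    have pm: "pos i \<le> pos (i + 1)" unfolding pos_def by (intro add_mono min.mono) auto
    have rd: "hoareM (\<lambda>s D T. s = s0 \<and> D = D1 \<and> T = T0)
      (Rd ib (\<lambda>b s. s\<lparr>ibuf := (if ib s < blocks (2 * n) then take (2 * n - ib s * B) b
         else take (2 * e - (ib s - blocks (2 * n)) * B) b)\<rparr>)) J"
    proof (rule hoare_Rd)
      fix s D T assume s: "s = s0 \<and> D = D1 \<and> T = T0"
      have 1: "i < A" using i small(4) by linarith
      have 2: "s0\<lparr>ibuf := (if ib s0 < blocks (2 * n) then take (2 * n - ib s0 * B) (block B D1 (ib s0))
         else take (2 * e - (ib s0 - blocks (2 * n)) * B) (block B D1 (ib s0)))\<rparr> = s1"
        unfolding s1_def bu' i_def nb_def ..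
      have "J s1 D1 (T0 + 1)"
        using iv1 ipi T0 pm unfolding J_def by (simp add: s1_def i_def bu_def)
      then show "ok s \<and> ib s < A \<and> J (s\<lparr>ibuf := (if ib s < blocks (2 * n) then take (2 * n - ib s * B) (block B D (ib s))
         else take (2 * e - (ib s - blocks (2 * n)) * B) (block B D (ib s)))\<rparr>) D (T + 1)"
        using s 1 ok0 unfolding ok_def i_def by (simp only: 2 simp_thms)
    qed
    have inner: "hoareM (\<lambda>s D T. J s D T \<and> ibuf s \<noteq> [] \<and> length (ibuf s) = l) (Basic (input_step n) ;; flushes)
      (\<lambda>s D T. J s D T \<and> length (ibuf s) < l)" for l
    proof (rule hoare_start)
      fix s2 D2 T2 assume b: "J s2 D2 T2 \<and> ibuf s2 \<noteq> [] \<and> length (ibuf s2) = l"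
      then have c: "inv_in s2 D2 T2" "ibuf s2 \<noteq> []" "ibuf s2 = take (pos (i + 1) - ip s2) (drop (ip s2) ins)"
        and d: "ib s2 = i" "T2 \<le> i + 1 + flush_cost (nfl s2)" "length (ibuf s2) = l"
        by (auto simp: J_def)
      have lt: "ip s2 + 1 \<le> pos (i + 1)"
      proof (rule ccontr)
        assume "\<not> ip s2 + 1 \<le> pos (i + 1)"
        then show False using c(2,3) by simp
      qed
      show "hoareM (\<lambda>s D T. s = s2 \<and> D = D2 \<and> T = T2) (Basic (input_step n) ;; flushes)
        (\<lambda>s D T. J s D T \<and> length (ibuf s) < l)"
        by (rule hoare_conseq[OF input_step[OF c pos_le]]) (use d lt in \<open>auto simp: J_def\<close>)
    qed
    have last: "hoareM (\<lambda>s D T. J s D T \<and> ibuf s = []) (Basic (\<lambda>s. s\<lparr>ib := ib s + 1\<rparr>)) (\<lambda>s D T. I s D T \<and> nb + eb - ib s < k)"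
    proof (rule hoare_Basic)
      fix s D T assume b: "J s D T \<and> ibuf s = []"
      then have iv2: "inv_in s D T" and d: "ib s = i" "ip s \<le> pos (i + 1)" "T \<le> i + 1 + flush_cost (nfl s)"
        "take (pos (i + 1) - ip s) (drop (ip s) ins) = []" unfolding J_def by metis+
      have ip: "ip s = pos (i + 1)" using d(2,4) pos_le[of "i + 1"] length_ins by auto
      have pq2: "pq s D (mset (take (ip s div 2) items))" using iv2 by (simp add: inv_in_def)
      then have ok2: "okm s" "okf s" by (auto simp: pq_def)
      let ?s = "s\<lparr>ib := ib s + 1\<rparr>"
      have "i + 1 < V0" using i small(2) by linarith
      then have "okm ?s" "okf ?s" using ok2 d(1) by (auto simp: okm_def okf_def)
      then have "pq ?s D (mset (take (ip s div 2) items))" by (intro pq_same[OF pq2]) simp_all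
      then have "inv_in ?s D T" using iv2 i d(1) account_cong[of 0 0 s ?s] unfolding inv_in_def by simp
      moreover have "nb + eb - (i + 1) < k" using a i unfolding i_def by linarith
      ultimately show "I ?s D T \<and> nb + eb - ib ?s < k"
        using d(1,3) ip by (simp add: I_def)
    qed
    show "hoareM (\<lambda>s D T. s = s0 \<and> D = D1 \<and> T = T0)
     (Rd ib (\<lambda>b s. s\<lparr>ibuf := (if ib s < blocks (2 * n) then take (2 * n - ib s * B) b
         else take (2 * e - (ib s - blocks (2 * n)) * B) b)\<rparr>) ;;
      While (\<lambda>s. ibuf s \<noteq> []) (Basic (input_step n) ;; flushes) ;;
      Basic (\<lambda>s. s\<lparr>ib := ib s + 1\<rparr>)) (\<lambda>s D T. I s D T \<and> nb + eb - ib s < k)"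
      by (rule hoare_Seq[OF rd hoare_Seq[OF hoare_While[where m = "\<lambda>s D T. length (ibuf s)", OF inner] last]]) auto
  qed
  have "I start D0 0"
  proof -
    have "account 0 0 start" by (simp add: account_def start_def)
    then have "inv_in start D0 0" using pq_start U unfolding inv_in_def by (simp add: start_def)
    then show ?thesis by (simp add: I_def start_def pos_def)
  qed
  moreover have "inv_in s D T \<and> ip s = 2 * n + 2 * e \<and> T \<le> nb + eb + flush_cost (nfl s)"
    if i: "I s D T" and e0: "\<not> ib s < blocks (2 * n) + blocks (2 * e)" for s D T
  proof -
    have "ib s \<le> nb + eb" using i by (simp add: I_def inv_in_def)
    then have "ib s = nb + eb" using e0 unfolding nb_def eb_def by linarith
    then show ?thesis using i pos_end unfolding I_def by simp
  qed
  ultimately show ?thesis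
    unfolding input_loop_def
    by (intro hoare_While[where I = I and m = "\<lambda>s D T. nb + eb - ib s", OF body]) blast+
qed

text \<open>The output at any stage is part of the final output, whose length
  \<open>stage_final\<close> gives; so it never outgrows its area.\<close>

lemma length_out:
  assumes "stage P q C out"
  shows "length out \<le> 2 * n"
proof -
  have len: "length (concat (map outw (sorted_list_of_set S))) = (\<Sum>x\<in>S. length (outw x))" if "finite S" for S
  proof -
    have "sum_list (map (\<lambda>x. length (outw x)) (sorted_list_of_set S)) = (\<Sum>x\<in>set (sorted_list_of_set S). length (outw x))"
      by (rule sum_list_distinct_conv_sum_set) simp
    then show ?thesis by (simp only: length_concat map_map comp_def set_sorted_list_of_set[OF that])
  qed
  have fX: "finite X" using X_finite_card by blast
  have PX: "P \<subseteq> X" and out: "out = concat (map outw (sorted_list_of_set P))" using assms by (auto simp: stage_def)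
  have "stage X (if X = {} then ([], 0, 0) else after (Max X)) (mset_set (content X)) (concat (map outw (sorted_list_of_set X)))"
    unfolding stage_def by (intro conjI subset_refl ballI impI refl)
  from stage_final[OF this] obtain rs where rs: "concat (map outw (sorted_list_of_set X)) = pair_file rs"
    "length rs = card (nodes G)" by blast
  have "length out = (\<Sum>x\<in>P. length (outw x))" unfolding out by (rule len) (rule finite_subset[OF PX fX])
  also have "\<dots> \<le> (\<Sum>x\<in>X. length (outw x))" by (rule sum_mono2[OF fX PX]) simp
  also have "\<dots> = length (pair_file rs)" using len[OF fX] rs(1) by simp
  finally show ?thesis using rs(2) by (simp add: length_pair_file n_def)
qed

section \<open>Extraction and the output file\<close>

definition out_ok :: "st \<Rightarrow> (nat \<Rightarrow> nat) \<Rightarrow> nat list \<Rightarrow> bool" where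
  "out_ok s D out \<longleftrightarrow> obuf s = drop (ob s * B) out \<and> ob s * B \<le> length out \<and>
     (\<forall>p<ob s * B. D ((nb + eb) * B + p) = out ! p)"

lemma ob_less:
  assumes "out_ok s D out" "length out \<le> 2 * n" "obuf s \<noteq> []"
  shows "ob s < nb"
proof -
  have "ob s * B < length out" using assms by (auto simp: out_ok_def)
  also have "\<dots> \<le> nb * B" using assms(2) blocks(1)[of "2 * n"] by (simp add: nb_def)
  finally show ?thesis by (simp only: mult_less_cancel2)
qed

lemma ob_le:
  assumes "out_ok s D out" "length out \<le> 2 * n"
  shows "ob s * B \<le> nb * B" "ob s \<le> nb"
proof -
  have "ob s * B \<le> length out" using assms by (simp add: out_ok_def)
  also have "\<dots> \<le> nb * B" using assms(2) blocks(1)[of "2 * n"] unfolding nb_def by (rule le_trans)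
  finally show "ob s * B \<le> nb * B" .
  then show "ob s \<le> nb" using B by simp
qed

lemma out_ok_put:
  assumes "out_ok s D out" "length w = B" "\<forall>p<min B (length (obuf s)). w ! p = obuf s ! p"
  shows "\<forall>p<min (ob s * B + B) (length out). put B (nb + eb + ob s) w D ((nb + eb) * B + p) = out ! p"
proof (intro allI impI)
  fix p assume p: "p < min (ob s * B + B) (length out)"
  let ?x = "(nb + eb) * B + p"
  have x: "?x = p + (nb + eb) * B" by simp
  have dm: "?x div B = nb + eb + p div B" "?x mod B = p mod B" using B unfolding x by simp_all
  show "put B (nb + eb + ob s) w D ?x = out ! p"
  proof (cases "p < ob s * B")
    case True
    then have "p div B < ob s" by (rule less_mult_imp_div_less)
    then show ?thesis using assms(1) True unfolding put_div dm out_ok_def by simp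
  next
    case False
    then have pd: "p div B = ob s" using p by (intro div_nat_eqI) (auto simp: mult.commute)
    then have pm: "p = ob s * B + p mod B" by (metis div_mult_mod_eq)
    have ob: "obuf s = drop (ob s * B) out" using assms(1) by (simp add: out_ok_def)
    have "p mod B < B" using B by simp
    moreover have "p mod B < length (obuf s)"
    proof -
      have "ob s * B + p mod B < length out" using p pm by linarith
      then show ?thesis using ob by simp
    qed
    ultimately have "w ! (p mod B) = obuf s ! (p mod B)" using assms(3) by simp
    also have "\<dots> = out ! (ob s * B + p mod B)" using ob p pm by (intro trans[OF arg_cong[of _ _ "\<lambda>l. l ! (p mod B)"] nth_drop]) auto
    finally show ?thesis using pd pm unfolding put_div dm by simp
  qed
qed

lemma write_obuf:
  assumes pq: "pq s0 D1 C" and out: "out_ok s0 D1 out" "length out \<le> 2 * n" and ac: "account a x s0"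
  shows "hoareM (\<lambda>s D T. s = s0 \<and> D = D1 \<and> T = T0) (write_obuf (nb + eb))
    (\<lambda>s D T. pq s D C \<and> heap s = heap s0 \<and> sta s = sta s0 \<and> nfl s = nfl s0 \<and> account a x s \<and> out_ok s D out \<and>
      T + ob s0 = T0 + ob s \<and> length (obuf s) < B)"
    (is "hoareM _ _ ?post")
proof -
  define I where "I = (\<lambda>s D T. pq s D C \<and> heap s = heap s0 \<and> sta s = sta s0 \<and> nfl s = nfl s0 \<and> account a x s \<and>
    out_ok s D out \<and> T + ob s0 = T0 + ob s)"
  have body: "hoareM (\<lambda>s D T. I s D T \<and> B \<le> length (obuf s) \<and> length (obuf s) = k)
     (Wr (\<lambda>s. nb + eb + ob s) (\<lambda>s. take B (obuf s)) ;; Basic (\<lambda>s. s\<lparr>obuf := drop B (obuf s), ob := ob s + 1\<rparr>))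
     (\<lambda>s D T. I s D T \<and> length (obuf s) < k)" for k
  proof (rule hoare_Seq[OF hoare_Wr hoare_Basic])
    let ?J = "\<lambda>s D T. length (obuf s) = k \<and> I (s\<lparr>obuf := drop B (obuf s), ob := ob s + 1\<rparr>) D T \<and> B \<le> k"
    fix s D T assume b: "I s D T \<and> B \<le> length (obuf s) \<and> length (obuf s) = k"
    then have iv: "pq s D C" "heap s = heap s0" "sta s = sta s0" "nfl s = nfl s0" "account a x s" "out_ok s D out"
      "T + ob s0 = T0 + ob s" and k: "B \<le> length (obuf s)" by (auto simp: I_def)
    have oks: "okm s" "okf s" using iv(1) by (auto simp: pq_def)
    have obn: "ob s < nb" by (rule ob_less[OF iv(6) out(2)]) (use k B in auto)
    have ad: "nb + eb + ob s < rbase" using obn rbase' by linarith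
    have w: "\<forall>x\<in>set (take B (obuf s)). x < V" "length (take B (obuf s)) = B"
      using oks(1) V_ge(1) k by (auto simp: okm_def dest!: in_set_takeD)
    let ?s = "s\<lparr>obuf := drop B (obuf s), ob := ob s + 1\<rparr>"
    let ?D = "put B (nb + eb + ob s) (take B (obuf s)) D"
    have lo: "ob s * B + B \<le> length out" "obuf s = drop (ob s * B) out" using iv(6) k by (auto simp: out_ok_def)
    have "ob s + 1 < V0" using obn small(2) by linarith
    then have "okm ?s" "okf ?s" using oks by (auto simp: okm_def okf_def dest!: in_set_dropD)
    then have "pq ?s ?D C" by (intro pq_same[OF pq_put[OF iv(1) ad w]]) simp_all
    moreover have "out_ok ?s ?D out"
      using out_ok_put[OF iv(6) w(2)] lo(1) unfolding out_ok_def by (simp add: lo(2) add.commute)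
    moreover have "account a x ?s" by (rule account_cong[OF iv(5)]) simp_all
    ultimately have "I ?s ?D (T + 1)" using iv by (simp add: I_def)
    then show "ok s \<and> nb + eb + ob s < A \<and> length (take B (obuf s)) = B \<and> (\<forall>x\<in>set (take B (obuf s)). x < V) \<and>
      ?J s ?D (T + 1)"
      using oks ad rbase w b by (simp add: ok_def)
  next
    fix s D T assume "length (obuf s) = k \<and> I (s\<lparr>obuf := drop B (obuf s), ob := ob s + 1\<rparr>) D T \<and> B \<le> k"
    then show "I (s\<lparr>obuf := drop B (obuf s), ob := ob s + 1\<rparr>) D T \<and>
      length (obuf (s\<lparr>obuf := drop B (obuf s), ob := ob s + 1\<rparr>)) < k" using B by simp
  qed
  show ?thesis
    unfolding write_obuf_def
    by (rule hoare_While[where I = I and m = "\<lambda>s D T. length (obuf s)", OF body])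
      (use pq out ac in \<open>auto simp: I_def\<close>)
qed

definition inv_ex :: "nat list set \<Rightarrow> nat list multiset \<Rightarrow> nat list \<Rightarrow> nat \<Rightarrow> st \<Rightarrow> (nat \<Rightarrow> nat) \<Rightarrow> nat \<Rightarrow> bool" where
  "inv_ex P C out a s D T \<longleftrightarrow> stage P (sta s) C out \<and> pq s D C \<and> account a (card P) s \<and> out_ok s D out \<and>
     length (obuf s) < B \<and> T \<le> nb + eb + ob s + a * (6 * f * L) + flush_cost (nfl s)"

lemma ensure_safe:
  assumes iv: "inv_ex P C out a s0 D1 T0" and ne: "heap s0 \<noteq> [] \<or> onD s0 \<noteq> 0" and lh: "length (heap s0) < 3 * U"
  shows "hoareM (\<lambda>s D T. s = s0 \<and> D = D1 \<and> T = T0) (Cond (\<lambda>s. safe s = 0 \<and> onD s \<noteq> 0) refill (Basic (\<lambda>s. s)))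
    (\<lambda>s D T. \<exists>a. inv_ex P C out a s D T \<and> C \<noteq> {#} \<and> length (heap s) < 4 * U \<and> (0 < safe s \<or> onD s = 0))"
    (is "hoareM _ _ ?post")
proof -
  have b: "stage P (sta s0) C out" "pq s0 D1 C" "account a (card P) s0" "out_ok s0 D1 out"
     "length (obuf s0) < B" "T0 \<le> nb + eb + ob s0 + a * (6 * f * L) + flush_cost (nfl s0)"
    using iv by (auto simp: inv_ex_def)
  have C: "C \<noteq> {#}" using pq_size[OF b(2)] ne by auto
  show ?thesis
  proof (cases "safe s0 = 0 \<and> onD s0 \<noteq> 0")
    case True
    \<comment> \<open>Without safe items the credit in \<open>account\<close> is 0: the refills so
      far are paid by extractions alone, and the next one can be booked.\<close>
    have ac: "U * nfl s0 \<le> onD s0 + U * a" "onD s0 \<le> U * nfl s0" "U * a \<le> card P" "0 < nfl s0 \<longrightarrow> 3 * U \<le> Q"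
      using b(3) True by (auto simp: account_def)
    have nf: "0 < nfl s0" using ac(2) True by (cases "nfl s0") auto
    then have Q3: "3 * U \<le> Q" using ac(4) by simp
    have l: "length (heap s0) + U \<le> 10 * U" using lh by linarith
    have r: "hoareM (\<lambda>s D T. s = s0 \<and> D = D1 \<and> T = T0) refill ?post"
    proof (rule hoare_conseq[OF refill[OF Q3 b(2) l]])
      fix s D T assume p: "pq s D C \<and> mainf s = mainf s0 \<and> nfl s = nfl s0 \<and>
        length (heap s) + onD s = length (heap s0) + onD s0 \<and>
        length (heap s) = length (heap s0) + safe s \<and> safe s \<le> U \<and> (safe s = U \<or> onD s = 0) \<and>
        T \<le> T0 + 6 * f * L \<and> (\<forall>x<rbase * B. D x = D1 x)"
      then have mf: "sta s = sta s0" "obuf s = obuf s0" "ob s = ob s0" "nfl s = nfl s0" by (auto simp: mainf_def)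
      have on: "onD s + safe s = onD s0" using p by linarith
      have "account (a + 1) (card P) s"
      proof -
        have "U * nfl s0 \<le> onD s + U * a + U" "onD s \<le> U * nfl s0" using ac on p by linarith+
        then show ?thesis using ac(3) p nf Q3 on unfolding account_def by (auto simp: algebra_simps)
      qed
      moreover have "out_ok s D out"
      proof -
        have "(nb + eb) * B + p < rbase * B" if "p < ob s0 * B" for p
        proof -
          have "ob s0 * B \<le> nb * B" by (rule ob_le(1)[OF b(4) length_out[OF b(1)]])
          moreover have "(nb + eb) * B + nb * B = rbase * B" by (simp add: rbase' algebra_simps)
          ultimately show ?thesis using that by linarith
        qed
        then show ?thesis using b(4) p unfolding out_ok_def mf by simp
      qed
      moreover have "T \<le> nb + eb + ob s + (a + 1) * (6 * f * L) + flush_cost (nfl s)"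
        using p b(6) unfolding mf add_mult_distrib by linarith
      ultimately have iv': "inv_ex P C out (a + 1) s D T" using b(1,5) p unfolding inv_ex_def mf by simp
      show "?post s D T"
        by (rule exI[of _ "a + 1"]) (use iv' C p lh U in auto)
    qed simp
    show ?thesis by (rule hoare_Cond[OF hoare_conseq[OF r] hoare_Basic]) (use True in auto)
  next
    case False
    then have "?post s0 D1 T0" using iv C lh U by (intro exI[of _ a]) auto
    then have r: "hoareM (\<lambda>s D T. s = s0 \<and> D = D1 \<and> T = T0) (Basic (\<lambda>s. s)) ?post"
      by (intro hoare_Basic) simp
    have v: "hoareM (\<lambda>s D T. (s = s0 \<and> D = D1 \<and> T = T0) \<and> safe s = 0 \<and> onD s \<noteq> 0) refill ?post"
      by (rule hoare_start) (use False in auto)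
    show ?thesis by (rule hoare_Cond[OF v hoare_conseq[OF r]]) auto
  qed
qed

lemma extract_step:
  assumes iv: "inv_ex P C out a s0 D1 T0" and C: "C \<noteq> {#}" and lh: "length (heap s0) < 4 * U"
    and safe: "0 < safe s0 \<or> onD s0 = 0"
  shows "hoareM (\<lambda>s D T. s = s0 \<and> D = D1 \<and> T = T0) (Basic ext_step ;; write_obuf (nb + eb) ;; flushes)
    (\<lambda>s D T. \<exists>P' C' out'. inv_ex P' C' out' a s D T \<and> length (heap s) < 3 * U \<and> card P < card P' \<and> card P' \<le> card X)"
proof (rule hoare_first)
  have b: "stage P (sta s0) C out" "pq s0 D1 C" "account a (card P) s0" "out_ok s0 D1 out"
     "length (obuf s0) < B" "T0 \<le> nb + eb + ob s0 + a * (6 * f * L) + flush_cost (nfl s0)"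
    using iv by (auto simp: inv_ex_def)
  have ok0: "okm s0" "okf s0" using b(2) by (auto simp: pq_def)
  note mn = pq_min[OF b(2) C safe]
  obtain q' new w where d: "delta (sta s0) (hd (heap s0)) = (q', new, w)" by (metis prod_cases3)
  define x where "x = Min (set_mset C)"
  have dx: "delta (sta s0) x = (q', new, w)" using d mn(2) by (simp add: x_def)
  note st = stage_step[OF b(1) C dx[unfolded x_def], folded x_def]
  define s1 where "s1 = ext_step s0"
  define P' where "P' = insert x P"
  define C' where "C' = C - {#x#} + mset new"
  have st': "stage P' q' C' (out @ w)" using st(2) by (simp add: P'_def C'_def)
  have P'X: "P' \<subseteq> X" using st' by (simp add: stage_def)
  have fX: "finite X" using X_finite_card by blast
  have cP: "card P' = card P + 1"
    using st(1) finite_subset[OF P'X fX] by (simp add: P'_def)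
  have cX: "card P' \<le> card X" by (rule card_mono[OF fX P'X])
  have eq: "heap s1 = sort (tl (heap s0) @ new)" "safe s1 = safe s0 - 1" "sta s1 = q'" "obuf s1 = obuf s0 @ w"
    "onD s1 = onD s0" "nfl s1 = nfl s0" "ob s1 = ob s0" "ib s1 = ib s0" "ibuf s1 = ibuf s0" "prv s1 = prv s0"
    "ip s1 = ip s0" "ci s1 = ci s0" "wb s1 = wb s0" "wi s1 = wi s0" "wj s1 = wj s0" "wp s1 = wp s0" "tot s1 = tot s0"
    "mg s1 = mg s0" "lo s1 = lo s0" "hi s1 = hi s0"
    by (simp_all add: s1_def ext_step_def d)
  have eqf: "fr s1 = fr s0" "lv s1 = lv s0" "xx s1 = xx s0" "tmp s1 = tmp s0" "rt s1 = rt s0"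
    by (simp_all add: s1_def ext_step_def d)
  have okf1: "okf s1" using ok0(2) unfolding okf_def eqf .
  have ln: "length new \<le> 2" "length w \<le> 2" using length_delta[of "sta s0" x] dx by simp_all
  have okm1: "okm s1"
  proof -
    have lh1: "length (heap s1) \<le> 10 * U" using ln lh U by (simp add: eq)
    have hX: "set (heap s1) \<subseteq> X"
    proof -
      have "set new \<subseteq> set_mset C'" by (simp add: C'_def)
      then have "set new \<subseteq> X" using stage_card(2)[OF st'] by blast
      moreover have "set (tl (heap s0)) \<subseteq> X" using ok0(1) mn(1) by (auto simp: okm_def dest: list.set_sel)
      ultimately show ?thesis by (simp add: eq)
    qed
    have sb: "length (fst q') \<le> 7 \<and> (\<forall>e\<in>set (fst q'). e < V0) \<and> fst (snd q') < V0 \<and> snd (snd q') < V0"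
      using stage_state_bound[OF st'] top by (meson le_less_trans)
    have "w = outw x"
    proof -
      have "out @ w = concat (map outw (sorted_list_of_set P'))" using st' by (simp add: stage_def)
      moreover have "sorted_list_of_set P' = sorted_list_of_set P @ [x]"
      proof (rule sorted_distinct_set_unique)
        have xP: "y < x" if "y \<in> P" for y
        proof (rule ccontr)
          assume "\<not> y < x"
          then have "x < y" using st(1) that by (metis DiffD2 linorder_cases)
          then show False using b(1) that st(1) by (auto simp: stage_def)
        qed
        have fP: "finite P" by (rule finite_subset[OF _ fX]) (use P'X in \<open>simp add: P'_def\<close>)
        show "sorted (sorted_list_of_set P @ [x])" using xP fP by (auto simp: sorted_append less_imp_le)
        show "distinct (sorted_list_of_set P @ [x])" using st(1) fP by auto
        show "set (sorted_list_of_set P') = set (sorted_list_of_set P @ [x])" using fP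
          by (simp only: P'_def set_sorted_list_of_set finite_insert set_append list.set) auto
      qed simp_all
      ultimately show ?thesis using b(1) by (simp add: stage_def)
    qed
    then have wV: "\<forall>e\<in>set w. e < V0" using stage_out_bound(2)[of x] st(1) top by (meson DiffD1 le_less_trans)
    have ob: "length (obuf s1) \<le> B + 2" "\<forall>e\<in>set (obuf s1). e < V0"
      using ln b(5) wV ok0(1) by (auto simp: eq okm_def)
    have "safe s1 < V0" using ok0(1) by (auto simp: okm_def eq)
    then show ?thesis using ok0(1) lh1 hX sb ob unfolding okm_def eq(3,5-) by simp
  qed
  have pq1: "pq s1 D1 C'"
    unfolding C'_def x_def mn(2)[symmetric]
    by (rule pq_extract[OF b(2) mn(1) okm1 okf1]) (simp_all add: eq)
  \<comment> \<open>One more extraction makes up for one safe item less.\<close>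
  have ac1: "account a (card P') s1"
    using b(3) unfolding account_def eq cP by (auto split: if_splits)
  have oo: "out_ok s1 D1 (out @ w)" using b(4) by (auto simp: out_ok_def eq nth_append)
  show "hoareM (\<lambda>s D T. s = ext_step s0 \<and> D = D1 \<and> T = T0) (write_obuf (nb + eb) ;; flushes)
    (\<lambda>s D T. \<exists>P' C' out'. inv_ex P' C' out' a s D T \<and> length (heap s) < 3 * U \<and> card P < card P' \<and> card P' \<le> card X)"
    unfolding s1_def[symmetric]
  proof (rule hoare_after[OF write_obuf[OF pq1 oo length_out[OF st'] ac1]])
    fix s D T assume p: "pq s D C' \<and> heap s = heap s1 \<and> sta s = sta s1 \<and> nfl s = nfl s1 \<and> account a (card P') s \<and>
      out_ok s D (out @ w) \<and> T + ob s1 = T0 + ob s \<and> length (obuf s) < B"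
    then have pq2: "pq s D C'" and ac2: "account a (card P') s" by auto
    have sC: "size C' + card P' \<le> Q" using stage_card(1)[OF st'] X_finite_card Q by linarith
    show "hoareM (\<lambda>s' D' T'. s' = s \<and> D' = D \<and> T' = T) flushes
      (\<lambda>s D T. \<exists>P' C' out'. inv_ex P' C' out' a s D T \<and> length (heap s) < 3 * U \<and> card P < card P' \<and> card P' \<le> card X)"
    proof (rule hoare_conseq[OF flushes[OF levels(1)[folded U_def] levels(2) pq2 sC ac2]])
      fix s2 D2 T2 assume r: "pq s2 D2 C' \<and> mainf s2 = mainf s \<and> account a (card P') s2 \<and> length (heap s2) < 3 * U \<and>
        T2 + flush_cost (nfl s) \<le> T + flush_cost (nfl s2) \<and> (\<forall>x<rbase * B. D2 x = D x)"
      then have mf: "sta s2 = sta s" "obuf s2 = obuf s" "ob s2 = ob s" by (auto simp: mainf_def)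
      have o: "out_ok s D (out @ w)" using p by simp
      have "out_ok s2 D2 (out @ w)"
      proof -
        have "(nb + eb) * B + k < rbase * B" if "k < ob s * B" for k
        proof -
          have "ob s * B \<le> nb * B" by (rule ob_le(1)[OF o length_out[OF st']])
          moreover have "(nb + eb) * B + nb * B = rbase * B" by (simp add: rbase' algebra_simps)
          ultimately show ?thesis using that by linarith
        qed
        then show ?thesis using o r unfolding out_ok_def mf by simp
      qed
      moreover have "T2 \<le> nb + eb + ob s2 + a * (6 * f * L) + flush_cost (nfl s2)"
      proof -
        have nf: "nfl s = nfl s0" "ob s1 = ob s0" using p eq by simp_all
        have "T2 + flush_cost (nfl s0) \<le> T + flush_cost (nfl s2)" using r unfolding nf by blast
        moreover have "T + ob s0 = T0 + ob s" using p unfolding nf by blast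
        ultimately show ?thesis using b(6) unfolding mf by linarith
      qed
      moreover have "sta s2 = q'" using mf p eq by simp
      ultimately have "inv_ex P' C' (out @ w) a s2 D2 T2" using st' r p unfolding inv_ex_def mf by simp
      then show "\<exists>P' C' out'. inv_ex P' C' out' a s2 D2 T2 \<and> length (heap s2) < 3 * U \<and> card P < card P' \<and> card P' \<le> card X"
        using r cP cX by (intro exI[of _ P'] exI[of _ C'] exI[of _ "out @ w"]) simp
    qed simp
  qed
qed

lemma main:
  "hoareM (\<lambda>s D T. s = start \<and> D = D0 \<and> T = 0) (main n e (nb + eb))
    (\<lambda>s D T. \<exists>rs a. file_at B D (nb + eb) (pair_file rs) \<and> represents_partition rs (bisim_partition G) \<and>
      length (pair_file rs) \<le> 2 * n \<and> account a (card X) s \<and> onD s = 0 \<and> T \<le> 2 * nb + eb + a * (6 * f * L) + flush_cost (nfl s))"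
    (is "hoareM _ _ ?post")
proof -
  define I where "I = (\<lambda>k s D T. length (heap s) < 3 * U \<and> (\<exists>P C out a. inv_ex P C out a s D T \<and> card X - card P = k))"
  have start: "\<exists>k. I k s D T" if iv: "inv_in s D T" and ip: "ip s = 2 * n + 2 * e" and T: "T \<le> nb + eb + flush_cost (nfl s)"
    for s D T
  proof -
    have "ip s div 2 = length items" using ip length_items by simp
    then have pq: "pq s D (mset items)" using iv by (simp add: inv_in_def)
    have st: "stage {} (sta s) (mset items) []"
      using stage_start iv mset_init[OF es] by (simp add: inv_in_def items_def)
    have "inv_ex {} (mset items) [] 0 s D T"
      using pq st iv T B unfolding inv_ex_def by (simp add: inv_in_def out_ok_def)
    then show ?thesis using iv unfolding I_def inv_in_def by blast
  qed
  have body: "hoareM (\<lambda>s D T. I k s D T \<and> (heap s \<noteq> [] \<or> onD s \<noteq> 0))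
     (Cond (\<lambda>s. safe s = 0 \<and> onD s \<noteq> 0) refill (Basic (\<lambda>s. s)) ;; Basic ext_step ;; write_obuf (nb + eb) ;; flushes)
     (\<lambda>s D T. \<exists>k'<k. I k' s D T)" for k
  proof (rule hoare_start)
    fix s0 D1 T0 assume a: "I k s0 D1 T0 \<and> (heap s0 \<noteq> [] \<or> onD s0 \<noteq> 0)"
    then obtain P C out a where iv: "inv_ex P C out a s0 D1 T0" and k: "card X - card P = k"
      and lh: "length (heap s0) < 3 * U" and ne: "heap s0 \<noteq> [] \<or> onD s0 \<noteq> 0" unfolding I_def by blast
    show "hoareM (\<lambda>s D T. s = s0 \<and> D = D1 \<and> T = T0)
     (Cond (\<lambda>s. safe s = 0 \<and> onD s \<noteq> 0) refill (Basic (\<lambda>s. s)) ;; Basic ext_step ;; write_obuf (nb + eb) ;; flushes)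
     (\<lambda>s D T. \<exists>k'<k. I k' s D T)"
    proof (rule hoare_after[OF ensure_safe[OF iv ne lh]])
      fix s D T assume "\<exists>a. inv_ex P C out a s D T \<and> C \<noteq> {#} \<and> length (heap s) < 4 * U \<and> (0 < safe s \<or> onD s = 0)"
      then obtain a' where b: "inv_ex P C out a' s D T" "C \<noteq> {#}" "length (heap s) < 4 * U" "0 < safe s \<or> onD s = 0"
        by blast
      show "hoareM (\<lambda>s' D' T'. s' = s \<and> D' = D \<and> T' = T) (Basic ext_step ;; write_obuf (nb + eb) ;; flushes)
        (\<lambda>s D T. \<exists>k'<k. I k' s D T)"
      proof (rule hoare_conseq[OF extract_step[OF b]])
        fix s D T assume "\<exists>P' C' out'. inv_ex P' C' out' a' s D T \<and> length (heap s) < 3 * U \<and> card P < card P' \<and> card P' \<le> card X"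
        then obtain P' C' out' where c: "inv_ex P' C' out' a' s D T" "length (heap s) < 3 * U" "card P < card P'"
          "card P' \<le> card X" by blast
        have "card X - card P' < k" using c(3,4) k by linarith
        moreover have "I (card X - card P') s D T" using c(1,2) unfolding I_def by blast
        ultimately show "\<exists>k'<k. I k' s D T" by blast
      qed simp
    qed
  qed
  define J where "J = (\<lambda>s D T. \<exists>out C a. stage X (sta s) C out \<and> account a (card X) s \<and> out_ok s D out \<and> okm s \<and> okf s \<and>
     (\<forall>x. D x < V) \<and> onD s = 0 \<and> length (obuf s) < B \<and> T \<le> nb + eb + ob s + a * (6 * f * L) + flush_cost (nfl s))"
  have J: "J s D T" if i: "I k s D T" and e0: "\<not> (heap s \<noteq> [] \<or> onD s \<noteq> 0)" for k s D T
  proof -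
    obtain P C out a where iv: "inv_ex P C out a s D T" using i unfolding I_def by blast
    then have pq: "pq s D C" by (simp add: inv_ex_def)
    then have "size C = 0" using pq_size e0 by simp
    then have "P = X" using iv stage_end[of P "sta s" out] by (simp add: inv_ex_def)
    moreover have "okm s \<and> okf s \<and> (\<forall>x. D x < V)" "onD s = 0" using pq e0 by (simp_all add: pq_def)
    ultimately show ?thesis using iv unfolding J_def inv_ex_def by blast
  qed
  have fin: "?post s D T" if st: "stage X (sta s) C out" and ac: "account a (card X) s" "onD s = 0" and
    D: "\<forall>p<length out. D ((nb + eb) * B + p) = out ! p" and T: "T \<le> 2 * nb + eb + a * (6 * f * L) + flush_cost (nfl s)"
    for s D T C out a
  proof -
    obtain rs where "out = pair_file rs" "represents_partition rs (bisim_partition G)" using stage_final[OF st] by blast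
    then show ?thesis using ac D T length_out[OF st] unfolding file_at_def by blast
  qed
  have last: "hoareM J (Cond (\<lambda>s. obuf s \<noteq> []) (Wr (\<lambda>s. nb + eb + ob s) (\<lambda>s. padded (obuf s))) (Basic (\<lambda>s. s))) ?post"
  proof (rule hoare_Cond[OF hoare_Wr hoare_Basic])
    fix s D T assume a: "J s D T \<and> obuf s \<noteq> []"
    then obtain out C a where j: "stage X (sta s) C out" "account a (card X) s" "out_ok s D out" "okm s" "okf s"
      "length (obuf s) < B" "T \<le> nb + eb + ob s + a * (6 * f * L) + flush_cost (nfl s)" "onD s = 0" unfolding J_def by blast
    have obn: "ob s < nb" by (rule ob_less[OF j(3) length_out[OF j(1)]]) (use a in simp)
    have w: "length (padded (obuf s)) = B" "\<forall>p<min B (length (obuf s)). padded (obuf s) ! p = obuf s ! p"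
      using j(6) by (auto simp: padded_def nth_append)
    have wV: "\<forall>x\<in>set (padded (obuf s)). x < V"
      using j(4) V_ge(1) V0 by (auto simp: padded_def okm_def)
    have "length out \<le> ob s * B + B" using j(3,6) a by (simp add: out_ok_def)
    then have "\<forall>p<length out. put B (nb + eb + ob s) (padded (obuf s)) D ((nb + eb) * B + p) = out ! p"
      using out_ok_put[OF j(3) w] by simp
    moreover have "T + 1 \<le> 2 * nb + eb + a * (6 * f * L) + flush_cost (nfl s)" using j(7) obn by linarith
    moreover have "nb + eb + ob s < A" using obn rbase rbase' by linarith
    ultimately show "ok s \<and> nb + eb + ob s < A \<and> length (padded (obuf s)) = B \<and> (\<forall>x\<in>set (padded (obuf s)). x < V) \<and>
      ?post s (put B (nb + eb + ob s) (padded (obuf s)) D) (T + 1)"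
      using fin[OF j(1,2,8)] w wV j(4,5) by (simp add: ok_def)
  next
    fix s D T assume a: "J s D T \<and> \<not> obuf s \<noteq> []"
    then obtain out C a where j: "stage X (sta s) C out" "account a (card X) s" "out_ok s D out"
      "T \<le> nb + eb + ob s + a * (6 * f * L) + flush_cost (nfl s)" "onD s = 0" unfolding J_def by blast
    have oB: "ob s * B = length out" using j(3) a by (simp add: out_ok_def)
    have "ob s \<le> nb" by (rule ob_le(2)[OF j(3) length_out[OF j(1)]])
    then show "?post s D T" using fin[OF j(1,2,5)] j(3,4) oB by (simp add: out_ok_def)
  qed
  have loop: "hoareM (\<lambda>s D T. inv_in s D T \<and> ip s = 2 * n + 2 * e \<and> T \<le> nb + eb + flush_cost (nfl s))
    (extract_loop (nb + eb)) J"
    unfolding extract_loop_def by (rule hoare_While_ex[where I = I, OF body]) (use start J in blast)+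
  show ?thesis
    unfolding main_def by (rule hoare_Seq[OF input_loop hoare_Seq[OF loop last]])
qed

end

section \<open>The cost of the program\<close>

context em
begin

text \<open>Level \<open>l\<close> is merged in every \<open>f ^ (l + 1)\<close>-th flush, at a cost
  of at most \<open>15 * f * f ^ (l + 1)\<close>, hence \<open>15 * f\<close> per flush and level.
  The flush itself adds \<open>f + 1 <= 2 * f\<close>.\<close>

lemma flush_cost_le:
  assumes "0 < L"
  shows "flush_cost k \<le> 17 * f * k * L"
proof -
  have cas: "cascade i = (\<Sum>l<L. if f ^ (l + 1) dvd i then mcost l else 0)" for i
    unfolding cascade_def by (subst sum.inter_filter[symmetric]) (auto intro!: sum.cong)
  have cnt: "card {i \<in> {1..k}. m dvd i} * m \<le> k" if m: "0 < m" for m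
  proof -
    have "{i \<in> {1..k}. m dvd i} \<subseteq> (\<lambda>j. m * j) ` {1..k div m}"
    proof
      fix i assume i: "i \<in> {i \<in> {1..k}. m dvd i}"
      then obtain j where j: "i = m * j" by auto
      then have "1 \<le> j" "j \<le> k div m" using i m by (auto simp: less_eq_div_iff_mult_less_eq mult.commute Suc_le_eq)
      then show "i \<in> (\<lambda>j. m * j) ` {1..k div m}" using j by auto
    qed
    then have "card {i \<in> {1..k}. m dvd i} \<le> card ((\<lambda>j. m * j) ` {1..k div m})" by (intro card_mono) auto
    also have "\<dots> \<le> k div m" using card_image_le[of "{1..k div m}" "\<lambda>j. m * j"] by simp
    finally have "card {i \<in> {1..k}. m dvd i} * m \<le> k div m * m" by (rule mult_le_mono1)
    also have "\<dots> \<le> k" by simp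
    finally show ?thesis .
  qed
  have mc: "mcost l \<le> 15 * f * f ^ (l + 1)" for l
  proof -
    define F where "F = f ^ (l + 1)"
    have F: "1 \<le> F" using f by (simp add: F_def)
    have "f * 1 \<le> f * F" using F by (intro mult_le_mono2)
    moreover have "7 * f * (F + 1) + 1 = 7 * (f * F) + 7 * f + 1" "15 * f * F = 15 * (f * F)"
      by (simp_all add: algebra_simps)
    ultimately show ?thesis using f unfolding mcost_def F_def[symmetric] by linarith
  qed
  have lev: "(\<Sum>i\<in>{1..k}. if f ^ (l + 1) dvd i then mcost l else 0) \<le> 15 * f * k" for l
  proof -
    define F where "F = f ^ (l + 1)"
    have "(\<Sum>i\<in>{1..k}. if F dvd i then mcost l else 0) = card {i \<in> {1..k}. F dvd i} * mcost l"
      by (subst sum.inter_filter[symmetric]) simp_all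
    also have "\<dots> \<le> card {i \<in> {1..k}. F dvd i} * (15 * f * F)" using mc[of l] by (intro mult_le_mono2) (simp add: F_def)
    also have "\<dots> = 15 * f * (card {i \<in> {1..k}. F dvd i} * F)" by simp
    also have "\<dots> \<le> 15 * f * k" using f by (intro mult_le_mono2 cnt) (simp add: F_def)
    finally show ?thesis unfolding F_def .
  qed
  have "flush_cost k = k * (f + 1) + (\<Sum>i\<in>{1..k}. cascade i)"
    by (simp only: flush_cost_def sum.distrib) simp
  also have "(\<Sum>i\<in>{1..k}. cascade i) = (\<Sum>l<L. \<Sum>i\<in>{1..k}. if f ^ (l + 1) dvd i then mcost l else 0)"
    unfolding cas by (rule sum.swap)
  also have "\<dots> \<le> (\<Sum>l<L. 15 * f * k)" by (intro sum_mono lev)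
  also have "k * (f + 1) + (\<Sum>l<L. 15 * f * k) \<le> 2 * f * k * 1 + 15 * f * k * L" using f by (simp add: algebra_simps)
  also have "\<dots> \<le> 2 * f * k * L + 15 * f * k * L" using assms by (intro add_right_mono mult_le_mono2) simp
  finally show ?thesis by (simp add: mult_ac)
qed

lemma csize_main: "csize (main n e o') \<le> 200"
  by (simp add: main_def input_loop_def extract_loop_def write_obuf_def flushes_def flush_def refill_def merge_def
      write_out_def write_meta_def select_def read_metas_def load_level_def)

text \<open>With an empty disk \<open>account\<close> gives \<open>nfl s <= a\<close>, so a refill
  and its flush together cost at most \<open>(6 + 17) * f * L\<close>. Moreover
  \<open>U * a <= x + U <= 2 * Q\<close> unless nothing was ever flushed; with
  \<open>U = f * B\<close> this gives 46.\<close>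

lemma account_cost:
  assumes ac: "account a x s" "onD s = 0" and x: "x \<le> Q" and L: "0 < L"
  shows "(a * (6 * f * L) + flush_cost (nfl s)) * B \<le> 46 * Q * L"
    "Q < 3 * U \<Longrightarrow> a * (6 * f * L) + flush_cost (nfl s) = 0"
proof -
  have 1: "U * nfl s \<le> U * a" "U * a \<le> x + U" "0 < a \<longrightarrow> 0 < nfl s" "0 < nfl s \<longrightarrow> 3 * U \<le> Q"
    using ac by (auto simp: account_def)
  show 0: "a * (6 * f * L) + flush_cost (nfl s) = 0" if "Q < 3 * U"
  proof -
    have "nfl s = 0" "a = 0" using 1 that by linarith+
    then show ?thesis by (simp add: flush_cost_def)
  qed
  show "(a * (6 * f * L) + flush_cost (nfl s)) * B \<le> 46 * Q * L"
  proof (cases "Q < 3 * U")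
    case False
    have k: "nfl s \<le> a" using 1(1) U by simp
    have "flush_cost (nfl s) \<le> 17 * f * nfl s * L" by (rule flush_cost_le[OF L])
    also have "\<dots> \<le> 17 * f * a * L" using k by (intro mult_le_mono1 mult_le_mono2)
    also have "\<dots> = 17 * (f * a * L)" by simp
    finally have "a * (6 * f * L) + flush_cost (nfl s) \<le> 23 * (f * a * L)" by (simp add: mult_ac)
    then have "(a * (6 * f * L) + flush_cost (nfl s)) * B \<le> 23 * (f * a * L) * B" by (rule mult_le_mono1)
    also have "\<dots> = 23 * (U * a) * L" by (simp add: U_def)
    also have "\<dots> \<le> 23 * (2 * Q) * L" using 1(2) x False by (intro mult_le_mono1 mult_le_mono2) linarith
    finally show ?thesis by simp
  next
    case True
    show ?thesis by (simp only: 0[OF True])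
  qed
qed

end

text \<open>The number of digits that the flush counter needs, according to the bound in
  \<open>flushes\<close>.\<close>

definition depth :: "nat \<Rightarrow> nat \<Rightarrow> nat \<Rightarrow> nat" where
  "depth B f Q = (LEAST L. 2 * Q div (f * B) + 3 < f ^ L)"

lemma depth:
  assumes "2 \<le> f"
  shows "2 * Q div (f * B) + 3 < f ^ depth B f Q" "0 < depth B f Q"
    "1 \<le> B \<Longrightarrow> 3 * (f * B) \<le> Q \<Longrightarrow> f ^ depth B f Q * B \<le> 3 * Q"
proof -
  let ?k = "2 * Q div (f * B) + 3"
  have "?k < 2 ^ ?k" by (rule less_exp)
  also have "\<dots> \<le> f ^ ?k" using assms by (intro power_mono) auto
  finally show 1: "?k < f ^ depth B f Q" unfolding depth_def by (rule LeastI)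
  then show 2: "0 < depth B f Q" by (cases "depth B f Q") auto
  show "f ^ depth B f Q * B \<le> 3 * Q" if B: "1 \<le> B" and Q: "3 * (f * B) \<le> Q"
  proof -
    have "\<not> ?k < f ^ (depth B f Q - 1)" unfolding depth_def by (rule not_less_Least) (use 2 in \<open>simp add: depth_def\<close>)
    then have "f ^ (depth B f Q - 1) \<le> ?k" by simp
    then have "f ^ (depth B f Q - 1) * (f * B) \<le> ?k * (f * B)" by (rule mult_le_mono1)
    also have "\<dots> = 2 * Q div (f * B) * (f * B) + 3 * (f * B)" by (rule add_mult_distrib)
    also have "\<dots> \<le> 2 * Q + Q" using Q by (intro add_mono) auto
    finally have "f ^ (depth B f Q - 1) * f * B \<le> 3 * Q" by (simp add: mult.assoc)
    moreover have "f ^ (depth B f Q - 1) * f = f ^ depth B f Q" using 2 by (cases "depth B f Q") auto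
    ultimately show ?thesis by simp
  qed
qed

text \<open>
  With \<open>y = m / B\<close> and \<open>r = M / B < f + 1 \<le> f\<^sup>2\<close>, minimality of the depth \<open>L\<close> gives
  \<open>r ^ L \<le> f ^ (2 * L) \<le> (30 * y)\<^sup>2\<close>.
\<close>

lemma depth_log:
  fixes M B m :: nat
  assumes B: "1 \<le> B" "2 * B \<le> M" and m: "0 < m" and Q: "3 * (M div B * B) \<le> 10 * m"
  shows "real (depth B (M div B) (10 * m)) \<le> 12 * max 1 (log (real M / real B) (real m / real B))"
proof -
  define f where "f = M div B"
  define L where "L = depth B f (10 * m)"
  define r where "r = real M / real B"
  define y where "y = real m / real B"
  define l where "l = max 1 (log r y)"
  have f2: "2 \<le> f" using B div_le_mono[OF B(2), of B] by (simp add: f_def)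
  have r2: "2 \<le> r" using B by (simp add: r_def field_simps flip: of_nat_mult)
  have y0: "0 < y" using m B by (simp add: y_def)
  have rf: "r \<le> real f ^ 2"
  proof -
    have "M < (f + 1) * B" using B unfolding f_def
      by (metis Suc_eq_plus1 dividend_less_div_times mult_Suc add.commute less_le_trans zero_less_one)
    then have "real M \<le> real (f + 1) * real B" by (metis less_imp_le of_nat_le_iff of_nat_mult)
    then have "r \<le> real (f + 1)" using B by (simp add: r_def field_simps)
    also have "f + 1 \<le> f ^ 2" using mult_le_mono1[OF f2, of f] f2 unfolding power2_eq_square by linarith
    then have "real (f + 1) \<le> real f ^ 2" by (metis of_nat_le_iff of_nat_power)
    finally show ?thesis .
  qed
  have "f ^ L * B \<le> 3 * (10 * m)" unfolding L_def by (rule depth(3)[OF f2 B(1)]) (use Q in \<open>simp add: f_def\<close>)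
  then have "real (f ^ L * B) \<le> real (30 * m)" by (intro of_nat_mono) simp
  then have "real f ^ L * real B \<le> 30 * real m" by simp
  then have fL: "real f ^ L \<le> 30 * y" using B by (simp add: y_def field_simps)
  have yr: "y \<le> r powr l"
  proof -
    have "y = r powr (log r y)" using r2 y0 by simp
    also have "\<dots> \<le> r powr l" using r2 by (intro powr_mono) (auto simp: l_def)
    finally show ?thesis .
  qed
  have "r powr real L = r ^ L" using r2 by (simp add: powr_realpow)
  also have "\<dots> \<le> (real f ^ 2) ^ L" using rf r2 by (intro power_mono) auto
  also have "\<dots> = (real f ^ L) ^ 2" by (simp only: power_mult[symmetric] mult.commute)
  also have "\<dots> \<le> (30 * y) ^ 2" using fL by (intro power_mono) auto
  also have "\<dots> = 900 * y ^ 2" by (simp add: power_mult_distrib)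
  \<comment> \<open>The constant is absorbed by \<open>900 <= 2 ^ 10 <= r ^ 10\<close>, which leads
    to \<open>10 + 2 * l <= 12 * l\<close>.\<close>
  also have "\<dots> \<le> r ^ 10 * (r powr l) ^ 2"
  proof (rule mult_mono)
    have "(2 :: real) ^ 10 \<le> r ^ 10" using r2 by (intro power_mono) auto
    then show "900 \<le> r ^ 10" by simp
    show "y ^ 2 \<le> (r powr l) ^ 2" using yr y0 by (intro power_mono) auto
  qed (use r2 in auto)
  also have "\<dots> = r powr (10 + 2 * l)"
  proof -
    have "(r powr l) ^ 2 = r powr (2 * l)" by (simp add: power2_eq_square flip: powr_add)
    moreover have "r powr (10 + 2 * l) = r ^ 10 * r powr (2 * l)" using r2 by (simp add: powr_add)
    ultimately show ?thesis by simp
  qed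
  finally have "real L \<le> 10 + 2 * l" using r2 by (subst (asm) powr_le_cancel_iff) auto
  also have "\<dots> \<le> 12 * l" by (simp add: l_def)
  finally show ?thesis by (simp add: L_def f_def l_def r_def y_def)
qed

section \<open>Encoding the store\<close>

definition fields :: "st \<Rightarrow> nat list list" where
  "fields s = [map list_encode (heap s),
     [safe s, onD s, nfl s, fst (snd (sta s)), snd (snd (sta s)), ib s, prv s, ip s, ob s, ci s, wi s, wj s, wp s, tot s,
      mg s, lo s, hi s, lv s, xx s, tmp s],
     fst (sta s), ibuf s, obuf s, map list_encode (wb s),
     map (\<lambda>(x, a, b). prod_encode (list_encode x, prod_encode (a, b))) (fr s),
     map (\<lambda>(a, b, c, x). prod_encode (prod_encode (a, b), prod_encode (c, list_encode x))) (rt s)]"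

text \<open>Shifting the entries by one frees 0 as an end mark, which makes the concatenation
  uniquely decodable.\<close>

definition flatten :: "nat list list \<Rightarrow> nat list" where
  "flatten xss = concat (map (\<lambda>xs. map Suc xs @ [0]) xss)"

lemma inj_flatten: "inj flatten"
proof -
  have *: "map Suc xs @ 0 # zs = map Suc ys @ 0 # ws \<Longrightarrow> xs = ys \<and> zs = ws" for xs ys zs ws
  proof (induction xs arbitrary: ys)
    case Nil then show ?case by (cases ys) auto
  next
    case (Cons x xs) then show ?case by (cases ys) auto
  qed
  have "flatten xss = flatten yss \<Longrightarrow> xss = yss" for xss yss
  proof (induction xss arbitrary: yss)
    case Nil then show ?case by (cases yss) (auto simp: flatten_def)
  next
    case (Cons xs xss)
    then obtain ys zss where "yss = ys # zss" by (cases yss) (auto simp: flatten_def)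
    then show ?case using Cons.prems *[of xs "flatten xss" ys "flatten zss"] Cons.IH[of zss] by (simp add: flatten_def)
  qed
  then show ?thesis by (auto intro: injI)
qed

lemma inj_fields: "inj fields"
proof (rule injI)
  fix s s' assume eq: "fields s = fields s'"
  have inj: "inj list_encode" "inj (\<lambda>(x, a, b). prod_encode (list_encode x, prod_encode (a, b)))"
    "inj (\<lambda>(a, b, c, x). prod_encode (prod_encode (a, b), prod_encode (c, list_encode x)))"
    by (auto simp: inj_def dest: injD[OF inj_prod_encode] injD[OF inj_list_encode])
  have "sta s = sta s'" using eq by (simp add: fields_def prod_eq_iff)
  then show "s = s'" using eq inj by (intro st.equality) (simp_all add: fields_def inj_map_eq_map)
qed

text \<open>The summand 28 comes from 20 scalars and 8 end marks; \<open>2 <= U\<close> absorbs it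
  together with the other constants.\<close>

lemma (in em) flatten_fields:
  assumes "ok s"
  shows "length (flatten (fields s)) \<le> 43 * U" "x \<in> set (flatten (fields s)) \<Longrightarrow> x < V"
proof -
  have "length (flatten (fields s)) = length (heap s) + length (fst (sta s)) + length (ibuf s) + length (obuf s) +
      length (wb s) + length (fr s) + length (rt s) + 28"
    by (simp add: flatten_def fields_def)
  also have "\<dots> \<le> 43 * U" using assms U by (simp add: ok_def okm_def okf_def)
  finally show "length (flatten (fields s)) \<le> 43 * U" .
  have V1: "Suc v < V" if "v < V0 ^ 4" for v
  proof -
    have "V0 ^ 4 < V" unfolding V_def using V0 by (intro power_strict_increasing) auto
    then show ?thesis using that by linarith
  qed
  have V04: "V0 \<le> V0 ^ 4" using power_increasing[of 1 4 V0] V0 by simp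
  have V2: "Suc v < V" if "v < V0" for v by (rule V1) (use that V04 in linarith)
  have pr: "prod_encode (a, b) < V0 ^ 4" if "a < V0" "b < V0" for a b
    using prod_encode_less[OF that] V0 by simp
  have V3: "Suc (prod_encode (u, v)) < V" if "u < V0 ^ 4" "v < V0 ^ 4" for u v
  proof -
    have "Suc (prod_encode (u, v)) < (V0 ^ 4) ^ 4" by (rule prod_encode_less[OF that]) (use V04 V0 in linarith)
    also have "\<dots> = V0 ^ 16" by (simp flip: power_mult)
    finally show ?thesis using V_ge(3) by linarith
  qed
  have VX: "Suc (list_encode z) < V" if "z \<in> X" for z using V2 X[OF that] by simp
  have frb: "Suc (prod_encode (list_encode z, prod_encode (a, b))) < V" if "(z, a, b) \<in> set (fr s)" for z a b
  proof (rule V3)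
    show "list_encode z < V0 ^ 4" using assms that X[of z] V04 by (fastforce simp: ok_def okf_def)
    show "prod_encode (a, b) < V0 ^ 4" by (rule pr) (use assms that in \<open>fastforce simp: ok_def okf_def\<close>)+
  qed
  have rtb: "Suc (prod_encode (prod_encode (a, b), prod_encode (c, list_encode z))) < V" if "(a, b, c, z) \<in> set (rt s)"
    for a b c z
    by (intro V3 pr) (use assms that in \<open>fastforce simp: ok_def okf_def\<close>)+
  have fl: "x = 0 \<or> (\<exists>xs\<in>set (fields s). \<exists>v\<in>set xs. x = Suc v)" if "x \<in> set (flatten (fields s))"
    using that by (auto simp: flatten_def split: if_splits)
  have "list_all (\<lambda>xs. \<forall>v\<in>set xs. Suc v < V) (fields s)"
  proof -
    note o = assms[unfolded ok_def okm_def okf_def]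
    have "safe s < V0" "onD s < V0" "nfl s < V0" "fst (snd (sta s)) < V0" "snd (snd (sta s)) < V0" "ib s < V0" "prv s < V0"
      "ip s < V0" "ob s < V0" "ci s < V0" "wi s < V0" "wj s < V0" "wp s < V0" "tot s < V0" "mg s < V0" "lo s < V0" "hi s < V0"
      "lv s < V0" "xx s < V0"
      using o by simp_all
    note scalars = this[THEN V2]
    have "Suc (tmp s) < V" by (rule V1) (use o in simp)
    then have 1: "\<forall>v\<in>set [safe s, onD s, nfl s, fst (snd (sta s)), snd (snd (sta s)), ib s, prv s, ip s, ob s, ci s, wi s,
      wj s, wp s, tot s, mg s, lo s, hi s, lv s, xx s, tmp s]. Suc v < V"
      using scalars by simp
    have 2: "\<forall>v\<in>set (map list_encode (heap s)). Suc v < V" "\<forall>v\<in>set (map list_encode (wb s)). Suc v < V"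
      using o VX by auto
    have 3: "\<forall>v\<in>set (fst (sta s)). Suc v < V" "\<forall>v\<in>set (ibuf s). Suc v < V" "\<forall>v\<in>set (obuf s). Suc v < V"
      using o V2 by blast+
    have 4: "\<forall>v\<in>set (map (\<lambda>(x, a, b). prod_encode (list_encode x, prod_encode (a, b))) (fr s)). Suc v < V"
      using frb by auto
    have 5: "\<forall>v\<in>set (map (\<lambda>(a, b, c, x). prod_encode (prod_encode (a, b), prod_encode (c, list_encode x))) (rt s)). Suc v < V"
      using rtb by auto
    show ?thesis unfolding fields_def list.pred_inject(2) by (intro conjI list.pred_inject(1) 1 2 3 4 5)
  qed
  then have bd: "Suc v < V" if "xs \<in> set (fields s)" "v \<in> set xs" for xs v
    using that by (simp add: list_all_iff)
  show "x < V" if "x \<in> set (flatten (fields s))" using fl[OF that] bd V0 by (auto simp: V_def)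
qed

section \<open>The theorem\<close>

definition out_addr :: "nat \<Rightarrow> nat \<Rightarrow> nat \<Rightarrow> nat \<Rightarrow> nat" where
  "out_addr M B n e = (2 * n + B - 1) div B + (2 * e + B - 1) div B"

text \<open>
  The bound on \<open>csize\<close> always holds for the parameters that matter; testing it makes the program
  a bounded command for all parameters, as the simulation requires.
\<close>

definition prog :: "nat \<Rightarrow> nat \<Rightarrow> nat \<Rightarrow> nat \<Rightarrow> st com" where
  "prog M B n e =
    (let p = em.main B (M div B) (depth B (M div B) (10 * (n + e))) ((2 * n + B - 1) div B + out_addr M B n e) n e
       (out_addr M B n e)
     in if csize p \<le> 200 then p else Basic id)"

text \<open>200 bounds the size of the command. A store has at most
  \<open>43 * U <= 43 * M <= 86 * (M - B)\<close> entries. 20 is the exponent of the address bound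
  \<open>(N + E + 2) ^ 20\<close>.\<close>

interpretation ext: machine prog start out_addr "\<lambda>s. flatten (fields s)" 200 86 20
proof
  show "inj (\<lambda>s. flatten (fields s))" using inj_compose[OF inj_flatten inj_fields] by (simp add: comp_def)
  show "csize (prog M B N E) \<le> 200" for M B N E by (simp add: prog_def Let_def)
qed

text \<open>From the outside in: a base of at most \<open>top ^ 3\<close>; \<open>4 ^ 8\<close> for
  items, which are lists of length at most 8; 20 for \<open>V\<close>; \<open>4 ^ ext.Z + 1\<close>
  for packing; and \<open>57 = 2 * 20 + 17\<close> for the simulation with
  \<open>M = 2\<close>.\<close>

definition exponent :: nat where
  "exponent = 3 * (4 ^ 8 * (20 * ((4 ^ ext.Z + 1) * 57)))"

text \<open>Let \<open>K\<close> be the number of blocks rounded up and \<open>l\<close> the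
  logarithmic factor. Scanning costs at most \<open>7 * K\<close>, the queue at most
  \<open>46 * 10 * 12 * (K * l)\<close> by \<open>depth_log\<close>; and
  \<open>3 * (7 + 5520) + 1 = 16582\<close>.\<close>

lemma cost_le:
  fixes M B m n e t t' x :: nat
  assumes B: "1 \<le> B" "2 * B \<le> M" and m: "m = n + e" "0 < m"
    and t: "t \<le> 2 * ((2 * n + B - 1) div B) + (2 * e + B - 1) div B + x"
    and x: "x * B \<le> 46 * (10 * m) * depth B (M div B) (10 * m)" "10 * m < 3 * (M div B * B) \<Longrightarrow> x = 0"
    and t': "t' \<le> 3 * t + 1"
  shows "real t' \<le> 16582 * sort_ios M B m"
proof -
  define l where "l = max 1 (log (real M / real B) (real m / real B))"
  define K where "K = real_of_int \<lceil>real m / real B\<rceil>"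
  have B0: "0 < real B" using B by simp
  have mK: "real m / real B \<le> K" unfolding K_def by (rule le_of_int_ceiling)
  have K1: "1 \<le> K"
  proof -
    have "0 < real m / real B" using m(2) B0 by simp
    then have "0 < K" using mK by linarith
    then show ?thesis by (simp add: K_def)
  qed
  have l1: "1 \<le> l" by (simp add: l_def)
  have blk: "real ((k + B - 1) div B) \<le> real k / real B + 1" for k
  proof -
    have "(k + B - 1) div B * B \<le> k + B - 1" by simp
    then have "(k + B - 1) div B * B \<le> k + B" by linarith
    then have "real ((k + B - 1) div B * B) \<le> real (k + B)" by (rule of_nat_mono)
    then have "real ((k + B - 1) div B) * real B \<le> real k + real B" by simp
    then show ?thesis using B0 by (simp add: field_simps)
  qed
  have "real (2 * n) / real B = 2 * (real n / real B)" "real (2 * e) / real B = 2 * (real e / real B)"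
    "real m / real B = real n / real B + real e / real B" "0 \<le> real e / real B"
    by (simp_all add: m add_divide_distrib)
  then have scan: "2 * real ((2 * n + B - 1) div B) + real ((2 * e + B - 1) div B) \<le> 7 * K"
    using blk[of "2 * n"] blk[of "2 * e"] mK K1 by linarith
  have xK: "real x \<le> 5520 * (K * l)"
  proof (cases "10 * m < 3 * (M div B * B)")
    case True
    have "0 \<le> K * l" using K1 l1 by simp
    then show ?thesis using x(2)[OF True] by simp
  next
    case False
    define d where "d = depth B (M div B) (10 * m)"
    have "real (x * B) \<le> real (46 * (10 * m) * d)" using x(1) unfolding d_def by (rule of_nat_mono)
    then have "real x * real B \<le> 460 * real m * real d" by simp
    then have "real x \<le> 460 * real m * real d / real B" using B0 by (simp add: field_simps)
    also have "\<dots> = 460 * (real m / real B * real d)" by simp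
    also have "\<dots> \<le> 460 * (K * (12 * l))"
    proof (intro mult_left_mono mult_mono mK)
      show "real d \<le> 12 * l" unfolding d_def l_def by (rule depth_log[OF B m(2)]) (use False in linarith)
    qed (use K1 in auto)
    finally show ?thesis by simp
  qed
  have Kl: "K \<le> K * l" using K1 l1 mult_left_mono[of 1 l K] by simp
  then have Kl1: "1 \<le> K * l" using K1 by linarith
  have "real t \<le> 2 * real ((2 * n + B - 1) div B) + real ((2 * e + B - 1) div B) + real x"
    using of_nat_mono[OF t, where 'a = real] by simp
  then have "real t \<le> 5527 * (K * l)" using scan xK Kl by linarith
  moreover have "real t' \<le> 3 * real t + 1" using of_nat_mono[OF t', where 'a = real] by simp
  ultimately have "real t' \<le> 16582 * (K * l)" using Kl1 by linarith
  then show ?thesis by (simp add: sort_ios_def K_def l_def)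
qed

lemma partition_runs:
  assumes B: "1 \<le> B" "2 * B \<le> M" and G: "wf_lgraph G" "reverse_topological G"
    and es: "distinct es" "set es = edges G"
  shows "\<exists>t a D out. runs M B (word_limit exponent G) (ext.machine_prog M B) (init_memory M G) (init_disk B G es) t a D \<and>
    file_at B D a (pair_file out) \<and> represents_partition out (bisim_partition G) \<and>
    real t \<le> 16582 * sort_ios M B (card (nodes G) + card (edges G))"
proof -
  interpret d: dag G by unfold_locales (rule G)+
  define n where "n = card (nodes G)"
  define e where "e = card (edges G)"
  define m where "m = n + e"
  define f where "f = M div B"
  define Q where "Q = 10 * m"
  define L where "L = depth B f Q"
  define nb where "nb = (2 * n + B - 1) div B"
  define eb where "eb = (2 * e + B - 1) div B"
  define rbase where "rbase = 2 * nb + eb"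
  \<comment> \<open>A power of \<open>N + E + 2\<close>, as needed to place the marks beyond it, and
    large enough for \<open>rbase + 4 * f ^ (L + 1)\<close>, since \<open>f ^ L\<close> and
    \<open>f\<close> are linear in \<open>m\<close> when the disk queue is used.\<close>
  define A where "A = (m + 2) ^ 20"
  define w where "w = (4 :: nat) ^ 8"
  \<comment> \<open>Exceeds every entry of an item or state, these being at most
    \<open>d.top + 3\<close>.\<close>
  define T where "T = d.top + 4"
  define V0 where "V0 = T ^ w"
  have w: "20 \<le> w" by (simp add: w_def)
  have f2: "2 \<le> f" using B div_le_mono[OF B(2), of B] by (simp add: f_def)
  have mT: "m + 2 \<le> d.top" by (simp add: d.top_def m_def n_def e_def)
  have TV: "T ^ j \<le> V0" if "j \<le> 20" for j unfolding V0_def by (rule power_increasing) (use that w in \<open>auto simp: T_def\<close>)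
  have aT: "(m + 2) ^ j < V0" if "0 < j" "j \<le> 20" for j
  proof -
    have "(m + 2) ^ j < T ^ j" by (rule power_strict_mono) (use mT that in \<open>auto simp: T_def\<close>)
    then show ?thesis using TV[OF that(2)] by linarith
  qed
  have aj: "c * (m + 2) ^ i \<le> (m + 2) ^ (j + i)" if "c \<le> 2 ^ j" for c i j
  proof -
    have "2 ^ j \<le> (m + 2) ^ j" by (rule power_mono) auto
    then show ?thesis using that unfolding power_add by (intro mult_le_mono1) linarith
  qed
  have Qa: "Q \<le> (m + 2) ^ 5" using aj[of 10 4 1] by (simp add: Q_def)
  have blk: "(k + B - 1) div B \<le> k" for k
  proof (cases "k = 0")
    case False
    have "k + B - 1 \<le> k * B" using False B by (cases k; cases B) auto
    then have "(k + B - 1) div B \<le> k * B div B" by (rule div_le_mono)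
    then show ?thesis using B by simp
  qed (use B in simp)
  have rb: "rbase \<le> 4 * (m + 2)"
    using blk[of "2 * n"] blk[of "2 * e"] by (simp add: rbase_def nb_def eb_def m_def)
  have rA: "rbase \<le> A"
  proof -
    have "4 * (m + 2) ^ 1 \<le> (m + 2) ^ (19 + 1)" by (rule aj) simp
    then show ?thesis using rb by (simp add: A_def)
  qed
  have em: "em B f L rbase A Q V0 d.X"
  proof
    show "list_encode x < V0 \<and> x \<noteq> []" if "x \<in> d.X" for x
    proof -
      note xb = d.X_bound[OF that]
      have "list_encode x < T ^ (4 ^ 8)"
        by (rule list_encode_less') (use xb in \<open>auto simp: T_def\<close>)
      then show ?thesis using xb by (simp add: V0_def w_def)
    qed
    have "6 ^ 3 \<le> T ^ 3" by (rule power_mono) (use mT in \<open>auto simp: T_def\<close>)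
    then show "64 \<le> V0" using TV[of 3] by simp
    show "rbase + 4 * f ^ (L + 1) \<le> A \<and> f ^ (L + 2) * B < V0" if q: "3 * (f * B) \<le> Q"
    proof -
      have fL: "f ^ L * B \<le> 3 * Q" unfolding L_def by (rule depth(3)[OF f2 B(1) q])
      have fQ: "f \<le> Q"
      proof -
        have "f \<le> f * B" using B(1) by simp
        then show ?thesis using q by linarith
      qed
      have "f ^ L \<le> f ^ L * B" using B(1) by simp
      then have "f ^ L \<le> 3 * Q" using fL by linarith
      then have "f ^ L * f \<le> 3 * Q * Q" using fQ by (rule mult_le_mono)
      also have "\<dots> \<le> 3 * (m + 2) ^ 5 * (m + 2) ^ 5" using Qa by (intro mult_le_mono mult_le_mono2)
      also have "\<dots> = 3 * (m + 2) ^ (5 + 5)" by (simp only: power_add mult.assoc)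
      finally have 1: "f ^ (L + 1) \<le> 3 * (m + 2) ^ 10" by (simp add: mult.commute)
      have "(m + 2) ^ 1 \<le> (m + 2) ^ 10" by (rule power_increasing) auto
      then have "rbase + 4 * f ^ (L + 1) \<le> 16 * (m + 2) ^ 10" using 1 rb by simp
      also have "\<dots> \<le> (m + 2) ^ (10 + 10)" by (rule aj) simp
      finally have 2: "rbase + 4 * f ^ (L + 1) \<le> A" by (simp add: A_def)
      have "f ^ L * B * (f * f) \<le> 3 * Q * (Q * Q)" by (rule mult_le_mono[OF fL mult_le_mono[OF fQ fQ]])
      also have "\<dots> \<le> 3 * (m + 2) ^ 5 * ((m + 2) ^ 5 * (m + 2) ^ 5)" using Qa by (intro mult_le_mono mult_le_mono2)
      also have "\<dots> = 3 * (m + 2) ^ (5 + (5 + 5))" by (simp only: power_add mult.assoc)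
      also have "\<dots> \<le> (m + 2) ^ (2 + (5 + (5 + 5)))" by (rule aj) simp
      also have "\<dots> < V0" by (rule aT) simp_all
      finally show ?thesis using 2 by (simp add: mult_ac power2_eq_square)
    qed
  qed (use B f2 rA in auto)
  then interpret q: em B f L rbase A Q V0 d.X .
  have V0V: "V0 \<le> q.V" by (rule q.V_ge)
  have n2: "2 * n \<le> nb * B" and e2: "2 * e \<le> eb * B"
  proof -
    have "k \<le> (k + B - 1) div B * B" for k
    proof -
      have "k + B - 1 = (k + B - 1) div B * B + (k + B - 1) mod B" by simp
      moreover have "(k + B - 1) mod B < B" using B by simp
      ultimately show ?thesis using B by linarith
    qed
    then show "2 * n \<le> nb * B" "2 * e \<le> eb * B" by (auto simp: nb_def eb_def)
  qed
  have len: "length (node_file G) = 2 * n" "length (pair_file es) = 2 * e"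
    using distinct_card[OF es(1)] es(2) by (simp_all add: node_file_def length_pair_file n_def e_def)
  have es_eq: "edge_start B G = nb" by (simp add: edge_start_def len nb_def)
  have word: "x \<in> set (node_file G) \<or> x \<in> set (pair_file es) \<Longrightarrow> x < V0" for x
  proof -
    assume "x \<in> set (node_file G) \<or> x \<in> set (pair_file es)"
    then have "x \<in> insert 0 (nodes G \<union> label G ` nodes G)"
      using d.E_sub es(2) by (auto simp: node_file_def pair_file_def)
    then have "x \<le> Max (insert 0 (nodes G \<union> label G ` nodes G))" by (intro Max_ge) auto
    then have "x < T ^ 1" by (simp add: T_def d.top_def)
    then show "x < V0" using TV[of 1] by linarith
  qed
  have ed: "em_dag G B f L rbase A Q V0 es (init_disk B G es)"
  proof
    show "2 * Q div (f * B) + 3 < f ^ L" unfolding L_def by (rule depth(1)[OF f2])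
    show "Q < V0" using Qa aT[of 5] by simp
    show "d.top + 3 < V0" using TV[of 1] by (simp add: T_def)
    show "init_disk B G es x = node_file G ! x" if "x < 2 * card (nodes G)" for x
      using that len by (simp add: init_disk_def n_def)
    show "init_disk B G es ((2 * card (nodes G) + B - 1) div B * B + x) = pair_file es ! x"
      if "x < 2 * card (edges G)" for x
      unfolding n_def[symmetric] nb_def[symmetric] using that len n2 by (simp add: init_disk_def es_eq Let_def e_def)
    show "init_disk B G es x < q.V" for x
    proof -
      have "init_disk B G es x \<in> {0} \<union> set (node_file G) \<union> set (pair_file es)"
        by (auto simp: init_disk_def Let_def)
      then have "init_disk B G es x < V0" using word[of "init_disk B G es x"] q.V0 by auto
      then show ?thesis using V0V by (rule less_le_trans)
    qed
    show "init_disk B G es x = 0" if x: "rbase * B \<le> x" for x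
    proof -
      have "rbase * B = nb * B + nb * B + eb * B" by (simp add: rbase_def algebra_simps)
      then have "nb * B + 2 * e \<le> x" using x e2 by linarith
      then show ?thesis using n2 by (simp add: init_disk_def es_eq len Let_def)
    qed
  qed (use es in \<open>auto simp: Q_def m_def n_def e_def rbase_def nb_def eb_def\<close>)
  then interpret x: em_dag G B f L rbase A Q V0 es "init_disk B G es" .
  have xnb: "x.n = n" "x.e = e" "x.nb = nb" "x.eb = eb"
    by (simp_all add: x.n_def x.e_def x.nb_def x.eb_def q.blocks_def n_def e_def nb_def eb_def)
  define p where "p = em.main B f L rbase n e (nb + eb)"
  have "(2 * n + B - 1) div B + out_addr M B n e = rbase" "out_addr M B n e = nb + eb"
    by (simp_all add: out_addr_def nb_def eb_def rbase_def)
  moreover have "depth B (M div B) (10 * (n + e)) = L" "M div B = f" by (simp_all add: L_def Q_def m_def f_def)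
  ultimately have prog: "prog M B n e = p"
    using q.csize_main[of n e "nb + eb"] unfolding prog_def Let_def p_def by (simp only: if_True)
  obtain t s D rs a where ex: "exec B q.ok A q.V p start (init_disk B G es) t s D"
    and out: "file_at B D (nb + eb) (pair_file rs)" "represents_partition rs (bisim_partition G)"
    and lrs: "length (pair_file rs) \<le> 2 * n"
    and ac: "q.account a (card d.X) s" "onD s = 0" and t: "t \<le> 2 * nb + eb + a * (6 * f * L) + q.flush_cost (nfl s)"
    using x.main unfolding hoare_def xnb p_def[symmetric] by auto
  have L0: "0 < L" unfolding L_def by (rule depth(2)[OF f2])
  have cX: "card d.X \<le> Q" using d.X_finite_card by (simp add: Q_def m_def n_def e_def)
  define W where "W = word_limit exponent G"
  have wide: "ext.wide q.V ^ (2 * 20 + 17) \<le> W"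
  proof -
    have "ext.wide q.V = (V0 ^ 20) ^ (4 ^ ext.Z + 1)" by (simp only: ext.wide_def q.V_def)
    moreover have "2 * 20 + 17 = (57 :: nat)" by simp
    ultimately have "ext.wide q.V ^ (2 * 20 + 17) = T ^ (w * (20 * ((4 ^ ext.Z + 1) * 57)))"
      by (simp only: V0_def power_mult)
    also have "\<dots> \<le> (d.top ^ 3) ^ (w * (20 * ((4 ^ ext.Z + 1) * 57)))"
    proof (rule power_mono)
      have t2: "2 \<le> d.top" using mT by simp
      have "3 * d.top \<le> d.top ^ 2 * d.top"
        using power_mono[OF t2, of 2] by (intro mult_le_mono1) simp
      then show "T \<le> d.top ^ 3" using t2 unfolding T_def power3_eq_cube power2_eq_square by linarith
    qed simp
    also have "\<dots> = W" by (simp only: W_def word_limit_def exponent_def d.top_def w_def flip: power_mult)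
    finally show ?thesis .
  qed
  have V4: "64 ^ 4 \<le> q.V" using power_mono[OF q.V0, of 4] q.V_ge(2) by simp
  have VW: "q.V \<le> W"
  proof -
    have "q.V ^ 1 \<le> ext.wide q.V" unfolding ext.wide_def by (rule power_increasing) (use V4 in auto)
    moreover have "ext.wide q.V ^ 1 \<le> ext.wide q.V ^ (2 * 20 + 17)"
      by (rule power_increasing) (use calculation V4 in auto)
    ultimately show ?thesis using wide by simp
  qed
  have AW: "A \<le> W" using aT[of 20] V0V VW by (simp add: A_def)
  have store: "\<forall>s. q.ok s \<longrightarrow> length (flatten (fields s)) \<le> 86 * (M - B) \<and> (\<forall>x\<in>set (flatten (fields s)). x < q.V)"
  proof -
    have "q.U \<le> M" unfolding q.U_def unfolding f_def by simp
    then have "43 * q.U \<le> 86 * (M - B)" using B(2) by linarith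
    then show ?thesis using q.flatten_fields by (meson le_trans)
  qed
  have "\<exists>t' D''. runs M B W (ext.machine_prog M B) (init_memory M G) (init_disk B G es) t' (out_addr M B n e) D'' \<and>
    (\<forall>x<A * B. D'' x = D x) \<and> t' \<le> 3 * t + 1 \<and> (n = 0 \<longrightarrow> t' \<le> 3 * t)"
    unfolding n_def e_def
  proof (rule ext.exec_runs[OF B store _ _ _ wide AW _ _ G(1)])
    show "2 \<le> q.V" "200 < q.V" using V4 by auto
    show "card (nodes G) + card (edges G) < q.V" using aT[of 1] V0V by (simp add: m_def n_def e_def)
    show "A \<le> (card (nodes G) + card (edges G) + 2) ^ 20" by (simp add: A_def m_def n_def e_def)
    show "out_addr M B (card (nodes G)) (card (edges G)) < W"
      using x.small(2) V0V VW unfolding xnb by (simp add: out_addr_def nb_def eb_def n_def e_def)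
    show "init_disk B G es x < q.V" for x by (rule x.D0_less)
    show "init_disk B G es x = 0" if "2 * card (nodes G) + 2 * card (edges G) \<le> x" "B = 1" for x
      using that len by (simp add: init_disk_def Let_def edge_start_def n_def e_def)
    show "exec B q.ok A q.V (prog M B (card (nodes G)) (card (edges G))) start (init_disk B G es) t s D"
      using ex prog by (simp add: n_def e_def)
  qed
  then obtain t' D'' where run: "runs M B W (ext.machine_prog M B) (init_memory M G) (init_disk B G es) t' (nb + eb) D''"
    and D'': "\<forall>x<A * B. D'' x = D x" and t': "t' \<le> 3 * t + 1" "n = 0 \<longrightarrow> t' \<le> 3 * t"
    by (auto simp: out_addr_def nb_def eb_def)
  have "file_at B D'' (nb + eb) (pair_file rs)"
    unfolding file_at_def
  proof (intro allI impI)
    fix i assume i: "i < length (pair_file rs)"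
    have "(nb + eb) * B + i < (nb + eb) * B + nb * B" using i lrs n2 by linarith
    also have "\<dots> = rbase * B" by (simp add: rbase_def algebra_simps)
    also have "\<dots> \<le> A * B" using rA by (rule mult_le_mono1)
    finally have "D'' ((nb + eb) * B + i) = D ((nb + eb) * B + i)" using D'' by blast
    then show "D'' ((nb + eb) * B + i) = pair_file rs ! i" using out(1) i by (simp add: file_at_def)
  qed
  moreover have "real t' \<le> 16582 * sort_ios M B m"
  proof (cases "m = 0")
    case True
    \<comment> \<open>\<open>sort_ios\<close> vanishes on the empty input, so not a single IO may be
      spent.\<close>
    have "a * (6 * f * L) + q.flush_cost (nfl s) = 0"
      by (rule q.account_cost(2)[OF ac cX L0]) (use True q.U in \<open>simp add: Q_def\<close>)
    moreover have "nb = 0" "eb = 0" using True B by (simp_all add: nb_def eb_def m_def)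
    ultimately have "t = 0" using t by linarith
    then show ?thesis using t'(2) True by (simp add: m_def sort_ios_def)
  next
    case False
    show ?thesis
    proof (rule cost_le[OF B m_def _ _ _ _ t'(1)])
      show "t \<le> 2 * ((2 * n + B - 1) div B) + (2 * e + B - 1) div B + (a * (6 * f * L) + q.flush_cost (nfl s))"
        using t by (simp add: nb_def eb_def)
      show "(a * (6 * f * L) + q.flush_cost (nfl s)) * B \<le> 46 * (10 * m) * depth B (M div B) (10 * m)"
        using q.account_cost(1)[OF ac cX L0] unfolding L_def f_def Q_def .
      show "a * (6 * f * L) + q.flush_cost (nfl s) = 0" if "10 * m < 3 * (M div B * B)"
        by (rule q.account_cost(2)[OF ac cX L0]) (unfold q.U_def Q_def, use that in \<open>simp add: f_def\<close>)
    qed (use False in simp)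
  qed
  ultimately show ?thesis using run out(2) unfolding W_def m_def n_def e_def by blast
qed

theorem theorem1:
  "\<exists>(c::real) (k::nat) (P :: nat \<Rightarrow> nat \<Rightarrow> program).
     \<forall>(M::nat) (B::nat) (G :: (nat, nat) lgraph) (es :: (nat \<times> nat) list).
       1 \<le> B \<and> 2 * B \<le> M \<and>
       wf_lgraph G \<and> acyclic (edges G) \<and> reverse_topological G \<and>
       distinct es \<and> set es = edges G \<longrightarrow>
       (\<exists>t a D out.
          runs M B (word_limit k G) (P M B) (init_memory M G) (init_disk B G es) t a D \<and>
          file_at B D a (pair_file out) \<and>
          represents_partition out (bisim_partition G) \<and>
          real t \<le> c * sort_ios M B (card (nodes G) + card (edges G)))"
  by (rule exI[of _ 16582], rule exI[of _ exponent], rule exI[of _ ext.machine_prog]) (blast intro: partition_runs)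

end
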